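(* Let $g\in C^2(\mathbb{R})$ satisfy $$\inf_{\mathbb{R}}g>-1,\quad g(t)=g(-t)\ \text{ for all }t,\quad\lim_{|t|\to\infty}g(t)=0,$$ and suppose that the function $h(t):=g(t)+\frac{g'(t)}{2t}$, $t\in\mathbb{R}\setminus\{0\}$, satisfies $$\inf_{(0,\infty)}h>-1,\quad \sup_{(0,\infty)}h<\infty,\quad \lim_{t\to\infty}t^2h(t)=0$$ and $$\lim_{t\to\infty}\sup_{|s|\le1}t^4\left|h\left(t+\frac{s(8\log t+1)}{t}\right)-h(t)\right|=0.$$ Set $$E(u):=\int_{B_1}(1+g(u))e^{u^2}dx,\qquad M_\Lambda:=\left\{u\in H^1_0(B_1):\|\nabla u\|_{L^2}^2=\Lambda\right\}.$$ Then there exists $\Lambda^*>4\pi$ such that for every $\Lambda\in(4\pi,\Lambda^* )$ the functional $E|_{M_\Lambda}$ has at least two positive critical points.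
   Context: $B_1$ is the open unit disk in $\mathbb{R}^2$. Critical points of $E|_{M_\Lambda}$ are critical points of $E$ constrained to $M_\Lambda$; the corresponding Euler-Lagrange equation is $-\Delta u=\lambda(1+h(u))ue^{u^2}$ in $B_1$ for some Lagrange multiplier $\lambda\in\mathbb{R}$. *)

theory Defs
  imports "HOL-Analysis.Analysis"
begin

section \<open>Test functions on the unit disk\<close>

abbreviation B1 :: "(real ^ 2) set" where
  "B1 \<equiv> ball 0 1"

abbreviation leb_B1 :: "(real ^ 2) measure" where
  "leb_B1 \<equiv> lebesgue_on B1"

definition grad :: "(real ^ 2 \<Rightarrow> real) \<Rightarrow> real ^ 2 \<Rightarrow> real ^ 2" where
  "grad \<phi> x = (\<chi> i. frechet_derivative \<phi> (at x) (axis i 1))"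

primrec C_k :: "nat \<Rightarrow> (real ^ 2 \<Rightarrow> real) \<Rightarrow> bool" where
  "C_k 0 f \<longleftrightarrow> continuous_on UNIV f"
| "C_k (Suc k) f \<longleftrightarrow> f differentiable_on UNIV \<and> (\<forall>i. C_k k (\<lambda>x. grad f x $ i))"

definition test_fun :: "(real ^ 2 \<Rightarrow> real) \<Rightarrow> bool" where
  "test_fun \<phi> \<longleftrightarrow> (\<forall>k. C_k k \<phi>) \<and>
     compact (closure {x. \<phi> x \<noteq> 0}) \<and> closure {x. \<phi> x \<noteq> 0} \<subseteq> B1"

section \<open>The space \<open>H\<^sup>1\<^sub>0\<close> of the unit disk\<close>

text \<open>
  Elements of the Lebesgue and Sobolev spaces are represented by functions on the whole plane
  whose values outside \<^term>\<open>B1\<close> are irrelevant; two functions represent the same element iff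
  they agree almost everywhere in \<^term>\<open>B1\<close>. All notions below depend only on the element
  represented.
\<close>

definition L2 :: "(real ^ 2 \<Rightarrow> 'b::euclidean_space) \<Rightarrow> bool" where
  "L2 f \<longleftrightarrow> f \<in> borel_measurable leb_B1 \<and> integrable leb_B1 (\<lambda>x. (norm (f x))\<^sup>2)"

definition is_weak_grad :: "(real ^ 2 \<Rightarrow> real) \<Rightarrow> (real ^ 2 \<Rightarrow> real ^ 2) \<Rightarrow> bool" where
  "is_weak_grad u G \<longleftrightarrow> L2 u \<and> L2 G \<and>
     (\<forall>\<phi>. test_fun \<phi> \<longrightarrow>
        (LINT x|leb_B1. u x *\<^sub>R grad \<phi> x) = - (LINT x|leb_B1. \<phi> x *\<^sub>R G x))"

definition H1 :: "(real ^ 2 \<Rightarrow> real) set" where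
  "H1 = {u. \<exists>G. is_weak_grad u G}"

text \<open>The weak gradient is determined up to null sets, so the choice made here is immaterial.\<close>

definition wgrad :: "(real ^ 2 \<Rightarrow> real) \<Rightarrow> real ^ 2 \<Rightarrow> real ^ 2" where
  "wgrad u = (SOME G. is_weak_grad u G)"

definition dirichlet :: "(real ^ 2 \<Rightarrow> real) \<Rightarrow> (real ^ 2 \<Rightarrow> real) \<Rightarrow> real" where
  "dirichlet u v = (LINT x|leb_B1. wgrad u x \<bullet> wgrad v x)"

definition H1_norm :: "(real ^ 2 \<Rightarrow> real) \<Rightarrow> real" where
  "H1_norm u = sqrt ((LINT x|leb_B1. (u x)\<^sup>2) + (LINT x|leb_B1. (norm (wgrad u x))\<^sup>2))"

text \<open>The closure of the test functions in \<^term>\<open>H1\<close>.\<close>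

definition H10 :: "(real ^ 2 \<Rightarrow> real) set" where
  "H10 = {u \<in> H1. \<exists>\<phi>. (\<forall>n. test_fun (\<phi> n)) \<and>
            (\<lambda>n. H1_norm (\<lambda>x. \<phi> n x - u x)) \<longlonglongrightarrow> 0}"

section \<open>Constrained critical points\<close>

definition bounded_functional :: "((real ^ 2 \<Rightarrow> real) \<Rightarrow> real) \<Rightarrow> bool" where
  "bounded_functional L \<longleftrightarrow>
     (\<forall>v\<in>H10. \<forall>w\<in>H10. \<forall>a b. L (\<lambda>x. a * v x + b * w x) = a * L v + b * L w) \<and>
     (\<exists>C. \<forall>v\<in>H10. \<bar>L v\<bar> \<le> C * H1_norm v)"

text \<open>
  Frechet differentiability on \<^term>\<open>H10\<close>. The library predicate \<open>has_derivative\<close> is tied to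
  normed vector space types, whereas \<^term>\<open>H1_norm\<close> is only a seminorm on functions.
\<close>

definition has_H10_derivative ::
  "((real ^ 2 \<Rightarrow> real) \<Rightarrow> real) \<Rightarrow> ((real ^ 2 \<Rightarrow> real) \<Rightarrow> real) \<Rightarrow> (real ^ 2 \<Rightarrow> real) \<Rightarrow> bool" where
  "has_H10_derivative F L u \<longleftrightarrow> bounded_functional L \<and>
     (\<forall>\<epsilon>>0. \<exists>\<delta>>0. \<forall>v\<in>H10. H1_norm v < \<delta> \<longrightarrow>
        \<bar>F (\<lambda>x. u x + v x) - F u - L v\<bar> \<le> \<epsilon> * H1_norm v)"

definition M :: "real \<Rightarrow> (real ^ 2 \<Rightarrow> real) set" where
  "M \<Lambda> = {u \<in> H10. (LINT x|leb_B1. (norm (wgrad u x))\<^sup>2) = \<Lambda>}"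

text \<open>
  For positive \<open>\<Lambda>\<close> the constraint is regular on \<^term>\<open>M \<Lambda>\<close> and its derivative at \<open>u\<close> is
  \<open>v \<mapsto> 2 * dirichlet u v\<close>, whose kernel is the tangent space.
\<close>

definition tangent_M :: "(real ^ 2 \<Rightarrow> real) \<Rightarrow> (real ^ 2 \<Rightarrow> real) set" where
  "tangent_M u = {v \<in> H10. dirichlet u v = 0}"

definition critical_point_on_M ::
  "((real ^ 2 \<Rightarrow> real) \<Rightarrow> real) \<Rightarrow> real \<Rightarrow> (real ^ 2 \<Rightarrow> real) \<Rightarrow> bool" where
  "critical_point_on_M F \<Lambda> u \<longleftrightarrow> u \<in> M \<Lambda> \<and>
     (\<exists>L. has_H10_derivative F L u \<and> (\<forall>v\<in>tangent_M u. L v = 0))"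

text \<open>
  By the Moser--Trudinger inequality the integrand is integrable for every \<open>u\<close> in \<^term>\<open>H10\<close>
  when \<open>g\<close> is continuous and bounded.
\<close>

definition E :: "(real \<Rightarrow> real) \<Rightarrow> (real ^ 2 \<Rightarrow> real) \<Rightarrow> real" where
  "E g u = (LINT x|leb_B1. (1 + g (u x)) * exp ((u x)\<^sup>2))"

end

(* A radial solution of the Euler-Lagrange equation with multiplier is a profile w of the variable
   r = R |x|^2, governed by a first-order system; shooting from the height mu yields a solution of Dirichlet
   energy 4 pi J(mu), where J is continuous in mu. The energy J tends to 0 as mu tends to 0, and comparison with
   the standard bubble shows that J(mu) > 1 and J(mu) -> 1 as mu tends to infinity. Hence every energy slightly
   above 4 pi is attained at two different heights. *)

theory Submission
  imports Defs "HOL-Real_Asymp.Real_Asymp"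
begin

text \<open>In the variable log r the profile near its maximum is a perturbation of the Liouville
  bubble, for which \<open>Y\<close> equals j (1 - j) and j tends to exactly 1. Comparison to
  leading order therefore cannot tell on which side of 1 the energy lies. The sign comes from
  \<open>Q\<close>, a correction of j (1 - j) - Y: after multiplication by 1 / w^2 all errors of
  first order in \<mu>^(-2) cancel, and what remains makes \<open>Q\<close> negative of size
  \<mu>^(-4). Hence \<open>Y\<close> stays above a multiple of \<mu>^(-4) as j approaches 1, and j
  crosses 1. This size is the reason for the weight t^4 in the oscillation hypothesis; the
  logarithmic width of its window gives j the room to come that close to 1. Outside the window only
  upper and lower bounds on 1 + h are available, but there the concavity of w in log r leaves little
  mass in the tail. A second obstacle is that the integrand of E grows like exp (u^2):
  differentiability on \<open>H10\<close> rests on a Trudinger-type estimate, and one for small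
  norms is enough because the constructed critical points are bounded functions.\<close>

lemma log_deriv_nonincreasing:
  fixes \<Phi> :: "real \<Rightarrow> real"
  assumes "0 \<le> a" "a \<le> b" "continuous_on {a..b} \<Phi>"
    and "\<And>r. a < r \<Longrightarrow> r < b \<Longrightarrow> \<exists>e\<le>0. (\<Phi> has_real_derivative e / r) (at r)"
  shows "\<Phi> b \<le> \<Phi> a"
proof (rule DERIV_nonpos_imp_decreasing_open[OF assms(2) _ assms(3)])
  fix r assume r: "a < r" "r < b"
  then obtain e where e: "e \<le> 0" "(\<Phi> has_real_derivative e / r) (at r)"
    using assms(4) by blast
  then have "e / r \<le> 0" using r assms(1) by (simp add: divide_nonpos_pos)
  then show "\<exists>y. (\<Phi> has_real_derivative y) (at r) \<and> y \<le> 0" using e by blast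
qed

section \<open>Comparison with the bubble near the maximum of the profile\<close>

locale inner_region =
  fixes \<mu> b we \<eta>0 d :: real and w p j Y \<eta> :: "real \<Rightarrow> real"
  assumes b_pos: "0 < b"
    and cont: "continuous_on {0..b} w" "continuous_on {0..b} p" "continuous_on {0..b} j"
      "continuous_on {0..b} Y"
    and init: "w 0 = \<mu>" "p 0 = 0" "j 0 = 0" "Y 0 = 0"
    and we: "0 < we" "we \<le> \<mu>" "(95 / 100) * \<mu> \<le> we"
    and w_ge: "\<And>r. 0 \<le> r \<Longrightarrow> r \<le> b \<Longrightarrow> we \<le> w r"
    and Y_pos: "\<And>r. 0 < r \<Longrightarrow> r \<le> b \<Longrightarrow> 0 < Y r"
    and eta: "\<And>r. 0 < r \<Longrightarrow> r \<le> b \<Longrightarrow> \<bar>\<eta> r\<bar> \<le> \<eta>0"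
    and dw: "\<And>r. 0 < r \<Longrightarrow> r < b \<Longrightarrow> (w has_real_derivative (- p r) / r) (at r)"
    and dp: "\<And>r. 0 < r \<Longrightarrow> r < b \<Longrightarrow>
        (p has_real_derivative (Y r * (1 + \<eta> r) / w r) / r) (at r)"
    and dj: "\<And>r. 0 < r \<Longrightarrow> r < b \<Longrightarrow> (j has_real_derivative (Y r * (1 + \<eta> r)) / r) (at r)"
    and dY: "\<And>r. 0 < r \<Longrightarrow> r < b \<Longrightarrow>
        (Y has_real_derivative (Y r * (1 - 2 * (w r * p r) - 2 * (p r / w r))) / r) (at r)"
    and small: "2 * (\<mu> - we) / we \<le> d" "d \<le> 1 / 300" "\<eta>0 \<le> 1 / (1000 * \<mu> ^ 4)"
      "4 / \<mu>\<^sup>2 \<le> d" "1000 \<le> \<mu>\<^sup>2"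
begin

definition "\<epsilon> = 1 / \<mu>\<^sup>2"
definition "\<sigma> = 3 * d"
definition "x r = w r * p r"
definition "s r = 1 / (w r)\<^sup>2"
text \<open>The derivative of \<open>D\<close> in log r is p^2 = x^2 s, the term by which the
  equation for x = w p differs from that for \<open>j\<close>. It disappears in the bubble limit s
  -> 0.\<close>

definition "D r = j r - x r"
text \<open>The exact bubble has x = j and Y = j (1 - j), hence Q = 0. Writing x - D = j - 2 D in
  place of j is the finite-height correction for which the terms of first order in s cancel in
  \<open>dQs\<close>.\<close>

definition "Q r = (1 - j r) * (x r - D r) - Y r"

lemma mu_pos: "0 < \<mu>" using we by simp

lemma eps: "0 < \<epsilon>" "\<epsilon> \<le> 1 / 1000" "4 * \<epsilon> \<le> d"
  using mu_pos small by (auto simp: \<epsilon>_def divide_simps)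

lemma eta0: "0 \<le> \<eta>0" "\<eta>0 \<le> \<epsilon>\<^sup>2 / 1000" "\<eta>0 \<le> \<epsilon> / 1000" "\<eta>0 \<le> 1 / 1000"
proof -
  show "0 \<le> \<eta>0" using eta[of b] b_pos by force
  show 1: "\<eta>0 \<le> \<epsilon>\<^sup>2 / 1000" using small(3) by (simp add: \<epsilon>_def power_divide flip: power_mult)
  have "\<epsilon>\<^sup>2 \<le> \<epsilon>" using eps mult_left_le[of \<epsilon> \<epsilon>] by (simp add: power2_eq_square)
  then show "\<eta>0 \<le> \<epsilon> / 1000" using 1 by simp
  then show "\<eta>0 \<le> 1 / 1000" using eps by simp
qed

lemma w_pos: "0 \<le> r \<Longrightarrow> r \<le> b \<Longrightarrow> 0 < w r"
  using w_ge[of r] we by linarith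

lemma eta_bounds: "0 < r \<Longrightarrow> r \<le> b \<Longrightarrow> (999 / 1000) \<le> 1 + \<eta> r" "0 < r \<Longrightarrow> r \<le> b \<Longrightarrow> 1 + \<eta> r \<le> (1001 / 1000)"
  using eta[of r] eta0 by auto

lemma Y_nonneg: "0 \<le> r \<Longrightarrow> r \<le> b \<Longrightarrow> 0 \<le> Y r"
  using Y_pos[of r] init by (cases "r = 0") auto

lemma cont_x: "continuous_on {0..b} x"
  unfolding x_def by (intro continuous_intros cont)

lemma cont_s: "continuous_on {0..b} s"
  unfolding s_def using w_pos by (intro continuous_intros cont) force

lemma cont_D: "continuous_on {0..b} D"
  unfolding D_def by (intro continuous_intros cont cont_x)

lemma cont_Q: "continuous_on {0..b} Q"
  unfolding Q_def by (intro continuous_intros cont cont_x cont_D)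

lemmas conts = cont cont_x cont_s cont_D cont_Q

lemma dx: "0 < r \<Longrightarrow> r < b \<Longrightarrow> (x has_real_derivative (Y r * (1 + \<eta> r) - (p r)\<^sup>2) / r) (at r)"
  unfolding x_def using w_pos[of r]
  by (auto intro!: derivative_eq_intros dw dp simp: field_simps power2_eq_square)

lemma x2s: "0 \<le> r \<Longrightarrow> r \<le> b \<Longrightarrow> (p r)\<^sup>2 = (x r)\<^sup>2 * s r"
  unfolding x_def s_def using w_pos[of r] by (auto simp: field_simps)

lemma xs: "0 \<le> r \<Longrightarrow> r \<le> b \<Longrightarrow> p r / w r = x r * s r"
  unfolding x_def s_def using w_pos[of r] by (auto simp: field_simps power2_eq_square)

lemma dD: "0 < r \<Longrightarrow> r < b \<Longrightarrow> (D has_real_derivative ((x r)\<^sup>2 * s r) / r) (at r)"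
  unfolding D_def using x2s[of r]
  by (auto intro!: derivative_eq_intros dx dj simp: diff_divide_distrib)

lemma dY': "0 < r \<Longrightarrow> r < b \<Longrightarrow>
    (Y has_real_derivative (Y r * (1 - 2 * x r - 2 * (x r * s r))) / r) (at r)"
  using dY[of r] xs[of r] by (simp add: x_def)

lemma ds: "0 < r \<Longrightarrow> r < b \<Longrightarrow> (s has_real_derivative (2 * x r * (s r)\<^sup>2) / r) (at r)"
  unfolding s_def x_def using w_pos[of r]
  by (auto intro!: derivative_eq_intros dw simp: field_simps power2_eq_square)

text \<open>All estimates of this region have the form of a monotone quantity. Derivatives in log r
  appear as quotients by r, so only the sign of the numerator has to be checked and the singularity
  at r = 0 never matters.\<close>

lemma nonincreasing:
  assumes "0 \<le> r" "r \<le> r'" "r' \<le> b" "continuous_on {0..b} \<Phi>"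
    and "\<And>q. r < q \<Longrightarrow> q < r' \<Longrightarrow> \<exists>e\<le>0. (\<Phi> has_real_derivative e / q) (at q)"
  shows "\<Phi> r' \<le> \<Phi> r"
  using assms continuous_on_subset[OF assms(4), of "{r..r'}"]
  by (intro log_deriv_nonincreasing[of r r' \<Phi>]) auto

lemma j_mono: assumes "0 \<le> r" "r \<le> r'" "r' \<le> b" shows "j r \<le> j r'"
proof -
  have "- j r' \<le> - j r"
  proof (rule nonincreasing[OF assms, where \<Phi>="\<lambda>r. - j r"])
    fix q assume q: "r < q" "q < r'"
    then have "((\<lambda>r. - j r) has_real_derivative (- (Y q * (1 + \<eta> q))) / q) (at q)"
      using assms by (auto intro!: derivative_eq_intros dj)
    moreover have "- (Y q * (1 + \<eta> q)) \<le> 0"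
      using Y_nonneg[of q] eta_bounds[of q] q assms by auto
    ultimately show "\<exists>e\<le>0. ((\<lambda>r. - j r) has_real_derivative e / q) (at q)" by blast
  qed (intro continuous_intros cont)
  then show ?thesis by simp
qed

lemma j_nonneg: "0 \<le> r \<Longrightarrow> r \<le> b \<Longrightarrow> 0 \<le> j r"
  using j_mono[of 0 r] init by simp

lemma p_nonneg: assumes "0 \<le> r" "r \<le> b" shows "0 \<le> p r"
proof -
  have "- p r \<le> - p 0"
  proof (rule nonincreasing[where \<Phi>="\<lambda>r. - p r"])
    fix q assume q: "0 < q" "q < r"
    then have "((\<lambda>r. - p r) has_real_derivative (- (Y q * (1 + \<eta> q) / w q)) / q) (at q)"
      using assms dp[of q] by (auto intro!: derivative_eq_intros)
    moreover have "- (Y q * (1 + \<eta> q) / w q) \<le> 0"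
      using Y_nonneg[of q] eta_bounds[of q] q assms w_pos[of q] by auto
    ultimately show "\<exists>e\<le>0. ((\<lambda>r. - p r) has_real_derivative e / q) (at q)" by blast
  qed (use assms in \<open>auto intro!: continuous_intros cont\<close>)
  then show ?thesis using init by simp
qed

lemma x_nonneg: "0 \<le> r \<Longrightarrow> r \<le> b \<Longrightarrow> 0 \<le> x r"
  unfolding x_def using p_nonneg w_pos by (simp add: less_imp_le)

lemma D_0: "D 0 = 0" and x_0: "x 0 = 0"
  by (auto simp: D_def x_def init)

lemma D_nonneg: assumes "0 \<le> r" "r \<le> b" shows "0 \<le> D r"
proof -
  have "- D r \<le> - D 0"
  proof (rule nonincreasing[where \<Phi>="\<lambda>r. - D r"])
    fix q assume q: "0 < q" "q < r"
    then have "((\<lambda>r. - D r) has_real_derivative (- ((x q)\<^sup>2 * s q)) / q) (at q)"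
      using assms by (auto intro!: derivative_eq_intros dD)
    moreover have "- ((x q)\<^sup>2 * s q) \<le> 0" by (auto simp: s_def)
    ultimately show "\<exists>e\<le>0. ((\<lambda>r. - D r) has_real_derivative e / q) (at q)" by blast
  qed (use assms in \<open>auto intro!: continuous_intros conts\<close>)
  then show ?thesis using D_0 by simp
qed

lemma x_le_j: "0 \<le> r \<Longrightarrow> r \<le> b \<Longrightarrow> x r \<le> j r"
  using D_nonneg[of r] by (simp add: D_def)

lemma w_le: assumes "0 \<le> r" "r \<le> b" shows "w r \<le> \<mu>"
proof -
  have "w r \<le> w 0"
  proof (rule nonincreasing[where \<Phi>=w])
    fix q assume q: "0 < q" "q < r"
    then show "\<exists>e\<le>0. (w has_real_derivative e / q) (at q)"
      using dw[of q] p_nonneg[of q] assms by (intro exI[of _ "- p q"]) auto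
  qed (use assms in \<open>auto intro!: continuous_intros conts\<close>)
  then show ?thesis using init by simp
qed

lemma s_bounds: assumes "0 \<le> r" "r \<le> b" shows "\<epsilon> \<le> s r" "s r \<le> (12 / 10) * \<epsilon>" "0 < s r"
proof -
  have 1: "(95 / 100) * \<mu> \<le> w r" "w r \<le> \<mu>" "0 < w r"
    using w_le[OF assms] w_ge[OF assms] we by auto
  show "\<epsilon> \<le> s r" using 1 mu_pos unfolding \<epsilon>_def s_def by (intro divide_left_mono) auto
  have "((95 / 100) * \<mu>)\<^sup>2 \<le> (w r)\<^sup>2" using 1 mu_pos by (intro power_mono) auto
  then have "361 / 400 * \<mu>\<^sup>2 \<le> (w r)\<^sup>2" by (simp add: power_mult_distrib power_divide)
  then have "\<mu>\<^sup>2 \<le> (12 / 10) * (w r)\<^sup>2" using zero_le_power2[of \<mu>] by linarith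
  then show "s r \<le> (12 / 10) * \<epsilon>" using 1 mu_pos unfolding \<epsilon>_def s_def
    by (simp add: field_simps)
  show "0 < s r" using 1 by (simp add: s_def)
qed

lemma p_le: assumes "0 \<le> r" "r \<le> b" "j r \<le> c" "0 \<le> c" shows "p r \<le> c / we"
proof -
  have "p r * we \<le> p r * w r" using p_nonneg[of r] w_ge[of r] assms by (intro mult_left_mono) auto
  also have "\<dots> \<le> c" using x_le_j[of r] assms by (simp add: x_def mult.commute)
  finally show ?thesis using we by (simp add: field_simps)
qed

text \<open>In log r the derivative of D is p^2 and that of w is - p. Since p \<le> c / we, the
  growth of D is paid for by the drop of w.\<close>

lemma D_le_drop: assumes "0 \<le> r" "r \<le> b" "j r \<le> c" "0 \<le> c"
  shows "D r \<le> c / we * (\<mu> - w r)"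
proof -
  have "D r + c / we * w r \<le> D 0 + c / we * w 0"
  proof (rule nonincreasing[where \<Phi>="\<lambda>r. D r + c / we * w r"])
    fix q assume q: "0 < q" "q < r"
    have "((\<lambda>r. D r + c / we * w r) has_real_derivative ((p q)\<^sup>2 - c / we * p q) / q) (at q)"
      using q assms x2s[of q]
      by (intro DERIV_cong[OF DERIV_add[OF dD DERIV_cmult[OF dw]]]) (auto simp: diff_divide_distrib)
    moreover have "(p q)\<^sup>2 - c / we * p q \<le> 0"
      using p_le[of q c] p_nonneg[of q] q assms j_mono[of q r] mult_right_mono[of "p q" "c/we" "p q"]
      by (auto simp: power2_eq_square)
    ultimately show "\<exists>e\<le>0. ((\<lambda>r. D r + c / we * w r) has_real_derivative e / q) (at q)" by blast
  qed (use assms we in \<open>auto intro!: continuous_intros conts\<close>)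
  then show ?thesis using D_0 init by (simp add: algebra_simps)
qed

lemma D_le_d: assumes "0 \<le> r" "r \<le> b" "j r \<le> 2" shows "D r \<le> d"
proof -
  have "D r \<le> 2 / we * (\<mu> - w r)" using D_le_drop[of r 2] assms by simp
  also have "\<dots> \<le> 2 / we * (\<mu> - we)" using w_ge[of r] assms we by (intro mult_left_mono) auto
  also have "\<dots> \<le> d" using small by simp
  finally show ?thesis .
qed

text \<open>In log r the derivative of Y - j + j^2 is Y times \<open>?B\<close>, whose absolute
  value is at most slightly more than 2 d. The multiple \<sigma> = 3 d of the derivative Y (1 +
  \<eta>) of j absorbs it, for either sign. The provisional bound j \<le> 2 is removed in
  \<open>j_less\<close>.\<close>

lemma Y_near_aux:
  assumes "0 \<le> r" "r \<le> b" "j r \<le> 2"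
  shows "Y r \<le> j r * (1 - j r) + \<sigma> * j r" "j r * (1 - j r) - \<sigma> * j r \<le> Y r"
proof -
  have key: "\<exists>e\<le>0. ((\<lambda>r. Y r - j r + (j r)\<^sup>2 - \<sigma> * j r) has_real_derivative e / q) (at q)"
    "\<exists>e\<le>0. ((\<lambda>r. - Y r + j r - (j r)\<^sup>2 - \<sigma> * j r) has_real_derivative e / q) (at q)"
    if q: "0 < q" "q < r" for q
  proof -
    have q': "0 < q" "q < b" "0 \<le> q" "q \<le> b" "j q \<le> 2" using q assms j_mono[of q r] by auto
    let ?B = "2 * D q - 2 * (x q * s q) - \<eta> q + 2 * j q * \<eta> q"
    have 1: "((\<lambda>r. Y r - j r + (j r)\<^sup>2 - \<sigma> * j r) has_real_derivative
        (Y q * (?B - \<sigma> * (1 + \<eta> q))) / q) (at q)"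
      using q' by (auto intro!: derivative_eq_intros dj dY' simp: D_def diff_divide_distrib
          add_divide_distrib algebra_simps)
    have 2: "((\<lambda>r. - Y r + j r - (j r)\<^sup>2 - \<sigma> * j r) has_real_derivative
        (Y q * (- ?B - \<sigma> * (1 + \<eta> q))) / q) (at q)"
      using q' by (auto intro!: derivative_eq_intros dj dY' simp: D_def diff_divide_distrib
          add_divide_distrib algebra_simps)
    have "\<bar>\<eta> q * (2 * j q - 1)\<bar> \<le> \<eta>0 * 3"
      unfolding abs_mult using eta[of q] q' j_nonneg[of q] by (intro mult_mono) auto
    then have a: "\<bar>- \<eta> q + 2 * j q * \<eta> q\<bar> \<le> \<eta>0 * 3" by (simp add: algebra_simps)
    have b: "0 \<le> x q * s q" using x_nonneg[of q] s_bounds[of q] q' by simp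
    have "x q * s q \<le> 2 * ((12 / 10) * \<epsilon>)"
      using x_nonneg[of q] x_le_j[of q] s_bounds[of q] q' by (intro mult_mono) auto
    then have c: "x q * s q \<le> (24 / 10) * \<epsilon>" by simp
    have dpos: "0 < d" using eps by linarith
    have e: "\<sigma> * (999 / 1000) \<le> \<sigma> * (1 + \<eta> q)"
      using eta_bounds[of q] q' dpos unfolding \<sigma>_def by (intro mult_left_mono) auto
    have D: "0 \<le> D q" "D q \<le> d" using D_nonneg[of q] D_le_d[of q] q' by auto
    have "?B - \<sigma> * (1 + \<eta> q) \<le> 0" "- ?B - \<sigma> * (1 + \<eta> q) \<le> 0"
      using a b c e D eta0 eps dpos unfolding \<sigma>_def by linarith+
    then have "Y q * (?B - \<sigma> * (1 + \<eta> q)) \<le> 0" "Y q * (- ?B - \<sigma> * (1 + \<eta> q)) \<le> 0"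
      using Y_nonneg[of q] q' by (auto simp: mult_nonneg_nonpos)
    then show "\<exists>e\<le>0. ((\<lambda>r. Y r - j r + (j r)\<^sup>2 - \<sigma> * j r) has_real_derivative e / q) (at q)"
      "\<exists>e\<le>0. ((\<lambda>r. - Y r + j r - (j r)\<^sup>2 - \<sigma> * j r) has_real_derivative e / q) (at q)"
      using 1 2 by blast+
  qed
  have "Y r - j r + (j r)\<^sup>2 - \<sigma> * j r \<le> Y 0 - j 0 + (j 0)\<^sup>2 - \<sigma> * j 0"
    using assms key by (intro nonincreasing[where \<Phi>="\<lambda>r. Y r - j r + (j r)\<^sup>2 - \<sigma> * j r"]) (auto intro!: continuous_intros conts)
  then show "Y r \<le> j r * (1 - j r) + \<sigma> * j r" using init by (simp add: algebra_simps power2_eq_square)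
  have "- Y r + j r - (j r)\<^sup>2 - \<sigma> * j r \<le> - Y 0 + j 0 - (j 0)\<^sup>2 - \<sigma> * j 0"
    using assms key by (intro nonincreasing[where \<Phi>="\<lambda>r. - Y r + j r - (j r)\<^sup>2 - \<sigma> * j r"]) (auto intro!: continuous_intros conts)
  then show "j r * (1 - j r) - \<sigma> * j r \<le> Y r" using init by (simp add: algebra_simps power2_eq_square)
qed

lemma sigma: "0 < \<sigma>" "\<sigma> \<le> 1 / 100"
  using eps small by (auto simp: \<sigma>_def)

lemma j_pos: assumes "0 < r" "r \<le> b" shows "0 < j r"
proof (rule ccontr)
  assume "\<not> 0 < j r"
  then have "j r = 0" using j_nonneg[of r] assms by auto
  then have "Y r \<le> 0" using Y_near_aux(1)[of r] assms by auto
  then show False using Y_pos[of r] assms by auto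
qed

text \<open>A continuity argument: where j = 2 the upper comparison would give Y \<le> 2 \<sigma> -
  2 < 0, so j never reaches 2 and the comparison holds throughout. Positivity of Y in Y \<le> j (1 -
  j + \<sigma>) then bounds j.\<close>

lemma j_less: assumes "0 \<le> r" "r \<le> b" shows "j r < 1 + \<sigma>"
proof -
  have le2: "j r \<le> 2"
  proof (rule ccontr)
    assume "\<not> j r \<le> 2"
    then have "j 0 \<le> 2" "2 \<le> j r" using init by auto
    moreover have "continuous_on {0..r} j"
      using continuous_on_subset[OF cont(3), of "{0..r}"] assms by auto
    ultimately have "\<exists>q\<ge>0. q \<le> r \<and> j q = 2" using IVT'[of j 0 2 r] assms by blast
    then obtain q where q: "0 \<le> q" "q \<le> r" "j q = 2" by blast
    have "Y q \<le> \<sigma> * 2 - 2" using Y_near_aux(1)[of q] q assms by simp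
    moreover have "0 \<le> Y q" using Y_nonneg[of q] q assms by simp
    ultimately show False using sigma by linarith
  qed
  show ?thesis
  proof (cases "r = 0")
    case False
    then have "0 < Y r" "0 < j r" using Y_pos j_pos assms by auto
    moreover have "Y r \<le> j r * (1 - j r + \<sigma>)"
      using Y_near_aux(1)[of r] le2 assms by (auto simp: algebra_simps)
    ultimately have "0 < j r * (1 - j r + \<sigma>)" by linarith
    then show ?thesis using \<open>0 < j r\<close> by (simp add: zero_less_mult_iff)
  qed (use init sigma in auto)
qed

lemma j_le: "0 \<le> r \<Longrightarrow> r \<le> b \<Longrightarrow> j r \<le> (101 / 100)"
  using j_less[of r] sigma by auto

lemma Y_near:
  assumes "0 \<le> r" "r \<le> b"
  shows "Y r \<le> j r * (1 - j r + \<sigma>)" "j r * (1 - j r - \<sigma>) \<le> Y r"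
  using Y_near_aux[OF assms] j_le[OF assms] by (auto simp: algebra_simps)

end

context inner_region
begin

lemma Y_le: assumes "0 \<le> r" "r \<le> b" shows "Y r \<le> 102 / 100 * j r"
proof -
  have "j r * (1 - j r + \<sigma>) \<le> j r * (102 / 100)"
    using j_nonneg[OF assms] sigma by (intro mult_left_mono) auto
  then show ?thesis using Y_near(1)[OF assms] by linarith
qed

text \<open>The absolute bound D \<le> d is too weak where j is small. While j \<le> 1/2, Y is at
  least 0.49 j, so the source x^2 s of D is dominated by that of 2 \<epsilon> j; once j > 1/2, d is
  already below \<sigma> j.\<close>

lemma D_le_j: assumes "0 \<le> r" "r \<le> b" shows "D r \<le> \<sigma> * j r"
proof (cases "j r \<le> 1 / 2")
  case True
  have "D r - 2 * \<epsilon> * j r \<le> D 0 - 2 * \<epsilon> * j 0"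
  proof (rule nonincreasing[where \<Phi>="\<lambda>r. D r - 2 * \<epsilon> * j r"])
    fix q assume q: "0 < q" "q < r"
    then have q': "0 \<le> q" "q \<le> b" "0 < q" "q < b" using assms by auto
    have jq: "j q \<le> 1 / 2" "0 \<le> j q" using True j_mono[of q r] j_nonneg[of q] q' q assms by auto
    have der: "((\<lambda>r. D r - 2 * \<epsilon> * j r) has_real_derivative
        ((x q)\<^sup>2 * s q - 2 * \<epsilon> * (Y q * (1 + \<eta> q))) / q) (at q)"
      using q' by (intro DERIV_cong[OF DERIV_diff[OF dD DERIV_cmult[OF dj]]]) (auto simp: diff_divide_distrib)
    have "(x q)\<^sup>2 \<le> j q * (1 / 2)" unfolding power2_eq_square
      using jq x_le_j[of q] x_nonneg[of q] q' by (intro mult_mono) auto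
    then have "(x q)\<^sup>2 * s q \<le> (j q * (1 / 2)) * (12 / 10 * \<epsilon>)"
      using s_bounds[of q] q' jq by (intro mult_mono) auto
    moreover have "j q * (49 / 100) \<le> j q * (1 - j q - \<sigma>)" using jq sigma by (intro mult_left_mono) auto
    then have "j q * (49 / 100) \<le> Y q" using Y_near(2)[of q] q' by linarith
    then have "(j q * (49 / 100)) * (999 / 1000) \<le> Y q * (1 + \<eta> q)"
      using jq eta_bounds[of q] Y_nonneg[of q] q' by (intro mult_mono) auto
    then have "2 * \<epsilon> * ((j q * (49 / 100)) * (999 / 1000)) \<le> 2 * \<epsilon> * (Y q * (1 + \<eta> q))"
      using eps by (intro mult_left_mono) auto
    moreover have "(j q * (1 / 2)) * (12 / 10 * \<epsilon>) \<le> 2 * \<epsilon> * ((j q * (49 / 100)) * (999 / 1000))"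
    proof -
      have "0 \<le> \<epsilon> * j q" using jq eps by simp
      then show ?thesis by (simp add: algebra_simps)
    qed
    ultimately have "(x q)\<^sup>2 * s q - 2 * \<epsilon> * (Y q * (1 + \<eta> q)) \<le> 0" by linarith
    then show "\<exists>e\<le>0. ((\<lambda>r. D r - 2 * \<epsilon> * j r) has_real_derivative e / q) (at q)" using der by blast
  qed (use assms in \<open>auto intro!: continuous_intros conts\<close>)
  then have "D r \<le> 2 * \<epsilon> * j r" using D_0 init by simp
  also have "\<dots> \<le> \<sigma> * j r"
    using eps j_nonneg[OF assms] unfolding \<sigma>_def by (intro mult_right_mono) auto
  finally show ?thesis .
next
  case False
  have "D r \<le> d" using D_le_d[of r] j_le[of r] assms by auto
  also have "d \<le> \<sigma> * (1 / 2)" using eps unfolding \<sigma>_def by simp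
  also have "\<dots> \<le> \<sigma> * j r" using False sigma by (intro mult_left_mono) auto
  finally show ?thesis .
qed

lemma x_ge: assumes "0 \<le> r" "r \<le> b" shows "99 / 100 * j r \<le> x r"
proof -
  have "\<sigma> * j r \<le> 1 / 100 * j r" using sigma j_nonneg[OF assms] by (intro mult_right_mono) auto
  then show ?thesis using D_le_j[OF assms] by (simp add: D_def)
qed

text \<open>Since x \<ge> 0.99 j and Y \<le> 1.02 j, the source x^2 s of D exceeds the derivative of
  0.3 \<epsilon> j^2. This lower bound is what gives the main term of \<open>dQs\<close> a definite
  size.\<close>

lemma D_ge: assumes "0 \<le> r" "r \<le> b" shows "3 / 10 * \<epsilon> * (j r)\<^sup>2 \<le> D r"
proof -
  have "3 / 10 * \<epsilon> * (j r)\<^sup>2 - D r \<le> 3 / 10 * \<epsilon> * (j 0)\<^sup>2 - D 0"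
  proof (rule nonincreasing[where \<Phi>="\<lambda>r. 3 / 10 * \<epsilon> * (j r)\<^sup>2 - D r"])
    fix q assume q: "0 < q" "q < r"
    then have q': "0 \<le> q" "q \<le> b" "0 < q" "q < b" using assms by auto
    have jq: "0 \<le> j q" using j_nonneg[of q] q' by auto
    have der: "((\<lambda>r. 3 / 10 * \<epsilon> * (j r)\<^sup>2 - D r) has_real_derivative
        (6 / 10 * \<epsilon> * j q * (Y q * (1 + \<eta> q)) - (x q)\<^sup>2 * s q) / q) (at q)"
      using q' by (auto intro!: derivative_eq_intros dD dj simp: diff_divide_distrib)
    have "(99 / 100 * j q)\<^sup>2 \<le> (x q)\<^sup>2" using x_ge[of q] jq q' by (intro power_mono) auto
    then have "(99 / 100 * j q)\<^sup>2 * \<epsilon> \<le> (x q)\<^sup>2 * s q"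
      using s_bounds[of q] q' eps by (intro mult_mono) auto
    moreover have "Y q * (1 + \<eta> q) \<le> (102 / 100 * j q) * (1001 / 1000)"
      using Y_le[of q] eta_bounds[of q] Y_nonneg[of q] q' jq by (intro mult_mono) auto
    then have "6 / 10 * \<epsilon> * j q * (Y q * (1 + \<eta> q)) \<le> 6 / 10 * \<epsilon> * j q * ((102 / 100 * j q) * (1001 / 1000))"
      using jq eps by (intro mult_left_mono) auto
    moreover have "6 / 10 * \<epsilon> * j q * ((102 / 100 * j q) * (1001 / 1000)) \<le> (99 / 100 * j q)\<^sup>2 * \<epsilon>"
    proof -
      have "0 \<le> \<epsilon> * (j q * j q)" using jq eps by simp
      then show ?thesis by (simp add: algebra_simps power2_eq_square)
    qed
    ultimately have "6 / 10 * \<epsilon> * j q * (Y q * (1 + \<eta> q)) - (x q)\<^sup>2 * s q \<le> 0" by linarith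
    then show "\<exists>e\<le>0. ((\<lambda>r. 3 / 10 * \<epsilon> * (j r)\<^sup>2 - D r) has_real_derivative e / q) (at q)"
      using der by blast
  qed (use assms in \<open>auto intro!: continuous_intros conts\<close>)
  then show ?thesis using D_0 init by simp
qed

text \<open>The derivative of s is 2 x s^2, which cancels the contribution proportional to Q; this
  is why the product with s is used. The first summand left over is of second order in s, carries
  the small factor D, and is nonpositive as long as j \<le> 1.\<close>

lemma dQs:
  assumes r: "0 < r" "r < b"
  shows "((\<lambda>r. Q r * s r) has_real_derivative
    (- 2 * x r * (s r)\<^sup>2 * (1 - j r) * D r + \<eta> r * s r * Y r * (1 - 2 * x r)) / r) (at r)"
proof -
  let ?u = "Y r * (1 + \<eta> r)" and ?v = "(x r)\<^sup>2 * s r" and ?y = "Y r * (1 - 2 * x r - 2 * (x r * s r))"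
  have dx': "(x has_real_derivative (?u - ?v) / r) (at r)" using dx[OF r] x2s[of r] r by simp
  let ?A = "(1 - j r) * ((?u - ?v) - ?v) - ?u * (x r - D r) - ?y"
  have "((\<lambda>r. (1 - j r) * (x r - D r)) has_real_derivative
      (1 - j r) * ((?u - ?v) / r - ?v / r) + (0 - ?u / r) * (x r - D r)) (at r)"
    by (intro DERIV_mult' DERIV_diff DERIV_const dj dx' dD r)
  from DERIV_diff[OF this dY'[OF r]] have "(Q has_real_derivative ?A / r) (at r)"
    unfolding Q_def[abs_def] by (rule DERIV_cong) (simp add: diff_divide_distrib right_diff_distrib)
  from DERIV_mult'[OF this ds[OF r]] have
    "((\<lambda>r. Q r * s r) has_real_derivative (Q r * (2 * x r * (s r)\<^sup>2) + ?A * s r) / r) (at r)"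
    by (simp add: add_divide_distrib)
  moreover have "Q r * (2 * x r * (s r)\<^sup>2) + ?A * s r =
      - 2 * x r * (s r)\<^sup>2 * (1 - j r) * D r + \<eta> r * s r * Y r * (1 - 2 * x r)"
    unfolding Q_def D_def by algebra
  ultimately show ?thesis by simp
qed

text \<open>While j \<le> 0.95 the lower comparison gives Y \<ge> 0.04 j, whereas w falls at rate p
  \<le> j / we. The constant 26 is just above 1 / 0.04, leaving room for the factor 1 +
  \<eta>.\<close>

lemma drop_le: assumes "0 \<le> r" "r \<le> b" "j r \<le> 95 / 100" shows "we * (\<mu> - w r) \<le> 26 * j r"
proof -
  have "we * (\<mu> - w r) - 26 * j r \<le> we * (\<mu> - w 0) - 26 * j 0"
  proof (rule nonincreasing[where \<Phi>="\<lambda>r. we * (\<mu> - w r) - 26 * j r"])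
    fix q assume q: "0 < q" "q < r"
    then have q': "0 \<le> q" "q \<le> b" "0 < q" "q < b" using assms by auto
    have jq: "0 \<le> j q" "j q \<le> 95 / 100" using j_nonneg[of q] q' q j_mono[of q r] assms by auto
    have der: "((\<lambda>r. we * (\<mu> - w r) - 26 * j r) has_real_derivative
        (we * p q - 26 * (Y q * (1 + \<eta> q))) / q) (at q)"
      using q' by (auto intro!: derivative_eq_intros dw dj simp: diff_divide_distrib mult_ac)
    have "p q \<le> j q / we" using p_le[of q "j q"] jq q' by auto
    then have 1: "we * p q \<le> j q" using we by (simp add: field_simps)
    have "j q * (4 / 100) \<le> j q * (1 - j q - \<sigma>)" using jq sigma by (intro mult_left_mono) auto
    then have "j q * (4 / 100) \<le> Y q" using Y_near(2)[of q] q' by linarith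
    then have "(j q * (4 / 100)) * (999 / 1000) \<le> Y q * (1 + \<eta> q)"
      using jq eta_bounds[of q] Y_nonneg[of q] q' by (intro mult_mono) auto
    then have "we * p q - 26 * (Y q * (1 + \<eta> q)) \<le> 0" using 1 jq by linarith
    then show "\<exists>e\<le>0. ((\<lambda>r. we * (\<mu> - w r) - 26 * j r) has_real_derivative e / q) (at q)"
      using der by blast
  qed (use assms in \<open>auto intro!: continuous_intros conts\<close>)
  then show ?thesis using init by simp
qed

text \<open>Integrating \<open>dQs\<close> with the lower bound on D gives Q s \<le> - const
  \<epsilon>^3, and s is of order \<epsilon>. The bound on \<eta>0 by \<epsilon>^2 / 1000 makes the
  oscillation of h contribute only a fraction of \<epsilon>^3.\<close>

lemma Q_neg:
  assumes "0 \<le> r" "r \<le> b" "95 / 100 \<le> j r" "j r \<le> 1"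
  shows "Q r \<le> - \<epsilon>\<^sup>2 / 100"
proof -
  \<comment> \<open>j^4 / 4 - j^5 / 5 is the primitive of j^3 (1 - j), the shape of x (1 - j) D once
    D is replaced by its lower bound. The last term pays for \<eta>, since the derivative of j is at
    least 0.999 Y.\<close>
  let ?P = "\<lambda>r. Q r * s r + 4 / 10 * \<epsilon> ^ 3 * ((j r) ^ 4 / 4 - (j r) ^ 5 / 5) - 5 / 2 * \<eta>0 * \<epsilon> * j r"
  have "?P r \<le> ?P 0"
  proof (rule nonincreasing[where \<Phi>="?P"])
    fix q assume q: "0 < q" "q < r"
    then have q': "0 \<le> q" "q \<le> b" "0 < q" "q < b" using assms by auto
    have jq: "0 \<le> j q" "j q \<le> 1" using j_nonneg[of q] q' q j_mono[of q r] assms by auto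
    have 1: "((\<lambda>r. 4 / 10 * \<epsilon> ^ 3 * ((j r) ^ 4 / 4 - (j r) ^ 5 / 5)) has_real_derivative
        (4 / 10 * \<epsilon> ^ 3 * ((j q) ^ 3 * (1 - j q)) * (Y q * (1 + \<eta> q))) / q) (at q)"
      using q' by (auto intro!: derivative_eq_intros dj simp: field_simps eval_nat_numeral)
    let ?e1 = "- 2 * x q * (s q)\<^sup>2 * (1 - j q) * D q + \<eta> q * s q * Y q * (1 - 2 * x q)"
    let ?e2 = "4 / 10 * \<epsilon> ^ 3 * ((j q) ^ 3 * (1 - j q)) * (Y q * (1 + \<eta> q))"
    let ?e3 = "5 / 2 * \<eta>0 * \<epsilon> * (Y q * (1 + \<eta> q))"
    have der: "(?P has_real_derivative (?e1 + ?e2 - ?e3) / q) (at q)"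
      using q' by (intro DERIV_cong[OF DERIV_diff[OF DERIV_add[OF dQs 1] DERIV_cmult[OF dj]]])
        (auto simp: diff_divide_distrib add_divide_distrib)
    have Yq: "0 \<le> Y q" "Y q \<le> 102 / 100" using Y_nonneg[of q] Y_le[of q] jq q' by auto
    have sq: "\<epsilon> \<le> s q" "s q \<le> 12 / 10 * \<epsilon>" using s_bounds[of q] q' by auto
    have xq: "0 \<le> x q" "x q \<le> 1" "99 / 100 * j q \<le> x q"
      using x_nonneg[of q] x_le_j[of q] x_ge[of q] jq q' by auto
    have "(99 / 100 * j q) * \<epsilon>\<^sup>2 * (1 - j q) * (3 / 10 * \<epsilon> * (j q)\<^sup>2) \<le> x q * (s q)\<^sup>2 * (1 - j q) * D q"
      using xq sq jq eps D_ge[of q] q' by (intro mult_mono power_mono) (auto intro!: mult_nonneg_nonneg)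
    moreover have "(99 / 100 * j q) * \<epsilon>\<^sup>2 * (1 - j q) * (3 / 10 * \<epsilon> * (j q)\<^sup>2) =
        297 / 1000 * (\<epsilon> ^ 3 * ((j q) ^ 3 * (1 - j q)))"
      by (simp add: eval_nat_numeral)
    moreover have "Y q * (1 + \<eta> q) \<le> (102 / 100) * (1001 / 1000)"
      using Yq eta_bounds[of q] q' by (intro mult_mono) auto
    then have "4 / 10 * \<epsilon> ^ 3 * ((j q) ^ 3 * (1 - j q)) * (Y q * (1 + \<eta> q))
        \<le> 4 / 10 * \<epsilon> ^ 3 * ((j q) ^ 3 * (1 - j q)) * ((102 / 100) * (1001 / 1000))"
      using eps jq by (intro mult_left_mono) auto
    moreover have "0 \<le> \<epsilon> ^ 3 * ((j q) ^ 3 * (1 - j q))" using eps jq by simp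
    ultimately have A: "- 2 * x q * (s q)\<^sup>2 * (1 - j q) * D q + ?e2 \<le> 0" by linarith
    have "\<bar>\<eta> q * s q * Y q * (1 - 2 * x q)\<bar> \<le> \<eta>0 * (12 / 10 * \<epsilon>) * Y q * 1"
      unfolding abs_mult using eta[of q] sq eps Yq xq q' eta0
      by (intro mult_mono) (auto intro!: mult_nonneg_nonneg)
    moreover have "5 / 2 * \<eta>0 * \<epsilon> * (Y q * (999 / 1000)) \<le> ?e3"
      using eta_bounds[of q] q' eta0 eps Yq by (intro mult_left_mono) auto
    moreover have "0 \<le> \<eta>0 * \<epsilon> * Y q" using eta0 eps Yq by simp
    moreover have "\<eta>0 * (12 / 10 * \<epsilon>) * Y q * 1 = 12 / 10 * (\<eta>0 * \<epsilon> * Y q)"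
      "5 / 2 * \<eta>0 * \<epsilon> * (Y q * (999 / 1000)) = 4995 / 2000 * (\<eta>0 * \<epsilon> * Y q)" by simp_all
    ultimately have B: "\<eta> q * s q * Y q * (1 - 2 * x q) \<le> ?e3" by linarith
    have "?e1 + ?e2 - ?e3 \<le> 0" using A B by linarith
    then show "\<exists>e\<le>0. (?P has_real_derivative e / q) (at q)" using der by blast
  qed (use assms in \<open>auto intro!: continuous_intros conts\<close>)
  also have "?P 0 = 0" using init x_0 D_0 by (simp add: Q_def)
  finally have P: "Q r * s r \<le> 5 / 2 * \<eta>0 * \<epsilon> * j r - 4 / 10 * \<epsilon> ^ 3 * ((j r) ^ 4 / 4 - (j r) ^ 5 / 5)"
    by simp
  have "(95 / 100) ^ 4 * (1 / 20) \<le> (j r) ^ 4 * (1 / 4 - j r / 5)"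
    using assms by (intro mult_mono power_mono) auto
  then have "4 / 100 \<le> (j r) ^ 4 / 4 - (j r) ^ 5 / 5" by (simp add: eval_nat_numeral algebra_simps)
  then have "4 / 10 * \<epsilon> ^ 3 * (4 / 100) \<le> 4 / 10 * \<epsilon> ^ 3 * ((j r) ^ 4 / 4 - (j r) ^ 5 / 5)"
    using eps by (intro mult_left_mono) auto
  moreover have "5 / 2 * \<eta>0 * \<epsilon> * j r \<le> 5 / 2 * (\<epsilon>\<^sup>2 / 1000) * \<epsilon> * 1"
    using eta0 eps assms by (intro mult_mono) auto
  moreover have "5 / 2 * (\<epsilon>\<^sup>2 / 1000) * \<epsilon> * 1 = 1 / 400 * \<epsilon> ^ 3" by (simp add: eval_nat_numeral)
  moreover have "0 \<le> \<epsilon> ^ 3" using eps by simp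
  ultimately have "Q r * s r \<le> - (12 / 1000) * \<epsilon> ^ 3" using P by linarith
  also have "\<dots> = - (\<epsilon>\<^sup>2 / 100) * (12 / 10 * \<epsilon>)" by (simp add: eval_nat_numeral)
  also have "\<dots> \<le> - (\<epsilon>\<^sup>2 / 100) * s r"
    using s_bounds[of r] assms by (intro mult_left_mono_neg) auto
  finally have "Q r * s r \<le> - (\<epsilon>\<^sup>2 / 100) * s r" .
  moreover have "0 < s r" using s_bounds[of r] assms by simp
  ultimately show ?thesis by (simp only: mult_le_cancel_right_pos minus_divide_left)
qed

lemma reach:
  assumes "we * (\<mu> - w b) > 26"
  obtains ra where "0 < ra" "ra \<le> b" "j ra = 95 / 100"
proof -
  have "95 / 100 \<le> j b"
  proof (rule ccontr)
    assume a: "\<not> 95 / 100 \<le> j b"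
    then show False using drop_le[of b] b_pos assms by auto
  qed
  moreover have "j 0 \<le> 95 / 100" using init by simp
  ultimately obtain ra where ra: "0 \<le> ra" "ra \<le> b" "j ra = 95 / 100"
    using IVT'[of j 0 "95 / 100" b] b_pos cont(3) by auto
  then have "ra \<noteq> 0" using init by auto
  with ra that[of ra] show ?thesis by simp
qed

text \<open>Suppose j \<le> 1 throughout. After j = 0.95, \<open>Q_neg\<close> gives Y \<ge> 0.9 (1
  - j) + c with c = \<epsilon>^2 / 100, so 1 - j + c decays at least like exp (- 0.8 we (\<mu> -
  w)). It can never fall below c, but \<open>large\<close> says that the available drop of w forces
  it to.\<close>

lemma j_exceeds_1:
  assumes exit: "w b = we"
    and large: "0 < 8 / 10 * (we * (\<mu> - we) - 26) + ln (\<epsilon>\<^sup>2 / 100)"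
  shows "\<exists>r. 0 < r \<and> r \<le> b \<and> 1 < j r"
proof (rule ccontr)
  assume "\<not> ?thesis"
  then have j1: "j r \<le> 1" if "0 \<le> r" "r \<le> b" for r
    using that init by (cases "r = 0") force+
  define c where "c = \<epsilon>\<^sup>2 / 100"
  have "\<epsilon>\<^sup>2 \<le> 1" using eps by (intro power_le_one) auto
  then have c: "0 < c" "c \<le> 1 / 100" using eps by (auto simp: c_def)
  have "ln c \<le> 0" using c by simp
  then have "we * (\<mu> - w b) > 26" using large unfolding c_def exit by argo
  then obtain ra where ra: "0 < ra" "ra \<le> b" "j ra = 95 / 100" by (rule reach)
  let ?P = "\<lambda>r. ln (1 - j r + c) + 8 / 10 * (we * (\<mu> - w r))"
  have pos: "0 < 1 - j r + c" if "0 \<le> r" "r \<le> b" for r using j1[OF that] c by auto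
  have "continuous_on {0..b} ?P"
    using pos by (intro continuous_intros conts) force
  then have "?P b \<le> ?P ra"
  proof (rule nonincreasing[where \<Phi>="?P", rotated 3])
    fix q assume q: "ra < q" "q < b"
    then have q': "0 \<le> q" "q \<le> b" "0 < q" "q < b" using ra by auto
    have jq: "95 / 100 \<le> j q" "j q \<le> 1" using j1[of q] j_mono[of ra q] ra q' q by auto
    let ?e = "- (Y q * (1 + \<eta> q)) / (1 - j q + c) + 8 / 10 * (we * p q)"
    have "((\<lambda>r. ln (1 - j r + c)) has_real_derivative - (Y q * (1 + \<eta> q)) / (1 - j q + c) / q) (at q)"
      using q' pos[of q] by (auto intro!: derivative_eq_intros dj simp: mult.commute)
    moreover have "((\<lambda>r. 8 / 10 * (we * (\<mu> - w r))) has_real_derivative 8 / 10 * (we * p q) / q) (at q)"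
      using q' by (auto intro!: derivative_eq_intros dw)
    ultimately have der: "(?P has_real_derivative ?e / q) (at q)"
      unfolding add_divide_distrib by (rule DERIV_add)
    have "p q \<le> 1 / we" using p_le[of q 1] jq q' by auto
    then have 1: "we * p q \<le> 1" using we by (simp add: field_simps)
    have "\<sigma> * j q \<le> 1 / 100" using sigma jq mult_mono[of \<sigma> "1/100" "j q" 1] by auto
    then have "9 / 10 \<le> x q - D q" using D_le_j[of q] q' jq by (auto simp: D_def)
    then have "(1 - j q) * (9 / 10) \<le> (1 - j q) * (x q - D q)"
      using jq by (intro mult_left_mono) auto
    moreover have "Q q \<le> - c" using Q_neg[of q] q' jq unfolding c_def by simp
    ultimately have "(1 - j q) * (9 / 10) + c \<le> Y q" unfolding Q_def by linarith
    then have "((1 - j q) * (9 / 10) + c) * (999 / 1000) \<le> Y q * (1 + \<eta> q)"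
      using eta_bounds[of q] q' jq c Y_nonneg[of q] by (intro mult_mono) auto
    then have "8 / 10 * (1 - j q + c) \<le> Y q * (1 + \<eta> q)" using jq c by argo
    then have "8 / 10 \<le> Y q * (1 + \<eta> q) / (1 - j q + c)" using pos[of q] q' by (simp add: field_simps)
    then have "?e \<le> 0" using 1 by simp
    then show "\<exists>e\<le>0. (?P has_real_derivative e / q) (at q)" using der by blast
  qed (use ra in auto)
  moreover have "we * (\<mu> - w ra) \<le> 26" using drop_le[of ra] ra by auto
  moreover have "ln (1 - j ra + c) \<le> 0" using ra c by simp
  moreover have "ln c \<le> ln (1 - j b + c)" using c j1[of b] b_pos by simp
  ultimately show False using large unfolding c_def exit by argo
qed

text \<open>Past j = 0.95 one has x \<ge> 0.94, so ln Y falls in log r at a rate of at least 2 x - 1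
  \<ge> 0.88, while we p \<le> 1.01. The quotient allows the rate 0.87 in terms of the drop of w.
  The first 26 units of drop are reserved for reaching j = 0.95.\<close>

lemma Y_end:
  assumes "26 < we * (\<mu> - w b)"
  shows "Y b \<le> exp (- (87 / 100) * (we * (\<mu> - w b) - 26))" "95 / 100 \<le> j b"
proof -
  obtain ra where ra: "0 < ra" "ra \<le> b" "j ra = 95 / 100" using assms by (rule reach)
  show "95 / 100 \<le> j b" using j_mono[of ra b] ra by auto
  let ?P = "\<lambda>r. ln (Y r) + 87 / 100 * (we * (\<mu> - w r))"
  have "?P b \<le> ?P ra"
  proof (rule log_deriv_nonincreasing[where \<Phi>="?P"])
    have "continuous_on {ra..b} Y" "continuous_on {ra..b} w"
      using ra by (auto intro: continuous_on_subset cont)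
    then show "continuous_on {ra..b} ?P"
      using ra Y_pos by (intro continuous_intros ballI) (auto simp: less_imp_neq[symmetric])
    fix q assume q: "ra < q" "q < b"
    then have q': "0 \<le> q" "q \<le> b" "0 < q" "q < b" using ra by auto
    have jq: "95 / 100 \<le> j q" "j q \<le> 101 / 100" using j_le[of q] j_mono[of ra q] ra q' q by auto
    let ?e = "1 - 2 * x q - 2 * (x q * s q) + 87 / 100 * (we * p q)"
    have der: "(?P has_real_derivative ?e / q) (at q)"
      using q' Y_pos[of q] by (auto intro!: derivative_eq_intros dw dY' simp: field_simps)
    have "p q \<le> (101 / 100) / we" using p_le[of q "101 / 100"] jq q' by auto
    then have "we * p q \<le> 101 / 100" using we by (simp add: field_simps)
    moreover have "0 \<le> x q * s q" using x_nonneg[of q] s_bounds[of q] q' by simp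
    ultimately have "?e \<le> 0" using x_ge[of q] jq q' by auto
    then show "\<exists>e\<le>0. (?P has_real_derivative e / q) (at q)" using der by blast
  qed (use ra in auto)
  moreover have "Y ra \<le> j ra * (1 - j ra + \<sigma>)" using Y_near(1)[of ra] ra(1,2) by simp
  then have "Y ra \<le> 1" using ra sigma by auto
  then have "ln (Y ra) \<le> 0" using Y_pos[of ra] ra by auto
  moreover have "we * (\<mu> - w ra) \<le> 26" using drop_le[of ra] ra by auto
  ultimately have "ln (Y b) \<le> - (87 / 100) * (we * (\<mu> - w b) - 26)" by argo
  then have "exp (ln (Y b)) \<le> exp (- (87 / 100) * (we * (\<mu> - w b) - 26))"
    by (simp only: exp_le_cancel_iff)
  then show "Y b \<le> exp (- (87 / 100) * (we * (\<mu> - w b) - 26))"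
    using Y_pos[of b] b_pos by simp
qed

text \<open>Since |(1 - j) D| \<le> d, the main term of \<open>dQs\<close> is at most d times the
  derivative of s. Hence |Q s| is at most d (s - \<epsilon>) plus an error from \<eta>, and s varies
  only by a relative amount d, which yields the square of d.\<close>

lemma Q_abs: assumes "0 \<le> r" "r \<le> b" shows "\<bar>Q r\<bar> \<le> 4 * d\<^sup>2"
proof -
  \<comment> \<open>The sign c treats the upper and the lower bound together.\<close>
  have key: "c * (Q r * s r) - d * s r - 2 * \<eta>0 * \<epsilon> * j r \<le> - d * \<epsilon>" if c: "c = 1 \<or> c = -1" for c :: real
  proof -
    let ?P = "\<lambda>r. c * (Q r * s r) - d * s r - 2 * \<eta>0 * \<epsilon> * j r"
    have "?P r \<le> ?P 0"
    proof (rule nonincreasing[where \<Phi>="?P"])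
      fix q assume q: "0 < q" "q < r"
      then have q': "0 \<le> q" "q \<le> b" "0 < q" "q < b" using assms by auto
      have jq: "0 \<le> j q" "j q \<le> 101 / 100" using j_nonneg[of q] q' j_le[of q] by auto
      let ?a = "- 2 * x q * (s q)\<^sup>2 * (1 - j q) * D q"
      let ?b = "\<eta> q * s q * Y q * (1 - 2 * x q)"
      let ?e = "c * (?a + ?b) - d * (2 * x q * (s q)\<^sup>2) - 2 * \<eta>0 * \<epsilon> * (Y q * (1 + \<eta> q))"
      have der: "(?P has_real_derivative ?e / q) (at q)"
        using q' by (intro DERIV_cong[OF DERIV_diff[OF DERIV_diff[OF DERIV_cmult[OF dQs] DERIV_cmult[OF ds]]
              DERIV_cmult[OF dj]]]) (simp_all only: diff_divide_distrib times_divide_eq_right)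
      have Yq: "0 \<le> Y q" using Y_nonneg[of q] q' by auto
      have sq: "0 < s q" "s q \<le> 12 / 10 * \<epsilon>" using s_bounds[of q] q' by auto
      have xq: "0 \<le> x q" "x q \<le> 101 / 100"
        using x_nonneg[of q] x_le_j[of q] jq q' by auto
      have Dq: "0 \<le> D q" "D q \<le> d" using D_nonneg[of q] D_le_d[of q] q' jq by auto
      have "\<bar>(1 - j q) * D q\<bar> \<le> 1 * d"
        unfolding abs_mult using Dq jq by (intro mult_mono) auto
      then have "(2 * x q * (s q)\<^sup>2) * \<bar>(1 - j q) * D q\<bar> \<le> (2 * x q * (s q)\<^sup>2) * d"
        using xq by (intro mult_left_mono) auto
      moreover have "\<bar>?a\<bar> = (2 * x q * (s q)\<^sup>2) * \<bar>(1 - j q) * D q\<bar>"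
        using xq by (simp add: abs_mult)
      ultimately have A: "\<bar>?a\<bar> \<le> d * (2 * x q * (s q)\<^sup>2)" by (simp add: mult.commute)
      have "\<bar>1 - 2 * x q\<bar> \<le> 102 / 100" using xq unfolding abs_le_iff by auto
      then have "\<bar>?b\<bar> \<le> \<eta>0 * (12 / 10 * \<epsilon>) * Y q * (102 / 100)"
        unfolding abs_mult using eta[of q] sq eps Yq xq q' eta0
        by (intro mult_mono) (auto intro!: mult_nonneg_nonneg)
      moreover have "2 * \<eta>0 * \<epsilon> * (Y q * (999 / 1000)) \<le> 2 * \<eta>0 * \<epsilon> * (Y q * (1 + \<eta> q))"
        using eta_bounds[of q] q' eta0 eps Yq by (intro mult_left_mono) auto
      moreover have "0 \<le> \<eta>0 * \<epsilon> * Y q" using eta0 eps Yq by simp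
      moreover have "\<eta>0 * (12 / 10 * \<epsilon>) * Y q * (102 / 100) = 1224 / 1000 * (\<eta>0 * \<epsilon> * Y q)"
        "2 * \<eta>0 * \<epsilon> * (Y q * (999 / 1000)) = 1998 / 1000 * (\<eta>0 * \<epsilon> * Y q)" by simp_all
      ultimately have B: "\<bar>?b\<bar> \<le> 2 * \<eta>0 * \<epsilon> * (Y q * (1 + \<eta> q))" by linarith
      have "c * (?a + ?b) \<le> \<bar>?a\<bar> + \<bar>?b\<bar>" using c by auto
      then have "?e \<le> 0" using A B by linarith
      then show "\<exists>e\<le>0. (?P has_real_derivative e / q) (at q)" using der by blast
    qed (use assms in \<open>auto intro!: continuous_intros conts\<close>)
    moreover have "?P 0 = - d * \<epsilon>" using init x_0 D_0 by (simp add: Q_def s_def \<epsilon>_def)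
    ultimately show ?thesis by simp
  qed
  have s: "\<epsilon> \<le> s r" "0 < s r" using s_bounds[OF assms] by auto
  have w: "w r \<le> \<mu>" "we \<le> w r" "0 < w r" using w_le w_ge w_pos assms by auto
  have "(s r - \<epsilon>) / s r = (\<mu> - w r) * (\<mu> + w r) / \<mu>\<^sup>2"
    using w mu_pos unfolding s_def \<epsilon>_def by (simp add: field_simps power2_eq_square)
  also have "\<dots> \<le> (\<mu> - w r) * (2 * \<mu>) / \<mu>\<^sup>2"
    using w mu_pos by (intro divide_right_mono mult_left_mono) auto
  also have "\<dots> = 2 * (\<mu> - w r) / \<mu>" using mu_pos by (simp add: power2_eq_square)
  also have "\<dots> \<le> 2 * (\<mu> - we) / we" using w we by (intro frac_le) auto
  also have "\<dots> \<le> d" using small by simp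
  finally have "s r - \<epsilon> \<le> d * s r" using s by (simp add: field_simps)
  then have 1: "d * (s r - \<epsilon>) \<le> d * (d * s r)" using eps by (intro mult_left_mono) auto
  have "\<epsilon>\<^sup>2 \<le> d\<^sup>2" using eps by (intro power_mono) auto
  then have "\<eta>0 \<le> d\<^sup>2 / 1000" using eta0 by linarith
  then have "2 * \<eta>0 * \<epsilon> * j r \<le> 2 * (d\<^sup>2 / 1000) * s r * (101 / 100)"
    using s j_le[OF assms] j_nonneg[OF assms] eps eta0 by (intro mult_mono) auto
  moreover have "0 \<le> d\<^sup>2 * s r" using s by simp
  ultimately have 2: "2 * \<eta>0 * \<epsilon> * j r \<le> d\<^sup>2 * s r" by (simp add: algebra_simps)
  have 3: "\<bar>Q r * s r\<bar> \<le> d * (s r - \<epsilon>) + 2 * \<eta>0 * \<epsilon> * j r"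
    using key[of 1] key[of "-1"] by (simp add: algebra_simps abs_le_iff)
  have "\<bar>Q r\<bar> * s r = \<bar>Q r * s r\<bar>" using s by (simp add: abs_mult)
  also have "\<dots> \<le> 2 * d\<^sup>2 * s r" using 1 2 3 by (simp add: power2_eq_square)
  finally have "\<bar>Q r\<bar> \<le> 2 * d\<^sup>2" using s by (simp add: mult_le_cancel_right)
  then show ?thesis using zero_le_power2[of d] by linarith
qed

text \<open>Here 1 - x = (1 - j) + D, and (1 - j) (x - D) = Y + Q controls 1 - j. The tail estimate
  contains exp (A (1 - x)) with A of order \<mu>^2, so 1 - x has to be known up to a multiple of ln
  \<mu> / \<mu>^2.\<close>

lemma x_end:
  assumes "26 < we * (\<mu> - w b)"
  shows "1 - x b \<le> 11 / 10 * (Y b + 4 * d\<^sup>2) + 101 / 100 / we * (\<mu> - w b)" "94 / 100 \<le> x b"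
proof -
  have b: "0 \<le> b" "b \<le> b" using b_pos by auto
  have j: "95 / 100 \<le> j b" "j b \<le> 101 / 100" using Y_end(2)[OF assms] j_le[OF b] by auto
  show x: "94 / 100 \<le> x b" using x_ge[OF b] j by simp
  have D: "D b \<le> 101 / 100 / we * (\<mu> - w b)" using D_le_drop[OF b, of "101 / 100"] j by simp
  have "D b \<le> d" using D_le_d[OF b] j by simp
  then have xD: "93 / 100 \<le> x b - D b" using x small by simp
  have "1 - j b \<le> 11 / 10 * (Y b + 4 * d\<^sup>2)"
  proof (cases "0 \<le> 1 - j b")
    case True
    then have "(1 - j b) * (93 / 100) \<le> (1 - j b) * (x b - D b)" using xD by (intro mult_left_mono) auto
    also have "\<dots> = Y b + Q b" by (simp add: Q_def)
    also have "\<dots> \<le> Y b + 4 * d\<^sup>2" using Q_abs[OF b] by simp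
    finally show ?thesis using True by simp
  next
    case False
    moreover have "0 \<le> Y b + 4 * d\<^sup>2" using Y_nonneg[OF b] by simp
    then have "0 \<le> 11 / 10 * (Y b + 4 * d\<^sup>2)" by simp
    ultimately show ?thesis by argo
  qed
  then show "1 - x b \<le> 11 / 10 * (Y b + 4 * d\<^sup>2) + 101 / 100 / we * (\<mu> - w b)"
    using D unfolding D_def by linarith
qed

end

section \<open>Radial profiles and the mass beyond the inner region\<close>

text \<open>\<open>p\<close> is the flux - r w', and 4 pi times j at the first zero R will be the
  Dirichlet energy. Scaling the disk by R removes the multiplier from the equations; R itself
  becomes the multiplier.\<close>

locale radial_profile =
  fixes f :: "real \<Rightarrow> real" and \<mu> R :: real and w p j :: "real \<Rightarrow> real"
  assumes R_pos: "0 < R" and mu_pos: "0 < \<mu>"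
    and f_pos: "\<And>t. 0 < t \<Longrightarrow> 0 < f t"
    and cont: "continuous_on {0..R} w" "continuous_on {0..R} p" "continuous_on {0..R} j"
    and init: "w 0 = \<mu>" "p 0 = 0" "j 0 = 0"
    and w_R: "w R = 0"
    and w_pos: "\<And>r. 0 \<le> r \<Longrightarrow> r < R \<Longrightarrow> 0 < w r"
    and dw: "\<And>r. 0 < r \<Longrightarrow> r < R \<Longrightarrow> (w has_real_derivative (- p r) / r) (at r)"
    and dp: "\<And>r. 0 < r \<Longrightarrow> r < R \<Longrightarrow> (p has_real_derivative f (w r) / 4) (at r)"
    and dj: "\<And>r. 0 < r \<Longrightarrow> r < R \<Longrightarrow> (j has_real_derivative w r * f (w r) / 4) (at r)"
begin

lemma p_mono: assumes "0 \<le> r" "r \<le> r'" "r' \<le> R" shows "p r \<le> p r'"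
  using assms
  by (intro DERIV_nonneg_imp_increasing_open[of r r' p])
    (force intro!: exI[of _ "f (w _) / 4"] dp less_imp_le[OF f_pos] w_pos continuous_on_subset[OF cont(2)])+

lemma p_nonneg: "0 \<le> r \<Longrightarrow> r \<le> R \<Longrightarrow> 0 \<le> p r"
  using p_mono[of 0 r] init by simp

lemma j_mono: assumes "0 \<le> r" "r \<le> r'" "r' \<le> R" shows "j r \<le> j r'"
  using assms
  by (intro DERIV_nonneg_imp_increasing_open[of r r' j])
    (force intro!: exI[of _ "w _ * f (w _) / 4"] dj less_imp_le[OF mult_pos_pos[OF w_pos f_pos]] w_pos
       continuous_on_subset[OF cont(3)])+

lemma w_anti: assumes "0 \<le> r" "r \<le> r'" "r' \<le> R" shows "w r' \<le> w r"
proof (rule log_deriv_nonincreasing[where \<Phi>=w])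
  show "continuous_on {r..r'} w" using assms by (intro continuous_on_subset[OF cont(1)]) auto
  fix q assume "r < q" "q < r'"
  then show "\<exists>e\<le>0. (w has_real_derivative e / q) (at q)"
    using assms dw[of q] p_nonneg[of q] by (intro exI[of _ "- p q"]) auto
qed (use assms in auto)

lemma level: assumes "0 < we" "we < \<mu>" obtains b where "0 < b" "b < R" "w b = we"
proof -
  have "\<exists>b\<ge>0. b \<le> R \<and> w b = we"
    using IVT2'[of w R we 0] assms init w_R R_pos cont(1) by auto
  then obtain b where "0 \<le> b" "b \<le> R" "w b = we" by blast
  moreover from this have "b \<noteq> 0" "b \<noteq> R" using assms init w_R by auto
  ultimately show ?thesis using that[of b] by simp
qed

lemma inner_regionI:
  fixes we d \<kappa> :: real and h :: "real \<Rightarrow> real"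
  assumes f_eq: "\<And>t. 0 < t \<Longrightarrow> f t = t * (1 + h t) * exp (t\<^sup>2)"
    and b: "0 < b" "b < R" "w b = we" "0 < we"
    and \<kappa>: "0 < \<kappa>" "\<And>t. we \<le> t \<Longrightarrow> t \<le> \<mu> \<Longrightarrow> \<bar>(1 + h t) / \<kappa> - 1\<bar> \<le> 1 / (1000 * \<mu> ^ 4)"
    and small: "0.95 * \<mu> \<le> we" "2 * (\<mu> - we) / we \<le> d" "d \<le> 1 / 300" "4 / \<mu>\<^sup>2 \<le> d" "1000 \<le> \<mu>\<^sup>2"
  shows "inner_region \<mu> b we (1 / (1000 * \<mu> ^ 4)) d w p j
     (\<lambda>r. r / 4 * \<kappa> * (w r)\<^sup>2 * exp ((w r)\<^sup>2)) (\<lambda>r. (1 + h (w r)) / \<kappa> - 1)"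
proof
  let ?Y = "\<lambda>r. r / 4 * \<kappa> * (w r)\<^sup>2 * exp ((w r)\<^sup>2)"
  have le: "w r \<le> \<mu>" "we \<le> w r" if "0 \<le> r" "r \<le> b" for r
    using w_anti[of 0 r] w_anti[of r b] that b init by auto
  show "continuous_on {0..b} w" "continuous_on {0..b} p" "continuous_on {0..b} j"
    using b by (auto intro!: continuous_on_subset[OF cont(1)] continuous_on_subset[OF cont(2)]
        continuous_on_subset[OF cont(3)])
  then show "continuous_on {0..b} ?Y" by (intro continuous_intros) auto
  show "we \<le> \<mu>" using le[of b] b by auto
  fix r :: real assume r: "0 < r"
  {
    assume rb: "r \<le> b"
    then show "0 < ?Y r" using w_pos[of r] r b \<kappa> by simp
    show "\<bar>(1 + h (w r)) / \<kappa> - 1\<bar> \<le> 1 / (1000 * \<mu> ^ 4)" using le[of r] r rb by (intro \<kappa>(2)) auto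
  }
  assume rb: "r < b"
  then have rR: "r < R" and wr: "0 < w r" using b w_pos[of r] r by auto
  have fw: "f (w r) = w r * (1 + h (w r)) * exp ((w r)\<^sup>2)" using f_eq wr by simp
  show "(w has_real_derivative - p r / r) (at r)" using dw[OF r rR] .
  show "(p has_real_derivative ?Y r * (1 + ((1 + h (w r)) / \<kappa> - 1)) / w r / r) (at r)"
    using dp[OF r rR] wr r \<kappa>(1) unfolding fw by (rule_tac DERIV_cong) (auto simp: field_simps power2_eq_square)
  show "(j has_real_derivative ?Y r * (1 + ((1 + h (w r)) / \<kappa> - 1)) / r) (at r)"
    using dj[OF r rR] wr r \<kappa>(1) unfolding fw by (rule_tac DERIV_cong) (auto simp: field_simps power2_eq_square)
  show "(?Y has_real_derivative ?Y r * (1 - 2 * (w r * p r) - 2 * (p r / w r)) / r) (at r)"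
    using r wr by (auto intro!: derivative_eq_intros dw[OF r rR])
      (simp add: field_simps power2_eq_square)
qed (use b init small w_anti in auto)

text \<open>As p increases, w is concave in log r and lies below its tangent at b, which vanishes at
  distance A = w / p in log r. Along the tangent the exponent is a convex quadratic, so the mass
  sits at the two ends: the end at b contributes a multiple of Y1, the end at the zero a multiple of
  exp (A (1 - x1)), damped by A^(-2) because w is small there.\<close>

lemma outer_bound:
  fixes h :: "real \<Rightarrow> real" and \<kappa> C b :: real
  defines "x1 \<equiv> w b * p b" and "Y1 \<equiv> b / 4 * \<kappa> * (w b)\<^sup>2 * exp ((w b)\<^sup>2)" and "A \<equiv> w b / p b"
  assumes f_eq: "\<And>t. 0 < t \<Longrightarrow> f t = t * (1 + h t) * exp (t\<^sup>2)"
    and C: "0 < \<kappa>" "\<And>t. 0 < t \<Longrightarrow> 1 + h t \<le> C * \<kappa>" "0 < C"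
    and b: "0 < b" "b < R"
    and x1: "5 / 6 \<le> x1" "x1 \<le> 6 / 5"
  shows "j R \<le> j b + C * (4 * Y1 + 500 * Y1 * exp (A * (1 - x1)) / A\<^sup>2)"
proof -
  define B where "B = 100 * Y1 * exp (A * (1 - x1)) / A\<^sup>2"
  define w1 where "w1 = w b"
  define p1 where "p1 = p b"
  have w1: "0 < w1" using w_pos[of b] b by (simp add: w1_def)
  have "0 < w1 * p1" using x1 unfolding x1_def w1_def p1_def by linarith
  then have p1: "0 < p1" using w1 by (simp add: zero_less_mult_iff)
  have A: "0 < A" "A = w1 / p1" using w1 p1 by (auto simp: A_def w1_def p1_def)
  have w1A: "w1 = p1 * A" using A p1 by simp
  have x1A: "p1\<^sup>2 * A = x1" unfolding A x1_def using p1 by (simp add: power2_eq_square w1_def p1_def)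
  have Y1: "0 < Y1" using b C w1 by (simp add: Y1_def w1_def)
  have B: "0 < B" using Y1 A(1) by (simp add: B_def)
  have wle: "w r \<le> w1 - p1 * ln (r / b)" if r: "b \<le> r" "r \<le> R" for r
  proof -
    have "w r + p1 * ln r \<le> w b + p1 * ln b"
    proof (rule log_deriv_nonincreasing[where \<Phi>="\<lambda>r. w r + p1 * ln r"])
      have "continuous_on {b..r} w" using b r by (intro continuous_on_subset[OF cont(1)]) auto
      then show "continuous_on {b..r} (\<lambda>r. w r + p1 * ln r)" using b by (intro continuous_intros) auto
      fix q assume q: "b < q" "q < r"
      have "((\<lambda>r. w r + p1 * ln r) has_real_derivative (- p q + p1) / q) (at q)"
        using q r b by (auto intro!: derivative_eq_intros dw simp: add_divide_distrib diff_divide_distrib)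
      moreover have "- p q + p1 \<le> 0" using p_mono[of b q] q r b by (simp add: p1_def)
      ultimately show "\<exists>e\<le>0. ((\<lambda>r. w r + p1 * ln r) has_real_derivative e / q) (at q)" by blast
    qed (use b r in auto)
    then show ?thesis using b r by (simp add: ln_div w1_def algebra_simps)
  qed
  have Yle: "r / 4 * \<kappa> * (w r)\<^sup>2 * exp ((w r)\<^sup>2)
      \<le> Y1 * exp (- (ln (r / b)) / 4) + B * exp (- (A - ln (r / b)) / 5)"
    if r: "b \<le> r" "r < R" for r
  proof -
    define a where "a = ln (r / b)"
    define a' where "a' = A - a"
    have a: "0 \<le> a" using r b by (simp add: a_def)
    have wr: "0 < w r" "w r \<le> p1 * a'"
      using w_pos[of r] wle[of r] r b w1A by (auto simp: a_def a'_def algebra_simps)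
    then have "0 < p1 * a'" by linarith
    then have a': "0 < a'" using p1 by (simp add: zero_less_mult_iff)
    have rb: "r = b * exp a" using r b by (simp add: a_def)
    have "(w r)\<^sup>2 \<le> (p1 * a')\<^sup>2" using wr by (intro power_mono) auto
    then have w2: "(w r)\<^sup>2 \<le> p1\<^sup>2 * a'\<^sup>2" by (simp add: power_mult_distrib)
    have w12: "(w b)\<^sup>2 = p1\<^sup>2 * A\<^sup>2" using w1A by (simp add: w1_def power_mult_distrib)
    \<comment> \<open>By w1 = p1 A and p1^2 A = x1 the change of the exponent along the tangent
      depends only on x1, A and a.\<close>
    have e1: "p1\<^sup>2 * a'\<^sup>2 - p1\<^sup>2 * A\<^sup>2 = x1 * a * (a / A - 2)"
    proof -
      have "p1\<^sup>2 * a'\<^sup>2 - p1\<^sup>2 * A\<^sup>2 = p1\<^sup>2 * A * (a * (a / A - 2))"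
        using A(1) unfolding a'_def by (simp add: field_simps power2_eq_square)
      then show ?thesis by (simp add: x1A)
    qed
    define T where "T = a + x1 * a * (a / A - 2)"
    have "r / 4 * \<kappa> * (w r)\<^sup>2 * exp ((w r)\<^sup>2) \<le> r / 4 * \<kappa> * (p1\<^sup>2 * a'\<^sup>2) * exp (p1\<^sup>2 * a'\<^sup>2)"
      using w2 r b C by (intro mult_mono mult_left_mono) auto
    also have "\<dots> = Y1 * (a'\<^sup>2 / A\<^sup>2) * exp (a + (p1\<^sup>2 * a'\<^sup>2 - p1\<^sup>2 * A\<^sup>2))"
      unfolding Y1_def w12 rb exp_add exp_diff using A(1) p1 by (simp add: field_simps)
    also have "\<dots> = Y1 * (a'\<^sup>2 / A\<^sup>2) * exp T" by (simp add: e1 T_def)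
    also have "\<dots> \<le> Y1 * exp (- a / 4) + B * exp (- a' / 5)"
    proof (cases "a \<le> A / 2")
      case True
      \<comment> \<open>On the half next to b, x1 \<ge> 5/6 and a / A - 2 \<le> - 3/2 give the slope
        1 - 5/4 = - 1/4.\<close>
      have "a / A - 2 \<le> - (3 / 2)" using True A(1) by (simp add: field_simps)
      then have "x1 * a * (a / A - 2) \<le> x1 * a * - (3 / 2)"
        using x1 a by (intro mult_left_mono) auto
      moreover have "5 / 6 * a \<le> x1 * a" using x1 a by (intro mult_right_mono) auto
      ultimately have T: "T \<le> - a / 4" unfolding T_def by argo
      have "a'\<^sup>2 \<le> A\<^sup>2" using a a' by (intro power_mono) (auto simp: a'_def)
      then have "a'\<^sup>2 / A\<^sup>2 \<le> 1" using A(1) by simp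
      then have "Y1 * (a'\<^sup>2 / A\<^sup>2) * exp T \<le> Y1 * 1 * exp (- a / 4)"
        using T Y1 by (intro mult_mono) auto
      moreover have "0 \<le> B * exp (- a' / 5)" using B by simp
      ultimately show ?thesis by simp
    next
      case False
      \<comment> \<open>On the half next to the zero of the tangent the exponent is expanded in the
        distance a' to that zero: it starts at A (1 - x1) and falls by at least 2 a' / 5. One half
        of this decay is spent on the factor a'^2.\<close>
      have T: "T = A * (1 - x1) - a' + x1 * a' * (a' / A)"
        using A(1) unfolding T_def a'_def by (simp add: field_simps power2_eq_square)
      have "a' / A \<le> 1 / 2" using False A(1) by (simp add: a'_def field_simps)
      then have "x1 * a' * (a' / A) \<le> x1 * a' * (1 / 2)" using x1 a' by (intro mult_left_mono) auto
      moreover have "x1 * a' \<le> 6 / 5 * a'" using x1 a' by (intro mult_right_mono) auto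
      ultimately have T: "T \<le> A * (1 - x1) + (- a' / 5 + - a' / 5)" unfolding T by argo
      have "(a' / 5)\<^sup>2 / 2 \<le> exp (a' / 5)"
        using exp_lower_Taylor_quadratic[of "a' / 5"] a' by simp
      then have "a'\<^sup>2 \<le> exp (a' / 5) * 50" by (simp add: power_divide)
      then have q: "a'\<^sup>2 \<le> 100 * exp (a' / 5)" using exp_gt_zero[of "a' / 5"] by argo
      have "Y1 * (a'\<^sup>2 / A\<^sup>2) * exp T \<le>
          Y1 * (100 * exp (a' / 5) / A\<^sup>2) * exp (A * (1 - x1) + (- a' / 5 + - a' / 5))"
        using T Y1 q by (intro mult_mono divide_right_mono mult_left_mono) auto
      also have "\<dots> = B * (exp (a' / 5) * (exp (- a' / 5) * exp (- a' / 5)))"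
        unfolding B_def exp_add by simp
      also have "exp (a' / 5) * (exp (- a' / 5) * exp (- a' / 5)) = exp (- a' / 5)"
        by (simp only: exp_add[symmetric]) simp
      also have "B * exp (- a' / 5) \<le> Y1 * exp (- a / 4) + B * exp (- a' / 5)" using Y1 by simp
      finally show ?thesis .
    qed
    finally show ?thesis by (simp add: a_def a'_def)
  qed
  \<comment> \<open>Each exponential is a primitive in log r of one part of \<open>Yle\<close>; the
    factors 4 and 5 are the reciprocals of the two rates.\<close>
  let ?P = "\<lambda>r. j r + 4 * C * Y1 * exp (- (ln (r / b)) / 4) - 5 * C * B * exp (- (A - ln (r / b)) / 5)"
  have "?P R \<le> ?P b"
  proof (rule log_deriv_nonincreasing[where \<Phi>="?P"])
    have "continuous_on {b..R} j" using b by (intro continuous_on_subset[OF cont(3)]) auto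
    then show "continuous_on {b..R} ?P" using b by (intro continuous_intros) auto
    fix r assume r: "b < r" "r < R"
    let ?Y = "r / 4 * \<kappa> * (w r)\<^sup>2 * exp ((w r)\<^sup>2)"
    let ?e = "r * (w r * f (w r) / 4) - C * Y1 * exp (- (ln (r / b)) / 4) - C * B * exp (- (A - ln (r / b)) / 5)"
    have der: "(?P has_real_derivative ?e / r) (at r)"
      using r b by (auto intro!: derivative_eq_intros dj simp: field_simps)
    have wr: "0 < w r" using w_pos[of r] r b by simp
    have "r * (w r * f (w r) / 4) = r / 4 * ((w r)\<^sup>2 * exp ((w r)\<^sup>2)) * (1 + h (w r))"
      using f_eq[OF wr] by (simp add: power2_eq_square)
    also have "\<dots> \<le> r / 4 * ((w r)\<^sup>2 * exp ((w r)\<^sup>2)) * (C * \<kappa>)"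
      using C(2)[OF wr] r b by (intro mult_left_mono) auto
    also have "\<dots> = C * ?Y" by simp
    also have "\<dots> \<le> C * (Y1 * exp (- (ln (r / b)) / 4) + B * exp (- (A - ln (r / b)) / 5))"
      using Yle[of r] r C by (intro mult_left_mono) auto
    finally have "?e \<le> 0" by (simp add: algebra_simps)
    then show "\<exists>e\<le>0. (?P has_real_derivative e / r) (at r)" using der by blast
  qed (use b in auto)
  moreover have "p1 * ln (R / b) \<le> p1 * A" using wle[of R] w_R b w1A by auto
  then have "ln (R / b) \<le> A" using p1 by simp
  then have "exp (- (A - ln (R / b)) / 5) \<le> 1" by simp
  then have "5 * C * B * exp (- (A - ln (R / b)) / 5) \<le> 5 * C * B * 1"
    using C B by (intro mult_left_mono) auto
  moreover have "0 \<le> 4 * C * Y1 * exp (- (ln (R / b)) / 4)" "0 \<le> 5 * C * B * exp (- (A - ln (b / b)) / 5)"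
    using C Y1 B by auto
  moreover have "4 * C * Y1 * exp (- (ln (b / b)) / 4) = 4 * C * Y1 * 1" using b by simp
  ultimately have "j R \<le> j b + 4 * C * Y1 * 1 + 5 * C * B * 1" by argo
  also have "\<dots> = j b + C * (4 * Y1 + 500 * Y1 * exp (A * (1 - x1)) / A\<^sup>2)"
    by (simp add: B_def algebra_simps)
  finally show ?thesis .
qed

end

section \<open>Error terms for large height and the resulting energy bounds\<close>

text \<open>This is the width of the window in the oscillation hypothesis at height \<mu>. In the
  natural unit 1 / \<mu> it is a drop of 8 ln \<mu> + 1.\<close>

definition drop_width :: "real \<Rightarrow> real" where
  "drop_width \<mu> = (8 * ln \<mu> + 1) / \<mu>"

definition drop_level :: "real \<Rightarrow> real" where
  "drop_level \<mu> = \<mu> - 4 * ln \<mu> / \<mu>"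

definition Y_bound :: "real \<Rightarrow> real" where
  "Y_bound \<mu> = exp (- (87 / 100) * (drop_level \<mu> * (\<mu> - drop_level \<mu>) - 26))"

definition d_bound :: "real \<Rightarrow> real" where
  "d_bound \<mu> = 2 * drop_width \<mu> / (\<mu> - drop_width \<mu>)"

definition u_bound :: "real \<Rightarrow> real" where
  "u_bound \<mu> = 11 / 10 * (Y_bound \<mu> + 4 * (d_bound \<mu>)\<^sup>2)
     + 101 / 100 / drop_level \<mu> * (\<mu> - drop_level \<mu>)"

text \<open>At \<open>drop_level\<close> the density bound \<open>Y_bound\<close> is of order
  \<mu>^(-3.48), since 0.87 * 4 = 3.48. The exponential is of order \<mu>^4.04, since
  \<open>u_bound\<close> is about 1.01 * 4 ln \<mu> / \<mu>^2. Division by the fourth power of the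
  level leaves a negative power of \<mu>.\<close>

definition excess_bound :: "real \<Rightarrow> real" where
  "excess_bound \<mu> = 4 * Y_bound \<mu> + 1000 * Y_bound \<mu> *
      exp ((drop_level \<mu>)\<^sup>2 / (1 - u_bound \<mu>) * u_bound \<mu>) / (drop_level \<mu>) ^ 4"

lemmas bounds_def = drop_width_def drop_level_def Y_bound_def d_bound_def u_bound_def excess_bound_def

text \<open>The delicate line is the one with \<open>ln\<close> of a power of 1 / \<mu>: the whole
  window supplies 0.8 * 8 ln \<mu> = 6.4 ln \<mu>, while reaching the scale \<mu>^(-4) / 100 costs 4
  ln \<mu> plus a constant.\<close>

lemma eventually_large:
  "\<forall>\<^sub>F \<mu> in at_top. 0.95 * \<mu> \<le> \<mu> - drop_width \<mu>"
  "\<forall>\<^sub>F \<mu> in at_top. d_bound \<mu> \<le> 1 / 300"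
  "\<forall>\<^sub>F \<mu> in at_top. (1000::real) \<le> \<mu>\<^sup>2"
  "\<forall>\<^sub>F \<mu> in at_top. 4 / \<mu>\<^sup>2 \<le> d_bound \<mu>"
  "\<forall>\<^sub>F \<mu> in at_top. 0 < 8 / 10 * ((\<mu> - drop_width \<mu>) * drop_width \<mu> - 26) + ln ((1 / \<mu>\<^sup>2)\<^sup>2 / 100)"
  "\<forall>\<^sub>F \<mu> in at_top. 26 < drop_level \<mu> * (\<mu> - drop_level \<mu>)"
  "\<forall>\<^sub>F \<mu> in at_top. \<mu> - drop_width \<mu> \<le> drop_level \<mu>"
  "\<forall>\<^sub>F \<mu> in at_top. drop_level \<mu> < \<mu>"
  "\<forall>\<^sub>F \<mu> in at_top. 0 < drop_width \<mu>"
  "(d_bound \<longlongrightarrow> 0) at_top"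
  unfolding bounds_def by real_asymp+

lemma u_bound_lim: "(u_bound \<longlongrightarrow> 0) at_top"
  unfolding bounds_def by real_asymp

lemma excess_bound_lim: "(excess_bound \<longlongrightarrow> 0) at_top"
  unfolding bounds_def by real_asymp

text \<open>The inner comparison is used at two depths: over the whole window, where j has enough
  room to pass 1, and down to \<open>drop_level\<close>, where Y is already a negative power of
  \<mu> and \<open>outer_bound\<close> takes over.\<close>

theorem profile_energy_bounds:
  fixes f h :: "real \<Rightarrow> real" and c0 C0 \<delta> :: real
  assumes f_eq: "\<And>t. 0 < t \<Longrightarrow> f t = t * (1 + h t) * exp (t\<^sup>2)"
    and c0: "0 < c0" "\<And>t. 0 < t \<Longrightarrow> c0 \<le> 1 + h t"
    and C0: "\<And>t. 0 < t \<Longrightarrow> 1 + h t \<le> C0"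
    and osc: "\<And>e. 0 < e \<Longrightarrow> \<forall>\<^sub>F t in at_top. \<forall>s. \<bar>s\<bar> \<le> 1 \<longrightarrow>
        t ^ 4 * \<bar>h (t + s * (8 * ln t + 1) / t) - h t\<bar> \<le> e"
    and \<delta>: "0 < \<delta>"
  shows "\<forall>\<^sub>F \<mu> in at_top. \<forall>R w p j. radial_profile f \<mu> R w p j \<longrightarrow> 1 < j R \<and> j R < 1 + \<delta>"
proof -
  define C where "C = C0 / c0"
  have C0_pos: "0 < C0" using c0(1) c0(2)[of 1] C0[of 1] by linarith
  have C: "0 < C" using c0 C0_pos by (simp add: C_def)
  have "((\<lambda>\<mu>. 3 * d_bound \<mu> + C * excess_bound \<mu>) \<longlongrightarrow> 3 * 0 + C * 0) at_top"
    by (intro tendsto_intros eventually_large(10) excess_bound_lim)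
  then have ev1: "\<forall>\<^sub>F \<mu> in at_top. 3 * d_bound \<mu> + C * excess_bound \<mu> < \<delta>"
    by (rule order_tendstoD(2)) (simp add: \<delta>)
  have ev2: "\<forall>\<^sub>F \<mu> in at_top. u_bound \<mu> < 1 / 6"
    by (rule order_tendstoD(2)[OF u_bound_lim]) simp
  have ev3: "\<forall>\<^sub>F \<mu> in at_top. (1::real) < \<mu>" by (rule eventually_gt_at_top)
  have ev4: "\<forall>\<^sub>F t in at_top. \<forall>s. \<bar>s\<bar> \<le> 1 \<longrightarrow>
        t ^ 4 * \<bar>h (t + s * (8 * ln t + 1) / t) - h t\<bar> \<le> c0 / 1000"
    using c0 by (intro osc) auto
  show ?thesis
    using ev1 ev2 ev3 ev4 eventually_large(1-9)
  proof eventually_elim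
    case (elim \<mu>)
    show ?case
    proof (intro allI impI)
      fix R w p j assume "radial_profile f \<mu> R w p j"
      then interpret P: radial_profile f \<mu> R w p j .
      define \<kappa> where "\<kappa> = 1 + h \<mu>"
      have \<kappa>: "0 < \<kappa>" "c0 \<le> \<kappa>" using c0(1) c0(2)[of \<mu>] elim(3) by (auto simp: \<kappa>_def)
      have \<mu>: "0 < \<mu>" using elim(3) by simp
      have h_near: "\<bar>(1 + h t) / \<kappa> - 1\<bar> \<le> 1 / (1000 * \<mu> ^ 4)"
        if t: "\<mu> - drop_width \<mu> \<le> t" "t \<le> \<mu>" for t
      proof -
        \<comment> \<open>s is the parameter for which the hypothesis speaks about t. Its tolerance
          c0 / 1000 turns into 1 / (1000 \<mu>^4) because \<kappa> \<ge> c0.\<close>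
        define s where "s = (t - \<mu>) / drop_width \<mu>"
        have s: "\<bar>s\<bar> \<le> 1" using t elim(13) unfolding s_def by (simp add: field_simps abs_le_iff)
        have "s * drop_width \<mu> = t - \<mu>" using elim(13) by (simp add: s_def)
        then have "\<mu> + s * (8 * ln \<mu> + 1) / \<mu> = t" by (simp add: drop_width_def)
        then have 1: "\<mu> ^ 4 * \<bar>h t - h \<mu>\<bar> \<le> c0 / 1000" using elim(4)[rule_format, OF s] by simp
        have "(1 + h t) / \<kappa> - 1 = (h t - h \<mu>) / \<kappa>"
          using \<kappa> by (simp add: \<kappa>_def field_simps)
        then have "\<bar>(1 + h t) / \<kappa> - 1\<bar> = \<bar>h t - h \<mu>\<bar> / \<kappa>" using \<kappa> by simp
        also have "\<dots> \<le> \<bar>h t - h \<mu>\<bar> / c0" using \<kappa> c0 by (intro divide_left_mono) auto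
        also have "\<dots> \<le> 1 / (1000 * \<mu> ^ 4)" using 1 c0 \<mu> by (simp add: field_simps)
        finally show ?thesis .
      qed
      have K: "0.95 * \<mu> \<le> \<mu> - drop_width \<mu>" "0 < \<mu> - drop_width \<mu>" using elim(5) \<mu> by auto
      have gt: "1 < j R"
      proof -
        define we where "we = \<mu> - drop_width \<mu>"
        obtain b where b: "0 < b" "b < R" "w b = we"
          using P.level[of we] K elim(13) by (auto simp: we_def)
        interpret I: inner_region \<mu> b we "1 / (1000 * \<mu> ^ 4)" "d_bound \<mu>" w p j
          "\<lambda>r. r / 4 * \<kappa> * (w r)\<^sup>2 * exp ((w r)\<^sup>2)" "\<lambda>r. (1 + h (w r)) / \<kappa> - 1"
        proof (rule P.inner_regionI[OF f_eq b _ \<kappa>(1) h_near])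
          show "2 * (\<mu> - we) / we \<le> d_bound \<mu>" by (simp add: we_def d_bound_def)
        qed (use K elim(6-8) in \<open>simp_all add: we_def\<close>)
        have "\<exists>r. 0 < r \<and> r \<le> b \<and> 1 < j r"
          using elim(9) by (intro I.j_exceeds_1 b) (simp add: we_def I.\<epsilon>_def)
        then obtain r where "0 < r" "r \<le> b" "1 < j r" by blast
        then show ?thesis using P.j_mono[of r R] b by simp
      qed
      define we where "we = drop_level \<mu>"
      have we: "\<mu> - drop_width \<mu> \<le> we" "we < \<mu>" "0 < we" using elim(11,12) K by (auto simp: we_def)
      obtain b where b: "0 < b" "b < R" "w b = we" using P.level[of we] we by auto
      have d: "2 * (\<mu> - we) / we \<le> d_bound \<mu>"
        using we K unfolding d_bound_def by (intro frac_le) auto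
      interpret I: inner_region \<mu> b we "1 / (1000 * \<mu> ^ 4)" "d_bound \<mu>" w p j
          "\<lambda>r. r / 4 * \<kappa> * (w r)\<^sup>2 * exp ((w r)\<^sup>2)" "\<lambda>r. (1 + h (w r)) / \<kappa> - 1"
        by (rule P.inner_regionI[OF f_eq b we(3) \<kappa>(1) h_near _ d]) (use K elim(6-8) we in simp_all)
      let ?Y = "b / 4 * \<kappa> * (w b)\<^sup>2 * exp ((w b)\<^sup>2)"
      have T: "26 < we * (\<mu> - w b)" using elim(10) b by (simp add: we_def)
      have Y: "?Y \<le> Y_bound \<mu>" using I.Y_end(1)[OF T] b by (simp add: Y_bound_def we_def)
      have Y0: "0 < ?Y" using b we \<kappa> by simp
      define x where "x = w b * p b"
      define u where "u = u_bound \<mu>"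
      have x_eq: "I.x b = x" by (simp add: I.x_def x_def)
      have "1 - x \<le> 11 / 10 * (?Y + 4 * (d_bound \<mu>)\<^sup>2) + 101 / 100 / we * (\<mu> - we)"
        using I.x_end(1)[OF T] b x_eq by simp
      also have "\<dots> \<le> u" unfolding u_def u_bound_def we_def
        using Y we(2,3) by (intro add_mono mult_left_mono) (auto simp: we_def)
      finally have xu: "1 - x \<le> u" .
      have u0: "0 \<le> u" using we unfolding u_def u_bound_def we_def[symmetric] Y_bound_def by simp
      have u1: "u < 1 / 6" using elim(2) by (simp add: u_def)
      have "x \<le> 101 / 100" using I.x_le_j[of b] I.j_le[of b] b x_eq by auto
      then have x: "5 / 6 \<le> x" "x \<le> 101 / 100" using xu u1 by auto
      have pb: "p b = x / we" using b we by (simp add: x_def)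
      define A where "A = w b / p b"
      have A: "A = we\<^sup>2 / x" using we x b pb by (simp add: A_def power2_eq_square)
      have jR: "j R \<le> j b + C * (4 * ?Y + 500 * ?Y * exp (A * (1 - x)) / A\<^sup>2)"
        unfolding A_def x_def
      proof (rule P.outer_bound[OF f_eq])
        fix t :: real assume "0 < t"
        have "c0 * C0 \<le> \<kappa> * C0" using \<kappa> C0_pos by (intro mult_right_mono) auto
        then have "C0 \<le> C * \<kappa>" using c0 by (simp add: C_def field_simps)
        then show "1 + h t \<le> C * \<kappa>" using C0[OF \<open>0 < t\<close>] by simp
      qed (use \<kappa> C b x in \<open>auto simp: x_def\<close>)
      have Av: "A * (1 - x) \<le> we\<^sup>2 / (1 - u) * u"
      proof (cases "1 - x \<le> 0")
        case True
        then have "A * (1 - x) \<le> 0" using x by (intro mult_nonneg_nonpos) (auto simp: A)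
        also have "0 \<le> we\<^sup>2 / (1 - u) * u" using u0 u1 by simp
        finally show ?thesis .
      next
        case False
        have "we\<^sup>2 / x \<le> we\<^sup>2 / (1 - u)" using xu u1 x by (intro divide_left_mono) auto
        then show ?thesis unfolding A using xu False u1 by (intro mult_mono) auto
      qed
      have "x\<^sup>2 \<le> (101 / 100)\<^sup>2" using x by (intro power_mono) auto
      then have x2: "x\<^sup>2 \<le> 2" by (simp add: power2_eq_square)
      have "500 * ?Y * exp (A * (1 - x)) / A\<^sup>2 = 500 * ?Y * exp (A * (1 - x)) * (x\<^sup>2 / we ^ 4)"
        using we x by (simp add: A power_divide flip: power_mult)
      also have "\<dots> \<le> 500 * Y_bound \<mu> * exp (we\<^sup>2 / (1 - u) * u) * (2 / we ^ 4)"
        using Y Y0 Av x2 we by (intro mult_mono divide_right_mono) auto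
      finally have "4 * ?Y + 500 * ?Y * exp (A * (1 - x)) / A\<^sup>2 \<le> excess_bound \<mu>"
        using Y unfolding excess_bound_def u_def we_def by argo
      then have "C * (4 * ?Y + 500 * ?Y * exp (A * (1 - x)) / A\<^sup>2) \<le> C * excess_bound \<mu>"
        using C by (intro mult_left_mono) auto
      moreover have "j b < 1 + 3 * d_bound \<mu>" using I.j_less[of b] b by (simp add: I.\<sigma>_def)
      ultimately have "j R < 1 + \<delta>" using jR elim(1) by linarith
      with gt show "1 < j R \<and> j R < 1 + \<delta>" by simp
    qed
  qed
qed

section \<open>The radial initial value problem as an integral equation\<close>

text \<open>The mean of g over [0, r], written over a fixed interval so that r = 0 is no exception.
  In these terms p / r is one quarter of a mean, which removes the singularity of the radial
  equation at the origin.\<close>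

definition Av :: "(real \<Rightarrow> real) \<Rightarrow> real \<Rightarrow> real" where
  "Av g r = integral {0..1} (\<lambda>t. g (r * t))"

lemma continuous_on_Av:
  assumes "continuous_on UNIV g" shows "continuous_on UNIV (Av g)"
proof -
  have "continuous_on (UNIV \<times> cbox 0 1) (\<lambda>(r::real, t). g (r * t))"
    unfolding split_def by (intro continuous_on_compose2[OF assms] continuous_intros) auto
  from integral_continuous_on_param[OF this] show ?thesis by (simp add: Av_def[abs_def])
qed

lemma integral_eq_Av:
  assumes "continuous_on UNIV g" "0 \<le> r"
  shows "integral {0..r} g = r * Av g r"
proof -
  define H where "H x = integral {0..x} g" for x
  have H: "(H has_real_derivative g x) (at x within {0..r})" if "x \<in> {0..r}" for x
    using integral_has_real_derivative[of 0 r g x] continuous_on_subset[OF assms(1)] that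
    by (simp add: H_def[abs_def])
  have "((\<lambda>t. r * g (r * t)) has_integral H (r * 1) - H (r * 0)) {0..1}"
  proof (rule fundamental_theorem_of_calculus)
    fix t :: real assume t: "t \<in> {0..1}"
    have rt: "r * t \<in> {0..r}" using t assms(2) by (auto simp: mult_left_le)
    have "((\<lambda>t. H (r * t)) has_real_derivative g (r * t) * r) (at t within {0..1})"
    proof (rule DERIV_image_chain[where f=H and g="(*) r", unfolded o_def])
      have "(*) r ` {0..1} \<subseteq> {0..r}" using assms(2) by (auto simp: mult_left_le)
      then show "(H has_real_derivative g (r * t)) (at (r * t) within (*) r ` {0..1})"
        using H[OF rt] by (rule DERIV_subset[rotated])
      show "((*) r has_real_derivative r) (at t within {0..1})"
        by (auto intro!: derivative_eq_intros)
    qed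
    then show "((\<lambda>t. H (r * t)) has_vector_derivative r * g (r * t)) (at t within {0..1})"
      by (simp add: has_real_derivative_iff_has_vector_derivative mult.commute)
  qed simp
  from integral_unique[OF this] have "r * integral {0..1} (\<lambda>t. g (r * t)) = H r" by (simp add: H_def)
  then show ?thesis by (simp add: H_def Av_def)
qed

lemma integral_has_deriv_at:
  fixes g :: "real \<Rightarrow> real"
  assumes "continuous_on UNIV g" "0 < r"
  shows "((\<lambda>x. integral {0..x} g) has_real_derivative g r) (at r)"
proof -
  have "((\<lambda>x. integral {0..x} g) has_real_derivative g r) (at r within {0..r + 1})"
    using integral_has_real_derivative[of 0 "r + 1" g r] continuous_on_subset[OF assms(1)] assms(2) by auto
  moreover have "at r within {0..r + 1} = at r" using assms(2) by (intro at_within_Icc_at) auto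
  ultimately show ?thesis by simp
qed

lemma continuous_on_integral_upto:
  fixes g :: "real \<Rightarrow> real"
  assumes "continuous_on UNIV g"
  shows "continuous_on {0..r} (\<lambda>x. integral {0..x} g)"
  using assms by (intro indefinite_integral_continuous_1 integrable_continuous_real)
    (auto intro: continuous_on_subset)

lemma abs_Av_le:
  assumes "continuous_on UNIV g" and "\<And>q. 0 \<le> q \<Longrightarrow> q \<le> r \<Longrightarrow> \<bar>g q\<bar> \<le> c" and "0 \<le> r"
  shows "\<bar>Av g r\<bar> \<le> c"
proof -
  have "norm (integral {0..1} (\<lambda>t. g (r * t))) \<le> c * (1 - 0)"
  proof (rule integral_bound)
    show "continuous_on {0..1} (\<lambda>t. g (r * t))"
      by (intro continuous_on_compose2[OF assms(1)] continuous_intros) auto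
  qed (use assms in \<open>auto simp: mult_left_le\<close>)
  then show ?thesis by (simp add: Av_def)
qed

text \<open>The weight \<open>exp (K * q)\<close> turns the double average into a contraction on every bounded interval.\<close>

lemma abs_Av_Av_le:
  assumes g: "continuous_on UNIV g" and K: "0 < K" and r: "0 \<le> r"
    and le: "\<And>q. 0 \<le> q \<Longrightarrow> q \<le> r \<Longrightarrow> \<bar>g q\<bar> \<le> c * exp (K * q)" and c: "0 \<le> c"
  shows "\<bar>r * Av (Av g) r\<bar> \<le> c * exp (K * r) / K"
proof -
  have 1: "\<bar>Av g q\<bar> \<le> c * exp (K * q)" if "0 \<le> q" "q \<le> r" for q
  proof (rule abs_Av_le[OF g])
    fix s assume s: "0 \<le> s" "s \<le> q"
    have "\<bar>g s\<bar> \<le> c * exp (K * s)" using le[of s] s that by auto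
    also have "\<dots> \<le> c * exp (K * q)" using s K c by (intro mult_left_mono) auto
    finally show "\<bar>g s\<bar> \<le> c * exp (K * q)" .
  qed (use that in auto)
  have int: "((\<lambda>q. c * exp (K * q)) has_integral c * exp (K * r) / K - c * exp (K * 0) / K) {0..r}"
    using K r by (intro fundamental_theorem_of_calculus)
      (auto intro!: derivative_eq_intros simp flip: has_real_derivative_iff_has_vector_derivative)
  have "r * Av (Av g) r = integral {0..r} (Av g)"
    using integral_eq_Av[OF continuous_on_Av[OF g] r] by simp
  moreover have "norm (integral {0..r} (Av g)) \<le> integral {0..r} (\<lambda>q. c * exp (K * q))"
    using 1 int continuous_on_subset[OF continuous_on_Av[OF g]]
    by (intro integral_norm_bound_integral) (auto simp: has_integral_iff intro!: integrable_continuous_real)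
  ultimately have "\<bar>r * Av (Av g) r\<bar> \<le> c * exp (K * r) / K - c * exp (K * 0) / K"
    using integral_unique[OF int] by simp
  also have "\<dots> \<le> c * exp (K * r) / K" using c K by simp
  finally show ?thesis .
qed

lemma abs_Av_Av_diff_le:
  assumes "continuous_on UNIV g1" "continuous_on UNIV g2" "0 < K" "0 \<le> r"
    and "\<And>q. 0 \<le> q \<Longrightarrow> q \<le> r \<Longrightarrow> \<bar>g1 q - g2 q\<bar> \<le> c * exp (K * q)" "0 \<le> c"
  shows "\<bar>r * Av (Av g1) r - r * Av (Av g2) r\<bar> \<le> c * exp (K * r) / K"
proof -
  have Av_diff: "Av (\<lambda>q. a q - b q) = (\<lambda>q. Av a q - Av b q)"
    if "continuous_on UNIV a" "continuous_on UNIV b" for a b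
    unfolding Av_def fun_eq_iff
    by (intro allI integral_diff integrable_continuous_real continuous_on_compose2[OF that(1)]
        continuous_on_compose2[OF that(2)] continuous_intros) auto
  have "Av (Av (\<lambda>q. g1 q - g2 q)) = (\<lambda>q. Av (Av g1) q - Av (Av g2) q)"
    using assms by (simp add: Av_diff continuous_on_Av)
  then show ?thesis
    using abs_Av_Av_le[of "\<lambda>q. g1 q - g2 q" K r c] assms by (simp add: right_diff_distrib continuous_on_diff)
qed

text \<open>Two integrations of the system w' = - p / r, p' = F (w) / 4 from r = 0 become two
  successive means, so the equation has a regular form at the origin.\<close>

definition is_sol :: "(real \<Rightarrow> real) \<Rightarrow> real \<Rightarrow> real \<Rightarrow> (real \<Rightarrow> real) \<Rightarrow> bool" where
  "is_sol F T \<mu> w \<longleftrightarrow> continuous_on UNIV w \<and>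
     (\<forall>r\<in>{0..T}. w r = \<mu> - r / 4 * Av (Av (\<lambda>q. F (w q))) r)"

text \<open>Banach's theorem in the unknown y = exp (- K r) (w - \<mu>) on bounded continuous
  functions. With K = L the factor 1/4 of the equation is the contraction constant, whatever the
  length T. The clamp \<open>cl\<close> extends everything from [0, T] to the line, where bounded
  continuous functions form a complete type.\<close>

lemma sol_exists_bounded:
  fixes F :: "real \<Rightarrow> real"
  assumes L: "0 < L" "\<And>x y. \<bar>F x - F y\<bar> \<le> L * \<bar>x - y\<bar>" and B: "\<And>x. \<bar>F x\<bar> \<le> B" and T: "0 \<le> T"
  shows "\<exists>w. is_sol F T \<mu> w"
proof -
  define K where "K = L"
  have K: "0 < K" using L by (simp add: K_def)
  have Fc: "continuous_on UNIV F"
  proof -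
    have "L-lipschitz_on UNIV F" using L by (intro lipschitz_onI) (auto simp: dist_real_def)
    then show ?thesis by (rule lipschitz_on_continuous_on)
  qed
  define cl where "cl r = max 0 (min T r)" for r :: real
  have cl: "0 \<le> cl r" "cl r \<le> T" "r \<in> {0..T} \<Longrightarrow> cl r = r" for r using T by (auto simp: cl_def)
  have clc: "continuous_on A cl" for A unfolding cl_def by (intro continuous_intros)
  define W where "W y = (\<lambda>q. \<mu> + exp (K * cl q) * apply_bcontfun y q)" for y
  have Wc: "continuous_on UNIV (W y)" for y
    unfolding W_def by (intro continuous_intros clc continuous_on_apply_bcontfun)
  have FWc: "continuous_on UNIV (\<lambda>q. F (W y q))" for y
    by (intro continuous_on_compose2[OF Fc Wc]) auto
  define G where "G y = (\<lambda>r. exp (- K * cl r) * (- (cl r / 4) * Av (Av (\<lambda>q. F (W y q))) (cl r)))" for y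
  have Gc: "continuous_on UNIV (G y)" for y
    unfolding G_def
    by (intro continuous_intros clc continuous_on_compose2[OF continuous_on_Av[OF continuous_on_Av[OF FWc]] clc]) auto
  have Gb: "bounded (range (G y))" for y
  proof -
    have "\<bar>G y r\<bar> \<le> 1 * (T / 4 * B)" for r
    proof -
      have "\<bar>Av (Av (\<lambda>q. F (W y q))) (cl r)\<bar> \<le> B"
        by (intro abs_Av_le continuous_on_Av FWc B cl)
      then show ?thesis unfolding G_def abs_mult using cl[of r] K by (intro mult_mono) auto
    qed
    then show ?thesis by (intro boundedI[of _ "1 * (T / 4 * B)"]) auto
  qed
  define \<Phi> where "\<Phi> y = Bcontfun (G y)" for y
  have \<Phi>: "apply_bcontfun (\<Phi> y) = G y" for y
    unfolding \<Phi>_def using Gc Gb by (intro Bcontfun_inverse) (auto simp: bcontfun_def)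
  have "\<exists>!y. \<Phi> y = y"
  proof (rule banach_fix_type[where c="1/4"])
    show "\<forall>x. \<forall>y. dist (\<Phi> x) (\<Phi> y) \<le> 1 / 4 * dist x y"
    proof (intro allI)
      fix x y :: "real \<Rightarrow>\<^sub>C real"
      show "dist (\<Phi> x) (\<Phi> y) \<le> 1 / 4 * dist x y"
      proof (rule dist_bound)
        fix r
        define c where "c = L * dist x y"
        have "\<bar>cl r * Av (Av (\<lambda>q. F (W x q))) (cl r) - cl r * Av (Av (\<lambda>q. F (W y q))) (cl r)\<bar>
            \<le> c * exp (K * cl r) / K"
        proof (rule abs_Av_Av_diff_le[OF FWc FWc K])
          fix q assume q: "0 \<le> q" "q \<le> cl r"
          then have clq: "cl q = q" using cl[of r] by (intro cl) auto
          have "\<bar>F (W x q) - F (W y q)\<bar> \<le> L * \<bar>W x q - W y q\<bar>" by (rule L)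
          also have "W x q - W y q = exp (K * q) * (apply_bcontfun x q - apply_bcontfun y q)"
            by (simp add: W_def clq algebra_simps)
          also have "L * \<bar>\<dots>\<bar> \<le> L * (exp (K * q) * dist x y)"
            using L dist_bounded[of x q y] by (simp add: abs_mult dist_real_def)
          finally show "\<bar>F (W x q) - F (W y q)\<bar> \<le> c * exp (K * q)" by (simp add: c_def mult_ac)
        qed (use L cl in \<open>auto simp: c_def\<close>)
        also have "c * exp (K * cl r) / K = dist x y * exp (K * cl r)" using L by (simp add: c_def K_def)
        finally have 1: "\<bar>cl r * Av (Av (\<lambda>q. F (W x q))) (cl r) - cl r * Av (Av (\<lambda>q. F (W y q))) (cl r)\<bar>
            \<le> dist x y * exp (K * cl r)" .
        have "dist (\<Phi> x r) (\<Phi> y r) = \<bar>G y r - G x r\<bar>" by (simp add: \<Phi> dist_real_def abs_minus_commute)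
        also have "G y r - G x r = exp (- K * cl r) / 4 *
            (cl r * Av (Av (\<lambda>q. F (W x q))) (cl r) - cl r * Av (Av (\<lambda>q. F (W y q))) (cl r))"
          by (simp add: G_def algebra_simps)
        also have "\<bar>\<dots>\<bar> \<le> exp (- K * cl r) / 4 * (dist x y * exp (K * cl r))"
          unfolding abs_mult using 1 by (intro mult_mono) auto
        also have "\<dots> = 1 / 4 * dist x y" by (simp add: exp_minus)
        finally show "dist (\<Phi> x r) (\<Phi> y r) \<le> 1 / 4 * dist x y" .
      qed
    qed
  qed auto
  then obtain y where y: "\<Phi> y = y" by blast
  have "W y r = \<mu> - r / 4 * Av (Av (\<lambda>q. F (W y q))) r" if "r \<in> {0..T}" for r
  proof -
    have "apply_bcontfun y r = G y r" using \<Phi>[of y] y by simp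
    then have "exp (K * r) * apply_bcontfun y r = - (r / 4 * Av (Av (\<lambda>q. F (W y q))) r)"
      using cl(3)[OF that] by (simp add: G_def exp_minus)
    then show ?thesis using cl(3)[OF that] by (simp add: W_def)
  qed
  then show ?thesis unfolding is_sol_def using Wc by blast
qed

text \<open>The weighted difference e is evaluated at its maximum point q0, where the equation gives
  e (q0) \<le> |\<mu> - \<nu>| + e (q0) / 4. This replaces a Gronwall argument.\<close>

lemma sol_dependence:
  fixes F :: "real \<Rightarrow> real"
  assumes w: "is_sol F T \<mu> w" and v: "is_sol F T \<nu> v"
    and Fw: "continuous_on UNIV (\<lambda>q. F (w q))" "continuous_on UNIV (\<lambda>q. F (v q))"
    and L: "0 < L" "\<And>q. q \<in> {0..T} \<Longrightarrow> \<bar>F (w q) - F (v q)\<bar> \<le> L * \<bar>w q - v q\<bar>"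
    and r: "r \<in> {0..T}"
  shows "\<bar>w r - v r\<bar> \<le> 2 * exp (L * T) * \<bar>\<mu> - \<nu>\<bar>"
proof -
  define e where "e q = exp (- L * q) * \<bar>w q - v q\<bar>" for q
  have "continuous_on {0..T} e"
    unfolding e_def using w v unfolding is_sol_def
    by (intro continuous_intros) (auto intro: continuous_on_subset)
  then obtain q0 where q0: "q0 \<in> {0..T}" "\<And>q. q \<in> {0..T} \<Longrightarrow> e q \<le> e q0"
    using continuous_attains_sup[of "{0..T}" e] r by auto
  have d: "\<bar>w q - v q\<bar> \<le> e q0 * exp (L * q)" if "q \<in> {0..T}" for q
    using q0(2)[OF that] by (simp add: e_def exp_minus field_simps)
  have e0: "0 \<le> e q0" by (simp add: e_def)
  have "\<bar>q0 * Av (Av (\<lambda>q. F (v q))) q0 - q0 * Av (Av (\<lambda>q. F (w q))) q0\<bar> \<le> (L * e q0) * exp (L * q0) / L"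
  proof (rule abs_Av_Av_diff_le[OF Fw(2,1) L(1)])
    fix q assume q: "0 \<le> q" "q \<le> q0"
    then have qT: "q \<in> {0..T}" using q0 by auto
    have "\<bar>F (v q) - F (w q)\<bar> \<le> L * \<bar>w q - v q\<bar>" using L(2)[OF qT] by (simp add: abs_minus_commute)
    also have "\<dots> \<le> L * (e q0 * exp (L * q))" using d[OF qT] L by (intro mult_left_mono) auto
    finally show "\<bar>F (v q) - F (w q)\<bar> \<le> (L * e q0) * exp (L * q)" by (simp add: mult_ac)
  qed (use q0 e0 L in auto)
  then have 1: "\<bar>q0 * Av (Av (\<lambda>q. F (v q))) q0 - q0 * Av (Av (\<lambda>q. F (w q))) q0\<bar> \<le> e q0 * exp (L * q0)"
    using L by simp
  define X where "X = q0 * Av (Av (\<lambda>q. F (v q))) q0 - q0 * Av (Av (\<lambda>q. F (w q))) q0"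
  have "w q0 - v q0 = (\<mu> - \<nu>) + X / 4"
  proof -
    have "w q0 = \<mu> - q0 / 4 * Av (Av (\<lambda>q. F (w q))) q0" "v q0 = \<nu> - q0 / 4 * Av (Av (\<lambda>q. F (v q))) q0"
      using w v q0(1) unfolding is_sol_def by blast+
    then show ?thesis unfolding X_def by (simp add: diff_divide_distrib)
  qed
  then have "\<bar>w q0 - v q0\<bar> \<le> \<bar>\<mu> - \<nu>\<bar> + \<bar>X\<bar> / 4" by linarith
  then have "\<bar>w q0 - v q0\<bar> \<le> \<bar>\<mu> - \<nu>\<bar> + 1 / 4 * (e q0 * exp (L * q0))"
    using 1 unfolding X_def by argo
  then have "e q0 \<le> exp (- L * q0) * (\<bar>\<mu> - \<nu>\<bar> + 1 / 4 * (e q0 * exp (L * q0)))"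
    unfolding e_def[of q0] by (intro mult_left_mono) auto
  also have "\<dots> = exp (- L * q0) * \<bar>\<mu> - \<nu>\<bar> + 1 / 4 * e q0" by (simp add: exp_minus distrib_left)
  also have "\<dots> \<le> 1 * \<bar>\<mu> - \<nu>\<bar> + 1 / 4 * e q0" using q0(1) L(1) e0 by (intro add_mono mult_right_mono) auto
  finally have "e q0 \<le> 2 * \<bar>\<mu> - \<nu>\<bar>" using abs_ge_zero[of "\<mu> - \<nu>"] by argo
  then have "\<bar>w r - v r\<bar> \<le> (2 * \<bar>\<mu> - \<nu>\<bar>) * exp (L * T)"
    using d[OF r] r L e0 by (intro order.trans[OF d[OF r]] mult_mono) auto
  then show ?thesis by (simp add: mult_ac)
qed

section \<open>Shooting and the energy as a function of the height\<close>

text \<open>The linear lower bound on f forces every profile down to zero before a radius that does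
  not depend on the height, so one interval serves all heights.\<close>

locale radial_source =
  fixes f :: "real \<Rightarrow> real" and c0 :: real
  assumes f_Lipschitz: "\<And>m. 0 < m \<Longrightarrow> \<exists>L>0. \<forall>x\<in>{0..m}. \<forall>y\<in>{0..m}. \<bar>f x - f y\<bar> \<le> L * \<bar>x - y\<bar>"
    and f_0: "f 0 = 0" and c0: "0 < c0" "\<And>t. 0 \<le> t \<Longrightarrow> c0 * t \<le> f t"
begin

definition "F t = f (max 0 t)"
text \<open>If w were still positive, p would be at least c0 w(1) / 4 from r = 1 on, and w would
  lose at least that number times ln r; ln T = 4 / c0 uses up w(1) exactly.\<close>

definition "T = exp (4 / c0)"

text \<open>Values of \<open>f\<close> above the height are never attained, so a truncation yields the solution.\<close>

definition sol :: "real \<Rightarrow> (real \<Rightarrow> real) \<Rightarrow> bool" where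
  "sol \<mu> w \<longleftrightarrow> is_sol F T \<mu> w \<and> (\<forall>q. w q \<le> \<mu>)"

lemma T: "1 < T" "0 < T" using c0 by (auto simp: T_def)

lemma F_nonneg: "0 \<le> F t"
proof -
  have "0 \<le> c0 * max 0 t" using c0 by simp
  then show ?thesis unfolding F_def using c0(2)[of "max 0 t"] by linarith
qed

lemma F_eq: "0 \<le> t \<Longrightarrow> F t = f t" by (simp add: F_def)

lemma F_Lipschitz:
  assumes "0 < m"
  shows "\<exists>L>0. (\<forall>x y. x \<le> m \<longrightarrow> y \<le> m \<longrightarrow> \<bar>F x - F y\<bar> \<le> L * \<bar>x - y\<bar>) \<and>
    (\<forall>x y. \<bar>F (min m x) - F (min m y)\<bar> \<le> L * \<bar>x - y\<bar>)"
proof -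
  obtain L where L: "0 < L" "\<And>x y. x \<in> {0..m} \<Longrightarrow> y \<in> {0..m} \<Longrightarrow> \<bar>f x - f y\<bar> \<le> L * \<bar>x - y\<bar>"
    using f_Lipschitz[OF assms] by blast
  have 1: "\<bar>F x - F y\<bar> \<le> L * \<bar>x - y\<bar>" if "x \<le> m" "y \<le> m" for x y
  proof -
    have "\<bar>F x - F y\<bar> \<le> L * \<bar>max 0 x - max 0 y\<bar>" unfolding F_def using that assms by (intro L) auto
    also have "\<dots> \<le> L * \<bar>x - y\<bar>" using L by (intro mult_left_mono) auto
    finally show ?thesis .
  qed
  have "\<bar>F (min m x) - F (min m y)\<bar> \<le> L * \<bar>x - y\<bar>" for x y
  proof -
    have "\<bar>F (min m x) - F (min m y)\<bar> \<le> L * \<bar>min m x - min m y\<bar>" by (intro 1) auto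
    also have "\<dots> \<le> L * \<bar>x - y\<bar>" using L by (intro mult_left_mono) auto
    finally show ?thesis .
  qed
  with L(1) 1 show ?thesis by blast
qed

lemma F_cont: "continuous_on UNIV F"
proof -
  have "isCont F x" for x
  proof -
    have "0 < \<bar>x\<bar> + 1" by linarith
    then obtain L where L: "0 < L" "\<And>y z. y \<le> \<bar>x\<bar> + 1 \<Longrightarrow> z \<le> \<bar>x\<bar> + 1 \<Longrightarrow> \<bar>F y - F z\<bar> \<le> L * \<bar>y - z\<bar>"
      using F_Lipschitz by blast
    have "L-lipschitz_on {..<\<bar>x\<bar> + 1} F" using L by (intro lipschitz_onI) (auto simp: dist_real_def)
    then have "continuous_on {..<\<bar>x\<bar> + 1} F" by (rule lipschitz_on_continuous_on)
    moreover have "x < \<bar>x\<bar> + 1" by linarith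
    ultimately show ?thesis by (simp add: continuous_on_eq_continuous_at)
  qed
  then show ?thesis by (simp add: continuous_at_imp_continuous_on)
qed

lemma sol_exists: assumes "0 < \<mu>" shows "\<exists>w. sol \<mu> w"
proof -
  obtain L where L: "0 < L" "\<And>x y. \<bar>F (min \<mu> x) - F (min \<mu> y)\<bar> \<le> L * \<bar>x - y\<bar>"
    using F_Lipschitz[OF assms] by blast
  define F' where "F' x = F (min \<mu> x)" for x
  have "\<bar>F' x\<bar> \<le> L * \<mu>" for x
  proof -
    define z where "z = max 0 (min \<mu> x)"
    have z: "0 \<le> z" "z \<le> \<mu>" using assms by (auto simp: z_def)
    have "\<bar>F (min \<mu> z) - F (min \<mu> 0)\<bar> \<le> L * \<bar>z - 0\<bar>" by (rule L)
    moreover have "L * \<bar>z - 0\<bar> \<le> L * \<mu>" using L(1) z by (intro mult_left_mono) auto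
    moreover have "min \<mu> z = z" "min \<mu> 0 = 0" using z assms by auto
    moreover have "F z = F' x" using z(1) by (simp add: F'_def F_def z_def)
    moreover have "F 0 = 0" by (simp add: F_def f_0)
    ultimately show ?thesis by simp
  qed
  then obtain w where w: "is_sol F' T \<mu> w"
    using sol_exists_bounded[of L F' "L * \<mu>" T \<mu>] L T unfolding F'_def by auto
  \<comment> \<open>Clamping the argument makes the upper bound by the height valid on the whole
    line and not only on [0, T].\<close>
  define v where "v q = w (max 0 (min T q))" for q
  have wc: "continuous_on UNIV w" using w by (simp add: is_sol_def)
  have F'c: "continuous_on UNIV F'" unfolding F'_def
    by (intro continuous_on_compose2[OF F_cont] continuous_intros) auto
  have F'w: "continuous_on UNIV (\<lambda>q. F' (w q))" by (rule continuous_on_compose2[OF F'c wc]) auto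
  have Av_nonneg: "0 \<le> Av g r" if "continuous_on UNIV g" "\<And>q. 0 \<le> g q" for g r
    unfolding Av_def using that
    by (intro integral_nonneg integrable_continuous_real continuous_on_compose2[OF that(1)] continuous_intros) auto
  have le: "w q \<le> \<mu>" if "q \<in> {0..T}" for q
  proof -
    have "0 \<le> Av (Av (\<lambda>q. F' (w q))) q"
      by (intro Av_nonneg continuous_on_Av F'w) (auto simp: F'_def F_nonneg)
    then have "0 \<le> q / 4 * Av (Av (\<lambda>q. F' (w q))) q" using that by (intro mult_nonneg_nonneg) auto
    moreover have "w q = \<mu> - q / 4 * Av (Av (\<lambda>q. F' (w q))) q" using w that unfolding is_sol_def by blast
    ultimately show ?thesis by linarith
  qed
  have Av_cong: "Av g r = Av g' r" if "\<And>q. q \<in> {0..T} \<Longrightarrow> g q = g' q" "r \<in> {0..T}" for g g' r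
    unfolding Av_def
  proof (intro integral_cong that(1))
    fix t :: real assume "t \<in> {0..1}"
    then show "r * t \<in> {0..T}" using that(2) mult_mono[of r T t 1] by auto
  qed
  have "v r = \<mu> - r / 4 * Av (Av (\<lambda>q. F (v q))) r" if r: "r \<in> {0..T}" for r
  proof -
    have "F (v q) = F' (w q)" if "q \<in> {0..T}" for q
      using le[OF that] that by (auto simp: v_def F'_def min_def max_def)
    then have "Av (Av (\<lambda>q. F (v q))) r = Av (Av (\<lambda>q. F' (w q))) r" by (intro Av_cong r)
    moreover have "v r = w r" using r by (simp add: v_def)
    ultimately show ?thesis using w r unfolding is_sol_def by simp
  qed
  moreover have "continuous_on UNIV v" unfolding v_def
    by (intro continuous_on_compose2[OF wc] continuous_intros) auto
  moreover have "v q \<le> \<mu>" for q unfolding v_def using T by (intro le) auto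
  ultimately show ?thesis unfolding sol_def is_sol_def by blast
qed

definition "prof \<mu> = (SOME w. sol \<mu> w)"
text \<open>The positive part makes the integrand vanish beyond the first zero. J is thus an
  integral over an interval independent of the height, and its continuity requires no continuity of
  the zero R.\<close>

definition "J \<mu> = integral {0..T} (\<lambda>q. max 0 (prof \<mu> q) * F (prof \<mu> q)) / 4"

lemma prof: assumes "0 < \<mu>"
  shows "continuous_on UNIV (prof \<mu>)" "prof \<mu> q \<le> \<mu>"
    "r \<in> {0..T} \<Longrightarrow> prof \<mu> r = \<mu> - r / 4 * Av (Av (\<lambda>q. F (prof \<mu> q))) r"
    "is_sol F T \<mu> (prof \<mu>)" "continuous_on UNIV (\<lambda>q. F (prof \<mu> q))"
proof -
  have "sol \<mu> (prof \<mu>)" unfolding prof_def using sol_exists[OF assms] by (rule someI_ex)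
  then show "continuous_on UNIV (prof \<mu>)" "prof \<mu> q \<le> \<mu>" "is_sol F T \<mu> (prof \<mu>)"
    "r \<in> {0..T} \<Longrightarrow> prof \<mu> r = \<mu> - r / 4 * Av (Av (\<lambda>q. F (prof \<mu> q))) r"
    unfolding sol_def is_sol_def by blast+
  then show "continuous_on UNIV (\<lambda>q. F (prof \<mu> q))"
    by (intro continuous_on_compose2[OF F_cont]) auto
qed

lemma prof_dependence:
  assumes "0 < m"
  shows "\<exists>C>0. \<forall>\<mu> \<nu> r. 0 < \<mu> \<longrightarrow> \<mu> \<le> m \<longrightarrow> 0 < \<nu> \<longrightarrow> \<nu> \<le> m \<longrightarrow> r \<in> {0..T} \<longrightarrow>
    \<bar>prof \<mu> r - prof \<nu> r\<bar> \<le> C * \<bar>\<mu> - \<nu>\<bar>"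
proof -
  obtain L where L: "0 < L" "\<And>x y. x \<le> m \<Longrightarrow> y \<le> m \<Longrightarrow> \<bar>F x - F y\<bar> \<le> L * \<bar>x - y\<bar>"
    using F_Lipschitz[OF assms] by blast
  show ?thesis
  proof (intro exI[of _ "2 * exp (L * T)"] conjI allI impI)
    fix \<mu> \<nu> r assume a: "0 < \<mu>" "\<mu> \<le> m" "0 < \<nu>" "\<nu> \<le> m" "r \<in> {0..T}"
    show "\<bar>prof \<mu> r - prof \<nu> r\<bar> \<le> 2 * exp (L * T) * \<bar>\<mu> - \<nu>\<bar>"
      using prof(2)[OF a(1)] prof(2)[OF a(3)] a
      by (intro sol_dependence[OF prof(4)[OF a(1)] prof(4)[OF a(3)] prof(5)[OF a(1)] prof(5)[OF a(3)] L(1)] L(2))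
        (auto intro: order.trans)
  qed simp
qed

text \<open>The profiles depend on the height in a Lipschitz way, uniformly in the radius but only
  for heights below a bound m. This gives joint continuity on each strip, hence continuity of the
  parameter integral there.\<close>

lemma J_cont: "continuous_on {0<..} J"
proof -
  have "continuous_on {0<..<m} J" if m: "0 < m" for m
  proof -
    obtain C where C: "0 < C" "\<And>\<mu> \<nu> r. 0 < \<mu> \<Longrightarrow> \<mu> \<le> m \<Longrightarrow> 0 < \<nu> \<Longrightarrow> \<nu> \<le> m \<Longrightarrow> r \<in> {0..T} \<Longrightarrow>
      \<bar>prof \<mu> r - prof \<nu> r\<bar> \<le> C * \<bar>\<mu> - \<nu>\<bar>" using prof_dependence[OF m] by blast
    have c2: "continuous_on ({0<..<m} \<times> {0..T}) (\<lambda>(\<mu>, q). prof \<mu> q)"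
      unfolding continuous_on_def
    proof (intro ballI)
      fix z assume z: "z \<in> {0<..<m} \<times> {0..T}"
      obtain \<mu> q where zz: "z = (\<mu>, q)" by force
      have \<mu>: "0 < \<mu>" "\<mu> < m" "q \<in> {0..T}" using z zz by auto
      let ?S = "{0<..<m} \<times> {0..T}"
      have "((\<lambda>y. C * \<bar>fst y - \<mu>\<bar>) \<longlongrightarrow> C * \<bar>fst z - \<mu>\<bar>) (at z within ?S)"
        by (intro tendsto_intros)
      then have t0: "((\<lambda>y. C * \<bar>fst y - \<mu>\<bar>) \<longlongrightarrow> 0) (at z within ?S)" by (simp add: zz)
      have 1: "((\<lambda>y. prof (fst y) (snd y) - prof \<mu> (snd y)) \<longlongrightarrow> 0) (at z within ?S)"
      proof (rule Lim_null_comparison[OF _ t0])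
        show "\<forall>\<^sub>F y in at z within ?S. norm (prof (fst y) (snd y) - prof \<mu> (snd y)) \<le> C * \<bar>fst y - \<mu>\<bar>"
          unfolding eventually_at_filter using \<mu> by (intro always_eventually) (auto intro!: C(2))
      qed
      have "isCont (prof \<mu>) q" using prof(1)[OF \<mu>(1)] by (simp add: continuous_on_eq_continuous_at)
      moreover have "(snd \<longlongrightarrow> q) (at z within ?S)" unfolding zz by (rule tendsto_eq_intros) auto
      ultimately have "((\<lambda>y. prof \<mu> (snd y)) \<longlongrightarrow> prof \<mu> q) (at z within ?S)"
        by (rule isCont_tendsto_compose)
      from tendsto_add[OF 1 this] show "((\<lambda>(\<mu>, q). prof \<mu> q) \<longlongrightarrow> (case z of (\<mu>, q) \<Rightarrow> prof \<mu> q)) (at z within ?S)"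
        by (simp add: zz case_prod_unfold)
    qed
    have "continuous_on ({0<..<m} \<times> cbox 0 T) (\<lambda>(\<mu>, q). max 0 (prof \<mu> q) * F (prof \<mu> q))"
      using c2 unfolding case_prod_unfold
      by (auto intro!: continuous_intros continuous_on_compose2[OF F_cont])
    from integral_continuous_on_param[OF this] show ?thesis
      unfolding J_def[abs_def] by (auto intro!: continuous_intros)
  qed
  then have "isCont J \<mu>" if "0 < \<mu>" for \<mu>
    using that by (intro continuous_on_interior[of "{0<..<\<mu> + 1}"]) auto
  then show ?thesis by (simp add: continuous_at_imp_continuous_on)
qed

lemma J_small: "\<exists>a>0. a \<le> \<delta> \<and> J a < 1" if "0 < \<delta>"
proof -
  obtain L where L: "0 < L" "\<And>x y. x \<le> 1 \<Longrightarrow> y \<le> 1 \<Longrightarrow> \<bar>F x - F y\<bar> \<le> L * \<bar>x - y\<bar>"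
    using F_Lipschitz[of 1] zero_less_one by blast
  \<comment> \<open>F vanishes at 0 and is Lipschitz, so the integrand is at most L a^2; the last
    term of the minimum makes a * (L * a) * T at most 1.\<close>
  define a where "a = min (min 1 \<delta>) (1 / (L * T))"
  have a: "0 < a" "a \<le> 1" "a \<le> \<delta>" "a \<le> 1 / (L * T)" using that L T by (auto simp: a_def)
  have "norm (integral {0..T} (\<lambda>q. max 0 (prof a q) * F (prof a q))) \<le> (a * (L * a)) * (T - 0)"
  proof (rule integral_bound)
    show "continuous_on {0..T} (\<lambda>q. max 0 (prof a q) * F (prof a q))"
      using prof(1,5)[OF a(1)] by (intro continuous_intros) (auto intro: continuous_on_subset)
    fix q assume "q \<in> {0..T}"
    have "F (prof a q) = F (max 0 (prof a q))" by (simp add: F_def)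
    also have "\<dots> = \<bar>F (max 0 (prof a q)) - F 0\<bar>" using F_nonneg f_0 by (simp add: F_def)
    also have "\<dots> \<le> L * \<bar>max 0 (prof a q) - 0\<bar>" using prof(2)[OF a(1), of q] a by (intro L) auto
    also have "\<dots> \<le> L * a" using prof(2)[OF a(1), of q] a L by (intro mult_left_mono) auto
    finally show "norm (max 0 (prof a q) * F (prof a q)) \<le> a * (L * a)"
      using prof(2)[OF a(1), of q] a F_nonneg[of "prof a q"] by (simp add: abs_mult) (intro mult_mono, auto)
  qed (use T in auto)
  then have "J a \<le> a * (L * a) * T / 4" unfolding J_def by auto
  also have "\<dots> = a * (a * (L * T)) / 4" by simp
  also have "\<dots> \<le> 1 * 1 / 4"
    using a L T by (intro divide_right_mono mult_mono) (auto simp: field_simps)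
  finally have "J a < 1" by simp
  with a show ?thesis by blast
qed

lemma profile: assumes \<mu>: "0 < \<mu>"
  shows "\<exists>R p j. radial_profile f \<mu> R (prof \<mu>) p j \<and> j R = J \<mu>"
proof -
  define w where "w = prof \<mu>"
  note w = prof[OF \<mu>, folded w_def]
  define p where "p r = integral {0..r} (\<lambda>q. F (w q)) / 4" for r
  define j where "j r = integral {0..r} (\<lambda>q. w q * F (w q)) / 4" for r
  have wF: "continuous_on UNIV (\<lambda>q. w q * F (w q))" by (intro continuous_intros w)
  have pA: "p r = r / 4 * Av (\<lambda>q. F (w q)) r" if "0 \<le> r" for r
    using integral_eq_Av[OF w(5) that] by (simp add: p_def)
  have w_int: "w r = \<mu> - integral {0..r} (Av (\<lambda>q. F (w q))) / 4" if "r \<in> {0..T}" for r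
    using w(3)[OF that] integral_eq_Av[OF continuous_on_Av[OF w(5)], of r] that by simp
  have dw: "(w has_real_derivative (- p r) / r) (at r)" if r: "0 < r" "r < T" for r
  proof -
    have "((\<lambda>r. \<mu> - integral {0..r} (Av (\<lambda>q. F (w q))) / 4) has_real_derivative - Av (\<lambda>q. F (w q)) r / 4) (at r)"
      using integral_has_deriv_at[OF continuous_on_Av[OF w(5)] r(1)]
      by (auto intro!: derivative_eq_intros)
    then have "(w has_real_derivative - Av (\<lambda>q. F (w q)) r / 4) (at r)"
      by (rule has_field_derivative_transform_within_open[where S="{0<..<T}"]) (use r in \<open>auto simp: w_int\<close>)
    moreover have "- p r / r = - Av (\<lambda>q. F (w q)) r / 4" using pA[of r] r by simp
    ultimately show ?thesis by (simp only:)
  qed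
  have dp: "(p has_real_derivative F (w r) / 4) (at r)" if r: "0 < r" for r
    unfolding p_def[abs_def] using integral_has_deriv_at[OF w(5) r] by (rule DERIV_cdivide)
  have dj: "(j has_real_derivative w r * F (w r) / 4) (at r)" if r: "0 < r" for r
    unfolding j_def[abs_def] using integral_has_deriv_at[OF wF r] by (rule DERIV_cdivide)
  have w0: "w 0 = \<mu>" using w(3)[of 0] T by simp
  have p_mono: "p r \<le> p r'" if "0 \<le> r" "r \<le> r'" for r r'
    unfolding p_def using that w(5) F_nonneg
    by (intro divide_right_mono integral_subset_le integrable_continuous_real) (auto intro: continuous_on_subset)
  have p0: "p 0 = 0" by (simp add: p_def)
  have w_anti: "w r' \<le> w r" if "0 \<le> r" "r \<le> r'" "r' \<le> T" for r r'
  proof (rule log_deriv_nonincreasing[where \<Phi>=w])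
    fix q assume q: "r < q" "q < r'"
    then show "\<exists>e\<le>0. (w has_real_derivative e / q) (at q)"
      using that dw[of q] p_mono[of 0 q] p0 by (intro exI[of _ "- p q"]) auto
  qed (use that w(1) in \<open>auto intro: continuous_on_subset\<close>)
  have wT: "w T \<le> 0"
  proof (rule ccontr)
    assume "\<not> w T \<le> 0"
    then have pos: "0 < w r" if "r \<in> {0..T}" for r using w_anti[of r T] that by auto
    \<comment> \<open>A lower bound for the flux at r = 1, and hence for the logarithmic speed of w
      from there on; T satisfies k ln T = w(1).\<close>
    define k where "k = c0 * w 1 / 4"
    have k: "0 < k" using pos[of 1] T c0 by (simp add: k_def)
    have "integral {0..1} (\<lambda>q::real. c0 * w 1) \<le> integral {0..1} (\<lambda>q. F (w q))"
    proof (rule Henstock_Kurzweil_Integration.integral_le)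
      show "(\<lambda>q. F (w q)) integrable_on {0..1}"
        by (intro integrable_continuous_real continuous_on_subset[OF w(5)]) auto
      fix q :: real assume q: "q \<in> {0..1}"
      have "c0 * w 1 \<le> c0 * w q" using w_anti[of q 1] q T c0 by (intro mult_left_mono) auto
      also have "\<dots> \<le> F (w q)" using c0(2)[of "w q"] pos[of q] q T by (simp add: F_eq)
      finally show "c0 * w 1 \<le> F (w q)" .
    qed auto
    then have pk: "k \<le> p 1" by (simp add: p_def k_def)
    have "w T + k * ln T \<le> w 1 + k * ln 1"
    proof (rule log_deriv_nonincreasing[where \<Phi>="\<lambda>r. w r + k * ln r"])
      have "continuous_on {1..T} w" using w(1) by (rule continuous_on_subset) auto
      then show "continuous_on {1..T} (\<lambda>r. w r + k * ln r)" by (intro continuous_intros) auto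
      fix q assume q: "1 < q" "q < T"
      have "((\<lambda>r. w r + k * ln r) has_real_derivative (- p q + k) / q) (at q)"
        using q by (auto intro!: derivative_eq_intros dw simp: add_divide_distrib diff_divide_distrib)
      moreover have "- p q + k \<le> 0" using p_mono[of 1 q] q pk by simp
      ultimately show "\<exists>e\<le>0. ((\<lambda>r. w r + k * ln r) has_real_derivative e / q) (at q)" by blast
    qed (use T in auto)
    moreover have "k * ln T = w 1" using c0 by (simp add: k_def T_def)
    ultimately show False using \<open>\<not> w T \<le> 0\<close> by simp
  qed
  \<comment> \<open>The first zero R is the least element of this compact set. Minimality gives
    strict positivity to its left, and the intermediate value theorem shows that w is exactly 0 at
    R.\<close>
  define S where "S = {0..T} \<inter> w -` {..0}"
  have "closed S" unfolding S_def using continuous_on_subset[OF w(1)]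
    by (intro continuous_closed_preimage) auto
  moreover have "bounded S" unfolding S_def by (rule bounded_subset[of "{0..T}"]) auto
  ultimately have "compact S" by (simp add: compact_eq_bounded_closed)
  moreover have "T \<in> S" using wT T by (auto simp: S_def)
  ultimately obtain R where R: "R \<in> S" "\<And>r. r \<in> S \<Longrightarrow> R \<le> r"
    using compact_attains_inf[of S] by blast
  have RT: "0 \<le> R" "R \<le> T" "w R \<le> 0" using R by (auto simp: S_def)
  have R0: "R \<noteq> 0" using RT w0 \<mu> by auto
  have w_pos: "0 < w r" if "0 \<le> r" "r < R" for r
    using R(2)[of r] that RT by (auto simp: S_def not_le[symmetric])
  have wR: "w R = 0"
  proof -
    have "\<exists>q\<ge>0. q \<le> R \<and> w q = 0"
      using IVT2'[of w R 0 0] RT w0 \<mu> continuous_on_subset[OF w(1), of "{0..R}"] by auto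
    then obtain q where q: "0 \<le> q" "q \<le> R" "w q = 0" by blast
    then have "q \<in> S" using RT by (auto simp: S_def)
    then have "q = R" using R(2)[of q] q by simp
    then show ?thesis using q by simp
  qed
  have prof: "radial_profile f \<mu> R w p j"
  proof
    show "0 < f t" if "0 < t" for t using c0(2)[of t] c0(1) that mult_pos_pos[of c0 t] by linarith
    show "continuous_on {0..R} w" using w(1) by (rule continuous_on_subset) auto
    show "continuous_on {0..R} p" unfolding p_def[abs_def]
      by (intro continuous_intros continuous_on_integral_upto w(5)) auto
    show "continuous_on {0..R} j" unfolding j_def[abs_def]
      by (intro continuous_intros continuous_on_integral_upto wF) auto
    show "p 0 = 0" "j 0 = 0" by (simp_all add: p_def j_def)
    fix r assume r: "0 < r" "r < R"
    have F: "F (w r) = f (w r)" using w_pos[of r] r by (simp add: F_eq)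
    show "(w has_real_derivative - p r / r) (at r)" using dw[of r] r RT by simp
    show "(p has_real_derivative f (w r) / 4) (at r)" using dp[of r] r F by simp
    show "(j has_real_derivative w r * f (w r) / 4) (at r)" using dj[of r] r F by simp
  qed (use R0 RT \<mu> w0 wR w_pos in auto)
  have "integral {0..T} (\<lambda>q. max 0 (w q) * F (w q)) =
      integral {0..R} (\<lambda>q. max 0 (w q) * F (w q)) + integral {R..T} (\<lambda>q. max 0 (w q) * F (w q))"
    using RT continuous_on_subset[OF w(1)] continuous_on_subset[OF w(5)]
    by (intro Henstock_Kurzweil_Integration.integral_combine[symmetric] integrable_continuous_real continuous_intros) auto
  also have "integral {0..R} (\<lambda>q. max 0 (w q) * F (w q)) = integral {0..R} (\<lambda>q. w q * F (w q))"
  proof (rule integral_cong)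
    fix q assume "q \<in> {0..R}"
    then show "max 0 (w q) * F (w q) = w q * F (w q)" using w_pos[of q] wR by (cases "q = R") auto
  qed
  also have "integral {R..T} (\<lambda>q. max 0 (w q) * F (w q)) = integral {R..T} (\<lambda>q. 0)"
  proof (rule integral_cong)
    fix q assume "q \<in> {R..T}"
    then have "w q \<le> 0" using w_anti[of R q] RT wR by auto
    then show "max 0 (w q) * F (w q) = 0" by simp
  qed
  finally have "j R = J \<mu>" by (simp add: j_def J_def w_def)
  with prof show ?thesis unfolding w_def by blast
qed

text \<open>The threshold is the energy at one height \<mu>0 where J exceeds 1. A value strictly
  between 1 and J(\<mu>0) is attained below \<mu>0, since J is below 1 for small heights, and above
  \<mu>0, since J returns to 1; strictness excludes \<mu>0 itself and keeps the two heights
  apart.\<close>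

lemma two_profiles:
  assumes ev: "\<And>\<delta>. 0 < \<delta> \<Longrightarrow> \<forall>\<^sub>F \<mu> in at_top. \<forall>R w p j. radial_profile f \<mu> R w p j \<longrightarrow> 1 < j R \<and> j R < 1 + \<delta>"
  shows "\<exists>I0>1. \<forall>I. 1 < I \<and> I < I0 \<longrightarrow> (\<exists>\<mu> \<nu>. \<mu> \<noteq> \<nu> \<and>
    (\<exists>R w p j. radial_profile f \<mu> R w p j \<and> j R = I) \<and>
    (\<exists>R w p j. radial_profile f \<nu> R w p j \<and> j R = I))"
proof -
  have evJ: "\<forall>\<^sub>F \<mu> in at_top. 1 < J \<mu> \<and> J \<mu> < 1 + \<delta>" if "0 < \<delta>" for \<delta>
    using ev[OF that] eventually_gt_at_top[of 0]
  proof eventually_elim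
    case (elim \<mu>)
    then show ?case using profile[of \<mu>] by metis
  qed
  have "\<forall>\<^sub>F \<mu> in at_top. 1 < J \<mu> \<and> 0 < \<mu>"
    using evJ[of 1] by (intro eventually_conj eventually_gt_at_top) (auto elim: eventually_mono)
  then obtain \<mu>0 where \<mu>0: "1 < J \<mu>0" "0 < \<mu>0" using eventually_happens'[OF trivial_limit_at_top_linorder] by blast
  have "\<exists>\<mu> \<nu>. \<mu> \<noteq> \<nu> \<and> 0 < \<mu> \<and> 0 < \<nu> \<and> J \<mu> = I \<and> J \<nu> = I" if I: "1 < I" "I < J \<mu>0" for I
  proof -
    obtain a where a: "0 < a" "a \<le> \<mu>0" "J a < 1" using J_small[OF \<mu>0(2)] by blast
    have "\<forall>\<^sub>F \<mu> in at_top. J \<mu> < I \<and> \<mu>0 < \<mu>"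
      using evJ[of "I - 1"] I
      by (intro eventually_conj eventually_gt_at_top) (auto elim: eventually_mono)
    then obtain b where b: "J b < I" "\<mu>0 < b" using eventually_happens'[OF trivial_limit_at_top_linorder] by blast
    have "\<exists>x\<ge>a. x \<le> \<mu>0 \<and> J x = I"
      using a I by (intro IVT' continuous_on_subset[OF J_cont]) auto
    then obtain x where x: "a \<le> x" "x \<le> \<mu>0" "J x = I" by blast
    have "\<exists>y\<ge>\<mu>0. y \<le> b \<and> J y = I"
      using b I \<mu>0 by (intro IVT2' continuous_on_subset[OF J_cont]) auto
    then obtain y where y: "\<mu>0 \<le> y" "J y = I" by blast
    have "x \<noteq> y"
    proof
      assume "x = y"
      then have "x = \<mu>0" using x y by simp
      then show False using x I by simp
    qed
    then show ?thesis using x y a \<mu>0 by (intro exI[of _ x] exI[of _ y]) auto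
  qed
  then show ?thesis using \<mu>0(1) profile by metis
qed

end

section \<open>Smooth functions and cut-offs\<close>

abbreviation smooth :: "(real ^ 2 \<Rightarrow> real) \<Rightarrow> bool" where
  "smooth f \<equiv> \<forall>k. C_k k f"

lemma grad_eq: "(f has_derivative f') (at x) \<Longrightarrow> grad f x $ i = f' (axis i 1)"
  using frechet_derivative_at[of f f' x] by (simp add: grad_def)

lemma has_derivative_grad:
  assumes "f differentiable (at x)"
  shows "(f has_derivative (\<lambda>h. grad f x \<bullet> h)) (at x)"
proof -
  let ?D = "frechet_derivative f (at x)"
  have 1: "(f has_derivative ?D) (at x)" using assms by (simp add: frechet_derivative_works)
  have lin: "linear ?D" using 1 by (rule has_derivative_linear)
  have "?D h = grad f x \<bullet> h" for h
  proof -
    have "?D h = ?D (\<Sum>i\<in>UNIV. h $ i *\<^sub>R axis i 1)" by (simp only: basis_expansion flip: scalar_mult_eq_scaleR)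
    also have "\<dots> = (\<Sum>i\<in>UNIV. h $ i * ?D (axis i 1))"
      using lin by (simp add: linear_sum linear_scale)
    also have "\<dots> = grad f x \<bullet> h" by (simp add: grad_def inner_vec_def mult.commute)
    finally show ?thesis .
  qed
  then have "?D = (\<lambda>h. grad f x \<bullet> h)" by (rule ext)
  then show ?thesis using 1 by simp
qed

lemma grad_eqI: "(f has_derivative (\<lambda>h. v \<bullet> h)) (at x) \<Longrightarrow> grad f x = v"
  by (simp add: vec_eq_iff grad_eq inner_axis)

lemma grad_add: "f differentiable (at x) \<Longrightarrow> g differentiable (at x) \<Longrightarrow>
    grad (\<lambda>x. f x + g x) x = grad f x + grad g x"
  by (rule grad_eqI) (auto intro!: derivative_eq_intros has_derivative_grad simp: inner_add_left)

lemma grad_mult: "f differentiable (at x) \<Longrightarrow> g differentiable (at x) \<Longrightarrow>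
    grad (\<lambda>x. f x * g x) x = f x *\<^sub>R grad g x + g x *\<^sub>R grad f x"
  by (rule grad_eqI) (auto intro!: derivative_eq_intros has_derivative_grad simp: inner_add_left mult.commute)

lemma grad_compose: "f differentiable (at x) \<Longrightarrow> (h has_real_derivative d) (at (f x)) \<Longrightarrow>
    grad (\<lambda>x. h (f x)) x = d *\<^sub>R grad f x"
  by (rule grad_eqI, rule has_derivative_eq_rhs[OF DERIV_compose_FDERIV[OF _ has_derivative_grad]])
    (auto simp: mult.commute fun_eq_iff)

lemma C_k_Suc: "C_k (Suc k) f \<Longrightarrow> C_k k f"
proof (induction k arbitrary: f)
  case 0
  then show ?case by (simp add: differentiable_imp_continuous_on)
qed simp

lemma C_k_D: "C_k (Suc k) f \<Longrightarrow> f differentiable (at x)"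
  by (simp add: differentiable_on_def)

lemma C_k_add: "C_k k f \<Longrightarrow> C_k k g \<Longrightarrow> C_k k (\<lambda>x. f x + g x)"
proof (induction k arbitrary: f g)
  case (Suc k)
  have "grad (\<lambda>x. f x + g x) x = grad f x + grad g x" for x
    using Suc.prems by (intro grad_add C_k_D)
  then show ?case using Suc by (simp add: differentiable_on_def)
qed (simp add: continuous_on_add)

lemma C_k_mult: "C_k k f \<Longrightarrow> C_k k g \<Longrightarrow> C_k k (\<lambda>x. f x * g x)"
proof (induction k arbitrary: f g)
  case (Suc k)
  have "grad (\<lambda>x. f x * g x) x = f x *\<^sub>R grad g x + g x *\<^sub>R grad f x" for x
    using Suc.prems by (intro grad_mult C_k_D)
  then show ?case using Suc C_k_Suc[OF Suc.prems(1)] C_k_Suc[OF Suc.prems(2)]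
    by (auto simp: differentiable_on_def intro!: C_k_add)
qed (simp add: continuous_on_mult)

lemma smooth_const: "smooth (\<lambda>x. c)"
proof
  fix k show "C_k k (\<lambda>x. c)"
  proof (induction k arbitrary: c)
    case (Suc k)
    have "grad (\<lambda>x. c) x = 0" for x by (rule grad_eqI) (auto intro!: derivative_eq_intros)
    then show ?case using Suc by simp
  qed simp
qed

lemma smooth_nth: "smooth (\<lambda>x. x $ i)"
proof
  fix k show "C_k k (\<lambda>x. x $ i)"
  proof (cases k)
    case (Suc m)
    have d: "((\<lambda>x. x $ i) has_derivative (\<lambda>h. axis i 1 \<bullet> h)) (at x)" for x :: "real ^ 2"
      by (auto intro!: derivative_eq_intros bounded_linear_imp_has_derivative bounded_linear_vec_nth
          simp: inner_axis inner_commute[of "axis i 1"])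
    then have "grad (\<lambda>x. x $ i) x = axis i 1" for x by (rule grad_eqI)
    then show ?thesis using Suc d smooth_const by (auto simp: differentiable_on_def differentiable_def)
  qed (simp add: continuous_intros)
qed

lemma smooth_add: "smooth f \<Longrightarrow> smooth g \<Longrightarrow> smooth (\<lambda>x. f x + g x)"
  by (simp add: C_k_add)

lemma smooth_mult: "smooth f \<Longrightarrow> smooth g \<Longrightarrow> smooth (\<lambda>x. f x * g x)"
  by (simp add: C_k_mult)

text \<open>H lists the outer function with all its derivatives. Differentiation shifts the index n,
  so the induction on the order k closes for all n at once.\<close>

lemma smooth_compose:
  assumes "smooth f" and H: "\<And>n x. (H n has_real_derivative H (Suc n) x) (at x)"
  shows "smooth (\<lambda>x. H n (f x))"
proof
  fix k show "C_k k (\<lambda>x. H n (f x))"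
  proof (induction k arbitrary: n)
    case 0
    have "continuous_on UNIV (H n)" using H by (auto intro: DERIV_continuous_on)
    moreover have "continuous_on UNIV f" using assms(1)[rule_format, of 0] by simp
    ultimately show ?case by (auto intro: continuous_on_compose2)
  next
    case (Suc k)
    have fd: "f differentiable (at x)" for x using assms(1) C_k_D by blast
    have "grad (\<lambda>x. H n (f x)) x = H (Suc n) (f x) *\<^sub>R grad f x" for x
      using fd H by (rule grad_compose)
    moreover have "(\<lambda>x. H n (f x)) differentiable (at x)" for x
      using DERIV_compose_FDERIV[OF H has_derivative_grad[OF fd]] unfolding differentiable_def by blast
    moreover have "C_k (Suc k) f" using assms(1) ..
    ultimately show ?case using Suc by (auto simp: differentiable_on_def intro!: C_k_mult)
  qed
qed

text \<open>The derivative of P (1 / t) exp (- 1 / t) is (P - P') (1 / t) exp (- 1 / t) / t^2, which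
  is again of this form; the recursion records the new polynomial in 1 / t.\<close>

primrec bump_poly :: "nat \<Rightarrow> real poly" where
  "bump_poly 0 = 1"
| "bump_poly (Suc n) = monom 1 2 * (bump_poly n - pderiv (bump_poly n))"

definition bump_deriv :: "nat \<Rightarrow> real \<Rightarrow> real" where
  "bump_deriv n t = (if t \<le> 0 then 0 else poly (bump_poly n) (1 / t) * exp (- 1 / t))"

abbreviation "bump \<equiv> bump_deriv 0"

lemma bump_def: "bump t = (if t \<le> 0 then 0 else exp (- 1 / t))"
  by (simp add: bump_deriv_def)

lemma poly_exp_at_top: "((\<lambda>s. poly p s * exp (- s)) \<longlongrightarrow> (0::real)) at_top"
proof -
  have "((\<lambda>s. \<Sum>i\<le>degree p. coeff p i * (s ^ i / exp s)) \<longlongrightarrow> (\<Sum>i\<le>degree p. coeff p i * 0)) at_top"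
    by (intro tendsto_intros tendsto_power_div_exp_0)
  moreover have "(\<lambda>s. \<Sum>i\<le>degree p. coeff p i * (s ^ i / exp s)) = (\<lambda>s. poly p s * exp (- s))"
    by (simp add: poly_altdef sum_distrib_right exp_minus divide_inverse mult.assoc)
  ultimately show ?thesis by simp
qed

text \<open>Only t = 0 is critical. There the difference quotient from the right is once more a
  polynomial in 1 / t times exp (- 1 / t), and tends to 0.\<close>

lemma bump_deriv: "(bump_deriv n has_real_derivative bump_deriv (Suc n) t) (at t)"
proof -
  consider "t < 0" | "t = 0" | "0 < t" by linarith
  then show ?thesis
  proof cases
    case 1
    have "((\<lambda>t. 0) has_real_derivative 0) (at t)" by simp
    then have "(bump_deriv n has_real_derivative 0) (at t)"
      by (rule has_field_derivative_transform_within_open[where S="{..<0}"]) (use 1 in \<open>auto simp: bump_deriv_def\<close>)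
    then show ?thesis using 1 by (simp add: bump_deriv_def)
  next
    case 2
    have "((\<lambda>h. bump_deriv n h / h) \<longlongrightarrow> 0) (at_right 0)"
    proof -
      have "((\<lambda>h. poly (monom 1 1 * bump_poly n) (inverse h) * exp (- inverse h)) \<longlongrightarrow> 0) (at_right 0)"
        by (rule filterlim_compose[OF poly_exp_at_top filterlim_inverse_at_top_right])
      then show ?thesis
        by (rule Lim_transform_eventually)
          (auto simp: bump_deriv_def eventually_at_filter poly_monom field_simps)
    qed
    moreover have "((\<lambda>h. bump_deriv n h / h) \<longlongrightarrow> 0) (at_left 0)"
      by (rule Lim_transform_eventually[OF tendsto_const]) (auto simp: bump_deriv_def eventually_at_filter)
    ultimately have "((\<lambda>h. bump_deriv n h / h) \<longlongrightarrow> 0) (at 0)"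
      by (rule filterlim_split_at_real[rotated])
    then show ?thesis using 2 by (simp add: has_field_derivative_iff bump_deriv_def)
  next
    case 3
    have "((\<lambda>t. poly (bump_poly n) (1 / t) * exp (- 1 / t)) has_real_derivative
        poly (bump_poly (Suc n)) (1 / t) * exp (- 1 / t)) (at t)"
      using 3 by (auto intro!: derivative_eq_intros DERIV_chain2[OF poly_DERIV]
          simp: poly_monom field_simps power2_eq_square)
    then have "(bump_deriv n has_real_derivative poly (bump_poly (Suc n)) (1 / t) * exp (- 1 / t)) (at t)"
      by (rule has_field_derivative_transform_within_open[where S="{0<..}"]) (use 3 in \<open>auto simp: bump_deriv_def\<close>)
    then show ?thesis using 3 by (simp add: bump_deriv_def)
  qed
qed

lemma smooth_bump: "smooth f \<Longrightarrow> smooth (\<lambda>x. bump (f x))"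
  by (rule smooth_compose[where H=bump_deriv]) (auto intro: bump_deriv)

lemma bump_bounds: "0 \<le> bump t" "bump t \<le> 1"
  by (auto simp: bump_def)

lemma bump_tendsto:
  assumes "0 < t" shows "(\<lambda>n. bump (real n * t)) \<longlonglongrightarrow> 1"
proof -
  have "(\<lambda>n. exp (- (1 / t) * (1 / real n))) \<longlonglongrightarrow> exp (- (1 / t) * 0)"
    by (intro tendsto_intros lim_1_over_n)
  moreover have "\<forall>\<^sub>F n in sequentially. exp (- (1 / t) * (1 / real n)) = bump (real n * t)"
    by (rule eventually_mono[OF eventually_gt_at_top[of 0]])
      (use assms in \<open>auto simp: bump_def not_le zero_less_mult_iff mult.commute\<close>)
  ultimately show ?thesis using Lim_transform_eventually by fastforce
qed

section \<open>Weak gradients\<close>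

lemma finite_leb_B1: "finite_measure leb_B1"
  using emeasure_lborel_ball_finite[of "0 :: real ^ 2" 1]
  by (intro finite_measureI) (auto simp: emeasure_restrict_space)

interpretation leb_B1: finite_measure leb_B1 by (rule finite_leb_B1)

lemma integrable_bounded:
  fixes f :: "real ^ 2 \<Rightarrow> 'b::euclidean_space"
  assumes "f \<in> borel_measurable leb_B1" "\<And>x. x \<in> B1 \<Longrightarrow> norm (f x) \<le> C"
  shows "integrable leb_B1 f"
  using assms by (intro leb_B1.integrable_const_bound[of _ C]) auto

lemma continuous_measurable: "continuous_on B1 f \<Longrightarrow> f \<in> borel_measurable leb_B1"
  by (intro continuous_imp_measurable_on_sets_lebesgue) auto

lemma L2_bounded:
  assumes "f \<in> borel_measurable leb_B1" "\<And>x. x \<in> B1 \<Longrightarrow> norm (f x) \<le> C"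
  shows "L2 f"
  unfolding L2_def using assms
  by (auto intro!: integrable_bounded[of _ "C\<^sup>2"] power_mono)

lemma L2_integrable: assumes "L2 f" shows "integrable leb_B1 f"
proof (rule Bochner_Integration.integrable_bound[of _ "\<lambda>x. 1 + (norm (f x))\<^sup>2"])
  show "AE x in leb_B1. norm (f x) \<le> norm (1 + (norm (f x))\<^sup>2)"
  proof (rule AE_I2)
    fix x
    have "norm (f x) * 2 \<le> 1 + (norm (f x))\<^sup>2"
      using zero_le_power2[of "norm (f x) - 1"] by (simp add: power2_diff)
    then have "norm (f x) \<le> 1 + (norm (f x))\<^sup>2" using norm_ge_zero[of "f x"] by linarith
    then show "norm (f x) \<le> norm (1 + (norm (f x))\<^sup>2)" by simp
  qed
qed (use assms in \<open>auto simp: L2_def\<close>)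

lemma L2_scale: assumes "L2 f" shows "L2 (\<lambda>x. c *\<^sub>R f x)"
  using assms unfolding L2_def by (auto simp: power_mult_distrib)

lemma L2_add: assumes "L2 f" "L2 g" shows "L2 (\<lambda>x. f x + g x)"
  unfolding L2_def
proof
  show "integrable leb_B1 (\<lambda>x. (norm (f x + g x))\<^sup>2)"
  proof (rule Bochner_Integration.integrable_bound[of _ "\<lambda>x. 2 * (norm (f x))\<^sup>2 + 2 * (norm (g x))\<^sup>2"])
    show "AE x in leb_B1. norm ((norm (f x + g x))\<^sup>2) \<le> norm (2 * (norm (f x))\<^sup>2 + 2 * (norm (g x))\<^sup>2)"
    proof (rule AE_I2)
      fix x
      have "(norm (f x + g x))\<^sup>2 \<le> (norm (f x) + norm (g x))\<^sup>2"
        by (intro power_mono norm_triangle_ineq) auto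
      also have "\<dots> \<le> 2 * (norm (f x))\<^sup>2 + 2 * (norm (g x))\<^sup>2"
        using zero_le_power2[of "norm (f x) - norm (g x)"] by (simp add: power2_diff power2_sum)
      finally show "norm ((norm (f x + g x))\<^sup>2) \<le> norm (2 * (norm (f x))\<^sup>2 + 2 * (norm (g x))\<^sup>2)" by simp
    qed
  qed (use assms in \<open>auto simp: L2_def\<close>)
qed (use assms in \<open>auto simp: L2_def\<close>)

lemma L2_inner: assumes "L2 f" "L2 g" shows "integrable leb_B1 (\<lambda>x. f x \<bullet> g x)"
proof (rule Bochner_Integration.integrable_bound[of _ "\<lambda>x. (norm (f x))\<^sup>2 + (norm (g x))\<^sup>2"])
  show "AE x in leb_B1. norm (f x \<bullet> g x) \<le> norm ((norm (f x))\<^sup>2 + (norm (g x))\<^sup>2)"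
  proof (rule AE_I2)
    fix x
    have "\<bar>f x \<bullet> g x\<bar> \<le> norm (f x) * norm (g x)" by (rule Cauchy_Schwarz_ineq2)
    also have "\<dots> \<le> (norm (f x))\<^sup>2 + (norm (g x))\<^sup>2"
    proof -
      have "0 \<le> (norm (f x) - norm (g x))\<^sup>2" "0 \<le> norm (f x) * norm (g x)" by auto
      then show ?thesis unfolding power2_diff by linarith
    qed
    finally show "norm (f x \<bullet> g x) \<le> norm ((norm (f x))\<^sup>2 + (norm (g x))\<^sup>2)" by simp
  qed
qed (use assms in \<open>auto simp: L2_def\<close>)

lemma L2_mult_real: "L2 f \<Longrightarrow> L2 g \<Longrightarrow> integrable leb_B1 (\<lambda>x. f x * g x :: real)"
  using L2_inner[of f g] by simp

lemma bounded_mult_integrable: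
  fixes G :: "real ^ 2 \<Rightarrow> 'b::euclidean_space"
  assumes "\<phi> \<in> borel_measurable leb_B1" "\<And>x. x \<in> B1 \<Longrightarrow> \<bar>\<phi> x\<bar> \<le> C" "integrable leb_B1 G"
  shows "integrable leb_B1 (\<lambda>x. \<phi> x *\<^sub>R G x)"
proof (rule Bochner_Integration.integrable_bound[of _ "\<lambda>x. C *\<^sub>R G x"])
  show "AE x in leb_B1. norm (\<phi> x *\<^sub>R G x) \<le> norm (C *\<^sub>R G x)"
    using assms(2) by (intro AE_I2) (force intro!: mult_right_mono)
qed (use assms in auto)

lemma LINT_leb_B1_lborel:
  fixes f :: "real ^ 2 \<Rightarrow> real"
  assumes "f \<in> borel_measurable borel" "\<And>x. x \<notin> B1 \<Longrightarrow> f x = 0"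
  shows "(LINT x|leb_B1. f x) = (LINT x|lborel. f x)" "integrable leb_B1 f \<longleftrightarrow> integrable lborel f"
proof -
  have eq: "(\<lambda>x. indicator B1 x *\<^sub>R f x) = f"
  proof
    fix x show "indicator B1 x *\<^sub>R f x = f x" using assms(2)[of x] by (cases "x \<in> B1") auto
  qed
  have "(LINT x|leb_B1. f x) = (LINT x|lebesgue. indicator B1 x *\<^sub>R f x)"
    by (rule integral_restrict_space) simp
  then show "(LINT x|leb_B1. f x) = (LINT x|lborel. f x)"
    unfolding eq using assms(1) by (simp add: integral_completion)
  have "integrable leb_B1 f \<longleftrightarrow> integrable lebesgue (\<lambda>x. indicator B1 x *\<^sub>R f x)"
    by (rule integrable_restrict_space) simp
  then show "integrable leb_B1 f \<longleftrightarrow> integrable lborel f"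
    unfolding eq using assms(1) by (simp add: integrable_completion)
qed

lemma lborel_integral_translate:
  fixes f :: "'a::euclidean_space \<Rightarrow> real"
  assumes "f \<in> borel_measurable borel"
  shows "(LINT x|lborel. f (c + x)) = (LINT x|lborel. f x)"
proof -
  have "(LINT x|lborel. f x) = (LINT x|distr lborel borel ((+) c). f x)" by (simp add: lborel_distr_plus)
  also have "\<dots> = (LINT x|lborel. f (c + x))" using assms by (intro integral_distr) auto
  finally show ?thesis by simp
qed

lemma grad_Lipschitz:
  assumes "\<And>x. \<psi> differentiable (at x)" "\<And>x. norm (grad \<psi> x) \<le> C"
  shows "\<bar>\<psi> x - \<psi> y\<bar> \<le> C * norm (x - y)"
proof -
  have "norm (\<psi> x - \<psi> y) \<le> C * norm (x - y)"
  proof (rule differentiable_bound[of UNIV \<psi> "\<lambda>x h. grad \<psi> x \<bullet> h"])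
    fix z
    show "(\<psi> has_derivative (\<lambda>h. grad \<psi> z \<bullet> h)) (at z within UNIV)"
      using has_derivative_grad[OF assms(1)] by simp
    show "onorm (\<lambda>h. grad \<psi> z \<bullet> h) \<le> C"
    proof (rule onorm_le)
      fix h
      have "norm (grad \<psi> z \<bullet> h) \<le> norm (grad \<psi> z) * norm h" by (rule Cauchy_Schwarz_ineq2[folded real_norm_def])
      also have "\<dots> \<le> C * norm h" using assms(2) by (intro mult_right_mono) auto
      finally show "norm (grad \<psi> z \<bullet> h) \<le> C * norm h" .
    qed
  qed auto
  then show ?thesis by simp
qed

text \<open>Translation invariance makes the integral of every difference quotient vanish.\<close>

lemma integral_grad_zero:
  fixes \<psi> :: "real ^ 2 \<Rightarrow> real"
  assumes d: "\<And>x. \<psi> differentiable (at x)" and supp: "\<And>x. x \<notin> B1 \<Longrightarrow> \<psi> x = 0"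
    and supp': "\<And>x. x \<notin> B1 \<Longrightarrow> grad \<psi> x = 0"
    and bd: "\<And>x. norm (grad \<psi> x) \<le> C"
  shows "integrable leb_B1 (\<lambda>x. grad \<psi> x $ i)" "(LINT x|leb_B1. grad \<psi> x $ i) = 0"
proof -
  define e :: "real ^ 2" where "e = axis i 1"
  have ne: "norm e = 1" by (simp add: e_def)
  define t where "t n = inverse (real (Suc n))" for n
  have t: "0 < t n" "t n \<le> 1" for n by (auto simp: t_def field_simps)
  define D where "D n x = (\<psi> (t n *\<^sub>R e + x) - \<psi> x) / t n" for n x
  have "continuous_on UNIV \<psi>"
    using d by (intro differentiable_imp_continuous_on) (simp add: differentiable_on_def)
  then have m: "\<psi> \<in> borel_measurable borel" by (rule borel_measurable_continuous_onI)
  have C: "0 \<le> C" using bd[of 0] norm_ge_zero by (rule order.trans[rotated])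
  have lim: "(\<lambda>n. D n x) \<longlonglongrightarrow> grad \<psi> x $ i" for x
  proof -
    have "((\<lambda>s. x + s *\<^sub>R e) has_derivative (\<lambda>s. s *\<^sub>R e)) (at 0)"
      by (auto intro!: derivative_eq_intros)
    moreover have "(\<psi> has_derivative (\<lambda>h. grad \<psi> x \<bullet> h)) (at (x + 0 *\<^sub>R e))"
      using has_derivative_grad[OF d] by simp
    ultimately have "((\<lambda>s. \<psi> (x + s *\<^sub>R e)) has_derivative (\<lambda>s. grad \<psi> x \<bullet> (s *\<^sub>R e))) (at 0)"
      by (rule has_derivative_compose)
    moreover have "(\<lambda>s. grad \<psi> x \<bullet> (s *\<^sub>R e)) = (*) (grad \<psi> x $ i)"
      by (auto simp: fun_eq_iff e_def inner_axis)
    ultimately have "((\<lambda>s. \<psi> (x + s *\<^sub>R e)) has_real_derivative grad \<psi> x $ i) (at 0)"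
      by (simp only: has_field_derivative_def)
    then have "((\<lambda>s. (\<psi> (x + s *\<^sub>R e) - \<psi> x) / s) \<longlongrightarrow> grad \<psi> x $ i) (at 0)"
      by (simp add: DERIV_def)
    moreover have "filterlim t (at 0) sequentially"
      using LIMSEQ_inverse_real_of_nat t by (intro filterlim_atI) (auto simp: t_def[abs_def])
    ultimately have "(\<lambda>n. (\<psi> (x + t n *\<^sub>R e) - \<psi> x) / t n) \<longlonglongrightarrow> grad \<psi> x $ i"
      by (rule filterlim_compose)
    then show ?thesis by (simp add: D_def add.commute)
  qed
  have Dm: "D n \<in> borel_measurable borel" for n
    unfolding D_def by (intro borel_measurable_divide borel_measurable_diff m
        measurable_compose[OF _ m]) auto
  have gm: "(\<lambda>x. grad \<psi> x $ i) \<in> borel_measurable borel"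
    by (rule borel_measurable_LIMSEQ_real[OF lim]) (use Dm in auto)
  \<comment> \<open>Steps of length at most 1 keep the difference quotients inside the ball of
    radius 2; its indicator, scaled by the Lipschitz constant, is the dominating function.\<close>
  have bound: "norm (D n x) \<le> C * indicator (ball 0 2) x" for n x
  proof (cases "x \<in> ball 0 2")
    case True
    have "\<bar>\<psi> (t n *\<^sub>R e + x) - \<psi> x\<bar> \<le> C * norm (t n *\<^sub>R e + x - x)" by (rule grad_Lipschitz[OF d bd])
    then show ?thesis using True t[of n] ne by (simp add: D_def field_simps)
  next
    case False
    have "norm x \<le> norm (t n *\<^sub>R e + x) + norm (t n *\<^sub>R e)"
      using norm_triangle_ineq4[of "t n *\<^sub>R e + x" "t n *\<^sub>R e"] by simp
    then have "x \<notin> B1" "t n *\<^sub>R e + x \<notin> B1" using False t[of n] ne by auto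
    then show ?thesis using C by (simp add: D_def supp)
  qed
  have wi: "integrable lborel (\<lambda>x::real ^ 2. C * indicator (ball 0 2) x)"
    using emeasure_lborel_ball_finite[of "0 :: real ^ 2" 2]
    by (intro integrable_mult_right integrable_real_indicator) auto
  have psi_i: "integrable lborel \<psi>"
  proof -
    have "\<bar>\<psi> x\<bar> \<le> C * 2" for x
    proof (cases "x \<in> B1")
      case True
      have "\<bar>\<psi> x - \<psi> (axis i 1)\<bar> \<le> C * norm (x - axis i 1)" by (rule grad_Lipschitz[OF d bd])
      also have "\<dots> \<le> C * 2"
        using True C norm_triangle_ineq4[of x "axis i 1"] by (intro mult_left_mono) auto
      finally show ?thesis by (simp add: supp)
    qed (use C in \<open>simp add: supp\<close>)
    then have "integrable leb_B1 \<psi>"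
      using \<open>continuous_on UNIV \<psi>\<close>
      by (intro integrable_bounded[of _ "C * 2"] continuous_measurable) (auto intro: continuous_on_subset)
    then show ?thesis using LINT_leb_B1_lborel(2)[OF m] supp by simp
  qed
  have psi_t: "integrable lborel (\<lambda>x. \<psi> (t n *\<^sub>R e + x))" for n
  proof -
    have "integrable (distr lborel borel ((+) (t n *\<^sub>R e))) \<psi>" using psi_i by (simp add: lborel_distr_plus)
    then show ?thesis using m by (subst (asm) integrable_distr_eq) auto
  qed
  have D0: "(LINT x|lborel. D n x) = 0" for n
    unfolding D_def integral_divide_zero Bochner_Integration.integral_diff[OF psi_t psi_i]
      lborel_integral_translate[OF m] by simp
  have "(\<lambda>n. LINT x|lborel. D n x) \<longlonglongrightarrow> (LINT x|lborel. grad \<psi> x $ i)"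
    using lim bound gm Dm by (intro integral_dominated_convergence[OF _ _ wi]) auto
  then have "(LINT x|lborel. grad \<psi> x $ i) = 0" unfolding D0 by (simp add: LIMSEQ_const_iff)
  moreover have "integrable lborel (\<lambda>x. grad \<psi> x $ i)"
    using lim bound gm Dm by (intro integrable_dominated_convergence[where s=D, OF _ _ wi]) auto
  ultimately show "integrable leb_B1 (\<lambda>x. grad \<psi> x $ i)" "(LINT x|leb_B1. grad \<psi> x $ i) = 0"
    using LINT_leb_B1_lborel[OF gm] by (simp_all add: supp')
qed

lemma vanish_off_closure:
  assumes "x \<notin> closure {x. f x \<noteq> 0}"
  shows "(f has_derivative (\<lambda>h. 0)) (at x)" "grad f x = 0" "f x = 0"
proof -
  let ?S = "- closure {x. f x \<noteq> 0}"
  have z: "0 = f y" if "y \<in> ?S" for y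
    using subsetD[OF closure_subset, of y "{x. f x \<noteq> 0}"] that by (cases "f y = 0") simp_all
  show "f x = 0" using z[of x] assms by simp
  have "open ?S" by (rule open_Compl) (rule closed_closure)
  moreover have "x \<in> ?S" using assms by blast
  ultimately show d: "(f has_derivative (\<lambda>h. 0)) (at x)"
    by (rule has_derivative_transform_within_open[OF has_derivative_const[of 0 "at x"] _ _ z])
  then show "grad f x = 0" using grad_eqI[of f 0 x] by simp
qed

lemmas test_fun_vanish = vanish_off_closure(3,2)

lemma test_fun_supp: "test_fun \<phi> \<Longrightarrow> closure {x. \<phi> x \<noteq> 0} \<subseteq> B1"
  unfolding test_fun_def by blast

lemma test_fun_smooth: "test_fun \<phi> \<Longrightarrow> C_k k \<phi>"
  unfolding test_fun_def by blast

lemma test_fun_outside: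
  assumes "test_fun \<phi>" "x \<notin> B1" shows "\<phi> x = 0" "grad \<phi> x = 0"
  using test_fun_vanish[of x \<phi>] test_fun_supp[OF assms(1)] assms(2) by blast+

lemma test_fun_differentiable: "test_fun \<phi> \<Longrightarrow> \<phi> differentiable (at x)"
  using C_k_D[OF test_fun_smooth] .

lemma test_fun_cont:
  assumes "test_fun \<phi>"
  shows "continuous_on UNIV \<phi>" "continuous_on UNIV (\<lambda>x. grad \<phi> x $ i)" "continuous_on UNIV (grad \<phi>)"
proof -
  have "C_k 0 \<phi>" "C_k (Suc 0) \<phi>" by (rule test_fun_smooth[OF assms])+
  then show "continuous_on UNIV \<phi>" "continuous_on UNIV (\<lambda>x. grad \<phi> x $ i)" by auto
  have "C_k (Suc 0) \<phi>" using assms by (rule test_fun_smooth)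
  then have "continuous_on UNIV (\<lambda>x. \<chi> i. grad \<phi> x $ i)" by (intro continuous_on_vec_lambda) auto
  then show "continuous_on UNIV (grad \<phi>)" by (simp add: vec_nth_inverse)
qed

lemma test_fun_bounded:
  assumes "test_fun \<phi>"
  shows "\<exists>C>0. \<forall>x. \<bar>\<phi> x\<bar> \<le> C \<and> norm (grad \<phi> x) \<le> C"
proof -
  let ?K = "closure {x. \<phi> x \<noteq> 0}"
  have K: "compact ?K" using assms unfolding test_fun_def by blast
  have "bounded (\<phi> ` ?K)" "bounded (grad \<phi> ` ?K)"
    using test_fun_cont(1,3)[OF assms] K
    by (auto intro!: compact_imp_bounded compact_continuous_image intro: continuous_on_subset)
  then obtain a b where ab: "0 < a" "\<And>x. x \<in> ?K \<Longrightarrow> norm (\<phi> x) \<le> a" "0 < b" "\<And>x. x \<in> ?K \<Longrightarrow> norm (grad \<phi> x) \<le> b"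
    unfolding bounded_pos by blast
  have "\<bar>\<phi> x\<bar> \<le> a + b \<and> norm (grad \<phi> x) \<le> a + b" for x
  proof (cases "x \<in> ?K")
    case True
    then show ?thesis using ab(1,3) ab(2)[OF True] ab(4)[OF True] by auto
  next
    case False
    then show ?thesis using test_fun_vanish[OF False] ab by simp
  qed
  then show ?thesis using ab by (intro exI[of _ "a + b"]) auto
qed

text \<open>u needs regularity only inside the disk: the product of u and \<phi> vanishes off the
  compact support of \<phi>, so it is differentiable on the whole plane and its gradient has
  integral zero.\<close>

lemma integral_by_parts:
  assumes \<phi>: "test_fun \<phi>"
    and u: "\<And>x. x \<in> B1 \<Longrightarrow> u differentiable (at x)" "\<And>x. x \<in> B1 \<Longrightarrow> \<bar>u x\<bar> \<le> C" "\<And>x. x \<in> B1 \<Longrightarrow> norm (grad u x) \<le> C"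
  shows "(LINT x|leb_B1. u x * grad \<phi> x $ i) = - (LINT x|leb_B1. \<phi> x * grad u x $ i)"
    "integrable leb_B1 (\<lambda>x. u x * grad \<phi> x $ i)" "integrable leb_B1 (\<lambda>x. \<phi> x * grad u x $ i)"
proof -
  obtain B where B: "0 < B" "\<And>x. \<bar>\<phi> x\<bar> \<le> B" "\<And>x. norm (grad \<phi> x) \<le> B" using test_fun_bounded[OF \<phi>] by blast
  define \<psi> where "\<psi> x = u x * \<phi> x" for x
  let ?K = "closure {x. \<phi> x \<noteq> 0}"
  have K: "?K \<subseteq> B1" using \<phi> by (rule test_fun_supp)
  have in_B1: "\<psi> differentiable (at x) \<and> grad \<psi> x = u x *\<^sub>R grad \<phi> x + \<phi> x *\<^sub>R grad u x" if "x \<in> B1" for x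
    unfolding \<psi>_def using u(1)[OF that] test_fun_differentiable[OF \<phi>] by (simp add: grad_mult)
  have sub: "closure {x. \<psi> x \<noteq> 0} \<subseteq> ?K" by (rule closure_mono) (auto simp: \<psi>_def)
  have out: "\<psi> differentiable (at x) \<and> grad \<psi> x = 0" if "x \<notin> ?K" for x
    using vanish_off_closure[of x \<psi>] sub that unfolding differentiable_def by blast
  have d: "\<psi> differentiable (at x)" for x using in_B1 out K by blast
  have C: "0 \<le> C" using u(2)[of 0] by simp
  have bd: "norm (grad \<psi> x) \<le> C * B + B * C" for x
  proof (cases "x \<in> B1")
    case True
    have "norm (grad \<psi> x) \<le> \<bar>u x\<bar> * norm (grad \<phi> x) + \<bar>\<phi> x\<bar> * norm (grad u x)"
      using in_B1[OF True] norm_triangle_ineq[of "u x *\<^sub>R grad \<phi> x" "\<phi> x *\<^sub>R grad u x"] by simp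
    also have "\<dots> \<le> C * B + B * C" using u(2,3)[OF True] B C by (intro add_mono mult_mono) auto
    finally show ?thesis .
  next
    case False
    then have "grad \<psi> x = 0" using out[of x] K by blast
    then show ?thesis using B C by simp
  qed
  note I = integral_grad_zero[of \<psi>, OF d _ _ bd, of i]
  have supp: "\<psi> x = 0" "grad \<psi> x = 0" if "x \<notin> B1" for x
  proof -
    show "\<psi> x = 0" using test_fun_outside(1)[OF \<phi> that] by (simp add: \<psi>_def)
    show "grad \<psi> x = 0" using that K out[of x] by blast
  qed
  have uc: "continuous_on B1 u"
    using u(1) by (auto intro!: continuous_at_imp_continuous_on differentiable_imp_continuous_within)
  show i1: "integrable leb_B1 (\<lambda>x. u x * grad \<phi> x $ i)"
  proof (rule integrable_bounded[of _ "C * B"])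
    show "(\<lambda>x. u x * grad \<phi> x $ i) \<in> borel_measurable leb_B1"
      by (intro continuous_measurable continuous_intros uc continuous_on_subset[OF test_fun_cont(2)[OF \<phi>]]) auto
    fix x assume "x \<in> B1"
    then show "norm (u x * grad \<phi> x $ i) \<le> C * B"
      using u(2) C B(3)[of x] component_le_norm_cart[of "grad \<phi> x" i] unfolding real_norm_def abs_mult by (intro mult_mono) auto
  qed
  have eq: "grad \<psi> x $ i = u x * grad \<phi> x $ i + \<phi> x * grad u x $ i" if "x \<in> space leb_B1" for x
    using in_B1[of x] that by simp
  have "integrable leb_B1 (\<lambda>x. grad \<psi> x $ i)" using I supp by blast
  then have "integrable leb_B1 (\<lambda>x. grad \<psi> x $ i - u x * grad \<phi> x $ i)" using i1 by (rule Bochner_Integration.integrable_diff)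
  then show i2: "integrable leb_B1 (\<lambda>x. \<phi> x * grad u x $ i)"
    by (rule Bochner_Integration.integrable_cong[THEN iffD1, rotated 2]) (auto simp: eq)
  have "(LINT x|leb_B1. grad \<psi> x $ i) = (LINT x|leb_B1. u x * grad \<phi> x $ i + \<phi> x * grad u x $ i)"
    by (rule Bochner_Integration.integral_cong) (auto simp: eq)
  also have "\<dots> = (LINT x|leb_B1. u x * grad \<phi> x $ i) + (LINT x|leb_B1. \<phi> x * grad u x $ i)"
    using i1 i2 by simp
  finally show "(LINT x|leb_B1. u x * grad \<phi> x $ i) = - (LINT x|leb_B1. \<phi> x * grad u x $ i)"
    using I(2) supp by simp
qed

lemma integral_vec_nth:
  fixes f :: "real ^ 2 \<Rightarrow> real ^ 2"
  assumes "integrable N f" shows "(LINT x|N. f x) $ i = (LINT x|N. f x $ i)"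
  using integral_bounded_linear[OF bounded_linear_vec_nth assms, of i] by simp

lemma classical_weak_grad:
  assumes u: "\<And>x. x \<in> B1 \<Longrightarrow> u differentiable (at x)" "\<And>x. x \<in> B1 \<Longrightarrow> \<bar>u x\<bar> \<le> C" "\<And>x. x \<in> B1 \<Longrightarrow> norm (grad u x) \<le> C"
    and c: "continuous_on B1 (grad u)"
  shows "is_weak_grad u (grad u)"
  unfolding is_weak_grad_def
proof (intro conjI allI impI)
  have uc: "continuous_on B1 u"
    using u(1) by (auto intro!: continuous_at_imp_continuous_on differentiable_imp_continuous_within)
  show "L2 u" using u(2) by (intro L2_bounded[of _ C] continuous_measurable uc) auto
  show L2g: "L2 (grad u)" using u(3) by (intro L2_bounded[of _ C] continuous_measurable c) auto
  fix \<phi> assume \<phi>: "test_fun \<phi>"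
  obtain B where B: "0 < B" "\<And>x. \<bar>\<phi> x\<bar> \<le> B" "\<And>x. norm (grad \<phi> x) \<le> B" using test_fun_bounded[OF \<phi>] by blast
  have i1: "integrable leb_B1 (\<lambda>x. \<phi> x *\<^sub>R grad u x)"
    using B L2_integrable[OF L2g] test_fun_cont(1)[OF \<phi>]
    by (intro bounded_mult_integrable[of _ B] continuous_measurable) (auto intro: continuous_on_subset)
  have i2: "integrable leb_B1 (\<lambda>x. u x *\<^sub>R grad \<phi> x)"
    using u(2) uc test_fun_cont(3)[OF \<phi>] B
    by (intro bounded_mult_integrable[of _ C] integrable_bounded[of _ B] continuous_measurable) (auto intro: continuous_on_subset)
  show "(LINT x|leb_B1. u x *\<^sub>R grad \<phi> x) = - (LINT x|leb_B1. \<phi> x *\<^sub>R grad u x)"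
    unfolding vec_eq_iff using integral_by_parts(1)[OF \<phi> u]
    by (simp add: integral_vec_nth i1 i2)
qed

lemma test_fun_weak_grad: assumes "test_fun \<phi>" shows "is_weak_grad \<phi> (grad \<phi>)"
proof -
  obtain B where B: "0 < B" "\<And>x. \<bar>\<phi> x\<bar> \<le> B" "\<And>x. norm (grad \<phi> x) \<le> B" using test_fun_bounded[OF assms] by blast
  show ?thesis
    using B test_fun_differentiable[OF assms] test_fun_cont(3)[OF assms]
    by (intro classical_weak_grad[of _ B]) (auto intro: continuous_on_subset)
qed

lemma integral_lincomb:
  fixes p q :: "'a \<Rightarrow> 'b::euclidean_space"
  assumes "integrable N p" "integrable N q"
  shows "(LINT x|N. a *\<^sub>R p x + b *\<^sub>R q x) = a *\<^sub>R (LINT x|N. p x) + b *\<^sub>R (LINT x|N. q x)"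
  using assms by (subst Bochner_Integration.integral_add) auto

lemma weak_grad_lincomb:
  assumes "is_weak_grad u G" "is_weak_grad v H"
  shows "is_weak_grad (\<lambda>x. a * u x + b * v x) (\<lambda>x. a *\<^sub>R G x + b *\<^sub>R H x)"
  unfolding is_weak_grad_def
proof (intro conjI allI impI)
  have L: "L2 u" "L2 v" "L2 G" "L2 H" using assms by (auto simp: is_weak_grad_def)
  show "L2 (\<lambda>x. a * u x + b * v x)" using L2_add[OF L2_scale[OF L(1)] L2_scale[OF L(2)], of a b] by simp
  show "L2 (\<lambda>x. a *\<^sub>R G x + b *\<^sub>R H x)" by (intro L2_add L2_scale L)
  fix \<phi> assume \<phi>: "test_fun \<phi>"
  obtain B where B: "0 < B" "\<And>x. \<bar>\<phi> x\<bar> \<le> B" "\<And>x. norm (grad \<phi> x) \<le> B" using test_fun_bounded[OF \<phi>] by blast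
  have m: "\<phi> \<in> borel_measurable leb_B1" "grad \<phi> \<in> borel_measurable leb_B1"
    using test_fun_cont(1,3)[OF \<phi>] by (auto intro!: continuous_measurable intro: continuous_on_subset)
  have iG: "integrable leb_B1 (\<lambda>x. \<phi> x *\<^sub>R K x)" if "L2 K" for K :: "real ^ 2 \<Rightarrow> real ^ 2"
    using m B L2_integrable[OF that] by (intro bounded_mult_integrable[of _ B]) auto
  have iu: "integrable leb_B1 (\<lambda>x. k x *\<^sub>R grad \<phi> x)" if "L2 k" for k
  proof (rule Bochner_Integration.integrable_bound[of _ "\<lambda>x. B *\<^sub>R k x"])
    show "AE x in leb_B1. norm (k x *\<^sub>R grad \<phi> x) \<le> norm (B *\<^sub>R k x)"
      using B(1) mult_left_mono[OF B(3) abs_ge_zero] by (intro AE_I2) (simp add: abs_mult mult.commute)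
  qed (use that m L2_integrable[OF that] in \<open>auto simp: L2_def\<close>)
  have eqs: "(\<lambda>x. (a * u x + b * v x) *\<^sub>R grad \<phi> x) = (\<lambda>x. a *\<^sub>R (u x *\<^sub>R grad \<phi> x) + b *\<^sub>R (v x *\<^sub>R grad \<phi> x))"
    "(\<lambda>x. \<phi> x *\<^sub>R (a *\<^sub>R G x + b *\<^sub>R H x)) = (\<lambda>x. a *\<^sub>R (\<phi> x *\<^sub>R G x) + b *\<^sub>R (\<phi> x *\<^sub>R H x))"
    by (auto simp: algebra_simps)
  have w: "(LINT x|leb_B1. u x *\<^sub>R grad \<phi> x) = - (LINT x|leb_B1. \<phi> x *\<^sub>R G x)"
    "(LINT x|leb_B1. v x *\<^sub>R grad \<phi> x) = - (LINT x|leb_B1. \<phi> x *\<^sub>R H x)"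
    using assms \<phi> by (auto simp: is_weak_grad_def)
  show "(LINT x|leb_B1. (a * u x + b * v x) *\<^sub>R grad \<phi> x) = - (LINT x|leb_B1. \<phi> x *\<^sub>R (a *\<^sub>R G x + b *\<^sub>R H x))"
    unfolding eqs integral_lincomb[OF iG[OF L(3)] iG[OF L(4)]] integral_lincomb[OF iu[OF L(1)] iu[OF L(2)]] w
    by simp
qed

section \<open>Cut-offs and uniqueness of the weak gradient\<close>

lemma test_funI:
  assumes "smooth \<phi>" "0 < \<delta>" "\<And>x. \<phi> x \<noteq> 0 \<Longrightarrow> norm x \<le> 1 - \<delta>"
  shows "test_fun \<phi>"
proof -
  have "closure {x. \<phi> x \<noteq> 0} \<subseteq> cball 0 (1 - \<delta>)"
    using assms(3) by (intro closure_minimal) auto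
  moreover have "cball 0 (1 - \<delta>) \<subseteq> B1" using assms(2) by auto
  moreover have "compact (closure {x. \<phi> x \<noteq> 0})"
    using assms(3) by (intro compact_closure[THEN iffD2] bounded_subset[OF bounded_cball[of 0 "1 - \<delta>"]]) auto
  ultimately show ?thesis using assms(1) unfolding test_fun_def by blast
qed

text \<open>The squared norm is a polynomial, so no smoothness is lost at the origin. The support
  lies in |x|^2 \<le> 1 - 1 / n, and the values tend to 1 inside the disk since \<open>bump\<close>
  tends to 1 at infinity.\<close>

definition cutoff :: "nat \<Rightarrow> real ^ 2 \<Rightarrow> real" where
  "cutoff n x = bump (real n * (1 - (norm x)\<^sup>2) - 1)"

lemma smooth_affine: "smooth f \<Longrightarrow> smooth (\<lambda>x. a * f x + b)"
  by (intro smooth_add smooth_mult smooth_const)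

lemma norm2_eq: "(norm x)\<^sup>2 = x $ 1 * x $ 1 + x $ 2 * x $ 2" for x :: "real ^ 2"
  unfolding power2_norm_eq_inner inner_vec_def by (simp add: sum_2)

lemma smooth_norm2: "smooth (\<lambda>x. (norm x)\<^sup>2)"
  unfolding norm2_eq by (intro smooth_add smooth_mult smooth_nth)

lemma smooth_cutoff: "smooth (cutoff n)"
proof -
  have "smooth (\<lambda>x. bump (- real n * (norm x)\<^sup>2 + (real n - 1)))"
    by (intro smooth_bump smooth_affine smooth_norm2)
  then show ?thesis by (simp add: cutoff_def[abs_def] algebra_simps)
qed

lemma smooth_continuous: "smooth f \<Longrightarrow> continuous_on A f"
  using continuous_on_subset[of UNIV f A] C_k.simps(1)[of f] by blast

lemma cutoff_test_fun:
  assumes "smooth f" shows "test_fun (\<lambda>x. cutoff n x * f x)"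
proof (cases "n = 0")
  case True
  \<comment> \<open>For n = 0 the argument of \<open>bump\<close> is - 1, so the product vanishes
    identically.\<close>
  show ?thesis
    by (rule test_funI[OF smooth_mult[OF smooth_cutoff assms], of 1]) (simp_all add: True cutoff_def bump_def)
next
  case False
  define \<delta> where "\<delta> = 1 - sqrt (1 - 1 / real n)"
  have \<delta>: "0 < \<delta>" using False by (simp add: \<delta>_def)
  show ?thesis
  proof (rule test_funI[OF _ \<delta>])
    show "smooth (\<lambda>x. cutoff n x * f x)" by (intro smooth_mult smooth_cutoff assms)
    fix x assume "cutoff n x * f x \<noteq> 0"
    then have "0 < real n * (1 - (norm x)\<^sup>2) - 1" by (auto simp: cutoff_def bump_def split: if_splits)
    then have "(norm x)\<^sup>2 \<le> 1 - 1 / real n" using False by (simp add: field_simps)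
    then show "norm x \<le> 1 - \<delta>" unfolding \<delta>_def by (simp add: real_le_rsqrt)
  qed
qed

lemma bump_tendsto_affine:
  assumes "0 < t" shows "(\<lambda>n. bump (real n * t - 1)) \<longlonglongrightarrow> 1"
proof -
  have "filterlim (\<lambda>n. real n * t - 1) at_top sequentially" using assms by real_asymp
  moreover have "(bump \<longlongrightarrow> 1) at_top"
  proof -
    have "((\<lambda>t::real. exp (- 1 / t)) \<longlongrightarrow> 1) at_top" by real_asymp
    then show ?thesis
      by (rule Lim_transform_eventually) (auto simp: bump_def intro: eventually_mono[OF eventually_gt_at_top[of 0]])
  qed
  ultimately show ?thesis by (rule filterlim_compose[rotated])
qed

lemma cutoff_tendsto: "x \<in> B1 \<Longrightarrow> (\<lambda>n. cutoff n x) \<longlonglongrightarrow> 1"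
  unfolding cutoff_def by (intro bump_tendsto_affine) (simp add: power_less_one_iff abs_square_less_1)

lemma cutoff_bounds: "0 \<le> cutoff n x" "cutoff n x \<le> 1"
  by (simp_all add: cutoff_def bump_bounds)

lemma bump_tendsto_indicator: "(\<lambda>n. bump (real n * t)) \<longlonglongrightarrow> (if 0 < t then 1 else 0)"
  using bump_tendsto[of t] by (auto simp: bump_def mult_nonneg_nonpos)

text \<open>Bounded pointwise limits of smooth functions give the indicators of open boxes. Boxes
  are closed under intersection and generate the Borel sets, so the integral of H vanishes over
  every Borel set; a Lebesgue set differs from a Borel set only by a null set.\<close>

lemma fundamental_lemma:
  assumes H: "integrable leb_B1 (H :: real ^ 2 \<Rightarrow> real)"
    and zero: "\<And>\<phi>. test_fun \<phi> \<Longrightarrow> (LINT x|leb_B1. \<phi> x * H x) = 0"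
  shows "AE x in leb_B1. H x = 0"
proof -
  \<comment> \<open>The cut-off supplies the compact support, tends to 1 in the disk, and leaves |H|
    as the dominating function.\<close>
  have lim0: "(LINT x|leb_B1. k x * H x) = 0"
    if s: "\<And>n. smooth (f n)" and b: "\<And>n x. \<bar>f n x\<bar> \<le> 1" and l: "\<And>x. (\<lambda>n. f n x) \<longlonglongrightarrow> k x" for f k
  proof -
    have km: "k \<in> borel_measurable borel"
      by (intro borel_measurable_LIMSEQ_real[OF l] borel_measurable_continuous_onI smooth_continuous s)
    have fm: "f n \<in> borel_measurable leb_B1" "cutoff n \<in> borel_measurable leb_B1" for n
      by (rule continuous_measurable, rule smooth_continuous, rule s, rule continuous_measurable, rule smooth_continuous, rule smooth_cutoff)
    have "k \<in> borel_measurable leb_B1" using km by (simp add: measurable_restrict_space1 measurable_completion)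
    then have "(\<lambda>n. LINT x|leb_B1. (cutoff n x * f n x) * H x) \<longlonglongrightarrow> (LINT x|leb_B1. k x * H x)"
    proof (intro integral_dominated_convergence[where w="\<lambda>x. \<bar>H x\<bar>"])
      show "AE x in leb_B1. (\<lambda>n. cutoff n x * f n x * H x) \<longlonglongrightarrow> k x * H x"
      proof (rule AE_I2)
        fix x assume "x \<in> space leb_B1"
        then have "x \<in> B1" by simp
        from tendsto_mult[OF tendsto_mult[OF cutoff_tendsto[OF this] l[of x]] tendsto_const[of "H x"]]
        show "(\<lambda>n. cutoff n x * f n x * H x) \<longlonglongrightarrow> k x * H x" by simp
      qed
      show "AE x in leb_B1. norm (cutoff n x * f n x * H x) \<le> \<bar>H x\<bar>" for n
      proof (rule AE_I2)
        fix x
        have "\<bar>cutoff n x * f n x\<bar> \<le> 1 * 1"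
          unfolding abs_mult using cutoff_bounds[of n x] b[of n x] by (intro mult_mono) auto
        then show "norm (cutoff n x * f n x * H x) \<le> \<bar>H x\<bar>"
          by (simp add: abs_mult[of _ "H x"] mult_left_le_one_le)
      qed
    qed (use H fm in auto)
    moreover have "(LINT x|leb_B1. (cutoff n x * f n x) * H x) = 0" for n
      by (intro zero cutoff_test_fun s)
    ultimately show ?thesis by (simp add: LIMSEQ_const_iff)
  qed
  have box0: "(LINT x|leb_B1. indicator (box a b) x * H x) = 0" for a b
  proof (rule lim0)
    \<comment> \<open>bump (n t) tends to 1 for t > 0 and is 0 otherwise; the four factors are the
      four sides of the box.\<close>
    let ?f = "\<lambda>n (x :: real ^ 2). (bump (real n * (x $ 1 - a $ 1)) * bump (real n * (b $ 1 - x $ 1))) *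
        (bump (real n * (x $ 2 - a $ 2)) * bump (real n * (b $ 2 - x $ 2)))"
    fix n and x :: "real ^ 2"
    have "smooth (\<lambda>x. bump (real n * x $ i + (- real n * a $ i)))" "smooth (\<lambda>x. bump (- real n * x $ i + real n * b $ i))" for i
      by (intro smooth_bump smooth_affine smooth_nth)+
    then have "smooth (\<lambda>x. bump (real n * (x $ i - a $ i)))" "smooth (\<lambda>x. bump (real n * (b $ i - x $ i)))" for i
      by (simp_all add: algebra_simps)
    then show "smooth (?f n)" by (intro smooth_mult)
    show "\<bar>?f n x\<bar> \<le> 1"
      unfolding abs_mult by (intro mult_le_one abs_ge_zero mult_nonneg_nonneg) (auto simp: bump_bounds)
    have "(\<lambda>n. ?f n x) \<longlonglongrightarrow> ((if 0 < x $ 1 - a $ 1 then 1 else 0) * (if 0 < b $ 1 - x $ 1 then 1 else 0)) *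
        ((if 0 < x $ 2 - a $ 2 then 1 else 0) * (if 0 < b $ 2 - x $ 2 then 1 else 0))"
      by (intro tendsto_mult bump_tendsto_indicator)
    also have "((if 0 < x $ 1 - a $ 1 then 1 else 0) * (if 0 < b $ 1 - x $ 1 then 1 else 0)) *
        ((if 0 < x $ 2 - a $ 2 then 1 else 0) * (if 0 < b $ 2 - x $ 2 then 1 else 0)) = (indicator (box a b) x :: real)"
      by (auto simp: indicator_def mem_box_cart forall_2)
    finally show "(\<lambda>n. ?f n x) \<longlonglongrightarrow> indicator (box a b) x" .
  qed
  have all0: "(LINT x|leb_B1. H x) = 0"
    using lim0[of "\<lambda>n x. 1" "\<lambda>x. 1"] by (simp add: smooth_const)
  have ind: "integrable leb_B1 (\<lambda>x. indicator A x * H x)" if "A \<in> sets borel" for A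
    using that H by (intro Bochner_Integration.integrable_bound[OF H])
      (auto simp: indicator_def measurable_restrict_space1 measurable_completion intro!: borel_measurable_times)
  have borel0: "(LINT x|leb_B1. indicator A x * H x) = 0" if "A \<in> sets borel" for A
  proof -
    have "Int_stable (range (\<lambda>(a, b). box a b :: (real ^ 2) set))"
      by (auto simp: Int_stable_def box_Int_box)
    moreover have "range (\<lambda>(a, b). box a b :: (real ^ 2) set) \<subseteq> Pow UNIV" by auto
    moreover have "A \<in> sigma_sets UNIV (range (\<lambda>(a, b). box a b))" using that by (simp add: borel_eq_box)
    ultimately show ?thesis
    proof (induction rule: sigma_sets_induct_disjoint)
      case (compl A)
      have A: "A \<in> sets borel" using compl(1) by (simp add: borel_eq_box)
      have "(\<lambda>x. indicator (UNIV - A) x * H x) = (\<lambda>x. H x - indicator A x * H x)"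
        by (auto simp: indicator_def)
      then show ?case using ind[OF A] H compl(2) all0 by simp
    next
      case (union F)
      have F: "F i \<in> sets borel" for i using union(2) by (auto simp: borel_eq_box)
      have "(\<lambda>n. LINT x|leb_B1. indicator (\<Union>i<n. F i) x * H x) \<longlonglongrightarrow> (LINT x|leb_B1. indicator (\<Union>i. F i) x * H x)"
      proof (rule integral_dominated_convergence[where w="\<lambda>x. \<bar>H x\<bar>"])
        show "AE x in leb_B1. (\<lambda>n. indicator (\<Union>i<n. F i) x * H x) \<longlonglongrightarrow> indicator (\<Union>i. F i) x * H x"
          by (intro AE_I2 tendsto_mult tendsto_const LIMSEQ_indicator_UN)
        show "AE x in leb_B1. norm (indicator (\<Union>i<n. F i) x * H x) \<le> \<bar>H x\<bar>" for n
          by (auto simp: indicator_def)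
      qed (use H F ind[of "\<Union>i. F i"] ind[of "\<Union>i<_. F i"] in \<open>auto intro!: borel_measurable_integrable ind\<close>)
      moreover have "(LINT x|leb_B1. indicator (\<Union>i<n. F i) x * H x) = 0" for n
      proof (induction n)
        case (Suc n)
        have "F i \<inter> F n = {}" if "i < n" for i
          using union(1) that by (simp add: disjoint_family_on_def)
        then have "(\<Union>i<n. F i) \<inter> F n = {}" by blast
        then have "indicator (\<Union>i<Suc n. F i) x = indicator (\<Union>i<n. F i) x + (indicator (F n) x :: real)" for x
          by (auto simp: indicator_def lessThan_Suc)
        then have "(\<lambda>x. indicator (\<Union>i<Suc n. F i) x * H x) = (\<lambda>x. indicator (\<Union>i<n. F i) x * H x + indicator (F n) x * H x)"
          by (simp add: distrib_right fun_eq_iff)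
        then show ?case using Suc ind[of "\<Union>i<n. F i"] ind[OF F] F union(3)[of n] by auto
      qed simp
      ultimately show ?case by (simp add: LIMSEQ_const_iff)
    qed (use box0 in auto)
  qed
  show ?thesis
  proof (rule density_unique_real[of _ H "\<lambda>x. 0"])
    fix A assume A: "A \<in> sets leb_B1"
    then have "A \<in> sets lebesgue" by (simp add: sets_restrict_space_iff)
    then obtain S N N' where SN: "A = S \<union> N" "N \<subseteq> N'" "N' \<in> null_sets lborel" "S \<in> sets lborel"
      by (rule sets_completionE)
    have "N' \<in> null_sets lebesgue" using SN(3) by (rule null_sets_completionI)
    then have "AE x in lebesgue. x \<notin> N'" by (rule AE_not_in)
    then have "AE x in leb_B1. x \<notin> N'" by (simp add: AE_restrict_space_iff) (auto elim: eventually_mono)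
    then have "AE x in leb_B1. indicator A x * H x = indicator S x * H x"
      by eventually_elim (use SN in \<open>auto simp: indicator_def\<close>)
    moreover have "(\<lambda>x. indicator A x * H x) \<in> borel_measurable leb_B1" using A H by auto
    ultimately have "(LINT x|leb_B1. indicator A x * H x) = (LINT x|leb_B1. indicator S x * H x)"
      using ind[of S] SN(4) by (intro integral_cong_AE) auto
    then show "set_lebesgue_integral leb_B1 A H = set_lebesgue_integral leb_B1 A (\<lambda>x. 0)"
      using borel0[of S] SN(4) by (simp add: set_lebesgue_integral_def)
  qed (use H in auto)
qed

lemma weak_grad_unique:
  assumes "is_weak_grad u G" "is_weak_grad u H"
  shows "AE x in leb_B1. G x = H x"
proof -
  have L: "L2 G" "L2 H" using assms unfolding is_weak_grad_def by blast+
  have iG: "integrable leb_B1 (\<lambda>x. G x $ i)" "integrable leb_B1 (\<lambda>x. H x $ i)" for i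
    using integrable_bounded_linear[OF bounded_linear_vec_nth L2_integrable[OF L(1)]]
      integrable_bounded_linear[OF bounded_linear_vec_nth L2_integrable[OF L(2)]] by blast+
  have "AE x in leb_B1. G x $ i - H x $ i = 0" for i
  proof (rule fundamental_lemma)
    show "integrable leb_B1 (\<lambda>x. G x $ i - H x $ i)" by (intro Bochner_Integration.integrable_diff iG)
    fix \<phi> assume \<phi>: "test_fun \<phi>"
    obtain B where B: "0 < B" "\<And>x. \<bar>\<phi> x\<bar> \<le> B" "\<And>x. norm (grad \<phi> x) \<le> B" using test_fun_bounded[OF \<phi>] by blast
    have m: "\<phi> \<in> borel_measurable leb_B1"
      by (rule continuous_measurable, rule continuous_on_subset[OF test_fun_cont(1)[OF \<phi>]]) simp
    have i1: "integrable leb_B1 (\<lambda>x. \<phi> x *\<^sub>R G x)" "integrable leb_B1 (\<lambda>x. \<phi> x *\<^sub>R H x)"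
      by (rule bounded_mult_integrable[OF m B(2) L2_integrable[OF L(1)]], rule bounded_mult_integrable[OF m B(2) L2_integrable[OF L(2)]])
    have i2: "integrable leb_B1 (\<lambda>x. \<phi> x * G x $ i)" "integrable leb_B1 (\<lambda>x. \<phi> x * H x $ i)"
      using integrable_bounded_linear[OF bounded_linear_vec_nth i1(1), of i]
        integrable_bounded_linear[OF bounded_linear_vec_nth i1(2), of i] by simp_all
    have "(LINT x|leb_B1. u x *\<^sub>R grad \<phi> x) = - (LINT x|leb_B1. \<phi> x *\<^sub>R G x)"
      using assms(1) \<phi> unfolding is_weak_grad_def by blast
    moreover have "(LINT x|leb_B1. u x *\<^sub>R grad \<phi> x) = - (LINT x|leb_B1. \<phi> x *\<^sub>R H x)"
      using assms(2) \<phi> unfolding is_weak_grad_def by blast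
    ultimately have "(LINT x|leb_B1. \<phi> x *\<^sub>R G x) $ i = (LINT x|leb_B1. \<phi> x *\<^sub>R H x) $ i" by simp
    then have "(LINT x|leb_B1. \<phi> x * G x $ i) = (LINT x|leb_B1. \<phi> x * H x $ i)"
      unfolding integral_vec_nth[OF i1(1)] integral_vec_nth[OF i1(2)] by simp
    then show "(LINT x|leb_B1. \<phi> x * (G x $ i - H x $ i)) = 0"
      unfolding right_diff_distrib Bochner_Integration.integral_diff[OF i2] by simp
  qed
  then have "AE x in leb_B1. \<forall>i. G x $ i = H x $ i" by (simp add: AE_all_countable)
  then show ?thesis by (simp add: vec_eq_iff)
qed

lemma wgrad: "u \<in> H1 \<Longrightarrow> is_weak_grad u (wgrad u)"
  using someI_ex[of "is_weak_grad u"] unfolding H1_def wgrad_def by simp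

lemma H1I: "is_weak_grad u G \<Longrightarrow> u \<in> H1"
  unfolding H1_def by blast

lemma wgrad_AE: "is_weak_grad u G \<Longrightarrow> AE x in leb_B1. wgrad u x = G x"
  using weak_grad_unique wgrad H1I by blast

lemma weak_grad_L2: assumes "is_weak_grad u G" shows "L2 u" "L2 G"
  using assms unfolding is_weak_grad_def by blast+

text \<open>The integral does not see the choice made in \<open>wgrad\<close>, so energies may be
  computed with classical gradients.\<close>

lemma dirichlet_eq:
  assumes "is_weak_grad u G" "is_weak_grad v H"
  shows "dirichlet u v = (LINT x|leb_B1. G x \<bullet> H x)"
  unfolding dirichlet_def
proof (rule integral_cong_AE)
  have "L2 (wgrad u)" "L2 (wgrad v)" "L2 G" "L2 H"
    using assms weak_grad_L2 wgrad H1I by blast+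
  then show "(\<lambda>x. wgrad u x \<bullet> wgrad v x) \<in> borel_measurable leb_B1" "(\<lambda>x. G x \<bullet> H x) \<in> borel_measurable leb_B1"
    by (auto simp: L2_def)
  show "AE x in leb_B1. wgrad u x \<bullet> wgrad v x = G x \<bullet> H x"
    using wgrad_AE[OF assms(1)] wgrad_AE[OF assms(2)] by eventually_elim simp
qed

lemma wgrad_energy:
  "is_weak_grad u G \<Longrightarrow> (LINT x|leb_B1. (norm (wgrad u x))\<^sup>2) = (LINT x|leb_B1. (norm (G x))\<^sup>2)"
  using dirichlet_eq[of u G u G] by (simp add: dirichlet_def power2_norm_eq_inner)

lemma H1_norm_sq:
  assumes "is_weak_grad u G"
  shows "(H1_norm u)\<^sup>2 = (LINT x|leb_B1. (u x)\<^sup>2) + (LINT x|leb_B1. (norm (G x))\<^sup>2)"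
  unfolding H1_norm_def wgrad_energy[OF assms]
  by (rule real_sqrt_pow2) (intro add_nonneg_nonneg Bochner_Integration.integral_nonneg, auto)

lemma H1_norm_nonneg: "0 \<le> H1_norm u"
  unfolding H1_norm_def by (rule real_sqrt_ge_zero) (intro add_nonneg_nonneg Bochner_Integration.integral_nonneg, auto)

lemma H10_approx:
  assumes "v \<in> H10"
  obtains \<phi> where "\<And>n. test_fun (\<phi> n)" "(\<lambda>n. LINT x|leb_B1. (\<phi> n x - v x)\<^sup>2) \<longlonglongrightarrow> 0"
    "(\<lambda>n. LINT x|leb_B1. (norm (grad (\<phi> n) x - wgrad v x))\<^sup>2) \<longlonglongrightarrow> 0"
proof -
  obtain \<phi> where \<phi>: "\<And>n. test_fun (\<phi> n)" "(\<lambda>n. H1_norm (\<lambda>x. \<phi> n x - v x)) \<longlonglongrightarrow> 0" and v: "v \<in> H1"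
    using assms unfolding H10_def by blast
  have wg: "is_weak_grad (\<lambda>x. \<phi> n x - v x) (\<lambda>x. grad (\<phi> n) x - wgrad v x)" for n
    using weak_grad_lincomb[OF test_fun_weak_grad[OF \<phi>(1)] wgrad[OF v], of 1 n "-1"] by simp
  have sq: "(LINT x|leb_B1. (\<phi> n x - v x)\<^sup>2) + (LINT x|leb_B1. (norm (grad (\<phi> n) x - wgrad v x))\<^sup>2)
      = (H1_norm (\<lambda>x. \<phi> n x - v x))\<^sup>2" for n
    using H1_norm_sq[OF wg] by simp
  have nn: "0 \<le> (LINT x|leb_B1. (\<phi> n x - v x)\<^sup>2)" "0 \<le> (LINT x|leb_B1. (norm (grad (\<phi> n) x - wgrad v x))\<^sup>2)" for n
    by (intro Bochner_Integration.integral_nonneg, auto)+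
  have l: "(\<lambda>n. (H1_norm (\<lambda>x. \<phi> n x - v x))\<^sup>2) \<longlonglongrightarrow> 0" using tendsto_power[OF \<phi>(2), of 2] by simp
  have le: "(LINT x|leb_B1. (\<phi> n x - v x)\<^sup>2) \<le> (H1_norm (\<lambda>x. \<phi> n x - v x))\<^sup>2"
    "(LINT x|leb_B1. (norm (grad (\<phi> n) x - wgrad v x))\<^sup>2) \<le> (H1_norm (\<lambda>x. \<phi> n x - v x))\<^sup>2" for n
    using sq[of n] nn[of n] by linarith+
  have "(\<lambda>n. LINT x|leb_B1. (\<phi> n x - v x)\<^sup>2) \<longlonglongrightarrow> 0"
    by (rule tendsto_sandwich[OF always_eventually always_eventually tendsto_const l]) (use nn le in blast)+
  moreover have "(\<lambda>n. LINT x|leb_B1. (norm (grad (\<phi> n) x - wgrad v x))\<^sup>2) \<longlonglongrightarrow> 0"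
    by (rule tendsto_sandwich[OF always_eventually always_eventually tendsto_const l]) (use nn le in blast)+
  ultimately show ?thesis using that \<phi>(1) by blast
qed

lemma H10_H1: "v \<in> H10 \<Longrightarrow> v \<in> H1" unfolding H10_def by blast

lemma H10_L2: assumes "v \<in> H10" shows "L2 v" "L2 (wgrad v)"
  using weak_grad_L2[OF wgrad[OF H10_H1[OF assms]]] .

lemma L2_CS:
  fixes f g :: "real ^ 2 \<Rightarrow> 'b::euclidean_space"
  assumes "L2 f" "L2 g"
  shows "(LINT x|leb_B1. f x \<bullet> g x)\<^sup>2 \<le> (LINT x|leb_B1. (norm (f x))\<^sup>2) * (LINT x|leb_B1. (norm (g x))\<^sup>2)"
proof -
  define A where "A = (LINT x|leb_B1. (norm (f x))\<^sup>2)"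
  define B where "B = (LINT x|leb_B1. f x \<bullet> g x)"
  define C where "C = (LINT x|leb_B1. (norm (g x))\<^sup>2)"
  have i: "integrable leb_B1 (\<lambda>x. (norm (f x))\<^sup>2)" "integrable leb_B1 (\<lambda>x. (norm (g x))\<^sup>2)" "integrable leb_B1 (\<lambda>x. f x \<bullet> g x)"
    using assms L2_inner unfolding L2_def by blast+
  have q: "0 \<le> a\<^sup>2 * A - 2 * a * s * B + s\<^sup>2 * C" for a s
  proof -
    have "0 \<le> (LINT x|leb_B1. (norm (a *\<^sub>R f x - s *\<^sub>R g x))\<^sup>2)" by (rule Bochner_Integration.integral_nonneg) simp
    also have "\<dots> = (LINT x|leb_B1. a\<^sup>2 * (norm (f x))\<^sup>2 - 2 * a * s * (f x \<bullet> g x) + s\<^sup>2 * (norm (g x))\<^sup>2)"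
    proof (rule Bochner_Integration.integral_cong[OF refl])
      fix x
      have "(norm (a *\<^sub>R f x - s *\<^sub>R g x))\<^sup>2 = (norm (a *\<^sub>R f x))\<^sup>2 + (norm (s *\<^sub>R g x))\<^sup>2 - 2 * ((a *\<^sub>R f x) \<bullet> (s *\<^sub>R g x))"
        by (subst dot_norm_neg) (simp add: field_simps)
      then show "(norm (a *\<^sub>R f x - s *\<^sub>R g x))\<^sup>2 = a\<^sup>2 * (norm (f x))\<^sup>2 - 2 * a * s * (f x \<bullet> g x) + s\<^sup>2 * (norm (g x))\<^sup>2"
        by (simp add: power_mult_distrib)
    qed
    also have "\<dots> = a\<^sup>2 * A - 2 * a * s * B + s\<^sup>2 * C"
      unfolding A_def B_def C_def
      by (simp only: Bochner_Integration.integral_add Bochner_Integration.integral_diff integral_mult_right_zero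
          integrable_mult_right Bochner_Integration.integrable_diff i simp_thms)
    finally show ?thesis .
  qed
  have A0: "0 \<le> A" "0 \<le> C" unfolding A_def C_def by (rule Bochner_Integration.integral_nonneg, simp)+
  have "B\<^sup>2 \<le> A * C"
  proof (cases "C = 0")
    case True
    have "B = 0"
    proof (rule ccontr)
      assume "B \<noteq> 0"
      \<comment> \<open>For C = 0 the quadratic form is affine in s, and this s makes it equal to -
        1.\<close>
      then show False using q[of 1 "(A + 1) / (2 * B)"] True by simp
    qed
    then show ?thesis using A0 by simp
  next
    case False
    have "0 \<le> C * (A * C - B\<^sup>2)" using q[of C B] by (simp add: power2_eq_square algebra_simps)
    then show ?thesis using False A0 by (simp add: zero_le_mult_iff)
  qed
  then show ?thesis by (simp add: A_def B_def C_def)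
qed

lemma L2_inner_tendsto:
  fixes f :: "real ^ 2 \<Rightarrow> 'b::euclidean_space"
  assumes f: "L2 f" and g: "\<And>n. L2 (g n)" "L2 v" and l: "(\<lambda>n. LINT x|leb_B1. (norm (g n x - v x))\<^sup>2) \<longlonglongrightarrow> 0"
  shows "(\<lambda>n. LINT x|leb_B1. f x \<bullet> g n x) \<longlonglongrightarrow> (LINT x|leb_B1. f x \<bullet> v x)"
proof -
  have L: "L2 (\<lambda>x. g n x - v x)" for n
    using L2_add[OF g(1) L2_scale[OF g(2)], of n "-1"] by simp
  define c where "c = (LINT x|leb_B1. (norm (f x))\<^sup>2)"
  have le: "\<forall>\<^sub>F n in sequentially. (LINT x|leb_B1. f x \<bullet> (g n x - v x))\<^sup>2 \<le> c * (LINT x|leb_B1. (norm (g n x - v x))\<^sup>2)"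
    by (rule always_eventually, rule allI, unfold c_def, rule L2_CS[OF f L])
  have ge: "\<forall>\<^sub>F n in sequentially. 0 \<le> (LINT x|leb_B1. f x \<bullet> (g n x - v x))\<^sup>2"
    by (rule always_eventually, rule allI, rule zero_le_power2)
  have "(\<lambda>n. c * (LINT x|leb_B1. (norm (g n x - v x))\<^sup>2)) \<longlonglongrightarrow> 0"
    using tendsto_mult_left[OF l, of c] by (simp only: mult_zero_right)
  from tendsto_sandwich[OF ge le tendsto_const this]
  have "(\<lambda>n. (LINT x|leb_B1. f x \<bullet> (g n x - v x))\<^sup>2) \<longlonglongrightarrow> 0" .
  from tendsto_real_sqrt[OF this]
  have "(\<lambda>n. \<bar>LINT x|leb_B1. f x \<bullet> (g n x - v x)\<bar>) \<longlonglongrightarrow> 0" by (simp only: real_sqrt_abs real_sqrt_zero)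
  then have z: "(\<lambda>n. LINT x|leb_B1. f x \<bullet> (g n x - v x)) \<longlonglongrightarrow> 0" by (rule tendsto_rabs_zero_cancel)
  have "(LINT x|leb_B1. f x \<bullet> (g n x - v x)) = (LINT x|leb_B1. f x \<bullet> g n x) - (LINT x|leb_B1. f x \<bullet> v x)" for n
    unfolding inner_diff_right by (rule Bochner_Integration.integral_diff[OF L2_inner[OF f g(1)] L2_inner[OF f g(2)]])
  with z show ?thesis by (rule_tac LIM_zero_cancel) (simp only:)
qed

section \<open>A Trudinger-type inequality\<close>

text \<open>Taking directions from an annulus with Lebesgue measure replaces polar coordinates. The
  inner radius 1/2 ensures that x + 4 z has left the disk for every x in it.\<close>

definition Ann :: "(real ^ 2) set" where "Ann = {z. 1 / 2 \<le> norm z \<and> norm z \<le> 1}"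

lemma Ann_meas [measurable]: "Ann \<in> sets borel"
proof -
  have "closed Ann" unfolding Ann_def by (intro closed_Collect_conj closed_Collect_le continuous_intros)
  then show ?thesis by simp
qed

definition annulus_area :: real where "annulus_area = 3 / 4 * pi"

lemma annulus_area: "emeasure lborel Ann = ennreal annulus_area" "3 / 2 \<le> annulus_area" "annulus_area \<le> 3" "0 < annulus_area"
proof -
  have Ann: "Ann = cball 0 1 - ball 0 (1 / 2)" by (auto simp: Ann_def)
  have "emeasure lborel Ann = emeasure lborel (cball (0 :: real ^ 2) 1) - emeasure lborel (ball (0 :: real ^ 2) (1 / 2))"
    unfolding Ann using emeasure_lborel_ball_finite[of "0 :: real ^ 2" "1 / 2"]
    by (intro emeasure_Diff) auto
  also have "\<dots> = ennreal pi - ennreal (pi / 4)"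
    by (simp add: emeasure_cball emeasure_ball unit_ball_vol_2 power2_eq_square)
  also have "\<dots> = ennreal (pi - pi / 4)" by (rule ennreal_minus) simp
  finally show "emeasure lborel Ann = ennreal annulus_area" by (simp add: annulus_area_def)
  show "3 / 2 \<le> annulus_area" "annulus_area \<le> 3" "0 < annulus_area"
    using pi_ge_two pi_less_4 by (simp_all add: annulus_area_def)
qed

text \<open>After the substitution y = r z this is r^(-2) times the integral of f over the annulus
  of radii r / 2 and r about x.\<close>

definition shell :: "(real ^ 2 \<Rightarrow> real) \<Rightarrow> real ^ 2 \<Rightarrow> real \<Rightarrow> ennreal" where
  "shell f x r = (\<integral>\<^sup>+ z. ennreal (f (x + r *\<^sub>R z)) * indicator Ann z \<partial>lborel)"

definition shell2 :: "(real ^ 2 \<Rightarrow> real) \<Rightarrow> real ^ 2 \<Rightarrow> real \<Rightarrow> ennreal" where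
  "shell2 f x r = (\<integral>\<^sup>+ z. (ennreal (f (x + r *\<^sub>R z)))\<^sup>2 * indicator Ann z \<partial>lborel)"

lemma shell_CS:
  assumes [measurable]: "f \<in> borel_measurable borel"
  shows "(shell f x r)\<^sup>2 \<le> ennreal annulus_area * shell2 f x r"
proof -
  have "shell f x r = (\<integral>\<^sup>+ z. (ennreal (f (x + r *\<^sub>R z)) * indicator Ann z) * indicator Ann z \<partial>lborel)"
    unfolding shell_def by (intro nn_integral_cong) (simp add: indicator_def)
  also have "\<dots>\<^sup>2 \<le> (\<integral>\<^sup>+ z. (ennreal (f (x + r *\<^sub>R z)) * indicator Ann z)\<^sup>2 \<partial>lborel) * (\<integral>\<^sup>+ z. (indicator Ann z)\<^sup>2 \<partial>lborel)"
    by (rule Cauchy_Schwarz_nn_integral) measurable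
  also have "(\<integral>\<^sup>+ z. (ennreal (f (x + r *\<^sub>R z)) * indicator Ann z)\<^sup>2 \<partial>lborel) = shell2 f x r"
    unfolding shell2_def by (intro nn_integral_cong) (simp add: indicator_def)
  also have "(\<integral>\<^sup>+ z. (indicator Ann z :: ennreal)\<^sup>2 \<partial>lborel) = (\<integral>\<^sup>+ z. indicator Ann z \<partial>lborel)"
    by (intro nn_integral_cong) (simp add: indicator_def)
  also have "\<dots> = ennreal annulus_area" by (simp add: annulus_area)
  finally show ?thesis by (simp add: mult.commute)
qed

lemma nn_integral_translate:
  fixes g :: "real ^ 2 \<Rightarrow> ennreal"
  assumes [measurable]: "g \<in> borel_measurable borel"
  shows "(\<integral>\<^sup>+ y. g (x + y) \<partial>lborel) = (\<integral>\<^sup>+ y. g y \<partial>lborel)"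
proof -
  have "(\<integral>\<^sup>+ y. g y \<partial>lborel) = (\<integral>\<^sup>+ y. g y \<partial>distr lborel borel ((+) x))" by (simp add: lborel_distr_plus)
  also have "\<dots> = (\<integral>\<^sup>+ y. g (x + y) \<partial>lborel)" by (rule nn_integral_distr) auto
  finally show ?thesis by simp
qed

lemma nn_integral_scale:
  fixes g :: "real ^ 2 \<Rightarrow> ennreal"
  assumes [measurable]: "g \<in> borel_measurable borel" and r: "0 < r"
  shows "(\<integral>\<^sup>+ y. g y \<partial>lborel) = ennreal (r\<^sup>2) * (\<integral>\<^sup>+ z. g (r *\<^sub>R z) \<partial>lborel)"
proof -
  have "(\<integral>\<^sup>+ y. g y \<partial>lborel) = (\<integral>\<^sup>+ y. g y \<partial>density (distr lborel borel (\<lambda>x. 0 + r *\<^sub>R x)) (\<lambda>_. \<bar>r\<bar>^DIM(real ^ 2)))"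
    using r by (subst lborel_affine[of r "0 :: real ^ 2"]) auto
  also have "\<dots> = (\<integral>\<^sup>+ y. ennreal (r\<^sup>2) * g y \<partial>distr lborel borel (\<lambda>x. 0 + r *\<^sub>R x))"
    using r by (subst nn_integral_density) auto
  also have "\<dots> = (\<integral>\<^sup>+ z. ennreal (r\<^sup>2) * g (0 + r *\<^sub>R z) \<partial>lborel)" by (rule nn_integral_distr) auto
  also have "\<dots> = ennreal (r\<^sup>2) * (\<integral>\<^sup>+ z. g (r *\<^sub>R z) \<partial>lborel)" by (simp add: nn_integral_cmult)
  finally show ?thesis .
qed

text \<open>The substitution contributes r^(-2); with the weight r of the logarithmic Cauchy-Schwarz
  inequality there remains the factor 1 / r that \<open>annulus_weight\<close> integrates.\<close>

lemma shell2_scale: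
  assumes [measurable]: "f \<in> borel_measurable borel" and r: "0 < r"
  shows "ennreal r * shell2 f x r =
    (\<integral>\<^sup>+ y. (ennreal (f (x + y)))\<^sup>2 * indicator Ann ((1 / r) *\<^sub>R y) * ennreal (1 / r) \<partial>lborel)"
proof -
  have "(\<integral>\<^sup>+ y. (ennreal (f (x + y)))\<^sup>2 * indicator Ann ((1 / r) *\<^sub>R y) * ennreal (1 / r) \<partial>lborel) =
      ennreal (r\<^sup>2) * (\<integral>\<^sup>+ z. (ennreal (f (x + r *\<^sub>R z)))\<^sup>2 * indicator Ann ((1 / r) *\<^sub>R (r *\<^sub>R z)) * ennreal (1 / r) \<partial>lborel)"
    by (rule nn_integral_scale[OF _ r]) measurable
  also have "\<dots> = ennreal (r\<^sup>2) * (shell2 f x r * ennreal (1 / r))"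
    unfolding shell2_def using r by (subst nn_integral_multc[symmetric]) auto
  also have "\<dots> = ennreal (r\<^sup>2) * ennreal (1 / r) * shell2 f x r" by (simp add: mult_ac)
  also have "ennreal (r\<^sup>2) * ennreal (1 / r) = ennreal r"
    using r by (simp add: ennreal_mult[symmetric] power2_eq_square)
  finally show ?thesis by simp
qed

text \<open>For y \<noteq> 0 the condition restricts r to the interval from |y| to 2 |y|, of length
  |y|, where 1 / r \<le> 1 / |y|.\<close>

lemma annulus_weight:
  "(\<integral>\<^sup>+ r. indicator Ann ((1 / r) *\<^sub>R y) * ennreal (1 / r) * indicator {0<..} r \<partial>lborel) \<le> 1"
proof (cases "y = 0")
  case True
  then show ?thesis by (simp add: Ann_def)
next
  case False
  have "(\<integral>\<^sup>+ r. indicator Ann ((1 / r) *\<^sub>R y) * ennreal (1 / r) * indicator {0<..} r \<partial>lborel) \<le>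
      (\<integral>\<^sup>+ r. ennreal (1 / norm y) * indicator {norm y..2 * norm y} r \<partial>lborel)"
  proof (rule nn_integral_mono)
    fix r :: real
    show "indicator Ann ((1 / r) *\<^sub>R y) * ennreal (1 / r) * indicator {0<..} r \<le> ennreal (1 / norm y) * indicator {norm y..2 * norm y} r"
    proof (cases "0 < r \<and> (1 / r) *\<^sub>R y \<in> Ann")
      case True
      then have "norm y \<le> r" "r \<le> 2 * norm y" by (auto simp: Ann_def field_simps)
      moreover have "1 / r \<le> 1 / norm y" using False calculation True by (intro divide_left_mono mult_pos_pos) auto
      ultimately show ?thesis using True by (simp add: ennreal_leI)
    next
      case False
      then show ?thesis by (auto simp: indicator_def)
    qed
  qed
  also have "\<dots> = ennreal (1 / norm y) * ennreal (norm y)"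
    by (simp add: nn_integral_cmult_indicator)
  also have "\<dots> = 1" using False by (simp add: ennreal_mult[symmetric])
  finally show ?thesis .
qed

text \<open>Cauchy-Schwarz in r with the weights r and 1 / r. The second produces ln (4 / \<delta>),
  the source of exponential integrability; for the first, Fubini and \<open>annulus_weight\<close>
  bound the integral of r shell^2 by a multiple of the squared L2 norm, uniformly in x.\<close>

lemma far_part:
  assumes [measurable]: "f \<in> borel_measurable borel" and \<delta>: "0 < \<delta>" "\<delta> < 4"
  shows "(\<integral>\<^sup>+ r. shell f x r * indicator {\<delta>..4} r \<partial>lborel)\<^sup>2 \<le>
    ennreal (annulus_area * ln (4 / \<delta>)) * (\<integral>\<^sup>+ y. (ennreal (f y))\<^sup>2 \<partial>lborel)"
proof -
  have sm [measurable]: "shell f x \<in> borel_measurable borel" "shell2 f x \<in> borel_measurable borel"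
    unfolding shell_def shell2_def by measurable
  let ?F = "\<lambda>r. shell f x r * ennreal (sqrt r) * indicator {\<delta>..4} r"
  let ?G = "\<lambda>r. ennreal (1 / sqrt r) * indicator {\<delta>..4} r"
  have "(\<integral>\<^sup>+ r. shell f x r * indicator {\<delta>..4} r \<partial>lborel) = (\<integral>\<^sup>+ r. ?F r * ?G r \<partial>lborel)"
  proof (rule nn_integral_cong)
    fix r
    show "shell f x r * indicator {\<delta>..4} r = ?F r * ?G r"
    proof (cases "r \<in> {\<delta>..4}")
      case True
      then have "ennreal (sqrt r) * ennreal (1 / sqrt r) = 1" using \<delta> by (simp add: ennreal_mult[symmetric])
      then show ?thesis using True by (simp add: mult.assoc)
    qed simp
  qed
  then have CS: "(\<integral>\<^sup>+ r. shell f x r * indicator {\<delta>..4} r \<partial>lborel)\<^sup>2 \<le>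
      (\<integral>\<^sup>+ r. (?F r)\<^sup>2 \<partial>lborel) * (\<integral>\<^sup>+ r. (?G r)\<^sup>2 \<partial>lborel)"
    by (simp only:) (rule Cauchy_Schwarz_nn_integral, measurable)
  have G: "(\<integral>\<^sup>+ r. (?G r)\<^sup>2 \<partial>lborel) = ennreal (ln (4 / \<delta>))"
  proof -
    have "(\<integral>\<^sup>+ r. (?G r)\<^sup>2 \<partial>lborel) = (\<integral>\<^sup>+ r. ennreal (1 / r) * indicator {\<delta>..4} r \<partial>lborel)"
    proof (rule nn_integral_cong)
      fix r show "(?G r)\<^sup>2 = ennreal (1 / r) * indicator {\<delta>..4} r"
        using \<delta> by (cases "r \<in> {\<delta>..4}") (simp_all add: ennreal_power power_divide)
    qed
    also have "\<dots> = ennreal (ln 4 - ln \<delta>)"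
      using \<delta> by (intro nn_integral_FTC_Icc) (auto intro!: derivative_eq_intros simp flip: has_real_derivative_iff_has_vector_derivative)
    finally show ?thesis using \<delta> by (simp add: ln_div)
  qed
  have F: "(\<integral>\<^sup>+ r. (?F r)\<^sup>2 \<partial>lborel) \<le> ennreal annulus_area * (\<integral>\<^sup>+ y. (ennreal (f y))\<^sup>2 \<partial>lborel)"
  proof -
    have "(?F r)\<^sup>2 \<le> ennreal annulus_area * (\<integral>\<^sup>+ y. (ennreal (f (x + y)))\<^sup>2 * (indicator Ann ((1 / r) *\<^sub>R y) * ennreal (1 / r) * indicator {0<..} r) \<partial>lborel)" for r
    proof (cases "r \<in> {\<delta>..4}")
      case True
      then have r: "0 < r" using \<delta> by simp
      have "(?F r)\<^sup>2 = ennreal r * (shell f x r)\<^sup>2" using True r by (simp add: power_mult_distrib ennreal_power mult.commute)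
      also have "\<dots> \<le> ennreal r * (ennreal annulus_area * shell2 f x r)" by (intro mult_left_mono shell_CS) auto
      also have "\<dots> = ennreal annulus_area * (ennreal r * shell2 f x r)" by (simp add: mult_ac)
      finally show ?thesis unfolding shell2_scale[OF assms(1) r] using r by (simp add: mult.assoc)
    qed simp
    then have "(\<integral>\<^sup>+ r. (?F r)\<^sup>2 \<partial>lborel) \<le> (\<integral>\<^sup>+ r. ennreal annulus_area * (\<integral>\<^sup>+ y. (ennreal (f (x + y)))\<^sup>2 * (indicator Ann ((1 / r) *\<^sub>R y) * ennreal (1 / r) * indicator {0<..} r) \<partial>lborel) \<partial>lborel)"
      by (intro nn_integral_mono)
    also have "\<dots> = ennreal annulus_area * (\<integral>\<^sup>+ r. (\<integral>\<^sup>+ y. (ennreal (f (x + y)))\<^sup>2 * (indicator Ann ((1 / r) *\<^sub>R y) * ennreal (1 / r) * indicator {0<..} r) \<partial>lborel) \<partial>lborel)"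
      by (rule nn_integral_cmult) measurable
    also have "(\<integral>\<^sup>+ r. (\<integral>\<^sup>+ y. (ennreal (f (x + y)))\<^sup>2 * (indicator Ann ((1 / r) *\<^sub>R y) * ennreal (1 / r) * indicator {0<..} r) \<partial>lborel) \<partial>lborel)
        = (\<integral>\<^sup>+ y. (\<integral>\<^sup>+ r. (ennreal (f (x + y)))\<^sup>2 * (indicator Ann ((1 / r) *\<^sub>R y) * ennreal (1 / r) * indicator {0<..} r) \<partial>lborel) \<partial>lborel)"
      by (rule lborel_pair.Fubini') measurable
    also have "\<dots> = (\<integral>\<^sup>+ y. (ennreal (f (x + y)))\<^sup>2 * (\<integral>\<^sup>+ r. indicator Ann ((1 / r) *\<^sub>R y) * ennreal (1 / r) * indicator {0<..} r \<partial>lborel) \<partial>lborel)"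
      by (intro nn_integral_cong nn_integral_cmult) measurable
    also have "ennreal annulus_area * \<dots> \<le> ennreal annulus_area * (\<integral>\<^sup>+ y. (ennreal (f (x + y)))\<^sup>2 * 1 \<partial>lborel)"
      by (rule mult_left_mono, rule nn_integral_mono, rule mult_left_mono[OF annulus_weight], simp_all)
    also have "(\<integral>\<^sup>+ y. (ennreal (f (x + y)))\<^sup>2 * 1 \<partial>lborel) = (\<integral>\<^sup>+ y. (ennreal (f y))\<^sup>2 \<partial>lborel)"
      using nn_integral_translate[of "\<lambda>y. (ennreal (f y))\<^sup>2" x] by simp
    finally show ?thesis .
  qed
  have "0 \<le> annulus_area" "0 \<le> ln (4 / \<delta>)" using annulus_area \<delta> by (simp_all add: less_imp_le)
  then have e: "ennreal (annulus_area * ln (4 / \<delta>)) = ennreal annulus_area * ennreal (ln (4 / \<delta>))" by (rule ennreal_mult)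
  note CS
  also have "(\<integral>\<^sup>+ r. (?F r)\<^sup>2 \<partial>lborel) * (\<integral>\<^sup>+ r. (?G r)\<^sup>2 \<partial>lborel) \<le>
      (ennreal annulus_area * (\<integral>\<^sup>+ y. (ennreal (f y))\<^sup>2 \<partial>lborel)) * ennreal (ln (4 / \<delta>))"
    unfolding G by (rule mult_right_mono[OF F]) simp
  finally show ?thesis unfolding e by (simp only: mult_ac)
qed

text \<open>Close to x no pointwise bound is available, but in the mean over x translation
  invariance makes each radius contribute the same squared L2 norm, and two factors \<delta>
  remain.\<close>

lemma near_part:
  assumes [measurable]: "f \<in> borel_measurable borel" and \<delta>: "0 < \<delta>"
  shows "(\<integral>\<^sup>+ x. (\<integral>\<^sup>+ r. shell f x r * indicator {0..\<delta>} r \<partial>lborel)\<^sup>2 \<partial>lborel) \<le>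
    ennreal ((annulus_area * \<delta>)\<^sup>2) * (\<integral>\<^sup>+ y. (ennreal (f y))\<^sup>2 \<partial>lborel)"
proof -
  define A where "A = (\<integral>\<^sup>+ y. (ennreal (f y))\<^sup>2 \<partial>lborel)"
  have [measurable]: "(\<lambda>(x, r). shell f x r) \<in> borel_measurable (borel \<Otimes>\<^sub>M borel)"
    "(\<lambda>(x, r). shell2 f x r) \<in> borel_measurable (borel \<Otimes>\<^sub>M borel)"
    unfolding shell_def shell2_def by measurable
  have 1: "(\<integral>\<^sup>+ r. shell f x r * indicator {0..\<delta>} r \<partial>lborel)\<^sup>2 \<le>
      ennreal (annulus_area * \<delta>) * (\<integral>\<^sup>+ r. shell2 f x r * indicator {0..\<delta>} r \<partial>lborel)" for x
  proof -
    have "(\<integral>\<^sup>+ r. shell f x r * indicator {0..\<delta>} r \<partial>lborel) = (\<integral>\<^sup>+ r. (shell f x r * indicator {0..\<delta>} r) * indicator {0..\<delta>} r \<partial>lborel)"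
      by (intro nn_integral_cong) (simp add: indicator_def)
    then have CS: "(\<integral>\<^sup>+ r. shell f x r * indicator {0..\<delta>} r \<partial>lborel)\<^sup>2 \<le>
        (\<integral>\<^sup>+ r. (shell f x r * indicator {0..\<delta>} r)\<^sup>2 \<partial>lborel) * (\<integral>\<^sup>+ r. (indicator {0..\<delta>} r)\<^sup>2 \<partial>lborel)"
      by (simp only:) (rule Cauchy_Schwarz_nn_integral, measurable)
    have "(\<integral>\<^sup>+ r. (indicator {0..\<delta>} r :: ennreal)\<^sup>2 \<partial>lborel) = (\<integral>\<^sup>+ r. indicator {0..\<delta>} r \<partial>lborel)"
      by (intro nn_integral_cong) (simp add: indicator_def)
    also have "\<dots> = ennreal \<delta>" using \<delta> by simp
    finally have G: "(\<integral>\<^sup>+ r. (indicator {0..\<delta>} r :: ennreal)\<^sup>2 \<partial>lborel) = ennreal \<delta>" .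
    have "(\<integral>\<^sup>+ r. (shell f x r * indicator {0..\<delta>} r)\<^sup>2 \<partial>lborel) \<le> (\<integral>\<^sup>+ r. ennreal annulus_area * (shell2 f x r * indicator {0..\<delta>} r) \<partial>lborel)"
    proof (rule nn_integral_mono)
      fix r show "(shell f x r * indicator {0..\<delta>} r)\<^sup>2 \<le> ennreal annulus_area * (shell2 f x r * indicator {0..\<delta>} r)"
        using shell_CS[OF assms(1), of x r] by (cases "r \<in> {0..\<delta>}") simp_all
    qed
    also have "\<dots> = ennreal annulus_area * (\<integral>\<^sup>+ r. shell2 f x r * indicator {0..\<delta>} r \<partial>lborel)"
      by (rule nn_integral_cmult) measurable
    finally have F: "(\<integral>\<^sup>+ r. (shell f x r * indicator {0..\<delta>} r)\<^sup>2 \<partial>lborel) \<le> ennreal annulus_area * (\<integral>\<^sup>+ r. shell2 f x r * indicator {0..\<delta>} r \<partial>lborel)" .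
    have "0 \<le> annulus_area" "0 \<le> \<delta>" using annulus_area \<delta> by (simp_all add: less_imp_le)
    then have e: "ennreal (annulus_area * \<delta>) = ennreal annulus_area * ennreal \<delta>" by (rule ennreal_mult)
    note CS
    also have "(\<integral>\<^sup>+ r. (shell f x r * indicator {0..\<delta>} r)\<^sup>2 \<partial>lborel) * (\<integral>\<^sup>+ r. (indicator {0..\<delta>} r)\<^sup>2 \<partial>lborel)
        \<le> (ennreal annulus_area * (\<integral>\<^sup>+ r. shell2 f x r * indicator {0..\<delta>} r \<partial>lborel)) * ennreal \<delta>"
      unfolding G by (rule mult_right_mono[OF F]) simp
    finally show ?thesis unfolding e by (simp only: mult_ac)
  qed
  have "(\<integral>\<^sup>+ x. (\<integral>\<^sup>+ r. shell f x r * indicator {0..\<delta>} r \<partial>lborel)\<^sup>2 \<partial>lborel) \<le>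
      (\<integral>\<^sup>+ x. ennreal (annulus_area * \<delta>) * (\<integral>\<^sup>+ r. shell2 f x r * indicator {0..\<delta>} r \<partial>lborel) \<partial>lborel)"
    by (intro nn_integral_mono 1)
  also have "\<dots> = ennreal (annulus_area * \<delta>) * (\<integral>\<^sup>+ x. (\<integral>\<^sup>+ r. shell2 f x r * indicator {0..\<delta>} r \<partial>lborel) \<partial>lborel)"
    by (rule nn_integral_cmult) measurable
  also have "(\<integral>\<^sup>+ x. (\<integral>\<^sup>+ r. shell2 f x r * indicator {0..\<delta>} r \<partial>lborel) \<partial>lborel) = (\<integral>\<^sup>+ r. (\<integral>\<^sup>+ x. shell2 f x r * indicator {0..\<delta>} r \<partial>lborel) \<partial>lborel)"
    by (rule lborel_pair.Fubini') measurable
  also have "\<dots> = (\<integral>\<^sup>+ r. (ennreal annulus_area * A) * indicator {0..\<delta>} r \<partial>lborel)"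
  proof (rule nn_integral_cong)
    fix r :: real
    have "(\<integral>\<^sup>+ x. shell2 f x r \<partial>lborel) = (\<integral>\<^sup>+ z. (\<integral>\<^sup>+ x. (ennreal (f (x + r *\<^sub>R z)))\<^sup>2 * indicator Ann z \<partial>lborel) \<partial>lborel)"
      unfolding shell2_def by (rule lborel_pair.Fubini') measurable
    also have "\<dots> = (\<integral>\<^sup>+ z. A * indicator Ann z \<partial>lborel)"
    proof (rule nn_integral_cong)
      fix z
      have "(\<integral>\<^sup>+ x. (ennreal (f (x + r *\<^sub>R z)))\<^sup>2 * indicator Ann z \<partial>lborel) = (\<integral>\<^sup>+ x. (ennreal (f (r *\<^sub>R z + x)))\<^sup>2 \<partial>lborel) * indicator Ann z"
        by (subst nn_integral_multc) (simp_all add: add.commute)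
      also have "(\<integral>\<^sup>+ x. (ennreal (f (r *\<^sub>R z + x)))\<^sup>2 \<partial>lborel) = A"
        unfolding A_def by (rule nn_integral_translate) measurable
      finally show "(\<integral>\<^sup>+ x. (ennreal (f (x + r *\<^sub>R z)))\<^sup>2 * indicator Ann z \<partial>lborel) = A * indicator Ann z" .
    qed
    also have "\<dots> = A * ennreal annulus_area" by (simp add: nn_integral_cmult_indicator annulus_area)
    finally show "(\<integral>\<^sup>+ x. shell2 f x r * indicator {0..\<delta>} r \<partial>lborel) = (ennreal annulus_area * A) * indicator {0..\<delta>} r"
      by (subst nn_integral_multc) (simp_all add: mult.commute)
  qed
  also have "\<dots> = ennreal annulus_area * A * ennreal \<delta>" using \<delta> by (simp add: nn_integral_cmult_indicator)
  also have "ennreal (annulus_area * \<delta>) * (ennreal annulus_area * A * ennreal \<delta>) = ennreal ((annulus_area * \<delta>)\<^sup>2) * A"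
    using annulus_area \<delta> by (simp add: ennreal_mult power2_eq_square mult_ac)
  finally show ?thesis by (simp add: A_def)
qed

text \<open>For each z in the annulus the fundamental theorem along the ray from x to x + 4 z bounds
  |\<phi> x|, because \<phi> vanishes at the far end. Integrating over z gives the factor
  \<open>annulus_area\<close>.\<close>

lemma Trudinger_pointwise:
  assumes \<phi>: "test_fun \<phi>"
  shows "ennreal (annulus_area * \<bar>\<phi> x\<bar>) \<le> (\<integral>\<^sup>+ r. shell (\<lambda>x. norm (grad \<phi> x)) x r * indicator {0..4} r \<partial>lborel)"
proof (cases "x \<in> B1")
  case False
  then show ?thesis using test_fun_outside(1)[OF \<phi>] by simp
next
  case True
  define f where "f x = norm (grad \<phi> x)" for x
  have fc: "continuous_on UNIV f" unfolding f_def by (intro continuous_intros test_fun_cont(3)[OF \<phi>])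
  have fm [measurable]: "f \<in> borel_measurable borel" by (rule borel_measurable_continuous_onI[OF fc])
  have line: "ennreal \<bar>\<phi> x\<bar> \<le> (\<integral>\<^sup>+ r. ennreal (f (x + r *\<^sub>R z)) * indicator {0..4} r \<partial>lborel)" if z: "z \<in> Ann" for z
  proof -
    have c4: "continuous_on {0..4} (\<lambda>r. f (x + r *\<^sub>R z))"
      by (rule continuous_on_compose2[OF fc]) (auto intro!: continuous_intros)
    have "((\<lambda>r. grad \<phi> (x + r *\<^sub>R z) \<bullet> z) has_integral \<phi> (x + 4 *\<^sub>R z) - \<phi> (x + 0 *\<^sub>R z)) {0..4}"
    proof (rule fundamental_theorem_of_calculus)
      fix r :: real
      have l: "((\<lambda>r. x + r *\<^sub>R z) has_derivative (\<lambda>h. h *\<^sub>R z)) (at r within {0..4})"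
        by (auto intro!: derivative_eq_intros)
      have "(\<phi> has_derivative (\<lambda>h. grad \<phi> (x + r *\<^sub>R z) \<bullet> h)) (at (x + r *\<^sub>R z))"
        by (rule has_derivative_grad[OF test_fun_differentiable[OF \<phi>]])
      from has_derivative_compose[OF l this]
      have "((\<lambda>r. \<phi> (x + r *\<^sub>R z)) has_derivative (\<lambda>h. grad \<phi> (x + r *\<^sub>R z) \<bullet> (h *\<^sub>R z))) (at r within {0..4})" .
      then show "((\<lambda>r. \<phi> (x + r *\<^sub>R z)) has_vector_derivative grad \<phi> (x + r *\<^sub>R z) \<bullet> z) (at r within {0..4})"
        by (simp add: has_vector_derivative_def)
    qed simp
    moreover have "\<phi> (x + 4 *\<^sub>R z) = 0"
    proof -
      have "2 \<le> norm (4 *\<^sub>R z)" "norm x < 1" using z True by (simp_all add: Ann_def)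
      moreover have "norm (4 *\<^sub>R z) \<le> norm (x + 4 *\<^sub>R z) + norm x"
        using norm_triangle_ineq4[of "x + 4 *\<^sub>R z" x] by simp
      ultimately have "x + 4 *\<^sub>R z \<notin> B1" by simp
      then show ?thesis using test_fun_outside(1)[OF \<phi>] by simp
    qed
    ultimately have hi: "((\<lambda>r. grad \<phi> (x + r *\<^sub>R z) \<bullet> z) has_integral - \<phi> x) {0..4}" by simp
    have "norm (integral {0..4} (\<lambda>r. grad \<phi> (x + r *\<^sub>R z) \<bullet> z)) \<le> integral {0..4} (\<lambda>r. f (x + r *\<^sub>R z))"
    proof (rule integral_norm_bound_integral)
      show "(\<lambda>r. grad \<phi> (x + r *\<^sub>R z) \<bullet> z) integrable_on {0..4}" using hi by blast
      show "(\<lambda>r. f (x + r *\<^sub>R z)) integrable_on {0..4}" by (rule integrable_continuous_real[OF c4])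
      fix r
      have "\<bar>grad \<phi> (x + r *\<^sub>R z) \<bullet> z\<bar> \<le> norm (grad \<phi> (x + r *\<^sub>R z)) * norm z" by (rule Cauchy_Schwarz_ineq2)
      also have "\<dots> \<le> f (x + r *\<^sub>R z) * 1" using z unfolding f_def by (intro mult_left_mono) (simp_all add: Ann_def)
      finally show "norm (grad \<phi> (x + r *\<^sub>R z) \<bullet> z) \<le> f (x + r *\<^sub>R z)" by simp
    qed
    then have "\<bar>\<phi> x\<bar> \<le> integral {0..4} (\<lambda>r. f (x + r *\<^sub>R z))" using integral_unique[OF hi] by simp
    moreover have "(\<integral>\<^sup>+ r. ennreal (f (x + r *\<^sub>R z)) * indicator {0..4} r \<partial>lborel) = ennreal (integral {0..4} (\<lambda>r. f (x + r *\<^sub>R z)))"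
      by (rule nn_integral_has_integral_lebesgue') (simp_all add: f_def integrable_integral integrable_continuous_real[OF c4, unfolded f_def])
    ultimately show ?thesis by (simp add: ennreal_leI)
  qed
  have "(\<integral>\<^sup>+ z. ennreal \<bar>\<phi> x\<bar> * indicator Ann z \<partial>lborel) = ennreal \<bar>\<phi> x\<bar> * ennreal annulus_area"
    by (subst nn_integral_cmult_indicator) (simp_all add: annulus_area)
  also have "\<dots> = ennreal (annulus_area * \<bar>\<phi> x\<bar>)"
    using annulus_area by (subst ennreal_mult) (simp_all add: mult.commute)
  finally have "ennreal (annulus_area * \<bar>\<phi> x\<bar>) = (\<integral>\<^sup>+ z. ennreal \<bar>\<phi> x\<bar> * indicator Ann z \<partial>lborel)"
    by (rule sym)
  also have "\<dots> \<le> (\<integral>\<^sup>+ z. (\<integral>\<^sup>+ r. ennreal (f (x + r *\<^sub>R z)) * indicator Ann z * indicator {0..4} r \<partial>lborel) \<partial>lborel)"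
  proof (rule nn_integral_mono)
    fix z show "ennreal \<bar>\<phi> x\<bar> * indicator Ann z \<le> (\<integral>\<^sup>+ r. ennreal (f (x + r *\<^sub>R z)) * indicator Ann z * indicator {0..4} r \<partial>lborel)"
      using line[of z] by (cases "z \<in> Ann") simp_all
  qed
  also have "\<dots> = (\<integral>\<^sup>+ r. (\<integral>\<^sup>+ z. ennreal (f (x + r *\<^sub>R z)) * indicator Ann z * indicator {0..4} r \<partial>lborel) \<partial>lborel)"
    by (rule lborel_pair.Fubini') measurable
  also have "\<dots> = (\<integral>\<^sup>+ r. shell f x r * indicator {0..4} r \<partial>lborel)"
    unfolding shell_def by (rule nn_integral_cong, rule nn_integral_multc) measurable
  finally show ?thesis by (simp add: f_def[abs_def])
qed

text \<open>The radius \<delta> is adapted to k so that the far part is at most half of c k. On the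
  level set the near part must supply the other half, and Markov's inequality bounds the measure by
  a multiple of \<delta>^2, which is a Gaussian in k.\<close>

lemma Trudinger_level:
  assumes \<phi>: "test_fun \<phi>" and A: "0 < A" "A \<le> 1 / 16" and k: "0 < k"
    and grad_le: "(\<integral>\<^sup>+ y. (ennreal (norm (grad \<phi> y)))\<^sup>2 \<partial>lborel) \<le> ennreal A"
  shows "emeasure lborel {x. k \<le> \<bar>\<phi> x\<bar>} \<le> ennreal (64 * A / k\<^sup>2 * exp (- 12 * k\<^sup>2))"
proof -
  define f where "f x = norm (grad \<phi> x)" for x
  define c where "c = annulus_area"
  have c: "3 / 2 \<le> c" "0 < c" using annulus_area by (simp_all add: c_def)
  have fc: "continuous_on UNIV f" unfolding f_def by (intro continuous_intros test_fun_cont(3)[OF \<phi>])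
  have fm [measurable]: "f \<in> borel_measurable borel" by (rule borel_measurable_continuous_onI[OF fc])
  have shm [measurable]: "(\<lambda>(x, r). shell f x r) \<in> borel_measurable (borel \<Otimes>\<^sub>M borel)"
    unfolding shell_def by measurable
  \<comment> \<open>L solves c L A = (c k / 2)^2, the equation that makes the bound of
    \<open>far_part\<close> equal to half of c k.\<close>
  define L where "L = c * k\<^sup>2 / (4 * A)"
  define \<delta> where "\<delta> = 4 * exp (- L)"
  have L: "0 < L" using c k A by (simp add: L_def)
  have \<delta>: "0 < \<delta>" "\<delta> < 4" using L by (simp_all add: \<delta>_def)
  have "4 / \<delta> = exp L" by (simp add: \<delta>_def exp_minus field_simps)
  then have ln\<delta>: "ln (4 / \<delta>) = L" by simp
  define P where "P x = (\<integral>\<^sup>+ r. shell f x r * indicator {0..\<delta>} r \<partial>lborel)" for x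
  define S where "S x = (\<integral>\<^sup>+ r. shell f x r * indicator {\<delta>..4} r \<partial>lborel)" for x
  have Pm [measurable]: "P \<in> borel_measurable borel" unfolding P_def by measurable
  have S: "S x \<le> ennreal (c * k / 2)" for x
  proof -
    have "(S x)\<^sup>2 \<le> ennreal (c * L) * (\<integral>\<^sup>+ y. (ennreal (f y))\<^sup>2 \<partial>lborel)"
      using far_part[OF fm \<delta>, of x] unfolding S_def ln\<delta> c_def .
    also have "\<dots> \<le> ennreal (c * L) * ennreal A"
      using grad_le unfolding f_def by (rule mult_left_mono) simp
    also have "\<dots> = ennreal (c * L * A)" using c L A by (intro ennreal_mult[symmetric]) simp_all
    also have "c * L * A = (c * k / 2)\<^sup>2" using A by (simp add: L_def power2_eq_square)
    finally have *: "(S x)\<^sup>2 \<le> ennreal ((c * k / 2)\<^sup>2)" .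
    show ?thesis
    proof (cases "S x")
      case (real s)
      then have "ennreal (s\<^sup>2) \<le> ennreal ((c * k / 2)\<^sup>2)" using * by (simp add: ennreal_power)
      then have "s\<^sup>2 \<le> (c * k / 2)\<^sup>2" by simp
      then have "s \<le> c * k / 2" by (rule power2_le_imp_le) (use c k in simp)
      then show ?thesis using real by (simp add: ennreal_leI)
    next
      case top
      then show ?thesis using * by (simp add: top_unique)
    qed
  qed
  have PS: "ennreal (c * \<bar>\<phi> x\<bar>) \<le> P x + S x" for x
  proof -
    have "ennreal (c * \<bar>\<phi> x\<bar>) \<le> (\<integral>\<^sup>+ r. shell f x r * indicator {0..4} r \<partial>lborel)"
      using Trudinger_pointwise[OF \<phi>, of x] by (simp add: c_def f_def[abs_def])
    also have "\<dots> \<le> (\<integral>\<^sup>+ r. shell f x r * indicator {0..\<delta>} r + shell f x r * indicator {\<delta>..4} r \<partial>lborel)"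
    proof (rule nn_integral_mono)
      fix r :: real
      show "shell f x r * indicator {0..4} r \<le> shell f x r * indicator {0..\<delta>} r + shell f x r * indicator {\<delta>..4} r"
      proof (cases "r \<in> {0..4}")
        case True
        then show ?thesis by (cases "r \<le> \<delta>") simp_all
      qed simp
    qed
    also have "\<dots> = P x + S x" unfolding P_def S_def by (rule nn_integral_add) measurable
    finally show ?thesis .
  qed
  define C where "C = 4 / (c * k)\<^sup>2"
  have C: "0 < C" using c k by (simp add: C_def)
  have "{x. k \<le> \<bar>\<phi> x\<bar>} \<subseteq> {x \<in> UNIV. 1 \<le> ennreal C * (P x)\<^sup>2}"
  proof (intro subsetI CollectI conjI UNIV_I)
    fix x assume "x \<in> {x. k \<le> \<bar>\<phi> x\<bar>}"
    then have "c * k \<le> c * \<bar>\<phi> x\<bar>" using c by simp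
    then have *: "ennreal (c * k) \<le> P x + S x" using PS[of x] ennreal_leI order.trans by blast
    show "1 \<le> ennreal C * (P x)\<^sup>2"
    proof (cases "P x")
      case (real q)
      obtain s where s: "S x = ennreal s" "0 \<le> s" "s \<le> c * k / 2"
      proof (cases "S x")
        case (real s)
        then show ?thesis using that[of s] S[of x] c k by simp
      next
        case top
        then show ?thesis using S[of x] by (simp add: top_unique)
      qed
      have nn: "0 \<le> q + s" using real(1) s(2) by simp
      have "ennreal (c * k) \<le> ennreal (q + s)"
        using * unfolding real(2) s(1) ennreal_plus[OF real(1) s(2)] .
      then have "c * k \<le> q + s" by (simp only: ennreal_le_iff[OF nn])
      then have "c * k / 2 \<le> q" using s by simp
      then have "(c * k / 2)\<^sup>2 \<le> q\<^sup>2" using c k by (intro power_mono) simp_all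
      then have "1 \<le> C * q\<^sup>2" using c k by (simp add: C_def field_simps power_mult_distrib)
      then show ?thesis using real C by (simp add: ennreal_power ennreal_mult[symmetric])
    next
      case top
      then show ?thesis using C by (simp add: ennreal_mult_top)
    qed
  qed
  then have "emeasure lborel {x. k \<le> \<bar>\<phi> x\<bar>} \<le> emeasure lborel {x \<in> UNIV. 1 \<le> ennreal C * (P x)\<^sup>2}"
    by (rule emeasure_mono) measurable
  also have "\<dots> \<le> ennreal C * (\<integral>\<^sup>+ x. (P x)\<^sup>2 * indicator UNIV x \<partial>lborel)"
    by (rule nn_integral_Markov_inequality) simp_all
  also have "\<dots> \<le> ennreal C * (ennreal ((c * \<delta>)\<^sup>2) * ennreal A)"
  proof (rule mult_left_mono)
    have "(\<integral>\<^sup>+ x. (P x)\<^sup>2 * indicator UNIV x \<partial>lborel) \<le> ennreal ((c * \<delta>)\<^sup>2) * (\<integral>\<^sup>+ y. (ennreal (f y))\<^sup>2 \<partial>lborel)"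
      using near_part[OF fm \<delta>(1)] by (simp add: P_def c_def)
    also have "\<dots> \<le> ennreal ((c * \<delta>)\<^sup>2) * ennreal A"
      using grad_le unfolding f_def by (rule mult_left_mono) simp
    finally show "(\<integral>\<^sup>+ x. (P x)\<^sup>2 * indicator UNIV x \<partial>lborel) \<le> ennreal ((c * \<delta>)\<^sup>2) * ennreal A" .
  qed simp
  also have "\<dots> = ennreal (C * ((c * \<delta>)\<^sup>2 * A))" using C A by (simp add: ennreal_mult)
  also have "C * ((c * \<delta>)\<^sup>2 * A) = 64 * A / k\<^sup>2 * (exp (- L))\<^sup>2"
    using c k by (simp add: C_def \<delta>_def power_mult_distrib field_simps)
  also have "(exp (- L))\<^sup>2 = exp (- 2 * L)" using exp_double[of "- L"] by simp
  also have "ennreal (64 * A / k\<^sup>2 * exp (- 2 * L)) \<le> ennreal (64 * A / k\<^sup>2 * exp (- 12 * k\<^sup>2))"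
  proof -
    \<comment> \<open>From c \<ge> 3/2 and A \<le> 1/16 it follows that 2 L = c k^2 / (2 A) is at
      least 12 k^2.\<close>
    have "12 * k\<^sup>2 * (2 * A) \<le> 12 * k\<^sup>2 * (1 / 8)" using A by (intro mult_left_mono) simp_all
    also have "\<dots> \<le> c * k\<^sup>2" using c mult_right_mono[of "3 / 2" c "k\<^sup>2"] by simp
    finally have "12 * k\<^sup>2 \<le> 2 * L" using A by (simp add: L_def field_simps)
    then show ?thesis using A by (intro ennreal_leI mult_left_mono) simp_all
  qed
  finally show ?thesis .
qed

text \<open>By n + 2 \<le> 2 (n + 1) the growth exp (2 (n + 2)^2) is at most exp (8 (n + 1)^2),
  which the decay with exponent 12 beats by a geometric margin.\<close>

lemma level_sum_bound:
  assumes "0 < A"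
  shows "(real n + 2)\<^sup>2 * exp (2 * (real n + 2)\<^sup>2) * (64 * A / (real n + 1)\<^sup>2 * exp (- 12 * (real n + 1)\<^sup>2)) \<le> 256 * A * (1 / 2) ^ Suc n"
proof -
  define m where "m = real n + 1"
  have m: "1 \<le> m" by (simp add: m_def)
  have "(real n + 2)\<^sup>2 \<le> (2 * m)\<^sup>2" by (intro power_mono) (simp_all add: m_def)
  then have q: "(real n + 2)\<^sup>2 \<le> 4 * m\<^sup>2" by (simp add: power_mult_distrib)
  have "(real n + 2)\<^sup>2 * exp (2 * (real n + 2)\<^sup>2) \<le> (4 * m\<^sup>2) * exp (8 * m\<^sup>2)"
    using q by (intro mult_mono) simp_all
  then have "(real n + 2)\<^sup>2 * exp (2 * (real n + 2)\<^sup>2) * (64 * A / m\<^sup>2 * exp (- 12 * m\<^sup>2)) \<le>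
      (4 * m\<^sup>2) * exp (8 * m\<^sup>2) * (64 * A / m\<^sup>2 * exp (- 12 * m\<^sup>2))"
    using assms by (intro mult_right_mono) simp_all
  also have "\<dots> = 256 * A * (exp (8 * m\<^sup>2) * exp (- 12 * m\<^sup>2))" using m by simp
  also have "exp (8 * m\<^sup>2) * exp (- 12 * m\<^sup>2) = exp (- 4 * m\<^sup>2)" by (simp flip: exp_add)
  also have "256 * A * exp (- 4 * m\<^sup>2) \<le> 256 * A * (1 / 2) ^ Suc n"
  proof -
    have "m \<le> m\<^sup>2" using m by (simp add: power2_eq_square)
    then have "m \<le> 4 * m\<^sup>2" using m by linarith
    then have "exp (- 4 * m\<^sup>2) \<le> exp (- m)" by simp
    also have "exp (- m) = exp (real (Suc n) * (- 1))" by (simp add: m_def)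
    also have "\<dots> = exp (- 1) ^ Suc n" by (rule exp_of_nat_mult)
    also have "\<dots> \<le> (1 / 2) ^ Suc n"
    proof (rule power_mono)
      have "2 \<le> exp (1 :: real)" using exp_ge_add_one_self[of 1] by simp
      then show "exp (- 1) \<le> (1 / 2 :: real)" by (simp add: exp_minus field_simps)
    qed simp
    finally show ?thesis using assms by (intro mult_left_mono) simp_all
  qed
  finally show ?thesis by (simp add: m_def)
qed

text \<open>Where |\<phi>| < 1 the exponential is at most e^2 \<le> 9. Above that, each layer of
  height one contributes its largest value times the measure of a level set. The total is 9 A + 256
  A.\<close>

lemma Trudinger_test_fun:
  assumes \<phi>: "test_fun \<phi>" and A: "0 < A" "A \<le> 1 / 16"
    and grad_le: "(\<integral>\<^sup>+ y. (ennreal (norm (grad \<phi> y)))\<^sup>2 \<partial>lborel) \<le> ennreal A"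
    and phi_le: "(\<integral>\<^sup>+ y. ennreal ((\<phi> y)\<^sup>2) \<partial>lborel) \<le> ennreal A"
  shows "(\<integral>\<^sup>+ x. ennreal ((\<phi> x)\<^sup>2 * exp (2 * (\<phi> x)\<^sup>2)) \<partial>lborel) \<le> ennreal (300 * A)"
proof -
  have \<phi>m [measurable]: "\<phi> \<in> borel_measurable borel" by (rule borel_measurable_continuous_onI[OF test_fun_cont(1)[OF \<phi>]])
  define E where "E n = {x. real n + 1 \<le> \<bar>\<phi> x\<bar>}" for n
  have [measurable]: "E n \<in> sets borel" for n unfolding E_def by measurable
  define a where "a n = (real n + 2)\<^sup>2 * exp (2 * (real n + 2)\<^sup>2)" for n
  have a0: "0 \<le> a n" for n by (simp add: a_def)
  have pw: "ennreal ((\<phi> x)\<^sup>2 * exp (2 * (\<phi> x)\<^sup>2)) \<le> ennreal 9 * ennreal ((\<phi> x)\<^sup>2) + (\<Sum>n. ennreal (a n) * indicator (E n) x)" for x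
  proof (cases "\<bar>\<phi> x\<bar> < 1")
    case True
    have "(\<phi> x)\<^sup>2 \<le> 1" using True by (simp add: abs_square_le_1 less_imp_le)
    then have "exp (2 * (\<phi> x)\<^sup>2) \<le> exp (2 * 1)" by simp
    also have "\<dots> = (exp 1)\<^sup>2" by (rule exp_double)
    also have "\<dots> \<le> 3\<^sup>2" using exp_le by (intro power_mono) simp_all
    finally have "(\<phi> x)\<^sup>2 * exp (2 * (\<phi> x)\<^sup>2) \<le> (\<phi> x)\<^sup>2 * 9" by (intro mult_left_mono) simp_all
    then have "ennreal ((\<phi> x)\<^sup>2 * exp (2 * (\<phi> x)\<^sup>2)) \<le> ennreal (9 * (\<phi> x)\<^sup>2)" by (intro ennreal_leI) simp
    also have "\<dots> = ennreal 9 * ennreal ((\<phi> x)\<^sup>2)" by (rule ennreal_mult) simp_all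
    also have "\<dots> \<le> ennreal 9 * ennreal ((\<phi> x)\<^sup>2) + (\<Sum>n. ennreal (a n) * indicator (E n) x)" by simp
    finally show ?thesis .
  next
    case False
    \<comment> \<open>Layer n begins at height n + 1, hence the shift by one from the floor.\<close>
    define n where "n = nat \<lfloor>\<bar>\<phi> x\<bar>\<rfloor> - 1"
    have fl: "1 \<le> \<lfloor>\<bar>\<phi> x\<bar>\<rfloor>" using False by (simp add: le_floor_iff)
    then have "int n = \<lfloor>\<bar>\<phi> x\<bar>\<rfloor> - 1" unfolding n_def by linarith
    then have "real_of_int (int n) = real_of_int (\<lfloor>\<bar>\<phi> x\<bar>\<rfloor> - 1)" by (rule arg_cong)
    then have "real n = real_of_int \<lfloor>\<bar>\<phi> x\<bar>\<rfloor> - 1" by simp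
    then have n: "real n + 1 \<le> \<bar>\<phi> x\<bar>" "\<bar>\<phi> x\<bar> \<le> real n + 2" by linarith+
    have "\<bar>\<phi> x\<bar>\<^sup>2 \<le> (real n + 2)\<^sup>2" using n by (intro power_mono) simp_all
    then have le: "(\<phi> x)\<^sup>2 \<le> (real n + 2)\<^sup>2" by simp
    then have "(\<phi> x)\<^sup>2 * exp (2 * (\<phi> x)\<^sup>2) \<le> a n" unfolding a_def by (intro mult_mono) simp_all
    then have "ennreal ((\<phi> x)\<^sup>2 * exp (2 * (\<phi> x)\<^sup>2)) \<le> ennreal (a n)" by (rule ennreal_leI)
    also have "\<dots> = (\<Sum>m\<in>{n}. ennreal (a m) * indicator (E m) x)" using n by (simp add: E_def)
    also have "\<dots> \<le> (\<Sum>n. ennreal (a n) * indicator (E n) x)" by (rule sum_le_suminf) (simp_all add: summableI)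
    also have "\<dots> \<le> ennreal 9 * ennreal ((\<phi> x)\<^sup>2) + (\<Sum>n. ennreal (a n) * indicator (E n) x)" by simp
    finally show ?thesis .
  qed
  have "(\<integral>\<^sup>+ x. ennreal ((\<phi> x)\<^sup>2 * exp (2 * (\<phi> x)\<^sup>2)) \<partial>lborel) \<le>
      (\<integral>\<^sup>+ x. ennreal 9 * ennreal ((\<phi> x)\<^sup>2) + (\<Sum>n. ennreal (a n) * indicator (E n) x) \<partial>lborel)"
    by (rule nn_integral_mono[OF pw])
  also have "\<dots> = (\<integral>\<^sup>+ x. ennreal 9 * ennreal ((\<phi> x)\<^sup>2) \<partial>lborel) + (\<integral>\<^sup>+ x. (\<Sum>n. ennreal (a n) * indicator (E n) x) \<partial>lborel)"
    by (rule nn_integral_add) measurable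
  also have "(\<integral>\<^sup>+ x. ennreal 9 * ennreal ((\<phi> x)\<^sup>2) \<partial>lborel) = ennreal 9 * (\<integral>\<^sup>+ x. ennreal ((\<phi> x)\<^sup>2) \<partial>lborel)"
    by (rule nn_integral_cmult) measurable
  also have "(\<integral>\<^sup>+ x. (\<Sum>n. ennreal (a n) * indicator (E n) x) \<partial>lborel) = (\<Sum>n. \<integral>\<^sup>+ x. ennreal (a n) * indicator (E n) x \<partial>lborel)"
    by (rule nn_integral_suminf) measurable
  also have "\<dots> = (\<Sum>n. ennreal (a n) * emeasure lborel (E n))"
    by (simp add: nn_integral_cmult_indicator)
  also have "ennreal 9 * (\<integral>\<^sup>+ x. ennreal ((\<phi> x)\<^sup>2) \<partial>lborel) + (\<Sum>n. ennreal (a n) * emeasure lborel (E n))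
      \<le> ennreal 9 * ennreal A + ennreal (256 * A)"
  proof (rule add_mono)
    show "ennreal 9 * (\<integral>\<^sup>+ x. ennreal ((\<phi> x)\<^sup>2) \<partial>lborel) \<le> ennreal 9 * ennreal A"
      by (rule mult_left_mono[OF phi_le]) simp
    have "ennreal (a n) * emeasure lborel (E n) \<le> ennreal (256 * A * (1 / 2) ^ Suc n)" for n
    proof -
      have "ennreal (a n) * emeasure lborel (E n) \<le> ennreal (a n) * ennreal (64 * A / (real n + 1)\<^sup>2 * exp (- 12 * (real n + 1)\<^sup>2))"
        unfolding E_def by (rule mult_left_mono[OF Trudinger_level[OF \<phi> A _ grad_le]]) simp_all
      also have "\<dots> = ennreal (a n * (64 * A / (real n + 1)\<^sup>2 * exp (- 12 * (real n + 1)\<^sup>2)))"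
        using A a0 by (intro ennreal_mult[symmetric]) simp_all
      also have "\<dots> \<le> ennreal (256 * A * (1 / 2) ^ Suc n)"
        unfolding a_def by (rule ennreal_leI[OF level_sum_bound[OF A(1)]])
      finally show ?thesis .
    qed
    then have "(\<Sum>n. ennreal (a n) * emeasure lborel (E n)) \<le> (\<Sum>n. ennreal (256 * A * (1 / 2) ^ Suc n))"
      by (rule suminf_le[OF _ summableI summableI])
    also have "\<dots> = ennreal (256 * A)"
    proof (rule suminf_ennreal_eq)
      show "(\<lambda>n. 256 * A * (1 / 2) ^ Suc n) sums (256 * A)"
        using sums_mult[OF power_half_series, of "256 * A"] by simp
    qed (use A in simp)
    finally show "(\<Sum>n. ennreal (a n) * emeasure lborel (E n)) \<le> ennreal (256 * A)" .
  qed
  also have "ennreal 9 * ennreal A + ennreal (256 * A) = ennreal (9 * A + 256 * A)"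
  proof -
    have "ennreal 9 * ennreal A = ennreal (9 * A)" using A by (intro ennreal_mult[symmetric]) simp_all
    moreover have "ennreal (9 * A) + ennreal (256 * A) = ennreal (9 * A + 256 * A)"
      using A by (intro ennreal_plus[symmetric]) simp_all
    ultimately show ?thesis by (simp only:)
  qed
  also have "\<dots> \<le> ennreal (300 * A)" using A by (intro ennreal_leI) simp
  finally show ?thesis .
qed

lemma L2_sq_tendsto:
  fixes v :: "real ^ 2 \<Rightarrow> 'b::euclidean_space"
  assumes g: "\<And>n. L2 (g n)" "L2 v" and l: "(\<lambda>n. LINT x|leb_B1. (norm (g n x - v x))\<^sup>2) \<longlonglongrightarrow> 0"
  shows "(\<lambda>n. LINT x|leb_B1. (norm (g n x))\<^sup>2) \<longlonglongrightarrow> (LINT x|leb_B1. (norm (v x))\<^sup>2)"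
proof -
  let ?V = "LINT x|leb_B1. (norm (v x))\<^sup>2"
  have iv: "(LINT x|leb_B1. v x \<bullet> v x) = ?V" by (simp add: power2_norm_eq_inner)
  have L: "L2 (\<lambda>x. g n x - v x)" for n
    using L2_add[OF g(1) L2_scale[OF g(2)], of n "-1"] by simp
  have i: "integrable leb_B1 (\<lambda>x. (norm (g n x - v x))\<^sup>2)" "integrable leb_B1 (\<lambda>x. v x \<bullet> g n x)"
    "integrable leb_B1 (\<lambda>x. (norm (v x))\<^sup>2)" for n
    using L[of n] L2_inner[OF g(2) g(1)] g(2) unfolding L2_def by blast+
  have eq: "(LINT x|leb_B1. (norm (g n x))\<^sup>2) =
      (LINT x|leb_B1. (norm (g n x - v x))\<^sup>2) + 2 * (LINT x|leb_B1. v x \<bullet> g n x) - ?V" for n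
  proof -
    have "(LINT x|leb_B1. (norm (g n x))\<^sup>2) = (LINT x|leb_B1. (norm (g n x - v x))\<^sup>2 + 2 * (v x \<bullet> g n x) - (norm (v x))\<^sup>2)"
      by (rule Bochner_Integration.integral_cong[OF refl])
        (simp add: power2_norm_eq_inner inner_diff_left inner_diff_right inner_commute)
    also have "\<dots> = (LINT x|leb_B1. (norm (g n x - v x))\<^sup>2) + 2 * (LINT x|leb_B1. v x \<bullet> g n x) - ?V"
      by (simp only: Bochner_Integration.integral_add Bochner_Integration.integral_diff integral_mult_right_zero
          integrable_mult_right Bochner_Integration.integrable_add i simp_thms)
    finally show ?thesis .
  qed
  have "(\<lambda>n. (LINT x|leb_B1. (norm (g n x - v x))\<^sup>2) + 2 * (LINT x|leb_B1. v x \<bullet> g n x) - ?V) \<longlonglongrightarrow> 0 + 2 * (LINT x|leb_B1. v x \<bullet> v x) - ?V"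
    by (rule tendsto_diff[OF tendsto_add[OF l tendsto_mult_left[OF L2_inner_tendsto[OF g(2) g l]]] tendsto_const])
  then show ?thesis unfolding eq iv by simp
qed

lemma nn_integral_leb_B1:
  fixes F :: "real ^ 2 \<Rightarrow> real"
  assumes "F \<in> borel_measurable borel" "\<And>x. x \<notin> B1 \<Longrightarrow> F x = 0"
  shows "(\<integral>\<^sup>+ x. ennreal (F x) \<partial>leb_B1) = (\<integral>\<^sup>+ x. ennreal (F x) \<partial>lborel)"
proof -
  have "(\<integral>\<^sup>+ x. ennreal (F x) \<partial>leb_B1) = (\<integral>\<^sup>+ x. ennreal (F x) * indicator B1 x \<partial>lebesgue)"
    by (rule nn_integral_restrict_space) simp
  also have "\<dots> = (\<integral>\<^sup>+ x. ennreal (F x) \<partial>lborel)"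
    unfolding nn_integral_completion
  proof (rule nn_integral_cong)
    fix x show "ennreal (F x) * indicator B1 x = ennreal (F x)" using assms(2)[of x] by (cases "x \<in> B1") simp_all
  qed
  finally show ?thesis .
qed

text \<open>Fatou's lemma along an almost everywhere convergent subsequence of approximating test
  functions. The strict inequality for A leaves room for the approximants to satisfy the energy
  bounds eventually.\<close>

lemma Trudinger:
  assumes v: "v \<in> H10" and A: "(H1_norm v)\<^sup>2 < A" "A \<le> 1 / 16"
  shows "integrable leb_B1 (\<lambda>x. (v x)\<^sup>2 * exp (2 * (v x)\<^sup>2))"
    "(LINT x|leb_B1. (v x)\<^sup>2 * exp (2 * (v x)\<^sup>2)) \<le> 300 * A"
proof -
  have A0: "0 < A" using A(1) zero_le_power2[of "H1_norm v"] by linarith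
  obtain \<phi> where \<phi>: "\<And>n. test_fun (\<phi> n)" "(\<lambda>n. LINT x|leb_B1. (\<phi> n x - v x)\<^sup>2) \<longlonglongrightarrow> 0"
    "(\<lambda>n. LINT x|leb_B1. (norm (grad (\<phi> n) x - wgrad v x))\<^sup>2) \<longlonglongrightarrow> 0"
    using H10_approx[OF v] by blast
  note Lv = H10_L2[OF v]
  have L\<phi>: "L2 (\<phi> n)" "L2 (grad (\<phi> n))" for n using weak_grad_L2[OF test_fun_weak_grad[OF \<phi>(1)]] .
  have \<phi>m: "\<phi> n \<in> borel_measurable borel" "grad (\<phi> n) \<in> borel_measurable borel" for n
    by (rule borel_measurable_continuous_onI, rule test_fun_cont(1)[OF \<phi>(1)],
        rule borel_measurable_continuous_onI, rule test_fun_cont(3)[OF \<phi>(1)])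
  have vm: "v \<in> borel_measurable leb_B1" using Lv(1) unfolding L2_def by blast
  have \<phi>m': "\<phi> n \<in> borel_measurable leb_B1" for n using L\<phi>(1) unfolding L2_def by blast
  define a where "a n = (LINT x|leb_B1. (norm (\<phi> n x))\<^sup>2)" for n
  define b where "b n = (LINT x|leb_B1. (norm (grad (\<phi> n) x))\<^sup>2)" for n
  have al: "a \<longlonglongrightarrow> (LINT x|leb_B1. (norm (v x))\<^sup>2)" unfolding a_def
    by (rule L2_sq_tendsto[OF L\<phi>(1) Lv(1)]) (use \<phi>(2) in simp)
  have bl: "b \<longlonglongrightarrow> (LINT x|leb_B1. (norm (wgrad v x))\<^sup>2)" unfolding b_def
    by (rule L2_sq_tendsto[OF L\<phi>(2) Lv(2) \<phi>(3)])
  have H: "(H1_norm v)\<^sup>2 = (LINT x|leb_B1. (norm (v x))\<^sup>2) + (LINT x|leb_B1. (norm (wgrad v x))\<^sup>2)"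
    using H1_norm_sq[OF wgrad[OF H10_H1[OF v]]] by simp
  have nn: "0 \<le> (LINT x|leb_B1. (norm (v x))\<^sup>2)" "0 \<le> (LINT x|leb_B1. (norm (wgrad v x))\<^sup>2)"
    by (rule Bochner_Integration.integral_nonneg, simp)+
  have ev: "\<forall>\<^sub>F n in sequentially. a n < A \<and> b n < A"
  proof (rule eventually_conj)
    show "\<forall>\<^sub>F n in sequentially. a n < A" by (rule order_tendstoD(2)[OF al]) (use H nn A in linarith)
    show "\<forall>\<^sub>F n in sequentially. b n < A" by (rule order_tendstoD(2)[OF bl]) (use H nn A in linarith)
  qed
  define F where "F t = t\<^sup>2 * exp (2 * t\<^sup>2)" for t :: real
  have Fc: "isCont F t" for t unfolding F_def by (intro continuous_intros)
  have Fm: "F \<in> borel_measurable borel" unfolding F_def by measurable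
  have F0: "0 \<le> F t" for t by (simp add: F_def)
  have bound: "(\<integral>\<^sup>+ x. ennreal (F (\<phi> n x)) \<partial>leb_B1) \<le> ennreal (300 * A)" if n: "a n < A \<and> b n < A" for n
  proof -
    have out: "x \<notin> B1 \<Longrightarrow> \<phi> n x = 0" "x \<notin> B1 \<Longrightarrow> grad (\<phi> n) x = 0" for x using test_fun_outside[OF \<phi>(1)] by blast+
    have "(\<integral>\<^sup>+ x. ennreal (F (\<phi> n x)) \<partial>leb_B1) = (\<integral>\<^sup>+ x. ennreal (F (\<phi> n x)) \<partial>lborel)"
      by (rule nn_integral_leb_B1) (use out measurable_compose[OF \<phi>m(1) Fm] in \<open>simp_all add: F_def\<close>)
    also have "\<dots> \<le> ennreal (300 * A)"
      unfolding F_def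
    proof (rule Trudinger_test_fun[OF \<phi>(1) A0 A(2)])
      have "(\<integral>\<^sup>+ y. (ennreal (norm (grad (\<phi> n) y)))\<^sup>2 \<partial>lborel) = (\<integral>\<^sup>+ y. ennreal ((norm (grad (\<phi> n) y))\<^sup>2) \<partial>leb_B1)"
        using out borel_measurable_power[OF measurable_compose[OF \<phi>m(2)[of n] borel_measurable_norm], of 2]
        by (subst nn_integral_leb_B1) (simp_all add: ennreal_power)
      also have "\<dots> = ennreal (b n)" unfolding b_def
        by (rule nn_integral_eq_integral) (use L\<phi>(2)[of n] in \<open>simp_all add: L2_def\<close>)
      finally show "(\<integral>\<^sup>+ y. (ennreal (norm (grad (\<phi> n) y)))\<^sup>2 \<partial>lborel) \<le> ennreal A" using n by (simp add: ennreal_leI)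
      have "(\<integral>\<^sup>+ y. ennreal ((\<phi> n y)\<^sup>2) \<partial>lborel) = (\<integral>\<^sup>+ y. ennreal ((\<phi> n y)\<^sup>2) \<partial>leb_B1)"
        using out by (subst nn_integral_leb_B1) (simp_all add: borel_measurable_power \<phi>m)
      also have "\<dots> = (\<integral>\<^sup>+ y. ennreal ((norm (\<phi> n y))\<^sup>2) \<partial>leb_B1)" by simp
      also have "\<dots> = ennreal (a n)" unfolding a_def
        by (rule nn_integral_eq_integral) (use L\<phi>(1)[of n] in \<open>simp_all add: L2_def\<close>)
      finally show "(\<integral>\<^sup>+ y. ennreal ((\<phi> n y)\<^sup>2) \<partial>lborel) \<le> ennreal A" using n by (simp add: ennreal_leI)
    qed
    finally show ?thesis .
  qed
  have "(\<lambda>n. LINT x|leb_B1. norm ((\<phi> n x - v x)\<^sup>2)) \<longlonglongrightarrow> 0" using \<phi>(2) by simp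
  moreover have "integrable leb_B1 (\<lambda>x. (\<phi> n x - v x)\<^sup>2)" for n
    using L2_add[OF L\<phi>(1) L2_scale[OF Lv(1)], of n "-1"] by (simp add: L2_def)
  ultimately obtain r where r: "strict_mono r" "AE x in leb_B1. (\<lambda>n. (\<phi> (r n) x - v x)\<^sup>2) \<longlonglongrightarrow> 0"
    using tendsto_L1_AE_subseq[of leb_B1 "\<lambda>n x. (\<phi> n x - v x)\<^sup>2"] by blast
  have AEF: "AE x in leb_B1. ennreal (F (v x)) = liminf (\<lambda>n. ennreal (F (\<phi> (r n) x)))"
    using r(2)
  proof eventually_elim
    case (elim x)
    from tendsto_real_sqrt[OF elim] have "(\<lambda>n. \<bar>\<phi> (r n) x - v x\<bar>) \<longlonglongrightarrow> 0" by (simp only: real_sqrt_abs real_sqrt_zero)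
    then have "(\<lambda>n. \<phi> (r n) x - v x) \<longlonglongrightarrow> 0" by (rule tendsto_rabs_zero_cancel)
    then have "(\<lambda>n. \<phi> (r n) x) \<longlonglongrightarrow> v x" by (rule LIM_zero_cancel)
    then have "(\<lambda>n. F (\<phi> (r n) x)) \<longlonglongrightarrow> F (v x)" by (rule isCont_tendsto_compose[OF Fc])
    then have "(\<lambda>n. ennreal (F (\<phi> (r n) x))) \<longlonglongrightarrow> ennreal (F (v x))" by (rule tendsto_ennrealI)
    then show ?case using lim_imp_Liminf[OF sequentially_bot] by metis
  qed
  have "(\<integral>\<^sup>+ x. ennreal (F (v x)) \<partial>leb_B1) = (\<integral>\<^sup>+ x. liminf (\<lambda>n. ennreal (F (\<phi> (r n) x))) \<partial>leb_B1)"
    by (rule nn_integral_cong_AE[OF AEF])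
  also have "\<dots> \<le> liminf (\<lambda>n. \<integral>\<^sup>+ x. ennreal (F (\<phi> (r n) x)) \<partial>leb_B1)"
    by (rule nn_integral_liminf, rule measurable_compose[OF measurable_compose[OF \<phi>m' Fm] measurable_ennreal])
  also have "\<dots> \<le> liminf (\<lambda>n. ennreal (300 * A))"
  proof (rule Liminf_mono)
    from eventually_subseq[OF r(1) ev]
    show "\<forall>\<^sub>F n in sequentially. (\<integral>\<^sup>+ x. ennreal (F (\<phi> (r n) x)) \<partial>leb_B1) \<le> ennreal (300 * A)"
      by (rule eventually_mono) (rule bound)
  qed
  also have "\<dots> = ennreal (300 * A)" by (simp add: Liminf_const)
  finally have fin: "(\<integral>\<^sup>+ x. ennreal (F (v x)) \<partial>leb_B1) \<le> ennreal (300 * A)" .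
  have mF: "(\<lambda>x. F (v x)) \<in> borel_measurable leb_B1" by (rule measurable_compose[OF vm Fm])
  have int: "integrable leb_B1 (\<lambda>x. F (v x))"
  proof (rule integrableI_bounded[OF mF])
    show "(\<integral>\<^sup>+ x. ennreal (norm (F (v x))) \<partial>leb_B1) < \<infinity>"
      using fin F0 by (simp add: le_less_trans)
  qed
  have "ennreal (LINT x|leb_B1. F (v x)) \<le> ennreal (300 * A)"
    using fin nn_integral_eq_integral[OF int] F0 by simp
  then have "(LINT x|leb_B1. F (v x)) \<le> 300 * A" using A0 by (simp add: ennreal_le_iff)
  with int show "integrable leb_B1 (\<lambda>x. (v x)\<^sup>2 * exp (2 * (v x)\<^sup>2))"
    "(LINT x|leb_B1. (v x)\<^sup>2 * exp (2 * (v x)\<^sup>2)) \<le> 300 * A" by (simp_all add: F_def)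
qed

text \<open>A enters the conclusion of \<open>Trudinger\<close> linearly, so it can be lowered to
  the squared norm. The quadratic dependence is what makes the Taylor remainder of the functional
  negligible against the norm.\<close>

lemma Trudinger_quadratic:
  assumes v: "v \<in> H10" and s: "H1_norm v < 1 / 4"
  shows "integrable leb_B1 (\<lambda>x. (v x)\<^sup>2 * exp (2 * (v x)\<^sup>2))"
    "(LINT x|leb_B1. (v x)\<^sup>2 * exp (2 * (v x)\<^sup>2)) \<le> 300 * (H1_norm v)\<^sup>2"
proof -
  have "(H1_norm v)\<^sup>2 < (1 / 4)\<^sup>2" using s H1_norm_nonneg[of v] by (intro power_strict_mono) simp_all
  then have lt: "(H1_norm v)\<^sup>2 < 1 / 16" by (simp add: power_divide)
  show "integrable leb_B1 (\<lambda>x. (v x)\<^sup>2 * exp (2 * (v x)\<^sup>2))" by (rule Trudinger(1)[OF v lt]) simp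
  show "(LINT x|leb_B1. (v x)\<^sup>2 * exp (2 * (v x)\<^sup>2)) \<le> 300 * (H1_norm v)\<^sup>2"
  proof (rule ccontr)
    assume "\<not> ?thesis"
    then have *: "(H1_norm v)\<^sup>2 < (LINT x|leb_B1. (v x)\<^sup>2 * exp (2 * (v x)\<^sup>2)) / 300" by simp
    obtain A where A: "(H1_norm v)\<^sup>2 < A" "A < min (1 / 16) ((LINT x|leb_B1. (v x)\<^sup>2 * exp (2 * (v x)\<^sup>2)) / 300)"
      using dense[of "(H1_norm v)\<^sup>2" "min (1 / 16) ((LINT x|leb_B1. (v x)\<^sup>2 * exp (2 * (v x)\<^sup>2)) / 300)"] lt * by auto
    have "(LINT x|leb_B1. (v x)\<^sup>2 * exp (2 * (v x)\<^sup>2)) \<le> 300 * A" by (rule Trudinger(2)[OF v A(1)]) (use A in simp)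
    then show False using A by simp
  qed
qed

section \<open>Differentiability of the functional on the Sobolev space\<close>

text \<open>For |b| \<le> 1 the Lipschitz bound on f makes the remainder quadratic. For |b| > 1
  there is no cancellation to exploit: each of the three terms is bounded separately, and b^2 \<ge>
  1 absorbs the constants.\<close>

lemma remainder_bound:
  fixes G f :: "real \<Rightarrow> real"
  assumes dG: "\<And>t. (G has_real_derivative 2 * f t) (at t)" and Gb: "\<And>t. \<bar>G t\<bar> \<le> K * exp (t\<^sup>2)"
    and fL: "\<And>m. 0 < m \<Longrightarrow> \<exists>L. \<forall>x\<in>{- m..m}. \<forall>y\<in>{- m..m}. \<bar>f x - f y\<bar> \<le> L * \<bar>x - y\<bar>"
    and C0: "0 < C0"
  shows "\<exists>C\<ge>0. \<forall>a b. \<bar>a\<bar> \<le> C0 \<longrightarrow> \<bar>G (a + b) - G a - 2 * f a * b\<bar> \<le> C * (b\<^sup>2 * exp (2 * b\<^sup>2))"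
proof -
  have "0 < C0 + 1" using C0 by simp
  from fL[OF this] obtain L where
    L: "\<And>x y. x \<in> {- (C0 + 1)..C0 + 1} \<Longrightarrow> y \<in> {- (C0 + 1)..C0 + 1} \<Longrightarrow> \<bar>f x - f y\<bar> \<le> L * \<bar>x - y\<bar>"
    by blast
  have L0: "0 \<le> L" using L[of 0 1] C0 by simp
  have K0: "0 \<le> K" using Gb[of 0] by simp
  define F0 where "F0 = \<bar>f 0\<bar> + L * C0"
  have F0: "\<bar>f a\<bar> \<le> F0" if "\<bar>a\<bar> \<le> C0" for a
  proof -
    have "\<bar>f a - f 0\<bar> \<le> L * \<bar>a - 0\<bar>" using that C0 by (intro L) (simp_all add: abs_le_iff)
    also have "\<dots> \<le> L * C0" using that L0 by (intro mult_left_mono) simp_all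
    finally show ?thesis unfolding F0_def by linarith
  qed
  have F00: "0 \<le> F0" using L0 C0 by (simp add: F0_def)
  define C where "C = 2 * L + (2 * K * exp (2 * C0\<^sup>2) + 2 * F0)"
  have "\<bar>G (a + b) - G a - 2 * f a * b\<bar> \<le> C * (b\<^sup>2 * exp (2 * b\<^sup>2))" if a: "\<bar>a\<bar> \<le> C0" for a b
  proof -
    have e1: "1 \<le> exp (2 * b\<^sup>2)" by simp
    have b2: "b\<^sup>2 \<le> b\<^sup>2 * exp (2 * b\<^sup>2)" using mult_left_mono[OF e1, of "b\<^sup>2"] by simp
    show ?thesis
    proof (cases "\<bar>b\<bar> \<le> 1")
      case True
      have "norm ((G (a + b) - 2 * f a * (a + b)) - (G a - 2 * f a * a)) \<le> (2 * L * \<bar>b\<bar>) * norm ((a + b) - a)"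
      proof (rule differentiable_bound[of "cball a \<bar>b\<bar>" "\<lambda>t. G t - 2 * f a * t" "\<lambda>t h. (2 * f t - 2 * f a) * h"])
        fix t assume t: "t \<in> cball a \<bar>b\<bar>"
        show "((\<lambda>t. G t - 2 * f a * t) has_derivative (\<lambda>h. (2 * f t - 2 * f a) * h)) (at t within cball a \<bar>b\<bar>)"
          unfolding has_field_derivative_def[symmetric]
          by (rule has_field_derivative_at_within) (auto intro!: derivative_eq_intros dG)
        have "\<bar>f t - f a\<bar> \<le> L * \<bar>t - a\<bar>" using t a True by (intro L) (auto simp: dist_real_def abs_le_iff)
        also have "\<dots> \<le> L * \<bar>b\<bar>" using t L0 by (intro mult_left_mono) (auto simp: dist_real_def)
        finally have "\<bar>2 * f t - 2 * f a\<bar> \<le> 2 * L * \<bar>b\<bar>" by linarith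
        then show "onorm ((*) (2 * f t - 2 * f a)) \<le> 2 * L * \<bar>b\<bar>"
          by (intro onorm_le) (simp add: abs_mult mult_right_mono)
      qed (simp_all add: dist_real_def)
      then have "\<bar>G (a + b) - G a - 2 * f a * b\<bar> \<le> 2 * L * (\<bar>b\<bar> * \<bar>b\<bar>)" by (simp add: algebra_simps)
      also have "\<bar>b\<bar> * \<bar>b\<bar> = b\<^sup>2" by (simp add: power2_eq_square)
      also have "2 * L * b\<^sup>2 \<le> 2 * L * (b\<^sup>2 * exp (2 * b\<^sup>2))" using b2 L0 by (intro mult_left_mono) simp_all
      also have "\<dots> \<le> C * (b\<^sup>2 * exp (2 * b\<^sup>2))"
        unfolding C_def using K0 F00 by (intro mult_right_mono) simp_all
      finally show ?thesis .
    next
      case False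
      have b1: "1 \<le> b\<^sup>2" using False abs_le_square_iff[of 1 b] by simp
      have a2: "a\<^sup>2 \<le> C0\<^sup>2" using a abs_le_square_iff[of a C0] C0 by simp
      \<comment> \<open>The inequality (a + b)^2 \<le> 2 a^2 + 2 b^2 is the origin of the exponent 2
        b^2 and thus of the factor 2 in the Trudinger estimate.\<close>
      have "0 \<le> (a - b)\<^sup>2" by simp
      then have ab: "(a + b)\<^sup>2 \<le> 2 * C0\<^sup>2 + 2 * b\<^sup>2" unfolding power2_sum power2_diff using a2 by linarith
      define e where "e = b\<^sup>2 * exp (2 * b\<^sup>2)"
      have ee: "exp (2 * b\<^sup>2) \<le> e" unfolding e_def using b1 mult_right_mono[OF b1, of "exp (2 * b\<^sup>2)"] by simp
      have e1': "1 \<le> e" using e1 ee by linarith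
      have "\<bar>G (a + b)\<bar> \<le> K * exp ((a + b)\<^sup>2)" by (rule Gb)
      also have "\<dots> \<le> K * exp (2 * C0\<^sup>2 + 2 * b\<^sup>2)" using ab K0 by (intro mult_left_mono) simp_all
      also have "\<dots> = K * exp (2 * C0\<^sup>2) * exp (2 * b\<^sup>2)" by (simp add: exp_add)
      also have "\<dots> \<le> K * exp (2 * C0\<^sup>2) * e" using ee K0 by (intro mult_left_mono) simp_all
      finally have 1: "\<bar>G (a + b)\<bar> \<le> K * exp (2 * C0\<^sup>2) * e" .
      have "\<bar>G a\<bar> \<le> K * exp (a\<^sup>2)" by (rule Gb)
      also have "\<dots> \<le> K * exp (2 * C0\<^sup>2)"
      proof (rule mult_left_mono[OF _ K0])
        have "a\<^sup>2 \<le> 2 * C0\<^sup>2" using a2 zero_le_power2[of C0] by linarith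
        then show "exp (a\<^sup>2) \<le> exp (2 * C0\<^sup>2)" by simp
      qed
      also have "\<dots> \<le> K * exp (2 * C0\<^sup>2) * e" using e1' K0 mult_left_mono[OF e1', of "K * exp (2 * C0\<^sup>2)"] by simp
      finally have 2: "\<bar>G a\<bar> \<le> K * exp (2 * C0\<^sup>2) * e" .
      have "\<bar>b\<bar> * 1 \<le> \<bar>b\<bar> * \<bar>b\<bar>" using False by (intro mult_left_mono) simp_all
      then have "\<bar>b\<bar> \<le> b\<^sup>2" by (simp add: power2_eq_square)
      then have be: "\<bar>b\<bar> \<le> e" using b2 unfolding e_def by linarith
      have "\<bar>2 * f a * b\<bar> = 2 * (\<bar>f a\<bar> * \<bar>b\<bar>)" by (simp add: abs_mult)
      also have "\<dots> \<le> 2 * (F0 * e)" using F0[OF a] be F00 by (intro mult_left_mono mult_mono) simp_all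
      finally have 3: "\<bar>2 * f a * b\<bar> \<le> 2 * (F0 * e)" .
      have "\<bar>G (a + b) - G a - 2 * f a * b\<bar> \<le> \<bar>G (a + b)\<bar> + \<bar>G a\<bar> + \<bar>2 * f a * b\<bar>" by linarith
      also have "\<dots> \<le> 2 * (K * exp (2 * C0\<^sup>2) * e) + 2 * (F0 * e)" using 1 2 3 by linarith
      also have "\<dots> = (2 * K * exp (2 * C0\<^sup>2) + 2 * F0) * e" by (simp add: distrib_right)
      also have "\<dots> \<le> C * e" unfolding C_def using L0 e1' by (intro mult_right_mono) simp_all
      finally show ?thesis by (simp add: e_def)
    qed
  qed
  moreover have "0 \<le> C" using L0 K0 F00 by (simp add: C_def)
  ultimately show ?thesis by blast
qed

text \<open>The base point u is bounded, so only the increment v needs exponential integrability,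
  and v may be taken small. The remainder integrates to at most 300 C times the squared norm of
  v.\<close>

lemma functional_differentiable:
  fixes G f :: "real \<Rightarrow> real"
  assumes dG: "\<And>t. (G has_real_derivative 2 * f t) (at t)" and Gb: "\<And>t. \<bar>G t\<bar> \<le> K * exp (t\<^sup>2)"
    and fL: "\<And>m. 0 < m \<Longrightarrow> \<exists>L. \<forall>x\<in>{- m..m}. \<forall>y\<in>{- m..m}. \<bar>f x - f y\<bar> \<le> L * \<bar>x - y\<bar>"
    and fc: "continuous_on UNIV f"
    and u: "continuous_on B1 u" "\<And>x. x \<in> B1 \<Longrightarrow> \<bar>u x\<bar> \<le> C0" and C0: "0 < C0"
  shows "has_H10_derivative (\<lambda>w. LINT x|leb_B1. G (w x)) (\<lambda>v. LINT x|leb_B1. (2 * f (u x)) * v x) u"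
proof -
  obtain C where C: "0 \<le> C" "\<And>a b. \<bar>a\<bar> \<le> C0 \<Longrightarrow> \<bar>G (a + b) - G a - 2 * f a * b\<bar> \<le> C * (b\<^sup>2 * exp (2 * b\<^sup>2))"
    using remainder_bound[OF dG Gb fL C0] by blast
  have um: "u \<in> borel_measurable leb_B1" by (rule continuous_measurable[OF u(1)])
  have Gc: "continuous_on UNIV G"
    by (rule DERIV_continuous_on) (rule has_field_derivative_at_within[OF dG])
  have Gm: "G \<in> borel_measurable borel" by (rule borel_measurable_continuous_onI[OF Gc])
  have fm: "f \<in> borel_measurable borel" by (rule borel_measurable_continuous_onI[OF fc])
  define F where "F x = 2 * f (u x)" for x
  have Fm: "F \<in> borel_measurable leb_B1" unfolding F_def
    by (rule borel_measurable_times[OF borel_measurable_const measurable_compose[OF um fm]])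
  have "compact (f ` {- C0..C0})" by (rule compact_continuous_image[OF continuous_on_subset[OF fc]]) simp_all
  from compact_imp_bounded[OF this] obtain B where B: "\<And>t. t \<in> {- C0..C0} \<Longrightarrow> norm (f t) \<le> B"
    unfolding bounded_iff by blast
  have FL: "L2 F"
  proof (rule L2_bounded[OF Fm])
    fix x assume "x \<in> B1"
    then show "norm (F x) \<le> 2 * B" using u(2)[of x] B[of "u x"] by (simp add: F_def abs_le_iff)
  qed
  have FvI: "integrable leb_B1 (\<lambda>x. F x * v x)" if "v \<in> H10" for v
    by (rule L2_mult_real[OF FL H10_L2(1)[OF that]])
  have GuI: "integrable leb_B1 (\<lambda>x. G (u x))"
  proof (rule integrable_bounded[OF measurable_compose[OF um Gm]])
    fix x assume x: "x \<in> B1"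
    have "(u x)\<^sup>2 \<le> C0\<^sup>2" using u(2)[OF x] abs_le_square_iff[of "u x" C0] C0 by simp
    moreover have "0 \<le> K" using Gb[of 0] by simp
    ultimately have "K * exp ((u x)\<^sup>2) \<le> K * exp (C0\<^sup>2)" by (intro mult_left_mono) simp_all
    then show "norm (G (u x)) \<le> K * exp (C0\<^sup>2)" using Gb[of "u x"] by simp
  qed
  define c where "c = sqrt (LINT x|leb_B1. (norm (F x))\<^sup>2)"
  have bf: "bounded_functional (\<lambda>v. LINT x|leb_B1. F x * v x)"
    unfolding bounded_functional_def
  proof (intro conjI ballI allI exI[of _ c])
    fix v w a b assume "v \<in> H10" "w \<in> H10"
    then show "(LINT x|leb_B1. F x * (a * v x + b * w x)) = a * (LINT x|leb_B1. F x * v x) + b * (LINT x|leb_B1. F x * w x)"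
      using integral_lincomb[OF FvI[of v] FvI[of w], of a b] by (simp add: algebra_simps)
  next
    fix v assume v: "v \<in> H10"
    have nn: "0 \<le> (LINT x|leb_B1. (norm (F x))\<^sup>2)" "0 \<le> (LINT x|leb_B1. (norm (wgrad v x))\<^sup>2)"
      by (rule Bochner_Integration.integral_nonneg, simp)+
    have "(LINT x|leb_B1. F x * v x)\<^sup>2 \<le> (LINT x|leb_B1. (norm (F x))\<^sup>2) * (LINT x|leb_B1. (norm (v x))\<^sup>2)"
      using L2_CS[OF FL H10_L2(1)[OF v]] by simp
    also have "\<dots> \<le> (LINT x|leb_B1. (norm (F x))\<^sup>2) * (H1_norm v)\<^sup>2"
      using H1_norm_sq[OF wgrad[OF H10_H1[OF v]]] nn by (intro mult_left_mono) simp_all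
    also have "\<dots> = (c * H1_norm v)\<^sup>2" using nn by (simp add: c_def power_mult_distrib)
    finally have "\<bar>LINT x|leb_B1. F x * v x\<bar> \<le> \<bar>c * H1_norm v\<bar>" by (simp add: abs_le_square_iff)
    moreover have "0 \<le> c * H1_norm v" using nn H1_norm_nonneg[of v] by (simp add: c_def)
    ultimately show "\<bar>LINT x|leb_B1. F x * v x\<bar> \<le> c * H1_norm v" by linarith
  qed
  have der: "\<exists>\<delta>>0. \<forall>v\<in>H10. H1_norm v < \<delta> \<longrightarrow>
      \<bar>(LINT x|leb_B1. G (u x + v x)) - (LINT x|leb_B1. G (u x)) - (LINT x|leb_B1. F x * v x)\<bar> \<le> e * H1_norm v" if e: "0 < e" for e
  proof -
    \<comment> \<open>1/4 is the range of \<open>Trudinger_quadratic\<close>; the other bound turns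
      300 C times the squared norm into at most e times the norm, and the summand 1 covers C =
      0.\<close>
    define \<delta> where "\<delta> = min (1 / 4) (e / (300 * C + 1))"
    have \<delta>: "0 < \<delta>" using e C by (simp add: \<delta>_def)
    have "\<bar>(LINT x|leb_B1. G (u x + v x)) - (LINT x|leb_B1. G (u x)) - (LINT x|leb_B1. F x * v x)\<bar> \<le> e * H1_norm v"
      if v: "v \<in> H10" "H1_norm v < \<delta>" for v
    proof -
      have s: "H1_norm v < 1 / 4" "H1_norm v < e / (300 * C + 1)" using v(2) by (simp_all add: \<delta>_def)
      note T = Trudinger_quadratic[OF v(1) s(1)]
      have vm: "v \<in> borel_measurable leb_B1" using H10_L2(1)[OF v(1)] unfolding L2_def by blast
      define rr where "rr x = G (u x + v x) - G (u x) - F x * v x" for x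
      have rm: "rr \<in> borel_measurable leb_B1" unfolding rr_def
        by (intro borel_measurable_diff borel_measurable_times measurable_compose[OF borel_measurable_add[OF um vm] Gm]
            measurable_compose[OF um Gm] Fm vm)
      have rb: "AE x in leb_B1. norm (rr x) \<le> C * ((v x)\<^sup>2 * exp (2 * (v x)\<^sup>2))"
      proof (rule AE_I2)
        fix x assume "x \<in> space leb_B1"
        then show "norm (rr x) \<le> C * ((v x)\<^sup>2 * exp (2 * (v x)\<^sup>2))"
          using C(2)[OF u(2)[of x], of "v x"] by (simp add: rr_def F_def)
      qed
      have TI: "integrable leb_B1 (\<lambda>x. C * ((v x)\<^sup>2 * exp (2 * (v x)\<^sup>2)))" by (rule integrable_mult_right[OF T(1)])
      have rI: "integrable leb_B1 rr"
      proof (rule Bochner_Integration.integrable_bound[OF TI rm])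
        show "AE x in leb_B1. norm (rr x) \<le> norm (C * ((v x)\<^sup>2 * exp (2 * (v x)\<^sup>2)))"
          using rb by eventually_elim simp
      qed
      have "(LINT x|leb_B1. G (u x + v x)) = (LINT x|leb_B1. rr x + G (u x) + F x * v x)"
        by (rule Bochner_Integration.integral_cong[OF refl]) (simp add: rr_def)
      also have "\<dots> = (LINT x|leb_B1. rr x) + (LINT x|leb_B1. G (u x)) + (LINT x|leb_B1. F x * v x)"
        by (simp only: Bochner_Integration.integral_add[OF Bochner_Integration.integrable_add[OF rI GuI] FvI[OF v(1)]]
            Bochner_Integration.integral_add[OF rI GuI])
      finally have "\<bar>(LINT x|leb_B1. G (u x + v x)) - (LINT x|leb_B1. G (u x)) - (LINT x|leb_B1. F x * v x)\<bar> = norm (LINT x|leb_B1. rr x)" by simp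
      also have "\<dots> \<le> (LINT x|leb_B1. C * ((v x)\<^sup>2 * exp (2 * (v x)\<^sup>2)))"
      proof (rule Bochner_Integration.integral_norm_bound_integral[OF rI TI])
        fix x assume "x \<in> space leb_B1"
        then show "norm (rr x) \<le> C * ((v x)\<^sup>2 * exp (2 * (v x)\<^sup>2))"
          using C(2)[OF u(2)[of x], of "v x"] by (simp add: rr_def F_def)
      qed
      also have "\<dots> = C * (LINT x|leb_B1. (v x)\<^sup>2 * exp (2 * (v x)\<^sup>2))" by simp
      also have "\<dots> \<le> C * (300 * (H1_norm v)\<^sup>2)" by (rule mult_left_mono[OF T(2) C(1)])
      also have "\<dots> = (300 * C) * H1_norm v * H1_norm v" by (simp add: power2_eq_square)
      also have "\<dots> \<le> e * H1_norm v"
      proof (rule mult_right_mono[OF _ H1_norm_nonneg])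
        have "(300 * C + 1) * H1_norm v \<le> e" using s(2) C(1) by (simp add: field_simps)
        then show "300 * C * H1_norm v \<le> e" using H1_norm_nonneg[of v] by (simp add: distrib_right)
      qed
      finally show ?thesis .
    qed
    with \<delta> show ?thesis by (intro exI[of _ \<delta>] conjI ballI impI)
  qed
  show ?thesis
    unfolding has_H10_derivative_def F_def[symmetric]
    by (rule conjI[OF bf], rule allI, rule impI, rule der)
qed

section \<open>Radial functions\<close>

text \<open>Profiles are assumed differentiable only on the open interval, so at the centre of the
  disk the derivative has to come from a direct estimate of the increment.\<close>

lemma has_derivative_at_0I:
  fixes g :: "real ^ 2 \<Rightarrow> real"
  assumes le: "\<And>x. x \<in> B1 \<Longrightarrow> \<bar>g x - g 0 - a \<bullet> x\<bar> \<le> e x * norm x" and e: "(e \<longlongrightarrow> 0) (at 0)"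
  shows "(g has_derivative (\<lambda>h. a \<bullet> h)) (at 0)"
  unfolding has_derivative_at
proof (intro conjI)
  show "bounded_linear (\<lambda>h. a \<bullet> h)" by (rule bounded_linear_inner_right)
  have ev: "\<forall>\<^sub>F h in at 0. norm (norm (g (0 + h) - g 0 - a \<bullet> h) / norm h) \<le> e h"
  proof -
    have "\<forall>\<^sub>F h in at (0 :: real ^ 2). h \<in> B1" unfolding eventually_at by (intro exI[of _ 1]) (simp add: dist_norm)
    moreover have "\<forall>\<^sub>F h in at (0 :: real ^ 2). h \<noteq> 0" by (simp add: eventually_at_filter)
    ultimately show ?thesis
    proof eventually_elim
      case (elim h)
      then show ?case using le[of h] by (simp add: divide_le_eq)
    qed
  qed
  show "((\<lambda>h. norm (g (0 + h) - g 0 - a \<bullet> h) / norm h) \<longlongrightarrow> 0) (at 0)"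
    by (rule Lim_null_comparison[OF ev e])
qed

lemma has_derivative_norm2: "((\<lambda>x :: real ^ 2. (norm x)\<^sup>2) has_derivative (\<lambda>h. (2 *\<^sub>R x) \<bullet> h)) (at x)"
  unfolding power2_norm_eq_inner
  by (auto intro!: derivative_eq_intros simp: inner_commute)

lemma smooth_power: "smooth f \<Longrightarrow> smooth (\<lambda>x. f x ^ n)"
proof (induction n)
  case 0
  show ?case using smooth_const[of 1] by simp
next
  case (Suc n)
  have "smooth (\<lambda>x. f x * f x ^ n)" by (rule smooth_mult[OF Suc.prems Suc.IH[OF Suc.prems]])
  then show ?case by simp
qed

lemma smooth_sum: "finite A \<Longrightarrow> (\<And>i. i \<in> A \<Longrightarrow> smooth (f i)) \<Longrightarrow> smooth (\<lambda>x. \<Sum>i\<in>A. f i x)"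
proof (induction A rule: finite_induct)
  case empty
  show ?case using smooth_const[of 0] by simp
next
  case (insert a A)
  have "smooth (\<lambda>x. f a x + (\<Sum>i\<in>A. f i x))" by (rule smooth_add) (use insert in blast)+
  then show ?case using insert by simp
qed

lemma bump_deriv_1: "0 < t \<Longrightarrow> bump_deriv 1 t = exp (- 1 / t) / t\<^sup>2"
  by (simp add: bump_deriv_def poly_monom power_divide)

text \<open>For t = n (1 - |x|^2) - 1 the factor t + 1 is the scaled distance to the circle, which
  meets the gradient of the cut-off. The bound is uniform in n because exp (1 / t) dominates 1 / t +
  1 / t^2 up to the factor 2.\<close>

lemma bump_deriv_1_bound: "\<bar>(t + 1) * bump_deriv 1 t\<bar> \<le> 2"
proof (cases "0 < t")
  case True
  have "1 + 1 / t + (1 / t)\<^sup>2 / 2 \<le> exp (1 / t)" using True by (intro exp_lower_Taylor_quadratic) simp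
  moreover have "0 \<le> 1 / t" using True by simp
  ultimately have "1 / t + (1 / t)\<^sup>2 \<le> 2 * exp (1 / t)" by linarith
  then have "(1 / t + (1 / t)\<^sup>2) * exp (- (1 / t)) \<le> 2 * exp (1 / t) * exp (- (1 / t))" by (intro mult_right_mono) simp_all
  also have "\<dots> = 2" by (simp add: exp_minus)
  also have "(1 / t + (1 / t)\<^sup>2) * exp (- (1 / t)) = (t + 1) * bump_deriv 1 t"
    using True unfolding bump_deriv_1[OF True] by (simp add: power2_eq_square field_simps)
  finally have "(t + 1) * bump_deriv 1 t \<le> 2" .
  moreover have "0 \<le> (t + 1) * bump_deriv 1 t" unfolding bump_deriv_1[OF True] using True by simp
  ultimately show ?thesis by linarith
next
  case False
  then show ?thesis by (simp add: bump_deriv_def)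
qed

lemma bump_deriv_1_tendsto:
  assumes "0 < t" shows "(\<lambda>n. (real n * t) * bump_deriv 1 (real n * t - 1)) \<longlonglongrightarrow> 0"
proof -
  have "(\<lambda>n. (real n * t) * (exp (- 1 / (real n * t - 1)) / (real n * t - 1)\<^sup>2)) \<longlonglongrightarrow> 0"
    using assms by real_asymp
  moreover have "\<forall>\<^sub>F n in sequentially. (real n * t) * (exp (- 1 / (real n * t - 1)) / (real n * t - 1)\<^sup>2) = (real n * t) * bump_deriv 1 (real n * t - 1)"
  proof -
    have "filterlim (\<lambda>n. real n * t - 1) at_top sequentially" using assms by real_asymp
    then have "\<forall>\<^sub>F n in sequentially. 0 < real n * t - 1" by (rule filterlim_at_top_dense[THEN iffD1, rule_format])
    then show ?thesis by eventually_elim (simp only: bump_deriv_1)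
  qed
  ultimately show ?thesis by (rule Lim_transform_eventually)
qed

lemma grad_cutoff: "grad (cutoff n) x = (- 2 * real n * bump_deriv 1 (real n * (1 - (norm x)\<^sup>2) - 1)) *\<^sub>R x"
proof -
  have "((\<lambda>x. real n * (1 - (norm x)\<^sup>2) - 1) has_derivative (\<lambda>h. - (real n * ((2 *\<^sub>R x) \<bullet> h)))) (at x)"
    by (auto intro!: derivative_eq_intros has_derivative_norm2)
  from DERIV_compose_FDERIV[OF bump_deriv this, of 0]
  have "(cutoff n has_derivative (\<lambda>h. - (real n * ((2 *\<^sub>R x) \<bullet> h)) * bump_deriv (Suc 0) (real n * (1 - (norm x)\<^sup>2) - 1))) (at x)"
    by (simp only: cutoff_def[abs_def])
  then have "(cutoff n has_derivative (\<lambda>h. ((- 2 * real n * bump_deriv 1 (real n * (1 - (norm x)\<^sup>2) - 1)) *\<^sub>R x) \<bullet> h)) (at x)"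
    by (rule has_derivative_eq_rhs) (simp add: fun_eq_iff)
  then show ?thesis by (rule grad_eqI)
qed

lemma norm_sq_B1: "x \<in> B1 \<Longrightarrow> (norm x)\<^sup>2 < 1" "x \<in> B1 \<Longrightarrow> 0 \<le> (norm x)\<^sup>2" "x \<in> B1 \<Longrightarrow> x \<noteq> 0 \<Longrightarrow> 0 < (norm x)\<^sup>2"
  by (simp_all add: abs_square_less_1)

lemma LINT_bounded_tendsto_0:
  fixes g :: "nat \<Rightarrow> real ^ 2 \<Rightarrow> real"
  assumes "\<And>n. g n \<in> borel_measurable leb_B1" "\<And>n x. x \<in> B1 \<Longrightarrow> \<bar>g n x\<bar> \<le> C" "\<And>x. x \<in> B1 \<Longrightarrow> (\<lambda>n. g n x) \<longlonglongrightarrow> 0"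
  shows "(\<lambda>n. LINT x|leb_B1. g n x) \<longlonglongrightarrow> 0"
proof -
  have "(\<lambda>n. LINT x|leb_B1. g n x) \<longlonglongrightarrow> (LINT x|leb_B1. (0 :: real))"
  proof (rule integral_dominated_convergence[where w="\<lambda>x. C"])
    show "AE x in leb_B1. (\<lambda>n. g n x) \<longlonglongrightarrow> 0" by (rule AE_I2) (use assms(3) in simp)
    show "AE x in leb_B1. norm (g n x) \<le> C" for n by (rule AE_I2) (use assms(2) in simp)
  qed (simp_all add: assms(1))
  then show ?thesis by simp
qed

text \<open>Multiplying by the cut-off is harmless because a radial polynomial that vanishes on the unit circle
  compensates the blow-up of the gradient of the cut-off.\<close>

lemma radial_polynomial_approx:
  fixes P Q :: "real \<Rightarrow> real"
  assumes smooth: "smooth (\<lambda>x. P ((norm x)\<^sup>2))" and Pd: "\<And>s. (P has_real_derivative Q s) (at s)"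
    and Qc: "continuous_on UNIV Q" and P1: "P 1 = 0"
  shows "\<And>n. test_fun (\<lambda>x. cutoff n x * P ((norm x)\<^sup>2))"
    "(\<lambda>n. LINT x|leb_B1. (cutoff n x * P ((norm x)\<^sup>2) - P ((norm x)\<^sup>2))\<^sup>2) \<longlonglongrightarrow> 0"
    "(\<lambda>n. LINT x|leb_B1. (norm (grad (\<lambda>x. cutoff n x * P ((norm x)\<^sup>2)) x - (2 * Q ((norm x)\<^sup>2)) *\<^sub>R x))\<^sup>2) \<longlonglongrightarrow> 0"
proof -
  show tf: "test_fun (\<lambda>x. cutoff n x * P ((norm x)\<^sup>2))" for n by (rule cutoff_test_fun[OF smooth])
  have "compact (Q ` {0..1})" by (rule compact_continuous_image[OF continuous_on_subset[OF Qc]]) simp_all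
  from compact_imp_bounded[OF this] obtain B where "\<forall>z\<in>Q ` {0..1}. norm z \<le> B"
    unfolding bounded_iff by blast
  then have B: "\<bar>Q s\<bar> \<le> B" if "s \<in> {0..1}" for s using that by simp
  have B0: "0 \<le> B" using B[of 0] by simp
  have P_le: "\<bar>P s\<bar> \<le> B * (1 - s)" if s: "s \<in> {0..1}" for s
  proof -
    have "norm (P s - P 1) \<le> B * norm (s - 1)"
    proof (rule field_differentiable_bound[of "{0..1}"])
      show "(P has_field_derivative Q z) (at z within {0..1})" if "z \<in> {0..1}" for z
        by (rule has_field_derivative_at_within[OF Pd])
    qed (use B s in simp_all)
    then show ?thesis using s P1 by simp
  qed
  have Pc: "continuous_on UNIV P" by (rule DERIV_continuous_on) (rule has_field_derivative_at_within[OF Pd])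
  have gP: "grad (\<lambda>x. P ((norm x)\<^sup>2)) x = (2 * Q ((norm x)\<^sup>2)) *\<^sub>R x" for x
  proof (rule grad_eqI)
    from DERIV_compose_FDERIV[OF Pd has_derivative_norm2]
    show "((\<lambda>x. P ((norm x)\<^sup>2)) has_derivative (\<lambda>h. ((2 * Q ((norm x)\<^sup>2)) *\<^sub>R x) \<bullet> h)) (at x)"
      by (rule has_derivative_eq_rhs) (simp add: fun_eq_iff)
  qed
  have diff: "cutoff n differentiable (at x)" "(\<lambda>x. P ((norm x)\<^sup>2)) differentiable (at x)" for n x
    by (rule C_k_D[OF smooth_cutoff[rule_format]], rule C_k_D[OF smooth[rule_format]])
  have g: "grad (\<lambda>x. cutoff n x * P ((norm x)\<^sup>2)) x - (2 * Q ((norm x)\<^sup>2)) *\<^sub>R x =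
      (cutoff n x - 1) *\<^sub>R ((2 * Q ((norm x)\<^sup>2)) *\<^sub>R x) + P ((norm x)\<^sup>2) *\<^sub>R grad (cutoff n) x" for n x
    unfolding grad_mult[OF diff] gP by (simp add: algebra_simps)
  \<comment> \<open>This is the product of the linear decay of P at the circle and the gradient of
    the cut-off, up to constants. It is bounded by 2 and tends to 0 pointwise, as dominated
    convergence requires.\<close>
  define y where "y n x = (real n * (1 - (norm x)\<^sup>2)) * bump_deriv 1 (real n * (1 - (norm x)\<^sup>2) - 1)" for n and x :: "real ^ 2"
  have y2: "\<bar>y n x\<bar> \<le> 2" for n x
    using bump_deriv_1_bound[of "real n * (1 - (norm x)\<^sup>2) - 1"] by (simp add: y_def)
  have y0: "(\<lambda>n. y n x) \<longlonglongrightarrow> 0" if "x \<in> B1" for x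
    unfolding y_def by (rule bump_deriv_1_tendsto) (use norm_sq_B1(1)[OF that] in simp)
  have gn: "norm (grad (\<lambda>x. cutoff n x * P ((norm x)\<^sup>2)) x - (2 * Q ((norm x)\<^sup>2)) *\<^sub>R x) \<le> 2 * B * \<bar>cutoff n x - 1\<bar> + 2 * B * \<bar>y n x\<bar>"
    if x: "x \<in> B1" for n x
  proof -
    have s: "(norm x)\<^sup>2 \<in> {0..1}" using norm_sq_B1(1,2)[OF x] by simp
    have nx: "norm x \<le> 1" using x by simp
    have "norm ((2 * Q ((norm x)\<^sup>2)) *\<^sub>R x) \<le> (2 * B) * 1"
      using B[OF s] nx B0 by (simp only: norm_scaleR) (intro mult_mono, simp_all add: abs_mult)
    then have "norm ((cutoff n x - 1) *\<^sub>R ((2 * Q ((norm x)\<^sup>2)) *\<^sub>R x)) \<le> \<bar>cutoff n x - 1\<bar> * (2 * B)"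
      by (simp only: norm_scaleR[of "cutoff n x - 1"]) (intro mult_left_mono, simp_all)
    moreover have "norm (P ((norm x)\<^sup>2) *\<^sub>R grad (cutoff n) x) \<le> (B * (1 - (norm x)\<^sup>2)) * (2 * real n * \<bar>bump_deriv 1 (real n * (1 - (norm x)\<^sup>2) - 1)\<bar> * 1)"
    proof -
      have "norm (grad (cutoff n) x) = 2 * real n * \<bar>bump_deriv 1 (real n * (1 - (norm x)\<^sup>2) - 1)\<bar> * norm x"
        unfolding grad_cutoff by (simp add: abs_mult)
      also have "\<dots> \<le> 2 * real n * \<bar>bump_deriv 1 (real n * (1 - (norm x)\<^sup>2) - 1)\<bar> * 1" using nx by (intro mult_left_mono) simp_all
      finally show ?thesis unfolding norm_scaleR using P_le[OF s] by (intro mult_mono) simp_all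
    qed
    moreover have "(B * (1 - (norm x)\<^sup>2)) * (2 * real n * \<bar>bump_deriv 1 (real n * (1 - (norm x)\<^sup>2) - 1)\<bar> * 1) = 2 * B * \<bar>y n x\<bar>"
      using norm_sq_B1(1)[OF x] by (simp add: y_def abs_mult)
    ultimately have "norm ((cutoff n x - 1) *\<^sub>R ((2 * Q ((norm x)\<^sup>2)) *\<^sub>R x)) \<le> 2 * B * \<bar>cutoff n x - 1\<bar>"
      and "norm (P ((norm x)\<^sup>2) *\<^sub>R grad (cutoff n) x) \<le> 2 * B * \<bar>y n x\<bar>" by (metis mult.commute, metis)
    then show ?thesis unfolding g by (rule norm_triangle_mono)
  qed
  have c1: "\<bar>cutoff n x - 1\<bar> \<le> 1" for n x using cutoff_bounds[of n x] by simp
  have c0: "(\<lambda>n. \<bar>cutoff n x - 1\<bar>) \<longlonglongrightarrow> 0" if "x \<in> B1" for x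
    using tendsto_rabs_zero[OF LIM_zero[OF cutoff_tendsto[OF that]]] .
  have n2c: "continuous_on UNIV (\<lambda>x :: real ^ 2. (norm x)\<^sup>2)" by (intro continuous_intros)
  have cn: "continuous_on UNIV (\<lambda>x :: real ^ 2. P ((norm x)\<^sup>2))" "continuous_on UNIV (\<lambda>x :: real ^ 2. Q ((norm x)\<^sup>2))"
    by (rule continuous_on_compose2[OF Pc n2c], simp, rule continuous_on_compose2[OF Qc n2c], simp)
  show "(\<lambda>n. LINT x|leb_B1. (cutoff n x * P ((norm x)\<^sup>2) - P ((norm x)\<^sup>2))\<^sup>2) \<longlonglongrightarrow> 0"
  proof (rule LINT_bounded_tendsto_0[where C="B\<^sup>2"])
    show "(\<lambda>x. (cutoff n x * P ((norm x)\<^sup>2) - P ((norm x)\<^sup>2))\<^sup>2) \<in> borel_measurable leb_B1" for n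
      by (rule continuous_measurable) (intro continuous_intros smooth_continuous[OF smooth_cutoff] continuous_on_subset[OF cn(1)] subset_UNIV)
    fix x assume x: "x \<in> B1"
    have s: "(norm x)\<^sup>2 \<in> {0..1}" using norm_sq_B1(1,2)[OF x] by simp
    have eq: "cutoff n x * P ((norm x)\<^sup>2) - P ((norm x)\<^sup>2) = (cutoff n x - 1) * P ((norm x)\<^sup>2)" for n by (simp add: algebra_simps)
    have "B * (1 - (norm x)\<^sup>2) \<le> B * 1" using B0 by (intro mult_left_mono) simp_all
    then have PB: "\<bar>P ((norm x)\<^sup>2)\<bar> \<le> B" using P_le[OF s] by linarith
    show "\<bar>(cutoff n x * P ((norm x)\<^sup>2) - P ((norm x)\<^sup>2))\<^sup>2\<bar> \<le> B\<^sup>2" for n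
    proof -
      have "\<bar>(cutoff n x - 1) * P ((norm x)\<^sup>2)\<bar> \<le> 1 * B" unfolding abs_mult using c1[of n x] PB by (intro mult_mono) simp_all
      then have "((cutoff n x - 1) * P ((norm x)\<^sup>2))\<^sup>2 \<le> B\<^sup>2" using B0 by (intro power2_le_iff_abs_le[THEN iffD2]) simp_all
      then show ?thesis unfolding eq by simp
    qed
    have "(\<lambda>n. cutoff n x * P ((norm x)\<^sup>2) - P ((norm x)\<^sup>2)) \<longlonglongrightarrow> 1 * P ((norm x)\<^sup>2) - P ((norm x)\<^sup>2)"
      by (intro tendsto_diff tendsto_mult cutoff_tendsto[OF x] tendsto_const)
    from tendsto_power[OF this, of 2] show "(\<lambda>n. (cutoff n x * P ((norm x)\<^sup>2) - P ((norm x)\<^sup>2))\<^sup>2) \<longlonglongrightarrow> 0" by simp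
  qed
  show "(\<lambda>n. LINT x|leb_B1. (norm (grad (\<lambda>x. cutoff n x * P ((norm x)\<^sup>2)) x - (2 * Q ((norm x)\<^sup>2)) *\<^sub>R x))\<^sup>2) \<longlonglongrightarrow> 0"
  proof (rule LINT_bounded_tendsto_0[where C="(6 * B)\<^sup>2"])
    show "(\<lambda>x. (norm (grad (\<lambda>x. cutoff n x * P ((norm x)\<^sup>2)) x - (2 * Q ((norm x)\<^sup>2)) *\<^sub>R x))\<^sup>2) \<in> borel_measurable leb_B1" for n
      by (rule continuous_measurable) (intro continuous_intros continuous_on_subset[OF test_fun_cont(3)[OF tf]] continuous_on_subset[OF cn(2)] subset_UNIV)
    fix x assume x: "x \<in> B1"
    have b: "norm (grad (\<lambda>x. cutoff n x * P ((norm x)\<^sup>2)) x - (2 * Q ((norm x)\<^sup>2)) *\<^sub>R x) \<le> 6 * B" for n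
    proof -
      have "2 * B * \<bar>cutoff n x - 1\<bar> \<le> 2 * B * 1" using B0 by (intro mult_left_mono c1) simp
      moreover have "2 * B * \<bar>y n x\<bar> \<le> 2 * B * 2" using B0 by (intro mult_left_mono y2) simp
      ultimately
      show ?thesis using gn[OF x, of n] by linarith
    qed
    show "\<bar>(norm (grad (\<lambda>x. cutoff n x * P ((norm x)\<^sup>2)) x - (2 * Q ((norm x)\<^sup>2)) *\<^sub>R x))\<^sup>2\<bar> \<le> (6 * B)\<^sup>2" for n
      using power_mono[OF b[of n] norm_ge_zero, of 2] by simp
    have "(\<lambda>n. 2 * B * \<bar>cutoff n x - 1\<bar> + 2 * B * \<bar>y n x\<bar>) \<longlonglongrightarrow> 2 * B * 0 + 2 * B * 0"
      by (rule tendsto_add[OF tendsto_mult_left[OF c0[OF x]] tendsto_mult_left[OF tendsto_rabs_zero[OF y0[OF x]]]])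
    then have z: "(\<lambda>n. 2 * B * \<bar>cutoff n x - 1\<bar> + 2 * B * \<bar>y n x\<bar>) \<longlonglongrightarrow> 0" by simp
    have "(\<lambda>n. norm (grad (\<lambda>x. cutoff n x * P ((norm x)\<^sup>2)) x - (2 * Q ((norm x)\<^sup>2)) *\<^sub>R x)) \<longlonglongrightarrow> 0"
      by (rule Lim_null_comparison[OF _ z]) (use gn[OF x] in simp)
    from tendsto_power[OF this, of 2]
    show "(\<lambda>n. (norm (grad (\<lambda>x. cutoff n x * P ((norm x)\<^sup>2)) x - (2 * Q ((norm x)\<^sup>2)) *\<^sub>R x))\<^sup>2) \<longlonglongrightarrow> 0" by simp
  qed
qed

lemma L2_triangle:
  fixes f g h :: "real ^ 2 \<Rightarrow> 'b::euclidean_space"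
  assumes "L2 f" "L2 g" "L2 h"
  shows "(LINT x|leb_B1. (norm (f x - h x))\<^sup>2) \<le> 2 * (LINT x|leb_B1. (norm (f x - g x))\<^sup>2) + 2 * (LINT x|leb_B1. (norm (g x - h x))\<^sup>2)"
proof -
  have D: "integrable leb_B1 (\<lambda>x. (norm (a x - b x))\<^sup>2)" if "L2 a" "L2 b" for a b :: "real ^ 2 \<Rightarrow> 'b"
    using L2_add[OF that(1) L2_scale[OF that(2)], of "-1"] by (simp add: L2_def)
  have "(LINT x|leb_B1. (norm (f x - h x))\<^sup>2) \<le> (LINT x|leb_B1. 2 * (norm (f x - g x))\<^sup>2 + 2 * (norm (g x - h x))\<^sup>2)"
  proof (rule integral_mono)
    show "integrable leb_B1 (\<lambda>x. (norm (f x - h x))\<^sup>2)" by (rule D[OF assms(1,3)])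
    show "integrable leb_B1 (\<lambda>x. 2 * (norm (f x - g x))\<^sup>2 + 2 * (norm (g x - h x))\<^sup>2)"
      by (rule Bochner_Integration.integrable_add[OF integrable_mult_right[OF D[OF assms(1,2)]] integrable_mult_right[OF D[OF assms(2,3)]]])
    fix x
    have "(norm (f x - h x))\<^sup>2 \<le> (norm (f x - g x) + norm (g x - h x))\<^sup>2"
      using norm_triangle_ineq[of "f x - g x" "g x - h x"] by (intro power_mono) simp_all
    also have "\<dots> \<le> 2 * (norm (f x - g x))\<^sup>2 + 2 * (norm (g x - h x))\<^sup>2"
      using zero_le_power2[of "norm (f x - g x) - norm (g x - h x)"] unfolding power2_diff power2_sum by linarith
    finally show "(norm (f x - h x))\<^sup>2 \<le> 2 * (norm (f x - g x))\<^sup>2 + 2 * (norm (g x - h x))\<^sup>2" .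
  qed
  also have "\<dots> = 2 * (LINT x|leb_B1. (norm (f x - g x))\<^sup>2) + 2 * (LINT x|leb_B1. (norm (g x - h x))\<^sup>2)"
    by (simp only: Bochner_Integration.integral_add integrable_mult_right integral_mult_right_zero D assms simp_thms)
  finally show ?thesis .
qed

lemma LINT_le_const:
  fixes g :: "real ^ 2 \<Rightarrow> real"
  assumes "g \<in> borel_measurable leb_B1" "\<And>x. x \<in> B1 \<Longrightarrow> 0 \<le> g x \<and> g x \<le> c"
  shows "(LINT x|leb_B1. g x) \<le> c * measure leb_B1 (space leb_B1)"
proof -
  have "(LINT x|leb_B1. g x) \<le> (LINT x|leb_B1. c)"
  proof (rule integral_mono)
    show "integrable leb_B1 g" by (rule integrable_bounded[OF assms(1), of c]) (use assms(2) in simp)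
  qed (use assms(2) in simp_all)
  then show ?thesis by (simp add: mult.commute)
qed

lemma mvt_bound:
  fixes f :: "real \<Rightarrow> real"
  assumes c: "continuous_on {0..1} f" and d: "\<And>z. 0 < z \<Longrightarrow> z < 1 \<Longrightarrow> (f has_real_derivative f' z) (at z)"
    and b: "\<And>z. 0 < z \<Longrightarrow> z < 1 \<Longrightarrow> \<bar>f' z\<bar> \<le> B" and st: "0 \<le> s" "s \<le> t" "t \<le> 1"
  shows "\<bar>f t - f s\<bar> \<le> B * (t - s)"
proof (cases "s = t")
  case False
  then have "s < t" using st by simp
  moreover have "continuous_on {s..t} f" by (rule continuous_on_subset[OF c]) (use st in auto)
  moreover have "f differentiable (at z)" if "s < z" "z < t" for z
    using d[of z] that st unfolding real_differentiable_def by auto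
  ultimately obtain l z where z: "s < z" "z < t" "(f has_real_derivative l) (at z)" "f t - f s = (t - s) * l"
    using MVT[of s t f] by blast
  have "l = f' z" by (rule DERIV_unique[OF z(3) d]) (use z st in auto)
  then have "\<bar>l\<bar> \<le> B" using b[of z] z st by simp
  then have "\<bar>f t - f s\<bar> \<le> (t - s) * B" unfolding z(4) abs_mult using st by (intro mult_mono) simp_all
  then show ?thesis by (simp add: mult.commute)
qed simp

section \<open>Radial functions of the squared norm and their Laplacian\<close>

text \<open>k is the derivative of U in s = |x|^2. Only s k1 is assumed bounded, as k1 itself may
  blow up at the centre; this is enough because k1 enters the second derivatives of u multiplied by
  products of two coordinates.\<close>

locale radial_C1 =
  fixes U k k1 :: "real \<Rightarrow> real" and C :: real
  assumes Uc: "continuous_on {0..1} U" and kc: "continuous_on {0..1} k" and U1: "U 1 = 0"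
    and dU: "\<And>s. 0 < s \<Longrightarrow> s < 1 \<Longrightarrow> (U has_real_derivative k s) (at s)"
    and dk: "\<And>s. 0 < s \<Longrightarrow> s < 1 \<Longrightarrow> (k has_real_derivative k1 s) (at s)"
    and k1_bound: "\<And>s. 0 < s \<Longrightarrow> s < 1 \<Longrightarrow> \<bar>s * k1 s\<bar> \<le> C"
begin

definition u :: "real ^ 2 \<Rightarrow> real" where "u x = U ((norm x)\<^sup>2)"
definition V :: "real ^ 2 \<Rightarrow> real ^ 2" where "V x = (2 * k ((norm x)\<^sup>2)) *\<^sub>R x"
definition W :: "2 \<Rightarrow> real ^ 2 \<Rightarrow> real ^ 2" where
  "W i x = (if x = 0 then (2 * k 0) *\<^sub>R axis i 1
     else (2 * k ((norm x)\<^sup>2)) *\<^sub>R axis i 1 + (4 * (x $ i) * k1 ((norm x)\<^sup>2)) *\<^sub>R x)"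
text \<open>Off the origin this is 4 (s U'(s))' at s = |x|^2, the planar radial Laplacian in the
  squared radius.\<close>

definition lap :: "real ^ 2 \<Rightarrow> real" where
  "lap x = (if x = 0 then 4 * k 0 else 4 * k ((norm x)\<^sup>2) + 4 * (norm x)\<^sup>2 * k1 ((norm x)\<^sup>2))"

lemma bound: "\<exists>B>0. \<forall>s\<in>{0..1}. \<bar>U s\<bar> \<le> B \<and> \<bar>k s\<bar> \<le> B"
proof -
  have "compact (U ` {0..1})" "compact (k ` {0..1})"
    by (rule compact_continuous_image[OF Uc], simp, rule compact_continuous_image[OF kc], simp)
  from compact_imp_bounded[OF this(1)] compact_imp_bounded[OF this(2)]
  obtain a b where ab: "0 < a" "\<forall>z\<in>U ` {0..1}. norm z \<le> a" "0 < b" "\<forall>z\<in>k ` {0..1}. norm z \<le> b"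
    unfolding bounded_pos by blast
  have "\<bar>U s\<bar> \<le> a + b \<and> \<bar>k s\<bar> \<le> a + b" if "s \<in> {0..1}" for s
    using ab(1,3) bspec[OF ab(2), of "U s"] bspec[OF ab(4), of "k s"] that by auto
  then show ?thesis using ab(1,3) by (intro exI[of _ "a + b"]) auto
qed

lemma sq_in: "x \<in> B1 \<Longrightarrow> (norm x)\<^sup>2 \<in> {0..1}"
  using norm_sq_B1(1,2)[of x] by simp

lemma cont_B1: "continuous_on B1 (\<lambda>x. U ((norm x)\<^sup>2))" "continuous_on B1 (\<lambda>x. k ((norm x)\<^sup>2))" "continuous_on B1 u" "continuous_on B1 V"
proof -
  have n: "continuous_on B1 (\<lambda>x :: real ^ 2. (norm x)\<^sup>2)" by (intro continuous_intros)
  show 1: "continuous_on B1 (\<lambda>x. U ((norm x)\<^sup>2))" by (rule continuous_on_compose2[OF Uc n]) (use sq_in in blast)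
  show 2: "continuous_on B1 (\<lambda>x. k ((norm x)\<^sup>2))" by (rule continuous_on_compose2[OF kc n]) (use sq_in in blast)
  show "continuous_on B1 u" using 1 by (simp add: u_def[abs_def])
  show "continuous_on B1 V" unfolding V_def by (intro continuous_intros 2)
qed

lemma du: assumes x: "x \<in> B1" shows "(u has_derivative (\<lambda>h. V x \<bullet> h)) (at x)"
proof (cases "x = 0")
  case False
  from DERIV_compose_FDERIV[OF dU[OF norm_sq_B1(3)[OF x False] norm_sq_B1(1)[OF x]] has_derivative_norm2]
  show ?thesis unfolding u_def[abs_def] V_def
    by (rule has_derivative_eq_rhs) (simp add: fun_eq_iff)
next
  case True
  obtain B where B: "0 < B" "\<forall>s\<in>{0..1}. \<bar>U s\<bar> \<le> B \<and> \<bar>k s\<bar> \<le> B" using bound by blast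
  have "(u has_derivative (\<lambda>h. V 0 \<bullet> h)) (at 0)"
  proof (rule has_derivative_at_0I[where e="\<lambda>x. B * norm x"])
    fix y :: "real ^ 2" assume y: "y \<in> B1"
    have "\<bar>U ((norm y)\<^sup>2) - U 0\<bar> \<le> B * ((norm y)\<^sup>2 - 0)"
      by (rule mvt_bound[OF Uc dU]) (use B norm_sq_B1(1,2)[OF y] in simp_all)
    then show "\<bar>u y - u 0 - V 0 \<bullet> y\<bar> \<le> B * norm y * norm y" by (simp add: u_def V_def power2_eq_square)
  next
    have "((\<lambda>x :: real ^ 2. B * norm x) \<longlongrightarrow> B * norm (0 :: real ^ 2)) (at 0)" by (intro tendsto_intros)
    then show "((\<lambda>x :: real ^ 2. B * norm x) \<longlongrightarrow> 0) (at 0)" by simp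
  qed
  then show ?thesis using True by simp
qed

lemma grad_u: "x \<in> B1 \<Longrightarrow> grad u x = V x"
  by (rule grad_eqI[OF du])

lemma dV: assumes x: "x \<in> B1" shows "((\<lambda>x. V x $ i) has_derivative (\<lambda>h. W i x \<bullet> h)) (at x)"
proof (cases "x = 0")
  case False
  have "((\<lambda>x :: real ^ 2. k ((norm x)\<^sup>2)) has_derivative (\<lambda>h. ((2 *\<^sub>R x) \<bullet> h) * k1 ((norm x)\<^sup>2))) (at x)"
    by (rule DERIV_compose_FDERIV[OF dk[OF norm_sq_B1(3)[OF x False] norm_sq_B1(1)[OF x]] has_derivative_norm2])
  moreover have "((\<lambda>x :: real ^ 2. x $ i) has_derivative (\<lambda>h. h $ i)) (at x)"
    by (rule bounded_linear_imp_has_derivative[OF bounded_linear_vec_nth])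
  ultimately have "((\<lambda>x. k ((norm x)\<^sup>2) * x $ i) has_derivative
      (\<lambda>h. k ((norm x)\<^sup>2) * h $ i + ((2 *\<^sub>R x) \<bullet> h) * k1 ((norm x)\<^sup>2) * x $ i)) (at x)"
    by (rule has_derivative_mult)
  from has_derivative_mult_right[OF this, of 2]
  have "((\<lambda>x. V x $ i) has_derivative (\<lambda>h. 2 * (k ((norm x)\<^sup>2) * h $ i + ((2 *\<^sub>R x) \<bullet> h) * k1 ((norm x)\<^sup>2) * x $ i))) (at x)"
    by (simp add: V_def mult.assoc)
  then show ?thesis
  proof (rule has_derivative_eq_rhs)
    show "(\<lambda>h. 2 * (k ((norm x)\<^sup>2) * h $ i + ((2 *\<^sub>R x) \<bullet> h) * k1 ((norm x)\<^sup>2) * x $ i)) = (\<lambda>h. W i x \<bullet> h)"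
      using False by (simp add: W_def inner_add_left inner_axis' fun_eq_iff algebra_simps)
  qed
next
  case True
  have "((\<lambda>x. V x $ i) has_derivative (\<lambda>h. W i 0 \<bullet> h)) (at 0)"
  proof (rule has_derivative_at_0I[where e="\<lambda>x. 2 * \<bar>k ((norm x)\<^sup>2) - k 0\<bar>"])
    fix y :: "real ^ 2" assume y: "y \<in> B1"
    have "V y $ i - V 0 $ i - W i 0 \<bullet> y = 2 * (k ((norm y)\<^sup>2) - k 0) * y $ i"
      by (simp add: V_def W_def inner_axis' algebra_simps)
    then have "\<bar>V y $ i - V 0 $ i - W i 0 \<bullet> y\<bar> = 2 * \<bar>k ((norm y)\<^sup>2) - k 0\<bar> * \<bar>y $ i\<bar>" by (simp only: abs_mult abs_numeral)
    also have "\<dots> \<le> 2 * \<bar>k ((norm y)\<^sup>2) - k 0\<bar> * norm y" by (intro mult_left_mono component_le_norm_cart) simp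
    finally show "\<bar>V y $ i - V 0 $ i - W i 0 \<bullet> y\<bar> \<le> 2 * \<bar>k ((norm y)\<^sup>2) - k 0\<bar> * norm y" .
  next
    have "isCont (\<lambda>x :: real ^ 2. k ((norm x)\<^sup>2)) 0"
      by (rule continuous_on_interior[OF cont_B1(2)]) (simp add: interior_open)
    then have "((\<lambda>x :: real ^ 2. k ((norm x)\<^sup>2)) \<longlongrightarrow> k 0) (at 0)" by (simp add: isCont_def)
    from tendsto_mult_left[OF tendsto_rabs_zero[OF LIM_zero[OF this]], of 2]
    show "((\<lambda>x :: real ^ 2. 2 * \<bar>k ((norm x)\<^sup>2) - k 0\<bar>) \<longlongrightarrow> 0) (at 0)" by (simp only: mult_zero_right)
  qed
  then show ?thesis using True by simp
qed

lemma V_bounds: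
  assumes B: "\<forall>s\<in>{0..1}. \<bar>U s\<bar> \<le> B \<and> \<bar>k s\<bar> \<le> B" and x: "x \<in> B1"
  shows "\<bar>u x\<bar> \<le> B" "norm (V x) \<le> 2 * B" "\<bar>V x $ i\<bar> \<le> 2 * B" "norm (W i x) \<le> 2 * B + 4 * C" "\<bar>lap x\<bar> \<le> 4 * B + 4 * C"
proof -
  have s: "(norm x)\<^sup>2 \<in> {0..1}" by (rule sq_in[OF x])
  have C: "0 \<le> C" using k1_bound[of "1/2"] by linarith
  have kb: "\<bar>k ((norm x)\<^sup>2)\<bar> \<le> B" "\<bar>U ((norm x)\<^sup>2)\<bar> \<le> B" "\<bar>k 0\<bar> \<le> B" using bspec[OF B s] bspec[OF B, of 0] by simp_all
  have nx: "norm x \<le> 1" using x by simp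
  show "\<bar>u x\<bar> \<le> B" using kb by (simp add: u_def)
  have "norm (V x) = 2 * \<bar>k ((norm x)\<^sup>2)\<bar> * norm x" by (simp add: V_def abs_mult)
  also have "\<dots> \<le> 2 * B * 1" using kb nx by (intro mult_mono) simp_all
  finally show nV: "norm (V x) \<le> 2 * B" by simp
  show "\<bar>V x $ i\<bar> \<le> 2 * B" using component_le_norm_cart[of "V x" i] nV by simp
  show "norm (W i x) \<le> 2 * B + 4 * C"
  proof (cases "x = 0")
    case True
    then show ?thesis using kb C by (simp add: W_def abs_mult)
  next
    case False
    have "norm (W i x) \<le> norm ((2 * k ((norm x)\<^sup>2)) *\<^sub>R axis i 1 :: real ^ 2) + norm ((4 * (x $ i) * k1 ((norm x)\<^sup>2)) *\<^sub>R x)"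
      using False norm_triangle_ineq by (simp only: W_def if_False)
    also have "\<dots> = 2 * \<bar>k ((norm x)\<^sup>2)\<bar> + 4 * (\<bar>x $ i\<bar> * (\<bar>k1 ((norm x)\<^sup>2)\<bar> * norm x))"
      by (simp add: abs_mult mult.assoc)
    also have "\<dots> \<le> 2 * B + 4 * (norm x * (\<bar>k1 ((norm x)\<^sup>2)\<bar> * norm x))"
      using kb component_le_norm_cart[of x i] by (intro add_mono mult_left_mono mult_right_mono) simp_all
    also have "norm x * (\<bar>k1 ((norm x)\<^sup>2)\<bar> * norm x) = \<bar>(norm x)\<^sup>2 * k1 ((norm x)\<^sup>2)\<bar>" by (simp add: abs_mult power2_eq_square)
    also have "2 * B + 4 * \<dots> \<le> 2 * B + 4 * C"
      using k1_bound[OF norm_sq_B1(3)[OF x False] norm_sq_B1(1)[OF x]] by simp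
    finally show ?thesis .
  qed
  show "\<bar>lap x\<bar> \<le> 4 * B + 4 * C"
  proof (cases "x = 0")
    case True
    then show ?thesis using kb C by (simp add: lap_def)
  next
    case False
    then show ?thesis using kb k1_bound[OF norm_sq_B1(3)[OF x False] norm_sq_B1(1)[OF x]] by (simp add: lap_def abs_le_iff)
  qed
qed

lemma trace_W: "W 1 x $ 1 + W 2 x $ 2 = lap x"
proof (cases "x = 0")
  case False
  have "4 * (norm x)\<^sup>2 * c = 4 * x $ 1 * c * x $ 1 + 4 * x $ 2 * c * x $ 2" for c
    unfolding norm2_eq by (simp add: algebra_simps)
  then show ?thesis using False by (simp add: W_def lap_def axis_def)
qed (simp add: W_def lap_def axis_def)

lemma weak_grad_u: "is_weak_grad u (grad u)"
proof -
  obtain B where B: "0 < B" "\<forall>s\<in>{0..1}. \<bar>U s\<bar> \<le> B \<and> \<bar>k s\<bar> \<le> B" using bound by blast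
  show ?thesis
  proof (rule classical_weak_grad[of u "2 * B"])
    show "u differentiable (at x)" if "x \<in> B1" for x using du[OF that] unfolding differentiable_def by blast
    show "\<bar>u x\<bar> \<le> 2 * B" if "x \<in> B1" for x using V_bounds(1)[OF B(2) that] B(1) by simp
    show "norm (grad u x) \<le> 2 * B" if "x \<in> B1" for x using V_bounds(2)[OF B(2) that] grad_u[OF that] by simp
    show "continuous_on B1 (grad u)" by (rule continuous_on_eq[OF cont_B1(4)]) (simp add: grad_u)
  qed
qed

text \<open>Integration by parts is applied to each component of V, whose gradient is the bounded
  field \<open>W i\<close>; the trace of these gradients is \<open>lap\<close>.\<close>

lemma weak_laplace_test:
  assumes \<phi>: "test_fun \<phi>"
  shows "(LINT x|leb_B1. grad u x \<bullet> grad \<phi> x) = - (LINT x|leb_B1. \<phi> x * lap x)"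
proof -
  obtain B where B: "0 < B" "\<forall>s\<in>{0..1}. \<bar>U s\<bar> \<le> B \<and> \<bar>k s\<bar> \<le> B" using bound by blast
  have C: "0 \<le> C" using k1_bound[of "1/2"] by linarith
  have Vb: "\<bar>V x $ i\<bar> \<le> 2 * B + 4 * C" "norm (grad (\<lambda>x. V x $ i) x) \<le> 2 * B + 4 * C" "(\<lambda>x. V x $ i) differentiable (at x)"
    "grad (\<lambda>x. V x $ i) x = W i x" if "x \<in> B1" for x i
  proof -
    show g: "grad (\<lambda>x. V x $ i) x = W i x" by (rule grad_eqI[OF dV[OF that]])
    show "\<bar>V x $ i\<bar> \<le> 2 * B + 4 * C" using V_bounds(3)[OF B(2) that, of i] C by simp
    show "norm (grad (\<lambda>x. V x $ i) x) \<le> 2 * B + 4 * C" unfolding g by (rule V_bounds(4)[OF B(2) that])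
    show "(\<lambda>x. V x $ i) differentiable (at x)" using dV[OF that] unfolding differentiable_def by blast
  qed
  have P: "(LINT x|leb_B1. V x $ i * grad \<phi> x $ i) = - (LINT x|leb_B1. \<phi> x * grad (\<lambda>x. V x $ i) x $ i)"
    "integrable leb_B1 (\<lambda>x. V x $ i * grad \<phi> x $ i)" "integrable leb_B1 (\<lambda>x. \<phi> x * grad (\<lambda>x. V x $ i) x $ i)" for i
    by (rule integral_by_parts[OF \<phi> Vb(3) Vb(1) Vb(2)]; assumption)+
  have "(LINT x|leb_B1. grad u x \<bullet> grad \<phi> x) = (LINT x|leb_B1. V x $ 1 * grad \<phi> x $ 1 + V x $ 2 * grad \<phi> x $ 2)"
  proof (rule Bochner_Integration.integral_cong[OF refl])
    fix x assume "x \<in> space leb_B1"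
    then have "grad u x = V x" by (intro grad_u) simp
    then show "grad u x \<bullet> grad \<phi> x = V x $ 1 * grad \<phi> x $ 1 + V x $ 2 * grad \<phi> x $ 2"
      by (simp add: inner_vec_def sum_2)
  qed
  also have "\<dots> = (LINT x|leb_B1. V x $ 1 * grad \<phi> x $ 1) + (LINT x|leb_B1. V x $ 2 * grad \<phi> x $ 2)"
    by (rule Bochner_Integration.integral_add[OF P(2) P(2)])
  also have "\<dots> = - ((LINT x|leb_B1. \<phi> x * grad (\<lambda>x. V x $ 1) x $ 1) + (LINT x|leb_B1. \<phi> x * grad (\<lambda>x. V x $ 2) x $ 2))"
    by (simp only: P(1) minus_add_distrib)
  also have "(LINT x|leb_B1. \<phi> x * grad (\<lambda>x. V x $ 1) x $ 1) + (LINT x|leb_B1. \<phi> x * grad (\<lambda>x. V x $ 2) x $ 2) =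
      (LINT x|leb_B1. \<phi> x * grad (\<lambda>x. V x $ 1) x $ 1 + \<phi> x * grad (\<lambda>x. V x $ 2) x $ 2)"
    by (rule Bochner_Integration.integral_add[OF P(3) P(3), symmetric])
  also have "\<dots> = (LINT x|leb_B1. \<phi> x * lap x)"
  proof (rule Bochner_Integration.integral_cong[OF refl])
    fix x assume "x \<in> space leb_B1"
    then have x: "x \<in> B1" by simp
    show "\<phi> x * grad (\<lambda>x. V x $ 1) x $ 1 + \<phi> x * grad (\<lambda>x. V x $ 2) x $ 2 = \<phi> x * lap x"
      unfolding Vb(4)[OF x] trace_W[symmetric] by (simp add: distrib_left)
  qed
  finally show ?thesis .
qed

lemma L2_lap: assumes "continuous_on B1 lap" shows "L2 lap"
proof -
  obtain B where B: "0 < B" "\<forall>s\<in>{0..1}. \<bar>U s\<bar> \<le> B \<and> \<bar>k s\<bar> \<le> B" using bound by blast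
  show ?thesis
    by (rule L2_bounded[OF continuous_measurable[OF assms], of "4 * B + 4 * C"]) (use V_bounds(5)[OF B(2)] in simp)
qed

text \<open>Both sides are continuous in v with respect to the H1 norm, so the identity passes from
  test functions to their closure.\<close>

lemma weak_laplace:
  assumes lc: "continuous_on B1 lap" and v: "v \<in> H10"
  shows "dirichlet u v = - (LINT x|leb_B1. lap x * v x)"
proof -
  obtain \<phi> where \<phi>: "\<And>n. test_fun (\<phi> n)" "(\<lambda>n. LINT x|leb_B1. (\<phi> n x - v x)\<^sup>2) \<longlonglongrightarrow> 0"
    "(\<lambda>n. LINT x|leb_B1. (norm (grad (\<phi> n) x - wgrad v x))\<^sup>2) \<longlonglongrightarrow> 0"
    by (rule H10_approx[OF v]) (rule that, blast+)
  note L\<phi> = weak_grad_L2[OF test_fun_weak_grad[OF \<phi>(1)]]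
  have l2: "(\<lambda>n. LINT x|leb_B1. (norm (\<phi> n x - v x))\<^sup>2) \<longlonglongrightarrow> 0" using \<phi>(2) by simp
  have 1: "(\<lambda>n. LINT x|leb_B1. grad u x \<bullet> grad (\<phi> n) x) \<longlonglongrightarrow> (LINT x|leb_B1. grad u x \<bullet> wgrad v x)"
    by (rule L2_inner_tendsto[OF weak_grad_L2(2)[OF weak_grad_u] L\<phi>(2) H10_L2(2)[OF v] \<phi>(3)])
  have "(\<lambda>n. LINT x|leb_B1. lap x \<bullet> \<phi> n x) \<longlonglongrightarrow> (LINT x|leb_B1. lap x \<bullet> v x)"
    by (rule L2_inner_tendsto[OF L2_lap[OF lc] L\<phi>(1) H10_L2(1)[OF v] l2])
  from tendsto_minus[OF this]
  have 2: "(\<lambda>n. - (LINT x|leb_B1. \<phi> n x * lap x)) \<longlonglongrightarrow> - (LINT x|leb_B1. lap x * v x)"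
    by (simp add: mult.commute)
  have "(LINT x|leb_B1. grad u x \<bullet> wgrad v x) = - (LINT x|leb_B1. lap x * v x)"
    by (rule LIMSEQ_unique[OF 1]) (use 2 weak_laplace_test[OF \<phi>(1)] in simp)
  then show ?thesis using dirichlet_eq[OF weak_grad_u wgrad[OF H10_H1[OF v]]] by simp
qed

text \<open>Weierstrass approximation is applied to the derivative k, and its polynomial q is
  integrated to P with P 1 = 0. Then P is close to U together with its derivative, and cutting off P
  costs little because P vanishes on the circle.\<close>

lemma u_approx: assumes e: "0 < e" shows "\<exists>\<phi>. test_fun \<phi> \<and> H1_norm (\<lambda>x. \<phi> x - u x) < e"
proof -
  define M1 where "M1 = measure leb_B1 (space leb_B1)"
  have M1: "0 \<le> M1" by (simp add: M1_def)
  \<comment> \<open>The two cut-off errors cost at most e^2 / 4 in total, and the approximation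
    errors 2 d^2 M1 + 2 (2 d)^2 M1 = 10 d^2 M1 less than e^2 / 2. The bound d \<le> 1 allows d^2 to
    be replaced by d.\<close>
  define d where "d = min 1 (e\<^sup>2 / (20 * (M1 + 1)))"
  have d: "0 < d" "d \<le> 1" using e M1 by (simp_all add: d_def)
  have "d * (20 * (M1 + 1)) \<le> e\<^sup>2 / (20 * (M1 + 1)) * (20 * (M1 + 1))" using M1 by (intro mult_right_mono) (simp_all add: d_def)
  also have "\<dots> = e\<^sup>2" using M1 by simp
  finally have dM: "d * (20 * (M1 + 1)) \<le> e\<^sup>2" .
  have "d\<^sup>2 \<le> d" using d by (simp add: power2_eq_square mult_left_le)
  then have "20 * (d\<^sup>2 * M1) \<le> 20 * (d * M1)" using M1 by (intro mult_left_mono mult_right_mono) simp_all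
  then have d2: "20 * (d\<^sup>2 * M1) < e\<^sup>2" using dM d by (simp add: algebra_simps)
  obtain q where q: "real_polynomial_function q" "\<And>s. s \<in> {0..1} \<Longrightarrow> \<bar>k s - q s\<bar> < d"
    by (rule Stone_Weierstrass_real_polynomial_function[OF compact_Icc kc d(1)]) (rule that, blast+)
  obtain a n where a: "q = (\<lambda>s. \<Sum>i\<le>n. a i * s ^ i)" using q(1) unfolding real_polynomial_function_iff_sum by blast
  define P where "P s = (\<Sum>i\<le>n. a i / (real i + 1) * (s ^ Suc i - 1))" for s
  have Pd: "(P has_real_derivative q s) (at s)" for s
  proof -
    have "((\<lambda>s. a i / (real i + 1) * (s ^ Suc i - 1)) has_real_derivative a i * s ^ i) (at s)" for i
    proof -
      have "((\<lambda>s. a i / (real i + 1) * (s ^ Suc i - 1)) has_real_derivative a i / (real i + 1) * (real (Suc i) * s ^ i - 0)) (at s)"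
        by (intro DERIV_cmult DERIV_diff DERIV_pow[of "Suc i" s UNIV, unfolded diff_Suc_Suc diff_zero] DERIV_const)
      moreover have "a i / (real i + 1) * (real (Suc i) * s ^ i - 0) = a i * s ^ i"
      proof -
        have "a i / c * (c * z - 0) = a i * z" if "c \<noteq> 0" for c z :: real using that by simp
        from this[of "real i + 1" "s ^ i"] show ?thesis by (simp add: add.commute)
      qed
      ultimately show ?thesis by simp
    qed
    then show ?thesis unfolding P_def[abs_def] a by (intro DERIV_sum)
  qed
  have P1: "P 1 = 0" by (simp add: P_def)
  have qc: "continuous_on UNIV q" unfolding a by (intro continuous_intros)
  have Ps: "smooth (\<lambda>x. P ((norm x)\<^sup>2))"
  proof -
    have "smooth (\<lambda>x. a i / (real i + 1) * ((norm x)\<^sup>2) ^ Suc i + - (a i / (real i + 1)))" for i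
      by (rule smooth_affine[OF smooth_power[OF smooth_norm2]])
    then have "smooth (\<lambda>x. \<Sum>i\<le>n. a i / (real i + 1) * ((norm x)\<^sup>2) ^ Suc i + - (a i / (real i + 1)))"
      by (rule smooth_sum[OF finite_atMost])
    then show ?thesis unfolding P_def by (simp only: right_diff_distrib mult_1_right add_uminus_conv_diff simp_thms)
  qed
  have Pc: "continuous_on {0..1} P" by (rule DERIV_continuous_on) (rule has_field_derivative_at_within[OF Pd])
  have PU: "\<bar>P s - U s\<bar> \<le> d" if s: "s \<in> {0..1}" for s
  proof -
    have s01: "0 \<le> s" "s \<le> 1" using s by simp_all
    have dPU: "((\<lambda>s. P s - U s) has_real_derivative q z - k z) (at z)" if "0 < z" "z < 1" for z
      by (rule DERIV_diff[OF Pd dU[OF that]])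
    have qk: "\<bar>q z - k z\<bar> \<le> d" if "0 < z" "z < 1" for z
    proof -
      have "z \<in> {0..1}" using that by simp
      from q(2)[OF this] show ?thesis by arith
    qed
    have "\<bar>(P 1 - U 1) - (P s - U s)\<bar> \<le> d * (1 - s)"
      by (rule mvt_bound[where f="\<lambda>s. P s - U s", OF continuous_on_diff[OF Pc Uc] dPU qk s01 order_refl])
    also have "\<dots> \<le> d * 1" by (rule mult_left_mono) (use s01 d in linarith)+
    finally show ?thesis unfolding P1 U1 by arith
  qed
  note A = radial_polynomial_approx[OF Ps Pd qc P1]
  have d4: "0 < e\<^sup>2 / 16" using e by simp
  have ev: "\<forall>\<^sub>F m in sequentially. (LINT x|leb_B1. (cutoff m x * P ((norm x)\<^sup>2) - P ((norm x)\<^sup>2))\<^sup>2) < e\<^sup>2 / 16"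
    "\<forall>\<^sub>F m in sequentially. (LINT x|leb_B1. (norm (grad (\<lambda>x. cutoff m x * P ((norm x)\<^sup>2)) x - (2 * q ((norm x)\<^sup>2)) *\<^sub>R x))\<^sup>2) < e\<^sup>2 / 16"
    by (rule order_tendstoD(2)[OF A(2) d4], rule order_tendstoD(2)[OF A(3) d4])
  from eventually_happens'[OF sequentially_bot eventually_conj[OF ev]]
  obtain m where m: "(LINT x|leb_B1. (cutoff m x * P ((norm x)\<^sup>2) - P ((norm x)\<^sup>2))\<^sup>2) < e\<^sup>2 / 16"
     "(LINT x|leb_B1. (norm (grad (\<lambda>x. cutoff m x * P ((norm x)\<^sup>2)) x - (2 * q ((norm x)\<^sup>2)) *\<^sub>R x))\<^sup>2) < e\<^sup>2 / 16"
    by (elim exE conjE) (rule that)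
  define \<phi> where "\<phi> x = cutoff m x * P ((norm x)\<^sup>2)" for x
  define uP where "uP x = P ((norm x)\<^sup>2)" for x :: "real ^ 2"
  define gP where "gP x = (2 * q ((norm x)\<^sup>2)) *\<^sub>R x" for x :: "real ^ 2"
  have t\<phi>: "test_fun \<phi>" unfolding \<phi>_def[abs_def] by (rule A(1))
  have nc: "continuous_on UNIV (\<lambda>x :: real ^ 2. (norm x)\<^sup>2)" by (intro continuous_intros)
  have uPc: "continuous_on B1 uP" unfolding uP_def[abs_def]
    by (rule continuous_on_compose2[OF Pc continuous_on_subset[OF nc subset_UNIV]]) (use sq_in in blast)
  have "continuous_on B1 (\<lambda>x :: real ^ 2. q ((norm x)\<^sup>2))"
    by (rule continuous_on_compose2[OF qc continuous_on_subset[OF nc subset_UNIV]]) simp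
  then have gPc: "continuous_on B1 gP" unfolding gP_def[abs_def] by (intro continuous_intros)
  obtain B where B: "0 < B" "\<forall>s\<in>{0..1}. \<bar>U s\<bar> \<le> B \<and> \<bar>k s\<bar> \<le> B" using bound by blast
  have du_le: "\<bar>uP x - u x\<bar> \<le> d" if "x \<in> B1" for x using PU[OF sq_in[OF that]] by (simp add: uP_def u_def)
  have dg_le: "norm (gP x - grad u x) \<le> 2 * d" if "x \<in> B1" for x
  proof -
    have "gP x - grad u x = (2 * (q ((norm x)\<^sup>2) - k ((norm x)\<^sup>2))) *\<^sub>R x"
      unfolding grad_u[OF that] gP_def V_def by (simp add: algebra_simps)
    then have "norm (gP x - grad u x) = 2 * \<bar>k ((norm x)\<^sup>2) - q ((norm x)\<^sup>2)\<bar> * norm x" by (simp only: norm_scaleR abs_mult abs_numeral abs_minus_commute)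
    also have "\<dots> \<le> 2 * d * 1" using q(2)[OF sq_in[OF that]] that by (intro mult_mono) simp_all
    finally show ?thesis by simp
  qed
  have Lu: "L2 u" "L2 (grad u)" by (rule weak_grad_L2[OF weak_grad_u])+
  have uPL: "L2 uP"
  proof (rule L2_bounded[OF continuous_measurable[OF uPc], of "B + d"])
    fix x assume x: "x \<in> B1"
    then show "norm (uP x) \<le> B + d" using du_le[OF x] V_bounds(1)[OF B(2) x] by simp
  qed
  have gPL: "L2 gP"
  proof (rule L2_bounded[OF continuous_measurable[OF gPc], of "2 * B + 2 * d"])
    fix x assume x: "x \<in> B1"
    have "norm (gP x) \<le> norm (gP x - grad u x) + norm (grad u x)" using norm_triangle_ineq[of "gP x - grad u x" "grad u x"] by simp
    then show "norm (gP x) \<le> 2 * B + 2 * d" using dg_le[OF x] V_bounds(2)[OF B(2) x] grad_u[OF x] by simp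
  qed
  note L\<phi> = weak_grad_L2[OF test_fun_weak_grad[OF t\<phi>]]
  have i1: "(LINT x|leb_B1. (norm (uP x - u x))\<^sup>2) \<le> d\<^sup>2 * M1" unfolding M1_def
  proof (rule LINT_le_const)
    show "(\<lambda>x. (norm (uP x - u x))\<^sup>2) \<in> borel_measurable leb_B1"
      using L2_add[OF uPL L2_scale[OF Lu(1)], of "-1"] by (simp add: L2_def borel_measurable_integrable)
    fix x assume "x \<in> B1"
    then show "0 \<le> (norm (uP x - u x))\<^sup>2 \<and> (norm (uP x - u x))\<^sup>2 \<le> d\<^sup>2"
      using power_mono[OF du_le[of x], of 2] by simp
  qed
  have i2: "(LINT x|leb_B1. (norm (gP x - grad u x))\<^sup>2) \<le> (2 * d)\<^sup>2 * M1" unfolding M1_def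
  proof (rule LINT_le_const)
    show "(\<lambda>x. (norm (gP x - grad u x))\<^sup>2) \<in> borel_measurable leb_B1"
      using L2_add[OF gPL L2_scale[OF Lu(2)], of "-1"] by (simp add: L2_def borel_measurable_integrable)
    fix x assume "x \<in> B1"
    then show "0 \<le> (norm (gP x - grad u x))\<^sup>2 \<and> (norm (gP x - grad u x))\<^sup>2 \<le> (2 * d)\<^sup>2"
      using power_mono[OF dg_le[of x], of 2] by simp
  qed
  have "is_weak_grad (\<lambda>x. \<phi> x - u x) (\<lambda>x. grad \<phi> x - grad u x)"
    using weak_grad_lincomb[OF test_fun_weak_grad[OF t\<phi>] weak_grad_u, of 1 "-1"] by simp
  from H1_norm_sq[OF this]
  have "(H1_norm (\<lambda>x. \<phi> x - u x))\<^sup>2 = (LINT x|leb_B1. (norm (\<phi> x - u x))\<^sup>2) + (LINT x|leb_B1. (norm (grad \<phi> x - grad u x))\<^sup>2)" by simp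
  also have "\<dots> \<le> (2 * (LINT x|leb_B1. (norm (\<phi> x - uP x))\<^sup>2) + 2 * (LINT x|leb_B1. (norm (uP x - u x))\<^sup>2)) +
      (2 * (LINT x|leb_B1. (norm (grad \<phi> x - gP x))\<^sup>2) + 2 * (LINT x|leb_B1. (norm (gP x - grad u x))\<^sup>2))"
    by (rule add_mono[OF L2_triangle[OF L\<phi>(1) uPL Lu(1)] L2_triangle[OF L\<phi>(2) gPL Lu(2)]])
  also have "\<dots> < e\<^sup>2"
  proof -
    have "(LINT x|leb_B1. (norm (\<phi> x - uP x))\<^sup>2) < e\<^sup>2 / 16" using m(1) by (simp add: \<phi>_def uP_def)
    moreover have "(LINT x|leb_B1. (norm (grad \<phi> x - gP x))\<^sup>2) < e\<^sup>2 / 16" using m(2) by (simp add: \<phi>_def[abs_def] gP_def)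
    moreover have "(2 * d)\<^sup>2 * M1 = 4 * (d\<^sup>2 * M1)" by (simp add: power_mult_distrib)
    moreover have "0 < e\<^sup>2" using e by simp
    ultimately show ?thesis using i1 i2 d2 by linarith
  qed
  finally have "H1_norm (\<lambda>x. \<phi> x - u x) < e" by (rule power2_less_imp_less) (rule less_imp_le[OF e])
  with t\<phi> show ?thesis by (intro exI[of _ \<phi>] conjI)
qed

lemma u_H10: "u \<in> H10"
proof -
  have "\<forall>n. \<exists>\<phi>. test_fun \<phi> \<and> H1_norm (\<lambda>x. \<phi> x - u x) < inverse (real (Suc n))" by (intro allI u_approx) simp
  from choice[OF this] obtain \<phi> where \<phi>: "\<forall>n. test_fun (\<phi> n) \<and> H1_norm (\<lambda>x. \<phi> n x - u x) < inverse (real (Suc n))" by blast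
  have ge: "\<forall>\<^sub>F n in sequentially. 0 \<le> H1_norm (\<lambda>x. \<phi> n x - u x)" by (rule always_eventually, rule allI, rule H1_norm_nonneg)
  have le: "\<forall>\<^sub>F n in sequentially. H1_norm (\<lambda>x. \<phi> n x - u x) \<le> inverse (real (Suc n))"
    by (rule always_eventually, rule allI, rule less_imp_le) (use \<phi> in blast)
  have "(\<lambda>n. H1_norm (\<lambda>x. \<phi> n x - u x)) \<longlonglongrightarrow> 0"
    by (rule tendsto_sandwich[OF ge le tendsto_const LIMSEQ_inverse_real_of_nat])
  then show ?thesis using \<phi> H1I[OF weak_grad_u] unfolding H10_def by blast
qed

end

section \<open>Solutions from radial profiles\<close>

lemma measure_B1_gt: "measure leb_B1 {x \<in> B1. t < (norm x)\<^sup>2} = pi * (1 - min 1 (max 0 t))"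
proof -
  have b: "measure lebesgue (ball (0 :: real ^ 2) 1) = pi"
    using content_ball[of 1 "0 :: real ^ 2"] by (simp add: measure_completion unit_ball_vol_2)
  have cb: "measure lebesgue (cball (0 :: real ^ 2) r) = pi * r\<^sup>2" if "0 \<le> r" for r
    using content_cball[OF that, of "0 :: real ^ 2"] by (simp add: measure_completion unit_ball_vol_2)
  have m: "measure leb_B1 A = measure lebesgue A" if "A \<subseteq> B1" for A
    by (rule measure_restrict_space) (use that in simp_all)
  have gt: "s < (norm x)\<^sup>2 \<longleftrightarrow> sqrt s < norm x" for x :: "real ^ 2" and s
    using real_sqrt_less_iff[of s "(norm x)\<^sup>2"] unfolding real_sqrt_abs abs_norm_cancel by (rule sym)
  consider "t < 0" | "1 \<le> t" | "0 \<le> t" "t < 1" by linarith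
  then show ?thesis
  proof cases
    case 1
    have "t < (norm x)\<^sup>2" for x :: "real ^ 2" using 1 zero_le_power2[of "norm x"] by linarith
    then have "{x \<in> B1. t < (norm x)\<^sup>2} = B1" by blast
    then show ?thesis using 1 b m[of B1] by simp
  next
    case 2
    have "\<not> t < (norm x)\<^sup>2" if "x \<in> B1" for x using norm_sq_B1(1)[OF that] 2 by linarith
    then have "{x \<in> B1. t < (norm x)\<^sup>2} = {}" by blast
    then show ?thesis using 2 by (simp only: measure_empty) simp
  next
    case 3
    have s: "{x \<in> B1. t < (norm x)\<^sup>2} = B1 - cball 0 (sqrt t)"
      unfolding gt by auto
    have sub: "cball 0 (sqrt t) \<subseteq> B1"
    proof
      fix x :: "real ^ 2" assume "x \<in> cball 0 (sqrt t)"
      then have "norm x \<le> sqrt t" by simp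
      also have "sqrt t < 1" using 3 by simp
      finally show "x \<in> B1" by simp
    qed
    have "measure lebesgue (B1 - cball 0 (sqrt t)) = measure lebesgue B1 - measure lebesgue (cball (0 :: real ^ 2) (sqrt t))"
    proof (rule measure_Diff)
      show "emeasure lebesgue B1 \<noteq> \<infinity>" using lmeasurable_ball[of "0 :: real ^ 2" 1] by (auto simp: fmeasurable_def)
    qed (use sub in simp_all)
    also have "\<dots> = pi * (1 - t)" unfolding b cb[OF real_sqrt_ge_zero[OF 3(1)]] using 3 by (simp add: right_diff_distrib)
    finally show ?thesis unfolding s using m[of "B1 - cball 0 (sqrt t)"] 3 by auto
  qed
qed

text \<open>The disk |x|^2 \<le> t has area pi t, so |x|^2 has constant density pi on [0, 1]. This
  fact takes the place of polar coordinates for radial integrals.\<close>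

lemma distr_norm_sq_B1:
  "distr leb_B1 borel (\<lambda>x. (norm x)\<^sup>2) = density lborel (\<lambda>s. ennreal (pi * indicator {0..1} s))"
proof (rule measure_eqI_lessThan)
  have nm: "(\<lambda>x :: real ^ 2. (norm x)\<^sup>2) \<in> borel_measurable leb_B1"
    by (rule continuous_measurable) (intro continuous_intros)
  have e1: "emeasure (distr leb_B1 borel (\<lambda>x. (norm x)\<^sup>2)) {t<..} = ennreal (pi * (1 - min 1 (max 0 t)))" for t
  proof -
    have "(\<lambda>x. (norm x)\<^sup>2) -` {t<..} \<inter> space leb_B1 = {x \<in> B1. t < (norm x)\<^sup>2}" by auto
    then have "emeasure (distr leb_B1 borel (\<lambda>x. (norm x)\<^sup>2)) {t<..} = emeasure leb_B1 {x \<in> B1. t < (norm x)\<^sup>2}"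
      using emeasure_distr[OF nm, of "{t<..}"] by simp
    also have "\<dots> = ennreal (measure leb_B1 {x \<in> B1. t < (norm x)\<^sup>2})" by (rule leb_B1.emeasure_eq_measure)
    finally show ?thesis by (simp only: measure_B1_gt)
  qed
  show "emeasure (distr leb_B1 borel (\<lambda>x. (norm x)\<^sup>2)) {t<..} < \<infinity>" for t unfolding e1 by simp
  show "emeasure (distr leb_B1 borel (\<lambda>x. (norm x)\<^sup>2)) {t<..} =
      emeasure (density lborel (\<lambda>s. ennreal (pi * indicator {0..1} s))) {t<..}" for t
  proof -
    have "emeasure (density lborel (\<lambda>s. ennreal (pi * indicator {0..1} s))) {t<..} =
        (\<integral>\<^sup>+ s. ennreal (pi * indicator {0..1} s) * indicator {t<..} s \<partial>lborel)"
      by (rule emeasure_density) simp_all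
    also have "\<dots> = (\<integral>\<^sup>+ s. ennreal pi * indicator ({0..1} \<inter> {t<..}) s \<partial>lborel)"
      by (rule nn_integral_cong) (simp add: indicator_def)
    also have "\<dots> = ennreal pi * emeasure lborel ({0..1} \<inter> {t<..})" by (rule nn_integral_cmult_indicator) simp
    also have "emeasure lborel ({0..1} \<inter> {t<..}) = ennreal (1 - min 1 (max 0 t))"
    proof -
      consider "t < 0" | "1 \<le> t" | "0 \<le> t" "t < 1" by linarith
      then show ?thesis
      proof cases
        case 1
        then have "{0..1} \<inter> {t<..} = {0..1}" by auto
        then show ?thesis using 1 by simp
      next
        case 2
        then have "{0..1} \<inter> {t<..} = {}" by auto
        then show ?thesis using 2 by simp
      next
        case 3
        then have "{0..1} \<inter> {t<..} = {t<..1}" by auto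
        then show ?thesis using 3 by simp
      qed
    qed
    also have "ennreal pi * \<dots> = ennreal (pi * (1 - min 1 (max 0 t)))" by (rule ennreal_mult[symmetric]) simp_all
    finally show ?thesis unfolding e1 by (rule sym)
  qed
qed simp_all

lemma radial_integral:
  fixes H :: "real \<Rightarrow> real"
  assumes c: "continuous_on {0..1} H" and I: "(H has_integral I) {0..1}"
  shows "(LINT x|leb_B1. H ((norm x)\<^sup>2)) = pi * I"
proof -
  define H' where "H' s = indicator {0..1} s *\<^sub>R H s" for s :: real
  have Hm: "H' \<in> borel_measurable borel" unfolding H'_def[abs_def]
    by (rule borel_measurable_continuous_on_indicator[OF _ c]) simp
  have nm: "(\<lambda>x :: real ^ 2. (norm x)\<^sup>2) \<in> borel_measurable leb_B1"
    by (rule continuous_measurable) (intro continuous_intros)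
  have "(LINT x|leb_B1. H ((norm x)\<^sup>2)) = (LINT x|leb_B1. H' ((norm x)\<^sup>2))"
  proof (rule Bochner_Integration.integral_cong[OF refl])
    fix x assume "x \<in> space leb_B1"
    then have "x \<in> B1" by simp
    from norm_sq_B1(1,2)[OF this] show "H ((norm x)\<^sup>2) = H' ((norm x)\<^sup>2)" by (simp add: H'_def)
  qed
  also have "\<dots> = integral\<^sup>L (distr leb_B1 borel (\<lambda>x. (norm x)\<^sup>2)) H'" by (rule integral_distr[OF nm Hm, symmetric])
  also have "\<dots> = (LINT s|lborel. (pi * indicator {0..1} s) *\<^sub>R H' s)"
    unfolding distr_norm_sq_B1 by (rule integral_density) (use Hm in simp_all)
  also have "\<dots> = (LINT s|lborel. pi * (indicator {0..1} s *\<^sub>R H s))"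
    by (rule Bochner_Integration.integral_cong[OF refl]) (simp add: H'_def indicator_def)
  also have "\<dots> = pi * (LINT s|lborel. indicator {0..1} s *\<^sub>R H s)" by (rule integral_mult_right_zero)
  also have "(LINT s|lborel. indicator {0..1} s *\<^sub>R H s) = I"
    using set_borel_integral_eq_integral(2)[OF borel_integrable_atLeastAtMost'[OF c]] integral_unique[OF I]
    by (simp add: set_lebesgue_integral_def)
  finally show ?thesis .
qed

context radial_profile
begin

text \<open>This is - w' with its singularity at 0 removed: p (r) / r tends to p'(0) = f (\<mu>) /
  4.\<close>

definition q :: "real \<Rightarrow> real" where "q r = (if r = 0 then f \<mu> / 4 else p r / r)"

text \<open>At r = 0 the mean value theorem gives p (r) / r = f (w z) / 4 for some z between 0 and
  r, and f composed with w is continuous.\<close>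

lemma q_continuous: assumes fc: "continuous_on UNIV f" shows "continuous_on {0..R} q"
  unfolding continuous_on_eq_continuous_within
proof
  have fw: "continuous_on {0..R} (\<lambda>r. f (w r))" by (rule continuous_on_compose2[OF fc cont(1)]) simp
  fix x assume x: "x \<in> {0..R}"
  show "continuous (at x within {0..R}) q"
  proof (cases "x = 0")
    case True
    show ?thesis unfolding continuous_within_eps_delta
    proof (intro allI impI)
      fix e :: real assume e: "0 < e"
      have "continuous (at 0 within {0..R}) (\<lambda>r. f (w r))"
        using fw R_pos unfolding continuous_on_eq_continuous_within by simp
      then obtain d where d: "0 < d" "\<And>r. r \<in> {0..R} \<Longrightarrow> dist r 0 < d \<Longrightarrow> dist (f (w r)) (f (w 0)) < e"
        using e unfolding continuous_within_eps_delta by blast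
      have "dist (q r) (q 0) < e" if r: "r \<in> {0..R}" "dist r 0 < d" for r
      proof (cases "r = 0")
        case False
        then have r0: "0 < r" using r by simp
        have "continuous_on {0..r} p" by (rule continuous_on_subset[OF cont(2)]) (use r in auto)
        moreover have "p differentiable (at z)" if "0 < z" "z < r" for z
          using dp[of z] that r unfolding real_differentiable_def by auto
        ultimately obtain l z where z: "0 < z" "z < r" "(p has_real_derivative l) (at z)" "p r - p 0 = (r - 0) * l"
          using MVT[of 0 r p] r0 by blast
        have l: "l = f (w z) / 4" by (rule DERIV_unique[OF z(3) dp]) (use z r in auto)
        have "q r = f (w z) / 4" using z(4) r0 init l by (simp add: q_def)
        moreover have "dist (f (w z)) (f (w 0)) < e" by (rule d(2)) (use z r in \<open>simp_all add: dist_real_def\<close>)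
        ultimately show ?thesis using init by (simp add: q_def dist_real_def)
      qed (use e in simp)
      then show "\<exists>d>0. \<forall>x'\<in>{0..R}. dist x' x < d \<longrightarrow> dist (q x') (q x) < e" using d(1) True by blast
    qed
  next
    case False
    then have x0: "0 < x" using x by simp
    have "continuous (at x within {0..R}) p" using cont(2) x unfolding continuous_on_eq_continuous_within by blast
    then have "continuous (at x within {0..R}) (\<lambda>r. p r / r)"
      by (rule continuous_at_within_divide[OF _ continuous_ident]) (use x0 in simp)
    then show ?thesis
    proof (rule continuous_transform_within[OF _ x0 x])
      show "p r / r = q r" if "r \<in> {0..R}" "dist r x < x" for r
        using that x0 by (auto simp: q_def dist_real_def)
    qed
  qed
qed

lemma dq: assumes r: "0 < r" "r < R" shows "(q has_real_derivative (f (w r) / 4 - q r) / r) (at r)"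
proof -
  have "((\<lambda>r. p r / r) has_real_derivative (f (w r) / 4 * r - p r * 1) / (r * r)) (at r)"
    by (rule DERIV_divide[OF dp[OF r] DERIV_ident]) (use r in simp)
  moreover have "(f (w r) / 4 * r - p r * 1) / (r * r) = (f (w r) / 4 - q r) / r"
    using r by (simp add: q_def field_simps)
  ultimately have "((\<lambda>r. p r / r) has_real_derivative (f (w r) / 4 - q r) / r) (at r)" by simp
  then show ?thesis
    by (rule has_field_derivative_transform_within_open[where S="{0<..}"]) (use r in \<open>simp_all add: q_def\<close>)
qed

text \<open>The function u (x) = w (R |x|^2) has Laplacian - R f (u), so the multiplier in terms of
  f is R. Since the derivative of the functional at u is 2 / R times v \<mapsto>
  \<open>dirichlet u v\<close>, it vanishes on the tangent space. The value at the centre is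
  recorded to tell solutions apart.\<close>

theorem critical_point:
  assumes dG: "\<And>t. (G has_real_derivative 2 * f t) (at t)" and Gb: "\<And>t. \<bar>G t\<bar> \<le> K * exp (t\<^sup>2)"
    and fL: "\<And>m. 0 < m \<Longrightarrow> \<exists>L. \<forall>x\<in>{- m..m}. \<forall>y\<in>{- m..m}. \<bar>f x - f y\<bar> \<le> L * \<bar>x - y\<bar>"
    and fc: "continuous_on UNIV f"
  shows "\<exists>u. critical_point_on_M (\<lambda>v. LINT x|leb_B1. G (v x)) (4 * pi * j R) u \<and>
    (\<forall>x\<in>B1. 0 < u x) \<and> continuous_on B1 u \<and> u 0 = \<mu>"
proof -
  have sc: "continuous_on {0..1} (\<lambda>s. R * s)" by (intro continuous_intros)
  have im: "(\<lambda>s. R * s) ` {0..1} \<subseteq> {0..R}" using R_pos by (auto simp: mult_left_le)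
  have dR: "((\<lambda>s. R * s) has_real_derivative R) (at s)" for s using DERIV_cmult_Id[of R s UNIV] .
  have in_R: "0 < R * s" "R * s < R" if "0 < s" "s < 1" for s using R_pos that by simp_all
  \<comment> \<open>In the coordinate s = |x|^2 on [0, 1], k is U' and k1 is U'', with p / r
    replaced by its continuous extension q.\<close>
  define U where "U s = w (R * s)" for s
  define k where "k s = - R * q (R * s)" for s
  define k1 where "k1 s = - R * ((f (w (R * s)) / 4 - q (R * s)) / s)" for s
  have Uc: "continuous_on {0..1} U" unfolding U_def[abs_def] by (rule continuous_on_compose2[OF cont(1) sc im])
  have qc: "continuous_on {0..1} (\<lambda>s. q (R * s))" by (rule continuous_on_compose2[OF q_continuous[OF fc] sc im])
  have kc: "continuous_on {0..1} k" unfolding k_def[abs_def] by (intro continuous_intros qc)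
  have fUc: "continuous_on {0..1} (\<lambda>s. f (U s))" by (rule continuous_on_compose2[OF fc Uc]) simp
  have "continuous_on {0..1} (\<lambda>s. R * (f (U s) / 4 - q (R * s)))" by (intro continuous_intros fUc qc) simp
  from compact_imp_bounded[OF compact_continuous_image[OF this compact_Icc]]
  obtain C where C: "\<forall>z\<in>(\<lambda>s. R * (f (U s) / 4 - q (R * s))) ` {0..1}. norm z \<le> C" unfolding bounded_iff by blast
  interpret P: radial_C1 U k k1 C
  proof
    show "continuous_on {0..1} U" by (rule Uc)
    show "continuous_on {0..1} k" by (rule kc)
    show "U 1 = 0" using w_R by (simp add: U_def)
    fix s :: real assume s: "0 < s" "s < 1"
    have "(U has_real_derivative - p (R * s) / (R * s) * R) (at s)" unfolding U_def[abs_def]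
      by (rule DERIV_chain2[OF dw[OF in_R[OF s]] dR])
    moreover have "- p (R * s) / (R * s) * R = k s" using s R_pos by (simp add: k_def q_def)
    ultimately show "(U has_real_derivative k s) (at s)" by simp
    have "((\<lambda>s. q (R * s)) has_real_derivative (f (w (R * s)) / 4 - q (R * s)) / (R * s) * R) (at s)"
      by (rule DERIV_chain2[OF dq[OF in_R[OF s]] dR])
    from DERIV_cmult[OF this, of "- R"]
    have "(k has_real_derivative - R * ((f (w (R * s)) / 4 - q (R * s)) / (R * s) * R)) (at s)" unfolding k_def[abs_def] .
    moreover have "(f (w (R * s)) / 4 - q (R * s)) / (R * s) * R = (f (w (R * s)) / 4 - q (R * s)) / s" using R_pos by simp
    ultimately show "(k has_real_derivative k1 s) (at s)" by (simp only: k1_def)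
    have "s * k1 s = - (R * (f (U s) / 4 - q (R * s)))" using s by (simp add: k1_def U_def)
    moreover have "\<bar>R * (f (U s) / 4 - q (R * s))\<bar> \<le> C"
      using bspec[OF C imageI[of s "{0..1}"]] s by simp
    ultimately show "\<bar>s * k1 s\<bar> \<le> C" by simp
  qed
  \<comment> \<open>The mean flux q enters through k and k1 with opposite signs and cancels, which
    leaves a pointwise equation.\<close>
  have lap: "P.lap x = - R * f (P.u x)" for x
  proof (cases "x = 0")
    case True
    then show ?thesis using init by (simp add: P.lap_def P.u_def k_def q_def U_def)
  next
    case False
    have "4 * s * k1 s = - R * f (U s) + 4 * R * q (R * s)" if "s \<noteq> 0" for s
    proof -
      have "4 * s * k1 s = - (4 * R * (f (U s) / 4 - q (R * s)))" using that by (simp add: k1_def U_def)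
      also have "\<dots> = - R * f (U s) + 4 * R * q (R * s)" by (simp add: algebra_simps)
      finally show ?thesis .
    qed
    from this[of "(norm x)\<^sup>2"] show ?thesis using False by (simp add: P.lap_def P.u_def k_def)
  qed
  have uc: "continuous_on B1 P.u" by (rule P.cont_B1(3))
  have fuc: "continuous_on B1 (\<lambda>x. f (P.u x))" by (rule continuous_on_compose2[OF fc uc]) simp
  have lc: "continuous_on B1 P.lap" unfolding lap[abs_def] by (intro continuous_intros fuc)
  have weak: "dirichlet P.u v = - (LINT x|leb_B1. (- R * f (P.u x)) * v x)" if "v \<in> H10" for v
    using P.weak_laplace[OF lc that] by (simp only: lap)
  obtain B where B: "0 < B" "\<forall>s\<in>{0..1}. \<bar>U s\<bar> \<le> B \<and> \<bar>k s\<bar> \<le> B" using P.bound by blast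
  have der: "has_H10_derivative (\<lambda>w. LINT x|leb_B1. G (w x)) (\<lambda>v. LINT x|leb_B1. (2 * f (P.u x)) * v x) P.u"
    by (rule functional_differentiable[OF dG Gb fL fc uc P.V_bounds(1)[OF B(2)] B(1)])
  have tan: "(LINT x|leb_B1. (2 * f (P.u x)) * v x) = 0" if "v \<in> tangent_M P.u" for v
  proof -
    have v: "v \<in> H10" "dirichlet P.u v = 0" using that by (simp_all add: tangent_M_def)
    have "(LINT x|leb_B1. (- R * f (P.u x)) * v x) = (LINT x|leb_B1. (- R / 2) * ((2 * f (P.u x)) * v x))"
      by (rule Bochner_Integration.integral_cong[OF refl]) simp
    also have "\<dots> = (- R / 2) * (LINT x|leb_B1. (2 * f (P.u x)) * v x)" by (rule integral_mult_right_zero)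
    finally show ?thesis using weak[OF v(1)] v(2) R_pos by simp
  qed
  have inM: "P.u \<in> M (4 * pi * j R)"
  proof -
    \<comment> \<open>Testing the equation with u itself expresses the Dirichlet energy by this
      integrand; its primitive is 4 j (R s), and the radial integral contributes the factor
      pi.\<close>
    have "((\<lambda>s. R * f (U s) * U s) has_integral 4 * j (R * 1) - 4 * j (R * 0)) {0..1}"
    proof (rule fundamental_theorem_of_calculus_interior)
      show "continuous_on {0..1} (\<lambda>s. 4 * j (R * s))"
        by (intro continuous_on_mult continuous_on_const continuous_on_compose2[OF cont(3) sc im])
      fix s :: real assume "s \<in> {0<..<1}"
      then have s: "0 < s" "s < 1" by simp_all
      have "((\<lambda>s. 4 * j (R * s)) has_real_derivative 4 * (w (R * s) * f (w (R * s)) / 4 * R)) (at s)"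
        by (rule DERIV_cmult[OF DERIV_chain2[OF dj[OF in_R[OF s]] dR]])
      moreover have "4 * (w (R * s) * f (w (R * s)) / 4 * R) = R * f (U s) * U s" by (simp add: U_def)
      ultimately show "((\<lambda>s. 4 * j (R * s)) has_vector_derivative R * f (U s) * U s) (at s)"
        by (simp only: has_real_derivative_iff_has_vector_derivative)
    qed simp
    then have I: "((\<lambda>s. R * f (U s) * U s) has_integral 4 * j R) {0..1}" using init by simp
    have "(LINT x|leb_B1. (norm (wgrad P.u x))\<^sup>2) = dirichlet P.u P.u"
      by (simp add: dirichlet_def power2_norm_eq_inner)
    also have "\<dots> = (LINT x|leb_B1. R * f (P.u x) * P.u x)" using weak[OF P.u_H10] by simp
    also have "\<dots> = pi * (4 * j R)" unfolding P.u_def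
      by (rule radial_integral[OF _ I]) (intro continuous_intros fUc Uc)
    finally show ?thesis using P.u_H10 by (simp add: M_def)
  qed
  have pos: "0 < P.u x" if "x \<in> B1" for x
    unfolding P.u_def U_def by (rule w_pos) (use norm_sq_B1(1,2)[OF that] R_pos in simp_all)
  have u0: "P.u 0 = \<mu>" using init by (simp add: P.u_def U_def)
  have tan': "\<forall>v\<in>tangent_M P.u. (LINT x|leb_B1. (2 * f (P.u x)) * v x) = 0" by (rule ballI) (rule tan)
  have "critical_point_on_M (\<lambda>v. LINT x|leb_B1. G (v x)) (4 * pi * j R) P.u" unfolding critical_point_on_M_def
    by (rule conjI[OF inM], rule exI[where x="\<lambda>v. LINT x|leb_B1. (2 * f (P.u x)) * v x"], rule conjI[OF der tan'])
  then show ?thesis by (intro exI[of _ P.u] conjI ballI pos uc u0)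
qed

end

section \<open>From the hypotheses on g and h to the two critical points\<close>

lemma lipschitz_of_C1:
  fixes f f' :: "real \<Rightarrow> real"
  assumes d: "\<And>t. (f has_real_derivative f' t) (at t)" and c: "continuous_on UNIV f'"
  shows "\<exists>L>0. \<forall>x\<in>{- m..m}. \<forall>y\<in>{- m..m}. \<bar>f x - f y\<bar> \<le> L * \<bar>x - y\<bar>"
proof -
  from compact_imp_bounded[OF compact_continuous_image[OF continuous_on_subset[OF c subset_UNIV] compact_Icc]]
  obtain L where L: "0 < L" "\<forall>z\<in>f' ` {- m..m}. norm z \<le> L" unfolding bounded_pos by blast
  have "norm (f x - f y) \<le> L * norm (x - y)" if "x \<in> {- m..m}" "y \<in> {- m..m}" for x y
  proof (rule field_differentiable_bound[of "{- m..m}"])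
    show "(f has_field_derivative f' z) (at z within {- m..m})" for z by (rule has_field_derivative_at_within[OF d])
  qed (use L that in simp_all)
  then show ?thesis using L(1) by (intro exI[of _ L]) simp
qed

lemma bounded_of_vanishing_at_infinity:
  fixes g :: "real \<Rightarrow> real"
  assumes c: "continuous_on UNIV g" and l: "(g \<longlongrightarrow> 0) at_infinity"
  shows "\<exists>K>0. \<forall>t. \<bar>g t\<bar> \<le> K"
proof -
  have "\<forall>\<^sub>F t in at_infinity. dist (g t) 0 < 1" by (rule tendstoD[OF l]) simp
  then obtain b where b: "\<And>t. b \<le> norm t \<Longrightarrow> dist (g t) 0 < 1" unfolding eventually_at_infinity by blast
  from compact_imp_bounded[OF compact_continuous_image[OF continuous_on_subset[OF c subset_UNIV] compact_Icc]]
  obtain L where L: "0 < L" "\<forall>z\<in>g ` {- b..b}. norm z \<le> L" unfolding bounded_pos by blast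
  have "\<bar>g t\<bar> \<le> L + 1" for t
  proof (cases "b \<le> \<bar>t\<bar>")
    case True
    then show ?thesis using b[of t] L(1) by simp
  next
    case False
    then have "t \<in> {- b..b}" by auto
    then have "norm (g t) \<le> L" using L(2) by blast
    then show ?thesis by simp
  qed
  then show ?thesis using L(1) by (intro exI[of _ "L + 1"]) simp
qed

text \<open>The set where the functions differ is open in the plane, and a nonempty open set is not
  negligible. This makes values at single points meaningful for comparing Sobolev elements.\<close>

lemma continuous_AE_eq_B1:
  fixes u v :: "real ^ 2 \<Rightarrow> real"
  assumes c: "continuous_on B1 u" "continuous_on B1 v" and ae: "AE x in leb_B1. u x = v x" and x: "x \<in> B1"
  shows "u x = v x"
proof (rule ccontr)
  assume ne: "u x \<noteq> v x"
  define S where "S = B1 \<inter> (\<lambda>x. u x - v x) -` (- {0})"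
  have oS: "open S" unfolding S_def
    by (rule continuous_open_preimage[OF continuous_on_diff[OF c]]) (simp_all add: open_Compl)
  have "AE x in lebesgue. x \<in> B1 \<longrightarrow> u x = v x" using ae by (subst (asm) AE_restrict_space_iff) simp_all
  then have "AE x in lebesgue. x \<notin> S" by eventually_elim (auto simp: S_def)
  then have "S \<in> null_sets lebesgue" using oS by (subst AE_iff_null_sets) simp_all
  then have "negligible S" by (simp add: negligible_iff_null_sets)
  moreover have "S \<noteq> {}" using x ne by (auto simp: S_def)
  ultimately show False using open_not_negligible[OF oS] by blast
qed

theorem theorem5:
  fixes g h :: "real \<Rightarrow> real"
  assumes g_C2: "g differentiable_on UNIV" "deriv g differentiable_on UNIV"
      "continuous_on UNIV (deriv (deriv g))"
    and g_inf: "(INF t. ereal (g t)) > -1"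
    and g_even: "\<And>t. g t = g (- t)"
    and g_lim: "(g \<longlongrightarrow> 0) at_infinity"
    and h_def: "\<And>t. t \<noteq> 0 \<Longrightarrow> h t = g t + deriv g t / (2 * t)"
    and h_inf: "(INF t\<in>{0<..}. ereal (h t)) > -1"
    and h_sup: "(SUP t\<in>{0<..}. ereal (h t)) < \<infinity>"
    and h_lim: "((\<lambda>t. t\<^sup>2 * h t) \<longlongrightarrow> 0) at_top"
    and h_osc: "((\<lambda>t. SUP s\<in>{s. \<bar>s\<bar> \<le> 1}.
        ereal (t ^ 4 * \<bar>h (t + s * (8 * ln t + 1) / t) - h t\<bar>)) \<longlongrightarrow> 0) at_top"
  shows "\<exists>\<Lambda>' > 4 * pi. \<forall>\<Lambda>. 4 * pi < \<Lambda> \<and> \<Lambda> < \<Lambda>' \<longrightarrow>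
     (\<exists>u v. critical_point_on_M (E g) \<Lambda> u \<and> (AE x in leb_B1. u x > 0) \<and>
            critical_point_on_M (E g) \<Lambda> v \<and> (AE x in leb_B1. v x > 0) \<and>
            \<not> (AE x in leb_B1. u x = v x))"
proof -
  have dg: "(g has_real_derivative deriv g t) (at t)" for t
    using g_C2(1) by (simp add: differentiable_on_def DERIV_deriv_iff_real_differentiable)
  have dg2: "(deriv g has_real_derivative deriv (deriv g) t) (at t)" for t
    using g_C2(2) by (simp add: differentiable_on_def DERIV_deriv_iff_real_differentiable)
  have gc: "continuous_on UNIV g" "continuous_on UNIV (deriv g)"
    by (rule differentiable_imp_continuous_on[OF g_C2(1)], rule differentiable_imp_continuous_on[OF g_C2(2)])
  define G where "G t = (1 + g t) * exp (t\<^sup>2)" for t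
  \<comment> \<open>Half the derivative of G. Away from 0 it equals t (1 + h t) exp (t^2), and this
    form stays C^1 across t = 0, where h is not prescribed.\<close>
  define f where "f t = (t * (1 + g t) + deriv g t / 2) * exp (t\<^sup>2)" for t
  define f' where "f' t = (1 + g t + t * deriv g t + deriv (deriv g) t / 2) * exp (t\<^sup>2) +
    (t * (1 + g t) + deriv g t / 2) * (2 * t * exp (t\<^sup>2))" for t
  have dG: "(G has_real_derivative 2 * f t) (at t)" for t
    unfolding G_def[abs_def] f_def by (auto intro!: derivative_eq_intros dg simp: algebra_simps)
  have df: "(f has_real_derivative f' t) (at t)" for t
    unfolding f_def[abs_def] f'_def by (auto intro!: derivative_eq_intros dg dg2 simp: algebra_simps)
  have f'c: "continuous_on UNIV f'" unfolding f'_def[abs_def] by (intro continuous_intros gc g_C2(3)) simp_all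
  have fc: "continuous_on UNIV f" by (rule DERIV_continuous_on) (rule has_field_derivative_at_within[OF df])
  obtain K where K: "0 < K" "\<forall>t. \<bar>g t\<bar> \<le> K" using bounded_of_vanishing_at_infinity[OF gc(1) g_lim] by blast
  have Gb: "\<bar>G t\<bar> \<le> (1 + K) * exp (t\<^sup>2)" for t
  proof -
    have "\<bar>1 + g t\<bar> \<le> 1 + K" using spec[OF K(2), of t] by linarith
    then show ?thesis by (simp add: G_def abs_mult)
  qed
  have fL: "\<exists>L. \<forall>x\<in>{- m..m}. \<forall>y\<in>{- m..m}. \<bar>f x - f y\<bar> \<le> L * \<bar>x - y\<bar>" for m
    using lipschitz_of_C1[OF df f'c, of m] by blast
  \<comment> \<open>Evenness of g forces its derivative at 0 to vanish, and that derivative is the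
    only term of f left at t = 0.\<close>
  have f0: "f 0 = 0"
  proof -
    have "((\<lambda>t. - t) has_real_derivative - 1) (at (0 :: real))" by (auto intro!: derivative_eq_intros)
    from DERIV_chain2[OF dg this] have "((\<lambda>t. g (- t)) has_real_derivative deriv g 0 * - 1) (at 0)" by simp
    then have "(g has_real_derivative deriv g 0 * - 1) (at 0)" using g_even by simp
    from DERIV_unique[OF this dg] show ?thesis by (simp add: f_def)
  qed
  have f_eq: "f t = t * (1 + h t) * exp (t\<^sup>2)" if "0 < t" for t
  proof -
    have "t * (1 + h t) = t * (1 + g t) + deriv g t / 2" using h_def[of t] that by (simp add: distrib_left)
    then show ?thesis by (simp add: f_def)
  qed
  \<comment> \<open>A real number strictly between - 1 and the infimum turns the extended-real
    hypothesis into the uniform bound 1 + h \<ge> c0 > 0.\<close>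
  obtain c where c: "- 1 < ereal c" "ereal c < (INF t\<in>{0<..}. ereal (h t))" using ereal_dense2[OF h_inf] by blast
  define c0 where "c0 = 1 + c"
  have c0: "0 < c0" using c(1) by (simp add: c0_def one_ereal_def)
  have c0h: "c0 \<le> 1 + h t" if "0 < t" for t using less_INF_D[OF c(2), of t] that by (simp add: c0_def)
  obtain C where C: "(SUP t\<in>{0<..}. ereal (h t)) < ereal C" using ereal_dense2[OF h_sup] by blast
  have C0: "1 + h t \<le> 1 + C" if "0 < t" for t using SUP_lessD[OF C, of t] that by simp
  have osc: "\<forall>\<^sub>F t in at_top. \<forall>s. \<bar>s\<bar> \<le> 1 \<longrightarrow> t ^ 4 * \<bar>h (t + s * (8 * ln t + 1) / t) - h t\<bar> \<le> e" if "0 < e" for e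
  proof -
    have "\<forall>\<^sub>F t in at_top. (SUP s\<in>{s. \<bar>s\<bar> \<le> 1}. ereal (t ^ 4 * \<bar>h (t + s * (8 * ln t + 1) / t) - h t\<bar>)) < ereal e"
      by (rule order_tendstoD(2)[OF h_osc]) (use that in simp)
    then show ?thesis
    proof eventually_elim
      case (elim t)
      show ?case
      proof (intro allI impI)
        fix s :: real assume "\<bar>s\<bar> \<le> 1"
        then have "s \<in> {s. \<bar>s\<bar> \<le> 1}" by simp
        from SUP_lessD[OF elim this] show "t ^ 4 * \<bar>h (t + s * (8 * ln t + 1) / t) - h t\<bar> \<le> e" by simp
      qed
    qed
  qed
  have bounds: "\<forall>\<^sub>F \<mu> in at_top. \<forall>R w p j. radial_profile f \<mu> R w p j \<longrightarrow> 1 < j R \<and> j R < 1 + \<delta>" if "0 < \<delta>" for \<delta>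
    by (rule profile_energy_bounds[OF f_eq c0 c0h C0 osc that])
  interpret radial_source f c0
  proof
    show "\<exists>L>0. \<forall>x\<in>{0..m}. \<forall>y\<in>{0..m}. \<bar>f x - f y\<bar> \<le> L * \<bar>x - y\<bar>" if "0 < m" for m
    proof -
      obtain L where "0 < L" "\<forall>x\<in>{- m..m}. \<forall>y\<in>{- m..m}. \<bar>f x - f y\<bar> \<le> L * \<bar>x - y\<bar>"
        using lipschitz_of_C1[OF df f'c, of m] by blast
      then show ?thesis using that by (intro exI[of _ L]) simp
    qed
    show "f 0 = 0" by (rule f0)
    show "0 < c0" by (rule c0)
    show "c0 * t \<le> f t" if "0 \<le> t" for t
    proof (cases "t = 0")
      case False
      then have t: "0 < t" using that by simp
      have "c0 * t * 1 \<le> (1 + h t) * t * exp (t\<^sup>2)"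
        using c0h[OF t] c0 t by (intro mult_mono) simp_all
      then show ?thesis using f_eq[OF t] by (simp add: mult.commute)
    qed (use f0 in simp)
  qed
  have "\<exists>I0>1. \<forall>I. 1 < I \<and> I < I0 \<longrightarrow> (\<exists>\<mu> \<nu>. \<mu> \<noteq> \<nu> \<and>
    (\<exists>R w p j. radial_profile f \<mu> R w p j \<and> j R = I) \<and> (\<exists>R w p j. radial_profile f \<nu> R w p j \<and> j R = I))"
    by (rule two_profiles) (rule bounds)
  then obtain I0 where I0: "1 < I0" and two: "\<forall>I. 1 < I \<and> I < I0 \<longrightarrow> (\<exists>\<mu> \<nu>. \<mu> \<noteq> \<nu> \<and>
    (\<exists>R w p j. radial_profile f \<mu> R w p j \<and> j R = I) \<and> (\<exists>R w p j. radial_profile f \<nu> R w p j \<and> j R = I))"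
    by (elim exE conjE) (rule that)
  have EG: "E g = (\<lambda>v. LINT x|leb_B1. G (v x))" by (simp add: E_def[abs_def] G_def)
  have crit: "\<exists>u. critical_point_on_M (E g) (4 * pi * j R) u \<and> (\<forall>x\<in>B1. 0 < u x) \<and> continuous_on B1 u \<and> u 0 = \<mu>"
    if "radial_profile f \<mu> R w p j" for \<mu> R w p j
    unfolding EG by (rule radial_profile.critical_point[OF that dG Gb fL fc])
  show ?thesis
  proof (intro exI[of _ "4 * pi * I0"] conjI allI impI)
    show "4 * pi < 4 * pi * I0" using I0 by simp
    fix \<Lambda> :: real assume \<Lambda>: "4 * pi < \<Lambda> \<and> \<Lambda> < 4 * pi * I0"
    define I where "I = \<Lambda> / (4 * pi)"
    have I: "1 < I" "I < I0" "4 * pi * I = \<Lambda>" using \<Lambda> pi_gt_zero by (simp_all add: I_def field_simps)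
    from two[rule_format, OF conjI[OF I(1,2)]] obtain \<mu> \<nu> R w p j R' w' p' j' where ne: "\<mu> \<noteq> \<nu>"
      and r: "radial_profile f \<mu> R w p j" "j R = I" "radial_profile f \<nu> R' w' p' j'" "j' R' = I"
      by (elim exE conjE) (rule that)
    from crit[OF r(1)] obtain u where u: "critical_point_on_M (E g) \<Lambda> u" "\<forall>x\<in>B1. 0 < u x" "continuous_on B1 u" "u 0 = \<mu>"
      unfolding r(2) I(3) by (elim exE conjE) (rule that)
    from crit[OF r(3)] obtain v where v: "critical_point_on_M (E g) \<Lambda> v" "\<forall>x\<in>B1. 0 < v x" "continuous_on B1 v" "v 0 = \<nu>"
      unfolding r(4) I(3) by (elim exE conjE) (rule that)
    have pos: "AE x in leb_B1. 0 < u x" "AE x in leb_B1. 0 < v x"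
      by (rule AE_I2, use u(2) in simp, rule AE_I2, use v(2) in simp)
    \<comment> \<open>Both functions are continuous, so equality almost everywhere would give
      equality at the centre, where the values are the two different shooting heights.\<close>
    have dist: "\<not> (AE x in leb_B1. u x = v x)"
    proof
      assume ae: "AE x in leb_B1. u x = v x"
      have "u 0 = v 0" by (rule continuous_AE_eq_B1[OF u(3) v(3) ae]) simp
      then show False using u(4) v(4) ne by simp
    qed
    show "\<exists>u v. critical_point_on_M (E g) \<Lambda> u \<and> (AE x in leb_B1. u x > 0) \<and>
            critical_point_on_M (E g) \<Lambda> v \<and> (AE x in leb_B1. v x > 0) \<and>
            \<not> (AE x in leb_B1. u x = v x)"
      by (rule exI[of _ u], rule exI[of _ v], intro conjI u(1) v(1) pos dist)
  qed
qed

end
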